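(* Let $X$ be a $(\mathtt P,\mathtt G)$-branching Markov process on a Polish space $E$ with bounded branching rate $\gamma\in B^+(E)$ and offspring point process $(\mathcal Z,\mathcal P_y)_{y\in E}$, where $\mathcal Z=\sum_{i=1}^N\delta_{x_i}$, and let $\psi_t[f](x)=\mathbb E_{\delta_x}[X_t[f]]$. Assume the following. (i) There exist $\lambda>0$, a bounded strictly positive function $\varphi\in B^+(E)$ and a probability measure $\tilde\varphi$ on $E$ such that $\tilde\varphi[\varphi]=1$; for all $t\ge 0$, $x\in E$ and $f\in B(E)$, $$\psi_t[\varphi](x)=e^{\lambda t}\varphi(x),\qquad \tilde\varphi[\psi_t[f]]=e^{\lambda t}\tilde\varphi[f];$$ and $$\sup_{x\in E,\, f\in B_1(E)}\left|e^{-\lambda t}\varphi(x)^{-1}\psi_t[f](x)-\tilde\varphi[f]\right|\to 0\quad\text{as } t\to\infty.$$ (ii) $\sup_{x\in E}\mathcal E_x[2^N]<\infty$. Then, for any $x\in E$ and $f\in B^+(E)$, under $\mathbb P_{\delta_x}$, $$e^{-\lambda t}X_t[f]\to W_x\,\tilde\varphi[f]\quad\text{in distribution as } t\to\infty,$$ where $W_x$ is the $\mathbb P_{\delta_x}$-almost sure limit of $e^{-\lambda t}X_t[\varphi]$ as $t\to\infty$. Moreover, the law of $W_x$ is determined by its moments (any $[0,\infty)$-valued random variable with the same moments has the same law), which satisfy, for each $k\ge 2$, $$\mathbb E[W_x^k]=k!\,\varphi(x)L_k(x),$$ where $L_1(x)=1$ and, iteratively for $k\ge 2$, $$L_k(x)=\int_0^\infty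 e^{-\lambda k s}\varphi(x)^{-1}\psi_s\left[\gamma(\cdot)\,\mathcal E_{\cdot}\left[\sum_{[k_1,\dots,k_N]_k^2}\ \prod_{j:\,k_j>0}\varphi(x_j)L_{k_j}(x_j)\right]\right](x)\,ds,$$ with $[k_1,\dots,k_N]_k^2$ denoting the set of all $N$-tuples $(k_1,\dots,k_N)$ of non-negative integers such that $\sum_{i=1}^N k_i=k$ and at least two of the $k_i$ are strictly positive.
   Context: $E$ is a Polish space and $\dagger\notin E$ is a cemetery (absorbing) point. $B(E)$ is the space of bounded (measurable) real-valued functions on $E$, $B^+(E)$ the non-negative ones, and $B_1(E)$ those $f\in B(E)$ bounded by $1$ in absolute value. Functions $f\in B(E)$ are extended to $E\cup\{\dagger\}$ by $f(\dagger)=0$. $M(E)$ is the space of atomic measures on $E$ with non-negative integer (finite) total mass. For a measure $\mu$ and a function $f$, $\mu[f]:=\int_E f(x)\,\mu(dx)$. Branching Markov process: $X=(X_t)_{t\ge0}$ is the measure-valued process $X_t=\sum_{i=1}^{N_t}\delta_{x_i(t)}$ whose atoms evolve in $E\cup\{\dagger\}$ as follows. From an initial position $x\in E$, particles move independently according to a Markov process $\xi$ with semigroup $(\mathtt P_t)_{t\ge0}$ (sent to $\dagger$ if killed). When at $y\in E$, a particle branches at rate $\gamma(y)$, where $\gamma\in B^+(E)$, at which point the particle is replaced by offspring given by a point process $\mathcal Z=\sum_{i=1}^N\delta_{x_i}$ on $E$ with law $\mathcal P_y$ and expectation $\mathcal E_y$; the offspring then evolve independently in the same way. $\mathbb P_\mu$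 is the law of $X$ started from $\mu\in M(E)$, with expectation $\mathbb E_\mu$. The process is characterised by $e^{-\mathtt v_t[f](x)}:=\mathbb E_{\delta_x}[e^{-X_t[f]}]$, $f\in B^+(E)$, which satisfies $$e^{-\mathtt v_t[f](x)}=\mathtt P_t[e^{-f}](x)+\int_0^t\mathtt P_s\left[\mathtt G[e^{-\mathtt v_{t-s}[f]}]\right](x)\,ds,\qquad \mathtt G[f](x):=\gamma(x)\,\mathcal E_x\left[\prod_{i=1}^N f(x_i)-f(x)\right],$$ where in $\mathtt P_t[e^{-f}]$ the function $e^{-f}$ takes the value $1$ at $\dagger$ (since $f(\dagger)=0$). Such an $X$ is called a $(\mathtt P,\mathtt G)$-branching Markov process. Empty products equal $1$ and empty sums equal $0$.
   Formalization: Since no path regularity of X is assumed, the almost sure limit defining W_x is proved along every countable set of times, and along all real t → ∞ when t ↦ X_t[φ] is almost surely right-continuous; without regularity, a bad modification of X destroys the limit over all t. *)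

theory Defs
  imports "HOL-Probability.Probability" "HOL-Combinatorics.Combinatorics"
begin

section \<open>Function spaces\<close>

definition bfun :: "('a::topological_space \<Rightarrow> real) set" where
  "bfun = {f \<in> borel_measurable borel. bounded (range f)}"

definition bfun_nonneg :: "('a::topological_space \<Rightarrow> real) set" where
  "bfun_nonneg = {f \<in> bfun. \<forall>x. 0 \<le> f x}"

definition bfun_unit :: "('a::topological_space \<Rightarrow> real) set" where
  "bfun_unit = {f \<in> bfun. \<forall>x. \<bar>f x\<bar> \<le> 1}"

section \<open>The state space of finite atomic measures\<close>

text \<open>
  An atomic measure with finite non-negative integer mass is a finite sum of Dirac masses,
  so it is represented by the multiset of its atoms: the Dirac mass at \<open>x\<close> is \<open>{#x#}\<close>,
  the integral of \<open>f\<close> is \<open>\<Sum>x\<in>#\<mu>. f x\<close> and the total mass is \<open>size \<mu>\<close>.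
  The sigma-algebra is the one generated by the evaluations on Borel sets.
\<close>

definition atomic_space :: "'a::topological_space multiset measure" where
  "atomic_space =
     sigma UNIV {{\<mu>. size (filter_mset (\<lambda>x. x \<in> B) \<mu>) = n} | B n. B \<in> sets borel}"

section \<open>Branching Markov processes\<close>

text \<open>
  The motion lives on the state space together with the cemetery point. Since functions vanish
  at the cemetery, its semigroup is given by sub-probability kernels \<open>P t x\<close> on the state space,
  and the missing mass \<open>1 - P t x UNIV\<close> is the probability of having been killed by time \<open>t\<close>.
\<close>

locale killed_markov_semigroup =
  fixes P :: "real \<Rightarrow> 'a::polish_space \<Rightarrow> 'a measure"
  assumes kernel: "(\<lambda>(t, x). P t x) \<in>
      restrict_space borel {0..} \<Otimes>\<^sub>M borel \<rightarrow>\<^sub>M subprob_algebra borel"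
    and start: "P 0 x = return borel x"
    and semigroup: "0 \<le> s \<Longrightarrow> 0 \<le> t \<Longrightarrow> P (s + t) x = P s x \<bind> P t"

definition branching_op ::
    "('a::polish_space \<Rightarrow> real) \<Rightarrow> ('a \<Rightarrow> 'a multiset measure) \<Rightarrow> ('a \<Rightarrow> real) \<Rightarrow> 'a \<Rightarrow> real" where
  "branching_op \<gamma> Off f x = \<gamma> x * (\<integral>Z. (\<Prod>y\<in>#Z. f y) - f x \<partial>Off x)"

definition exp_functional ::
    "('a multiset \<Rightarrow> 'w measure) \<Rightarrow> (real \<Rightarrow> 'w \<Rightarrow> 'a multiset) \<Rightarrow>
      real \<Rightarrow> ('a \<Rightarrow> real) \<Rightarrow> 'a multiset \<Rightarrow> real" where
  "exp_functional \<PP> X t f \<mu> = (\<integral>\<omega>. exp (- (\<Sum>y\<in>#X t \<omega>. f y)) \<partial>\<PP> \<mu>)"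

definition transition ::
    "('a::polish_space multiset \<Rightarrow> 'w measure) \<Rightarrow> (real \<Rightarrow> 'w \<Rightarrow> 'a multiset) \<Rightarrow>
      real \<Rightarrow> 'a multiset \<Rightarrow> 'a multiset measure" where
  "transition \<PP> X t \<mu> = distr (\<PP> \<mu>) atomic_space (X t)"

definition history ::
    "'w measure \<Rightarrow> (real \<Rightarrow> 'w \<Rightarrow> 'a::polish_space multiset) \<Rightarrow> real \<Rightarrow> 'w measure" where
  "history F X s =
     sigma (space F) {X u -` B \<inter> space F | u B. 0 \<le> u \<and> u \<le> s \<and> B \<in> sets atomic_space}"

text \<open>
  \<open>Off y\<close> is the law of the offspring point process of a particle branching at \<open>y\<close>; \<open>F\<close> is
  the measurable space carrying the process \<open>X\<close>; \<open>\<PP> \<mu>\<close> is the law of the process started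
  from \<open>\<mu>\<close>. Joint measurability of the kernels in time and space is what gives a meaning to
  the time integrals of the theory; no regularity of paths is required.

  In the last assumption the function \<open>exp (- f)\<close> equals one at the cemetery point, which
  contributes the summand \<open>1 - measure (P t x) UNIV\<close>.
\<close>

locale branching_markov_process = killed_markov_semigroup P
  for P :: "real \<Rightarrow> 'a::polish_space \<Rightarrow> 'a measure" +
  fixes \<gamma> :: "'a \<Rightarrow> real"
    and Off :: "'a \<Rightarrow> 'a multiset measure"
    and F :: "'w measure"
    and \<PP> :: "'a multiset \<Rightarrow> 'w measure"
    and X :: "real \<Rightarrow> 'w \<Rightarrow> 'a multiset"
  assumes rate: "\<gamma> \<in> bfun_nonneg"
    and offspring: "Off \<in> borel \<rightarrow>\<^sub>M prob_algebra atomic_space"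
    and prob: "prob_space (\<PP> \<mu>)"
    and sets_law: "sets (\<PP> \<mu>) = sets F"
    and process: "0 \<le> t \<Longrightarrow> X t \<in> F \<rightarrow>\<^sub>M atomic_space"
    and transition_kernel: "(\<lambda>(t, \<mu>). transition \<PP> X t \<mu>) \<in>
      restrict_space borel {0..} \<Otimes>\<^sub>M atomic_space \<rightarrow>\<^sub>M prob_algebra atomic_space"
    and initial: "AE \<omega> in \<PP> \<mu>. X 0 \<omega> = \<mu>"
    and markov: "0 \<le> s \<Longrightarrow> 0 \<le> t \<Longrightarrow> A \<in> sets (history F X s) \<Longrightarrow> B \<in> sets atomic_space \<Longrightarrow>
      emeasure (\<PP> \<mu>) (A \<inter> X (s + t) -` B) =
        (\<integral>\<^sup>+\<omega>\<in>A. emeasure (transition \<PP> X t (X s \<omega>)) B \<partial>\<PP> \<mu>)"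
    and branching: "0 \<le> t \<Longrightarrow> f \<in> bfun_nonneg \<Longrightarrow>
      exp_functional \<PP> X t f \<mu> = (\<Prod>x\<in>#\<mu>. exp_functional \<PP> X t f {#x#})"
    and evolution: "0 \<le> t \<Longrightarrow> f \<in> bfun_nonneg \<Longrightarrow>
      exp_functional \<PP> X t f {#x#} =
        (\<integral>y. exp (- f y) \<partial>P t x) + (1 - measure (P t x) UNIV)
        + (LBINT s:{0..t}.
            \<integral>y. branching_op \<gamma> Off (\<lambda>z. exp_functional \<PP> X (t - s) f {#z#}) y \<partial>P s x)"

definition mean_semigroup ::
    "('a multiset \<Rightarrow> 'w measure) \<Rightarrow> (real \<Rightarrow> 'w \<Rightarrow> 'a multiset) \<Rightarrow>
      real \<Rightarrow> ('a \<Rightarrow> real) \<Rightarrow> 'a \<Rightarrow> real" where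
  "mean_semigroup \<PP> X t f x = (\<integral>\<omega>. (\<Sum>y\<in>#X t \<omega>. f y) \<partial>\<PP> {#x#})"

section \<open>The limiting moments\<close>

definition splittings :: "nat \<Rightarrow> nat \<Rightarrow> nat list set" where
  "splittings N k =
     {ks. length ks = N \<and> sum_list ks = k \<and> 2 \<le> card {j. j < N \<and> 0 < ks ! j}}"

definition splitting_sum_list :: "nat \<Rightarrow> (nat \<Rightarrow> 'a \<Rightarrow> real) \<Rightarrow> 'a list \<Rightarrow> real" where
  "splitting_sum_list k h xs =
     (\<Sum>ks\<in>splittings (length xs) k. \<Prod>j | j < length xs \<and> 0 < ks ! j. h (ks ! j) (xs ! j))"

text \<open>
  The atoms of the offspring point process may be enumerated in any order, since the sum is
  symmetric, see \<open>splitting_sum_mset\<close> below.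
\<close>

definition splitting_sum :: "nat \<Rightarrow> (nat \<Rightarrow> 'a \<Rightarrow> real) \<Rightarrow> 'a multiset \<Rightarrow> real" where
  "splitting_sum k h Z = splitting_sum_list k h (SOME xs. mset xs = Z)"

lemma finite_splittings: "finite (splittings N k)"
proof (rule finite_subset)
  show "splittings N k \<subseteq> {ks. set ks \<subseteq> {..k} \<and> length ks = N}"
    by (auto simp: splittings_def intro: member_le_sum_list)
  show "finite {ks. set ks \<subseteq> {..k} \<and> length ks = N}"
    by (rule finite_lists_length_eq) simp
qed

lemma splitting_sum_list_perm:
  assumes "mset xs = mset ys"
  shows "splitting_sum_list k h xs = splitting_sum_list k h ys"
proof -
  from assms obtain p where p: "p permutes {..<length ys}" "permute_list p ys = xs"
    by (rule mset_eq_permutation)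
  let ?n = "length ys"
  have len: "length xs = ?n" using assms by (metis size_mset)
  have pos: "{j. j < ?n \<and> 0 < ks ! j} = p ` {j. j < ?n \<and> 0 < permute_list p ks ! j}"
    if "length ks = ?n" for ks :: "nat list"
  proof -
    have p': "p permutes {..<length ks}" using p(1) that by simp
    have lt: "p j < ?n \<longleftrightarrow> j < ?n" for j
      using permutes_in_image[OF p(1)] by simp
    have nth: "permute_list p ks ! j = ks ! p j" if "j < ?n" for j
      using permute_list_nth[OF p'] that \<open>length ks = ?n\<close> by simp
    have "j \<in> p ` {j. j < ?n \<and> 0 < permute_list p ks ! j}" if "j < ?n" "0 < ks ! j" for j
    proof -
      obtain i where i: "j = p i" using permutes_surj[OF p(1)] by (metis surjD)
      with that lt have "i < ?n" by simp
      with that i nth show ?thesis by auto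
    qed
    then show ?thesis using lt nth by auto
  qed
  have inj: "inj_on p A" for A
    using permutes_inj[OF p(1)] by (rule inj_on_subset) simp
  have mem: "permute_list p ks \<in> splittings ?n k" if "ks \<in> splittings ?n k" for ks
  proof -
    have l: "length ks = ?n" using that by (simp add: splittings_def)
    then have "mset (permute_list p ks) = mset ks" using p(1) by simp
    then have "sum_list (permute_list p ks) = sum_list ks" by (metis sum_mset_sum_list)
    moreover have "card {j. j < ?n \<and> 0 < permute_list p ks ! j} = card {j. j < ?n \<and> 0 < ks ! j}"
      unfolding pos[OF l] by (simp add: card_image inj)
    ultimately show ?thesis using that l by (simp add: splittings_def)
  qed
  have injp: "inj_on (permute_list p) (splittings ?n k)"
  proof (rule inj_onI)
    fix ks ls assume a: "ks \<in> splittings ?n k" "ls \<in> splittings ?n k"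
      and e: "permute_list p ks = permute_list p ls"
    have l: "length ks = ?n" "length ls = ?n" using a by (auto simp: splittings_def)
    show "ks = ls"
    proof (rule nth_equalityI)
      show "length ks = length ls" using l by simp
      fix j assume j: "j < length ks"
      obtain i where i: "j = p i" using permutes_surj[OF p(1)] by (metis surjD)
      have "i < ?n" using permutes_in_image[OF p(1), of i] i j l by simp
      then show "ks ! j = ls ! j"
        using e i l permute_list_nth[of p ks i] permute_list_nth[of p ls i] p(1) by simp
    qed
  qed
  have img: "permute_list p ` splittings ?n k = splittings ?n k"
    using mem injp finite_splittings by (intro endo_inj_surj) auto
  have "splitting_sum_list k h xs =
      (\<Sum>ks\<in>permute_list p ` splittings ?n k.
        \<Prod>j | j < ?n \<and> 0 < ks ! j. h (ks ! j) (xs ! j))"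
    by (simp add: splitting_sum_list_def len img)
  also have "\<dots> = (\<Sum>ks\<in>splittings ?n k.
        \<Prod>j | j < ?n \<and> 0 < permute_list p ks ! j. h (permute_list p ks ! j) (xs ! j))"
    by (simp add: sum.reindex[OF injp])
  also have "\<dots> = (\<Sum>ks\<in>splittings ?n k. \<Prod>j | j < ?n \<and> 0 < ks ! j. h (ks ! j) (ys ! j))"
  proof (rule sum.cong[OF refl])
    fix ks assume "ks \<in> splittings ?n k"
    then have l: "length ks = ?n" by (simp add: splittings_def)
    show "(\<Prod>j | j < ?n \<and> 0 < permute_list p ks ! j. h (permute_list p ks ! j) (xs ! j)) =
        (\<Prod>j | j < ?n \<and> 0 < ks ! j. h (ks ! j) (ys ! j))"
      unfolding pos[OF l]
      using l p permute_list_nth[of p ks] permute_list_nth[of p ys]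
      by (subst prod.reindex[OF inj]) (auto intro!: prod.cong)
  qed
  finally show ?thesis by (simp add: splitting_sum_list_def)
qed

lemma splitting_sum_mset: "splitting_sum k h (mset xs) = splitting_sum_list k h xs"
proof -
  have "mset (SOME ys. mset ys = mset xs) = mset xs" by (rule someI[of _ xs]) simp
  then show ?thesis unfolding splitting_sum_def by (rule splitting_sum_list_perm)
qed

lemma splittings_less:
  assumes "ks \<in> splittings N k" "j < N"
  shows "ks ! j < k"
proof -
  let ?J = "{i. i < N \<and> 0 < ks ! i}"
  have l: "length ks = N" and s: "sum_list ks = k" and c: "2 \<le> card ?J"
    using assms(1) by (auto simp: splittings_def)
  have "\<not> ?J \<subseteq> {j}"
    using c card_mono[of "{j}" ?J] by auto
  then obtain i where i: "i < N" "0 < ks ! i" "i \<noteq> j" by auto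
  have "(\<Sum>m\<in>{i, j}. ks ! m) \<le> (\<Sum>m<N. ks ! m)"
    by (rule sum_mono2) (use i assms(2) in auto)
  also have "\<dots> = k" using l s by (simp add: sum_list_sum_nth atLeast0LessThan)
  finally show ?thesis using i by simp
qed

lemma splitting_sum_cong [fundef_cong]:
  assumes "k = k'" "\<And>i x. 0 < i \<Longrightarrow> i < k' \<Longrightarrow> h i x = h' i x"
  shows "splitting_sum k h = splitting_sum k' h'"
  unfolding splitting_sum_def splitting_sum_list_def
  using assms by (auto intro!: ext sum.cong prod.cong dest: splittings_less)

text \<open>The value at index zero is never used.\<close>

function limit_moment ::
    "real \<Rightarrow> ('a::polish_space \<Rightarrow> real) \<Rightarrow> ('a \<Rightarrow> real) \<Rightarrow> ('a \<Rightarrow> 'a multiset measure) \<Rightarrow>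
      ('a multiset \<Rightarrow> 'w measure) \<Rightarrow> (real \<Rightarrow> 'w \<Rightarrow> 'a multiset) \<Rightarrow> nat \<Rightarrow> 'a \<Rightarrow> real" where
  "limit_moment lam \<phi> \<gamma> Off \<PP> X k x =
     (if k < 2 then 1
      else LBINT s:{0..}. exp (- lam * real k * s) * inverse (\<phi> x) *
        mean_semigroup \<PP> X s
          (\<lambda>y. \<gamma> y *
            (\<integral>Z. splitting_sum k (\<lambda>i z. \<phi> z * limit_moment lam \<phi> \<gamma> Off \<PP> X i z) Z \<partial>Off y)) x)"
  by pat_completeness auto
termination
  by (relation "Wellfounded.measure (\<lambda>(_, _, _, _, _, _, k, _). k)") auto

declare limit_moment.simps [simp del]

end

theory Submission
  imports Defs "HOL-Real_Asymp.Real_Asymp"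
begin

text \<open>
  Write \<open>w t x = 1 - E[exp (- X t [f])]\<close> for the population started from one particle at \<open>x\<close>. In
  terms of this gap the evolution equation is linear up to the expectation of
  \<open>remainder w = (\<Prod>(1 - w)) - 1 + (\<Sum>w)\<close> over the offspring, which is quadratic in \<open>w\<close>. The
  linear equation is solved by the mean semigroup, as follows by differentiating the evolution
  equation at \<open>f = 0\<close>, and its bounded solutions are unique by Gronwall's argument. Hence
  variation of constants (\<open>laplace_gap_mild\<close>): the gap at time \<open>t\<close> plus the integral over \<open>s\<close> of
  the mean semigroup at time \<open>s\<close>, applied to the remainder of the gap at time \<open>t - s\<close>, is the
  mean of \<open>1 - exp (- f)\<close>. The moment of \<open>2 ^ N\<close> makes the remainder locally Lipschitz, with a
  constant proportional to the size of its arguments, even if these take values down to \<open>- 1/2\<close>.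

  The expansion of the formula to second order shows that second moments are of the order of the
  squared mean, \<open>exp (2 * lam * t)\<close>. By the branching and the Markov property, the variance of
  \<open>X (s + t) [f]\<close> given the past up to \<open>s\<close> is at most of order \<open>exp (2 * lam * t)\<close> times the
  population size at time \<open>s\<close>; after normalisation the fluctuations after time \<open>s\<close> are of order
  \<open>exp (- lam * s / 2)\<close> in mean absolute value (\<open>conditional_mean_L1\<close>). For the eigenfunction
  \<open>\<phi>\<close> the normalised process is a martingale, and Doob's inequality yields its almost sure
  limit, along countable sets of times or along all times if paths are right-continuous. For
  other \<open>f\<close>, the time is cut into two halves: the second half is governed by the conditional
  mean, which ergodicity replaces by \<open>\<phi>t[f]\<close> times the martingale. Convergence in mean follows,
  hence convergence in distribution.

  Letting the time tend to infinity in the formula gives an equation for the Laplace transform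
  of the limit (\<open>limit_gap_equation\<close>): the gap \<open>u \<theta>\<close> of the limit satisfies \<open>\<theta> * \<phi> - u \<theta>\<close> =
  integral over \<open>s\<close> of the mean semigroup applied to the remainder of \<open>u (\<theta> * exp (- lam * s))\<close>.
  Inserting a power series in \<open>\<theta>\<close> and expanding the product over the offspring yields precisely
  the recursion of the theorem, since the coefficients of the remainder of a power series are
  the sums over splittings (\<open>splitting_sum_sums\<close>). The method of majorants shows that this
  series converges for small \<open>\<theta>\<close> (\<open>tame_all\<close>), and a contraction argument that its sum is the
  gap (\<open>gap_contraction\<close>). So near zero the Laplace transform of the limit is a power series,
  which gives the moments (\<open>moments_from_laplace\<close>) and shows that the moment of order \<open>k\<close> grows
  at most like \<open>fact k\<close> times a geometric sequence. Then the characteristic function is analytic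
  in a strip, and the moments determine the law (\<open>determined_by_moments\<close>).
\<close>

section \<open>Measurability of sums and products over the atoms\<close>

lemma space_atomic_space [simp]: "space atomic_space = UNIV"
  by (simp add: atomic_space_def space_measure_of_conv)

lemma measurable_count_atoms:
  assumes "B \<in> sets (borel :: 'a::topological_space measure)"
  shows "(\<lambda>\<mu>. size (filter_mset (\<lambda>x. x \<in> B) \<mu>)) \<in> atomic_space \<rightarrow>\<^sub>M count_space UNIV"
proof (rule measurable_count_space_eq2_countable[THEN iffD2], safe)
  fix n
  have "{\<mu>. size (filter_mset (\<lambda>x. x \<in> B) \<mu>) = n} \<in> sets atomic_space"
    using assms unfolding atomic_space_def by (auto intro!: sigma_sets.Basic)
  then show "(\<lambda>\<mu>. size (filter_mset (\<lambda>x. x \<in> B) \<mu>)) -` {n} \<inter> space atomic_space \<in> sets atomic_space"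
    by (simp add: vimage_def)
qed auto

lemma sum_mset_eq_sum_count:
  fixes f :: "'b \<Rightarrow> 'c::comm_semiring_1"
  assumes "finite A" "set_mset M \<subseteq> A"
  shows "(\<Sum>x\<in>#M. f x) = (\<Sum>x\<in>A. of_nat (count M x) * f x)"
  using assms(2)
proof (induction M)
  case (add y M)
  have "(\<Sum>x\<in>A. of_nat (count (add_mset y M) x) * f x)
      = (\<Sum>x\<in>A. of_nat (count M x) * f x + (if x = y then f x else 0))"
    by (intro sum.cong) (auto simp: algebra_simps)
  also have "\<dots> = (\<Sum>x\<in>A. of_nat (count M x) * f x) + f y"
    using add.prems assms(1) by (simp add: sum.distrib)
  finally show ?case using add by (simp add: add.commute)
qed simp

text \<open>
  The uniform law on the atoms, counted with multiplicity. Up to the factor \<open>size Z\<close> it turns a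
  sum over the atoms into an integral against a kernel, and joint measurability of such
  integrals in parameters is a general fact. The null measure at the empty configuration keeps
  it a subprobability kernel.
\<close>

definition atom_law :: "'a::topological_space multiset \<Rightarrow> 'a measure" where
  "atom_law Z = (if Z = {#} then null_measure borel
                 else distr (measure_pmf (pmf_of_multiset Z)) borel (\<lambda>x. x))"

lemma sets_atom_law [simp]: "sets (atom_law Z) = sets borel"
  by (simp add: atom_law_def)

lemma sum_mset_eq_nn_integral_atom_law:
  assumes [measurable]: "f \<in> borel_measurable borel"
  shows "(\<Sum>x\<in>#Z. f x) = of_nat (size Z) * (\<integral>\<^sup>+x. f x \<partial>atom_law Z)"
proof (cases "Z = {#}")
  case False
  then have pos: "size Z \<noteq> 0" by simp
  have "(\<integral>\<^sup>+x. f x \<partial>atom_law Z) = (\<integral>\<^sup>+x. f x \<partial>measure_pmf (pmf_of_multiset Z))"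
    using False by (simp add: atom_law_def nn_integral_distr)
  also have "\<dots> = (\<Sum>x\<in>set_mset Z. f x * ennreal (count Z x / size Z))"
    using False by (subst nn_integral_measure_pmf_finite) auto
  finally have "of_nat (size Z) * (\<integral>\<^sup>+x. f x \<partial>atom_law Z)
      = (\<Sum>x\<in>set_mset Z. of_nat (size Z) * (f x * ennreal (count Z x / size Z)))"
    by (simp add: sum_distrib_left)
  also have "\<dots> = (\<Sum>x\<in>set_mset Z. of_nat (count Z x) * f x)"
  proof (rule sum.cong[OF refl])
    fix x
    have "of_nat (size Z) * ennreal (count Z x / size Z) = ennreal (real (size Z) * (count Z x / size Z))"
      by (subst ennreal_mult) (auto simp: ennreal_of_nat_eq_real_of_nat)
    also have "\<dots> = of_nat (count Z x)"
      using pos by (simp add: ennreal_of_nat_eq_real_of_nat)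
    finally show "of_nat (size Z) * (f x * ennreal (count Z x / size Z)) = of_nat (count Z x) * f x"
      by (metis mult.assoc mult.commute)
  qed
  also have "\<dots> = (\<Sum>x\<in>#Z. f x)"
    by (rule sum_mset_eq_sum_count[symmetric]) auto
  finally show ?thesis by simp
qed auto

lemma measurable_atom_law [measurable]: "atom_law \<in> atomic_space \<rightarrow>\<^sub>M subprob_algebra borel"
proof (rule measurable_subprob_algebra)
  fix Z :: "'a multiset"
  show "subprob_space (atom_law Z)"
    by (cases "Z = {#}") (auto simp: atom_law_def intro!: subprob_spaceI
        prob_space_imp_subprob_space[OF prob_space.prob_space_distr[OF prob_space_measure_pmf]])
next
  fix B :: "'a set" assume B: "B \<in> sets borel"
  have *: "emeasure (atom_law Z) B = ennreal (real (size (filter_mset (\<lambda>x. x \<in> B) Z)) / real (size Z))"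
    for Z :: "'a multiset"
  proof (cases "Z = {#}")
    case False
    then have pos: "real (size Z) \<noteq> 0" by simp
    have "of_nat (size Z) * emeasure (atom_law Z) B = (\<Sum>x\<in>#Z. indicator B x)"
      using B by (subst sum_mset_eq_nn_integral_atom_law) auto
    also have "\<dots> = of_nat (size (filter_mset (\<lambda>x. x \<in> B) Z))"
      by (induction Z) (auto simp: indicator_def)
    finally have "of_nat (size Z) * emeasure (atom_law Z) B = of_nat (size (filter_mset (\<lambda>x. x \<in> B) Z))" .
    then have "ennreal (1 / size Z) * (ennreal (size Z) * emeasure (atom_law Z) B)
        = ennreal (1 / size Z) * ennreal (size (filter_mset (\<lambda>x. x \<in> B) Z))"
      by (simp add: ennreal_of_nat_eq_real_of_nat)
    then show ?thesis
      using pos by (simp add: mult.assoc[symmetric] ennreal_mult[symmetric])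
  qed (simp add: atom_law_def)
  have [measurable]: "(\<lambda>Z. size (filter_mset (\<lambda>x. x \<in> B) Z)) \<in> atomic_space \<rightarrow>\<^sub>M count_space UNIV"
    by (rule measurable_count_atoms[OF B])
  have [measurable]: "(\<lambda>Z::'a multiset. size Z) \<in> atomic_space \<rightarrow>\<^sub>M count_space UNIV"
    using measurable_count_atoms[of UNIV] by simp
  show "(\<lambda>Z. emeasure (atom_law Z) B) \<in> borel_measurable atomic_space"
    unfolding * by measurable
qed simp

lemma measurable_size_atoms [measurable]:
  "(\<lambda>Z::'a::topological_space multiset. size Z) \<in> atomic_space \<rightarrow>\<^sub>M count_space UNIV"
  using measurable_count_atoms[of UNIV] by simp

lemma borel_measurable_sum_atoms_ennreal [measurable (raw)]:
  fixes k :: "'p \<Rightarrow> 'a::topological_space \<Rightarrow> ennreal"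
  assumes k [measurable]: "(\<lambda>(p, y). k p y) \<in> borel_measurable (M \<Otimes>\<^sub>M borel)"
    and Z [measurable]: "Z \<in> M \<rightarrow>\<^sub>M atomic_space"
  shows "(\<lambda>p. \<Sum>y\<in>#Z p. k p y) \<in> borel_measurable M"
proof -
  have "(\<lambda>p. \<integral>\<^sup>+y. k p y \<partial>atom_law (Z p)) \<in> borel_measurable M"
    by (rule nn_integral_measurable_subprob_algebra2[OF k]) measurable
  then have "(\<lambda>p. of_nat (size (Z p)) * (\<integral>\<^sup>+y. k p y \<partial>atom_law (Z p))) \<in> borel_measurable M"
    by measurable
  moreover have "k p \<in> borel_measurable borel" if "p \<in> space M" for p
    using measurable_Pair2[OF k that] by simp
  ultimately show ?thesis
    by (subst measurable_cong[OF sum_mset_eq_nn_integral_atom_law]) auto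
qed

lemma sum_mset_nonneg:
  fixes f :: "'b \<Rightarrow> real"
  assumes "\<And>x. x \<in># Z \<Longrightarrow> 0 \<le> f x"
  shows "0 \<le> (\<Sum>x\<in>#Z. f x)"
  using assms by (induction Z) auto

lemma sum_mset_ennreal:
  assumes "\<And>x. x \<in># Z \<Longrightarrow> 0 \<le> f x"
  shows "(\<Sum>x\<in>#Z. ennreal (f x)) = ennreal (\<Sum>x\<in>#Z. f x)"
  using assms by (induction Z) (auto simp: ennreal_plus sum_mset_nonneg)

lemma sum_mset_subtractf:
  fixes f g :: "'b \<Rightarrow> 'c::ab_group_add"
  shows "(\<Sum>x\<in>#Z. f x - g x) = (\<Sum>x\<in>#Z. f x) - (\<Sum>x\<in>#Z. g x)"
  by (induction Z) (auto simp: algebra_simps)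

lemma borel_measurable_sum_atoms_real [measurable (raw)]:
  fixes k :: "'p \<Rightarrow> 'a::topological_space \<Rightarrow> real"
  assumes k [measurable]: "(\<lambda>(p, y). k p y) \<in> borel_measurable (M \<Otimes>\<^sub>M borel)"
    and Z [measurable]: "Z \<in> M \<rightarrow>\<^sub>M atomic_space"
  shows "(\<lambda>p. \<Sum>y\<in>#Z p. k p y) \<in> borel_measurable M"
proof -
  have "(\<Sum>y\<in>#Z p. k p y) = enn2real (\<Sum>y\<in>#Z p. ennreal (max 0 (k p y)))
      - enn2real (\<Sum>y\<in>#Z p. ennreal (max 0 (- k p y)))" for p
    by (subst (1 2) sum_mset_ennreal) (auto simp: sum_mset_nonneg sum_mset_subtractf[symmetric]
        intro!: arg_cong[where f = sum_mset] image_mset_cong)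
  moreover have "(\<lambda>p. enn2real (\<Sum>y\<in>#Z p. ennreal (max 0 (k p y)))
      - enn2real (\<Sum>y\<in>#Z p. ennreal (max 0 (- k p y)))) \<in> borel_measurable M"
    by measurable
  ultimately show ?thesis by presburger
qed

lemma prod_mset_exp_sum_ln:
  fixes f :: "'b \<Rightarrow> real"
  assumes "\<And>x. x \<in># Z \<Longrightarrow> 0 < f x"
  shows "(\<Prod>x\<in>#Z. f x) = exp (\<Sum>x\<in>#Z. ln (f x))"
  using assms by (induction Z) (auto simp: exp_add)

text \<open>Positivity of the factors is what reduces the product to a sum, through the logarithm.\<close>

lemma borel_measurable_prod_atoms:
  fixes k :: "'p \<Rightarrow> 'a::topological_space \<Rightarrow> real"
  assumes k [measurable]: "(\<lambda>(p, y). k p y) \<in> borel_measurable (M \<Otimes>\<^sub>M borel)"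
    and Z [measurable]: "Z \<in> M \<rightarrow>\<^sub>M atomic_space"
    and pos: "\<And>p y. 0 < k p y"
  shows "(\<lambda>p. \<Prod>y\<in>#Z p. k p y) \<in> borel_measurable M"
  by (subst prod_mset_exp_sum_ln) (use pos in auto)

lemma measurable_single_atom [measurable]:
  "(\<lambda>x::'a::topological_space. {#x#}) \<in> borel \<rightarrow>\<^sub>M atomic_space"
  unfolding atomic_space_def
proof (rule measurable_measure_of)
  fix A :: "'a multiset set"
  assume "A \<in> {{\<mu>. size (filter_mset (\<lambda>x. x \<in> B) \<mu>) = n} | B n. B \<in> sets borel}"
  then obtain B n where A: "A = {\<mu>. size (filter_mset (\<lambda>x. x \<in> B) \<mu>) = n}"
    and B [measurable]: "B \<in> sets borel" by auto
  have "(\<lambda>x. {#x#}) -` A \<inter> space borel = {x \<in> space borel. (if x \<in> B then 1 else 0) = n}"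
    by (auto simp: A split: if_splits)
  also have "\<dots> \<in> sets borel" by measurable
  finally show "(\<lambda>x. {#x#}) -` A \<inter> space borel \<in> sets borel" .
qed auto

section \<open>Kernels of the process\<close>

lemma measurable_triple_compose:
  assumes "(\<lambda>(p, s, y). k p s y) \<in> M1 \<Otimes>\<^sub>M M2 \<Otimes>\<^sub>M M3 \<rightarrow>\<^sub>M N"
    and "p \<in> M \<rightarrow>\<^sub>M M1" "s \<in> M \<rightarrow>\<^sub>M M2" "y \<in> M \<rightarrow>\<^sub>M M3"
  shows "(\<lambda>q. k (p q) (s q) (y q)) \<in> M \<rightarrow>\<^sub>M N"
  using measurable_compose[OF measurable_Pair[OF assms(2) measurable_Pair[OF assms(3,4)]] assms(1)]
  by simp

lemma measurable_time_integral [measurable (raw)]: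
  fixes k :: "'p \<Rightarrow> real \<Rightarrow> ennreal"
  assumes [measurable]: "(\<lambda>(p, s). k p s) \<in> borel_measurable (M \<Otimes>\<^sub>M borel)" "t \<in> borel_measurable M"
  shows "(\<lambda>p. \<integral>\<^sup>+s\<in>{0..t p}. k p s \<partial>lborel) \<in> borel_measurable M"
proof (rule lborel.borel_measurable_nn_integral)
  have "(\<lambda>(p, s). k p s * (if 0 \<le> s \<and> s \<le> t p then 1 else 0)) \<in> borel_measurable (M \<Otimes>\<^sub>M borel)"
    by measurable
  then show "(\<lambda>(p, s). k p s * indicator {0..t p} s) \<in> borel_measurable (M \<Otimes>\<^sub>M lborel)"
    unfolding measurable_cong_sets[OF sets_pair_measure_cong[OF refl sets_lborel] refl]
    by (auto simp: indicator_def cong: measurable_cong)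
qed

context branching_markov_process
begin

text \<open>Times are truncated at zero so that every kernel is measurable on the whole real line.\<close>

definition motion :: "real \<Rightarrow> 'a \<Rightarrow> 'a measure" where
  "motion t = P (max 0 t)"

definition population :: "real \<Rightarrow> 'a \<Rightarrow> 'a multiset measure" where
  "population t x = transition \<PP> X (max 0 t) {#x#}"

text \<open>
  These expectations and the time integral below are taken in \<^typ>\<open>ennreal\<close>: the equations for them
  can then be added, scaled and passed to the limit before anything is known to be finite.
\<close>

definition offspring_sum :: "('a \<Rightarrow> ennreal) \<Rightarrow> 'a \<Rightarrow> ennreal" where
  "offspring_sum f y = (\<integral>\<^sup>+Z. (\<Sum>z\<in>#Z. f z) \<partial>Off y)"

definition mean_sum :: "real \<Rightarrow> ('a \<Rightarrow> ennreal) \<Rightarrow> 'a \<Rightarrow> ennreal" where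
  "mean_sum t f x = (\<integral>\<^sup>+Z. (\<Sum>z\<in>#Z. f z) \<partial>population t x)"

text \<open>
  The source term of a mild equation: a particle moves for a time \<open>s\<close>, and \<open>k\<close> is evaluated at
  the place it has reached and at the time \<open>t - s\<close> that is left.
\<close>

definition duhamel :: "real \<Rightarrow> (real \<Rightarrow> 'a \<Rightarrow> ennreal) \<Rightarrow> 'a \<Rightarrow> ennreal" where
  "duhamel t k x = (\<integral>\<^sup>+s\<in>{0..t}. (\<integral>\<^sup>+y. k (t - s) y \<partial>motion s x) \<partial>lborel)"

lemma measurable_motion [measurable]:
  "(\<lambda>(t, x). motion t x) \<in> borel \<Otimes>\<^sub>M borel \<rightarrow>\<^sub>M subprob_algebra borel"
proof -
  have "(\<lambda>(t, x). (max 0 t, x)) \<in> borel \<Otimes>\<^sub>M borel \<rightarrow>\<^sub>M restrict_space borel {0::real..} \<Otimes>\<^sub>M (borel :: 'a measure)"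
    unfolding split_beta
    by (intro measurable_Pair measurable_restrict_space2) auto
  from measurable_compose[OF this kernel] show ?thesis
    by (simp add: motion_def split_beta)
qed

lemma measurable_population [measurable]:
  "(\<lambda>(t, x). population t x) \<in> borel \<Otimes>\<^sub>M borel \<rightarrow>\<^sub>M subprob_algebra atomic_space"
proof -
  have "(\<lambda>(t, x). (max 0 t, {#x#})) \<in> borel \<Otimes>\<^sub>M borel \<rightarrow>\<^sub>M
      restrict_space borel {0::real..} \<Otimes>\<^sub>M (atomic_space :: 'a multiset measure)"
    unfolding split_beta
    by (intro measurable_Pair measurable_restrict_space2) auto
  from measurable_compose[OF this measurable_prob_algebraD[OF transition_kernel]] show ?thesis
    by (simp add: population_def split_beta)
qed

lemma measurable_motion_x [measurable]: "motion t \<in> borel \<rightarrow>\<^sub>M subprob_algebra borel"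
  by (rule measurable_Pair_compose_split[OF measurable_motion, of "\<lambda>_. t" _ "\<lambda>x. x"]) auto

lemma measurable_population_x [measurable]:
  "population t \<in> borel \<rightarrow>\<^sub>M subprob_algebra atomic_space"
  by (rule measurable_Pair_compose_split[OF measurable_population, of "\<lambda>_. t" _ "\<lambda>x. x"]) auto

lemma measurable_Off [measurable]: "Off \<in> borel \<rightarrow>\<^sub>M subprob_algebra atomic_space"
  using offspring by (rule measurable_prob_algebraD)

lemma sets_motion [simp, measurable_cong]: "sets (motion t x) = sets borel"
  using sets_kernel[OF measurable_motion_x[of t], of x] by simp

lemma sets_population [simp, measurable_cong]: "sets (population t x) = sets atomic_space"
  using sets_kernel[OF measurable_population_x[of t], of x] by simp

lemma sets_Off [simp, measurable_cong]: "sets (Off x) = sets atomic_space"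
  using sets_kernel[OF measurable_Off, of x] by simp

lemma subprob_space_motion: "subprob_space (motion t x)"
  using subprob_space_kernel[OF measurable_motion_x[of t], of x] by simp

lemma prob_space_Off: "prob_space (Off x)"
  using measurable_space[OF offspring, of x] by (simp add: space_prob_algebra)

lemma sets_F_law [simp, measurable_cong]: "sets (\<PP> \<mu>) = sets F"
  by (rule sets_law)

lemma measurable_process [measurable]: "X (max 0 t) \<in> F \<rightarrow>\<^sub>M atomic_space"
  by (rule process) simp

lemma measurable_process_law: "0 \<le> t \<Longrightarrow> X t \<in> \<PP> \<mu> \<rightarrow>\<^sub>M atomic_space"
  using process[of t] by simp

lemma measurable_gamma [measurable]: "\<gamma> \<in> borel_measurable borel"
  using rate by (simp add: bfun_nonneg_def bfun_def)

lemma gamma_nonneg [simp]: "0 \<le> \<gamma> x"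
  using rate by (simp add: bfun_nonneg_def)

lemma prob_space_population: "prob_space (population t x)"
  unfolding population_def transition_def
  by (intro prob_space.prob_space_distr prob measurable_process_law) simp

lemma measurable_motion_integral [measurable (raw)]:
  assumes [measurable]: "(\<lambda>(p, y). k p y) \<in> borel_measurable (M \<Otimes>\<^sub>M borel)"
    "t \<in> borel_measurable M" "x \<in> M \<rightarrow>\<^sub>M borel"
  shows "(\<lambda>p. \<integral>\<^sup>+y. k p y \<partial>motion (t p) (x p)) \<in> borel_measurable M"
  by (rule nn_integral_measurable_subprob_algebra2[where N = borel]) measurable

lemma measurable_offspring_integral [measurable (raw)]:
  assumes [measurable]: "(\<lambda>(p, Z). k p Z) \<in> borel_measurable (M \<Otimes>\<^sub>M atomic_space)" "x \<in> M \<rightarrow>\<^sub>M borel"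
  shows "(\<lambda>p. \<integral>\<^sup>+Z. k p Z \<partial>Off (x p)) \<in> borel_measurable M"
  by (rule nn_integral_measurable_subprob_algebra2[where N = atomic_space]) measurable

lemma measurable_offspring_sum [measurable (raw)]:
  assumes [measurable]: "(\<lambda>(p, y). k p y) \<in> borel_measurable (M \<Otimes>\<^sub>M borel)" "x \<in> M \<rightarrow>\<^sub>M borel"
  shows "(\<lambda>p. offspring_sum (k p) (x p)) \<in> borel_measurable M"
  unfolding offspring_sum_def by measurable

lemma measurable_population_integral [measurable (raw)]:
  assumes [measurable]: "(\<lambda>(p, Z). k p Z) \<in> borel_measurable (M \<Otimes>\<^sub>M atomic_space)"
    "t \<in> borel_measurable M" "x \<in> M \<rightarrow>\<^sub>M borel"
  shows "(\<lambda>p. \<integral>\<^sup>+Z. k p Z \<partial>population (t p) (x p)) \<in> borel_measurable M"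
  by (rule nn_integral_measurable_subprob_algebra2[where N = atomic_space]) measurable

lemma measurable_mean_sum [measurable (raw)]:
  assumes [measurable]: "(\<lambda>(p, y). k p y) \<in> borel_measurable (M \<Otimes>\<^sub>M borel)"
    "t \<in> borel_measurable M" "x \<in> M \<rightarrow>\<^sub>M borel"
  shows "(\<lambda>p. mean_sum (t p) (k p) (x p)) \<in> borel_measurable M"
  unfolding mean_sum_def by measurable

lemma measurable_duhamel [measurable (raw)]:
  assumes k: "(\<lambda>(p, s, y). k p s y) \<in> borel_measurable (M \<Otimes>\<^sub>M borel \<Otimes>\<^sub>M borel)"
    and [measurable]: "t \<in> borel_measurable M" "x \<in> M \<rightarrow>\<^sub>M borel"
  shows "(\<lambda>p. duhamel (t p) (k p) (x p)) \<in> borel_measurable M"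
proof -
  note [measurable (raw)] = measurable_triple_compose[OF k]
  show ?thesis
    unfolding duhamel_def by measurable
qed

end

section \<open>The second order remainder of a product\<close>

text \<open>
  The error of the first order approximation \<open>1 - \<Sum> w\<close> to the product of the \<open>1 - w\<close>. Its
  integral against the offspring law is the nonlinear part of the branching operator.
\<close>

definition remainder :: "('a \<Rightarrow> real) \<Rightarrow> 'a multiset \<Rightarrow> real" where
  "remainder w Z = (\<Prod>z\<in>#Z. 1 - w z) - 1 + (\<Sum>z\<in>#Z. w z)"

lemma remainder_empty [simp]: "remainder w {#} = 0"
  by (simp add: remainder_def)

lemma remainder_add: "remainder w (add_mset x Z) = remainder w Z + w x * (1 - (\<Prod>z\<in>#Z. 1 - w z))"
  by (simp add: remainder_def algebra_simps)

lemma prod_one_minus_bounds: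
  fixes w :: "'b \<Rightarrow> real"
  assumes "\<And>z. 0 \<le> w z" "\<And>z. w z \<le> 1"
  shows "0 \<le> (\<Prod>z\<in>#Z. 1 - w z)" "(\<Prod>z\<in>#Z. 1 - w z) \<le> 1"
proof -
  have "0 \<le> (\<Prod>z\<in>#Z. 1 - w z) \<and> (\<Prod>z\<in>#Z. 1 - w z) \<le> 1"
    using assms by (induction Z) (auto intro!: mult_le_one)
  then show "0 \<le> (\<Prod>z\<in>#Z. 1 - w z)" "(\<Prod>z\<in>#Z. 1 - w z) \<le> 1" by auto
qed

lemma remainder_nonneg:
  assumes "\<And>z. 0 \<le> w z" "\<And>z. w z \<le> 1"
  shows "0 \<le> remainder w Z"
  by (induction Z) (auto simp: remainder_add assms prod_one_minus_bounds)

lemma remainder_le_sum: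
  assumes "\<And>z. 0 \<le> w z" "\<And>z. w z \<le> 1"
  shows "remainder w Z \<le> (\<Sum>z\<in>#Z. w z)"
  using prod_one_minus_bounds[of w Z] assms by (simp add: remainder_def)

lemma abs_sum_mult_le:
  fixes a b c d e :: real
  shows "\<bar>a + (b * c + d * e)\<bar> \<le> \<bar>a\<bar> + (\<bar>b\<bar> * \<bar>c\<bar> + \<bar>d\<bar> * \<bar>e\<bar>)"
  using abs_triangle_ineq[of a "b * c + d * e"] abs_triangle_ineq[of "b * c" "d * e"]
  by (simp add: abs_mult)

text \<open>
  The factors are exchanged one at a time; each exchange costs \<open>\<delta>\<close> times a product of other
  factors, which are at most \<open>q\<close> in absolute value.
\<close>

lemma prod_atoms_lipschitz:
  fixes w v :: "'b \<Rightarrow> real" and \<eta> \<delta> q :: real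
  assumes d: "\<And>z. \<bar>w z - v z\<bar> \<le> \<delta>" and q: "\<And>z. \<bar>1 - w z\<bar> \<le> q" "\<And>z. \<bar>1 - v z\<bar> \<le> q" "1 \<le> q"
  shows "\<bar>(\<Prod>z\<in>#Z. 1 - w z) - (\<Prod>z\<in>#Z. 1 - v z)\<bar> \<le> size Z * \<delta> * q ^ size Z"
proof (induction Z)
  case (add x Z)
  let ?W = "\<Prod>z\<in>#Z. 1 - w z" and ?V = "\<Prod>z\<in>#Z. 1 - v z"
  have V: "\<bar>?V\<bar> \<le> q ^ size Z"
    using q by (induction Z) (auto simp: abs_mult intro!: mult_mono)
  have "(1 - w x) * ?W - (1 - v x) * ?V = 0 + ((1 - w x) * (?W - ?V) + (v x - w x) * ?V)"
    by (simp add: algebra_simps)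
  also have "\<bar>\<dots>\<bar> \<le> \<bar>0\<bar> + (\<bar>1 - w x\<bar> * \<bar>?W - ?V\<bar> + \<bar>v x - w x\<bar> * \<bar>?V\<bar>)"
    by (rule abs_sum_mult_le)
  also have "\<dots> \<le> \<bar>0\<bar> + (q * (size Z * \<delta> * q ^ size Z) + \<delta> * q ^ size Z)"
    using add q V d[of x] by (intro add_mono mult_mono) (auto simp: abs_minus_commute)
  also have "\<dots> \<le> q * (size Z * \<delta> * q ^ size Z) + q * (\<delta> * q ^ size Z)"
    using q(3) d[of x] mult_right_mono[of 1 q "\<delta> * q ^ size Z"] by simp
  also have "\<dots> = size (add_mset x Z) * \<delta> * q ^ size (add_mset x Z)"
    by (simp add: algebra_simps)
  finally show ?case by simp
qed simp

text \<open>
  Being of second order, the remainder has increments of size \<open>\<eta> * \<delta>\<close>, where \<open>\<eta>\<close> bounds the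
  functions and \<open>\<delta>\<close> their distance: by \<open>remainder_add\<close>, a new atom contributes \<open>w x\<close> times a
  difference of products, hence a product of two small quantities. The functions may be
  negative; only \<open>q\<close> limits how much.
\<close>

lemma remainder_lipschitz:
  fixes w v :: "'b \<Rightarrow> real" and \<eta> \<delta> q :: real
  assumes w: "\<And>z. \<bar>w z\<bar> \<le> \<eta>" "\<And>z. \<bar>v z\<bar> \<le> \<eta>" and d: "\<And>z. \<bar>w z - v z\<bar> \<le> \<delta>"
    and q: "\<And>z. \<bar>1 - w z\<bar> \<le> q" "\<And>z. \<bar>1 - v z\<bar> \<le> q" "1 \<le> q"
  shows "\<bar>remainder w Z - remainder v Z\<bar> \<le> (real (size Z))\<^sup>2 * (\<eta> * \<delta>) * q ^ size Z"
proof (induction Z)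
  case (add x Z)
  let ?W = "\<Prod>z\<in>#Z. 1 - w z" and ?V = "\<Prod>z\<in>#Z. 1 - v z" and ?n = "real (size Z)"
  have nn: "0 \<le> \<eta>" "0 \<le> \<delta>" using w(1)[of x] d[of x] by auto
  have 1: "\<bar>1 - ?W\<bar> \<le> ?n * \<eta> * q ^ size Z"
    using prod_atoms_lipschitz[of w "\<lambda>_. 0" \<eta> q Z] w q by (simp add: abs_minus_commute)
  have 2: "\<bar>?W - ?V\<bar> \<le> ?n * \<delta> * q ^ size Z"
    by (rule prod_atoms_lipschitz[OF d q])
  have "remainder w (add_mset x Z) - remainder v (add_mset x Z)
      = (remainder w Z - remainder v Z) + ((w x - v x) * (1 - ?W) + v x * (?V - ?W))"
    by (simp add: remainder_add algebra_simps)
  also have "\<bar>\<dots>\<bar> \<le> \<bar>remainder w Z - remainder v Z\<bar> + (\<bar>w x - v x\<bar> * \<bar>1 - ?W\<bar> + \<bar>v x\<bar> * \<bar>?V - ?W\<bar>)"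
    by (rule abs_sum_mult_le)
  also have "\<dots> \<le> ?n\<^sup>2 * (\<eta> * \<delta>) * q ^ size Z + (\<delta> * (?n * \<eta> * q ^ size Z) + \<eta> * (?n * \<delta> * q ^ size Z))"
    using add.IH mult_mono[OF d[of x] 1 nn(2) abs_ge_zero] mult_mono[OF w(2)[of x] 2 nn(1) abs_ge_zero]
    unfolding abs_minus_commute[of ?W ?V] by linarith
  also have "\<dots> = (?n\<^sup>2 + 2 * ?n) * (\<eta> * \<delta> * q ^ size Z)"
    by (simp add: algebra_simps)
  also have "\<dots> \<le> (?n + 1)\<^sup>2 * (\<eta> * \<delta> * q ^ size Z)"
    using nn q(3) by (intro mult_right_mono) (auto simp: power2_sum)
  also have "\<dots> \<le> (?n + 1)\<^sup>2 * (\<eta> * \<delta> * q ^ Suc (size Z))"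
    using nn q(3) by (intro mult_left_mono power_increasing) auto
  finally show ?case by (simp add: algebra_simps)
qed simp

lemma remainder_bound:
  assumes "\<And>z. \<bar>w z\<bar> \<le> \<eta>" "\<And>z. \<bar>1 - w z\<bar> \<le> q" "1 \<le> q"
  shows "\<bar>remainder w Z\<bar> \<le> (real (size Z))\<^sup>2 * \<eta>\<^sup>2 * q ^ size Z"
proof -
  have "0 \<le> \<eta>" using assms(1)[of undefined] by linarith
  moreover have "remainder (\<lambda>_. 0) Z = 0" by (simp add: remainder_def)
  ultimately show ?thesis
    using remainder_lipschitz[of w \<eta> "\<lambda>_. 0" \<eta> q Z] assms by (simp add: power2_eq_square)
qed

text \<open>
  The gap between \<open>3/2\<close> and \<open>2\<close> pays for the quadratic factor in the two preceding bounds. Thus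
  remainders of functions with values in \<open>[- 1/2, 1]\<close> are integrable as soon as \<open>2 ^ size Z\<close> is.
\<close>

lemma square_le_power_two:
  "(real n)\<^sup>2 * (3/2) ^ n \<le> 18 * 2 ^ n"
proof -
  \<comment> \<open>the first three terms of the binomial expansion of \<open>(1 + 1/3) ^ n\<close>\<close>
  have *: "1 + n / 3 + n * (real n - 1) / 18 \<le> (4/3 :: real) ^ n"
  proof (induction n)
    case (Suc n)
    have "1 + real (Suc n) / 3 + real (Suc n) * (real (Suc n) - 1) / 18
        \<le> 4/3 * (1 + n / 3 + n * (real n - 1) / 18)"
      using mult_nonneg_nonneg[of "real n" "real n - 1"]
      by (cases n) (auto simp: field_simps)
    also have "\<dots> \<le> 4/3 * (4/3) ^ n"
      using Suc by (intro mult_left_mono) auto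
    finally show ?case by simp
  qed simp
  have "(real n)\<^sup>2 \<le> 18 * (1 + n / 3 + n * (real n - 1) / 18)"
    by (simp add: power2_eq_square field_simps)
  also have "\<dots> \<le> 18 * (4/3) ^ n" using * by simp
  finally have "(real n)\<^sup>2 * (3/2) ^ n \<le> 18 * (4/3) ^ n * (3/2) ^ n"
    by (intro mult_right_mono) auto
  also have "\<dots> = 18 * 2 ^ n"
    by (simp add: mult.assoc power_mult_distrib[symmetric])
  finally show ?thesis .
qed

lemma borel_measurable_remainder:
  fixes k :: "'p \<Rightarrow> 'a::topological_space \<Rightarrow> real"
  assumes [measurable]: "(\<lambda>(p, y). k p y) \<in> borel_measurable (M \<Otimes>\<^sub>M borel)" "Z \<in> M \<rightarrow>\<^sub>M atomic_space"
    and pos: "\<And>p y. k p y < 1"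
  shows "(\<lambda>p. remainder (k p) (Z p)) \<in> borel_measurable M"
proof -
  have "(\<lambda>p. \<Prod>y\<in>#Z p. 1 - k p y) \<in> borel_measurable M"
    by (rule borel_measurable_prod_atoms[OF _ assms(2)]) (measurable, simp add: pos)
  moreover have "(\<lambda>p. \<Sum>y\<in>#Z p. k p y) \<in> borel_measurable M"
    by measurable
  ultimately show ?thesis
    unfolding remainder_def by (intro borel_measurable_add borel_measurable_diff borel_measurable_const)
qed

section \<open>Exponential moments of the offspring and the Laplace gap\<close>

locale exponential_offspring = branching_markov_process +
  assumes offspring_moment: "(SUP y. \<integral>\<^sup>+Z. 2 ^ size Z \<partial>Off y) < \<infinity>"
begin

definition off_bound :: real where
  "off_bound = enn2real (SUP y. \<integral>\<^sup>+Z. 2 ^ size Z \<partial>Off y)"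

definition rate_bound :: real where
  "rate_bound = (SUP y. \<gamma> y)"

lemma gamma_le: "\<gamma> y \<le> rate_bound"
  unfolding rate_bound_def
  using rate by (intro cSUP_upper bounded_imp_bdd_above) (auto simp: bfun_nonneg_def bfun_def)

lemma rate_bound_nonneg [simp]: "0 \<le> rate_bound"
  using gamma_le gamma_nonneg order_trans by blast

lemma off_bound_nonneg [simp]: "0 \<le> off_bound"
  by (simp add: off_bound_def)

lemma offspring_exp_le: "(\<integral>\<^sup>+Z. ennreal (2 ^ size Z) \<partial>Off y) \<le> ennreal off_bound"
proof -
  have "(\<integral>\<^sup>+Z. ennreal (2 ^ size Z) \<partial>Off y) = (\<integral>\<^sup>+Z. 2 ^ size Z \<partial>Off y)"
    by (intro nn_integral_cong) (simp add: ennreal_power[symmetric])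
  also have "\<dots> \<le> (SUP y. \<integral>\<^sup>+Z. 2 ^ size Z \<partial>Off y)" by (rule SUP_upper) simp
  also have "\<dots> = ennreal off_bound"
    unfolding off_bound_def using offspring_moment by (simp only: ennreal_enn2real infinity_ennreal_def)
  finally show ?thesis .
qed

lemma measurable_exp_size: "(\<lambda>Z::'a multiset. ennreal (2 ^ size Z)) \<in> borel_measurable atomic_space"
  by (rule measurable_compose[OF measurable_size_atoms]) simp

lemma offspring_integral_le:
  assumes "\<And>Z. k Z \<le> C * 2 ^ size Z" "0 \<le> C"
  shows "(\<integral>\<^sup>+Z. ennreal (k Z) \<partial>Off y) \<le> ennreal (C * off_bound)"
proof -
  have "(\<integral>\<^sup>+Z. ennreal (k Z) \<partial>Off y) \<le> (\<integral>\<^sup>+Z. ennreal C * ennreal (2 ^ size Z) \<partial>Off y)"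
    using assms by (intro nn_integral_mono) (simp add: ennreal_mult[symmetric] ennreal_leI)
  also have "\<dots> = ennreal C * (\<integral>\<^sup>+Z. ennreal (2 ^ size Z) \<partial>Off y)"
    by (rule nn_integral_cmult) (simp add: measurable_exp_size cong: measurable_cong_sets)
  also have "\<dots> \<le> ennreal C * ennreal off_bound"
    by (intro mult_left_mono offspring_exp_le) simp
  finally show ?thesis using assms by (simp add: ennreal_mult)
qed

text \<open>
  The Laplace functional enters through its distance from one: the evolution equation for this
  gap has non-negative terms only, up to moving some of them across, and the gap is small when
  the test function is.
\<close>

definition laplace_gap :: "('a \<Rightarrow> real) \<Rightarrow> real \<Rightarrow> 'a \<Rightarrow> real" where
  "laplace_gap f t x = 1 - exp_functional \<PP> X (max 0 t) f {#x#}"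

definition branching_remainder :: "('a \<Rightarrow> real) \<Rightarrow> 'a \<Rightarrow> real" where
  "branching_remainder w y = \<gamma> y * (\<integral>Z. remainder w Z \<partial>Off y)"

lemma bfun_nonneg_measurable: "f \<in> bfun_nonneg \<Longrightarrow> f \<in> borel_measurable borel"
  and bfun_nonneg_pos: "f \<in> bfun_nonneg \<Longrightarrow> 0 \<le> f x"
  by (auto simp: bfun_nonneg_def bfun_def)

lemma exp_functional_population:
  assumes f: "f \<in> bfun_nonneg"
  shows "exp_functional \<PP> X (max 0 t) f {#x#} = (\<integral>Z. exp (- (\<Sum>z\<in>#Z. f z)) \<partial>population t x)"
proof -
  have [measurable]: "f \<in> borel_measurable borel" using f by (rule bfun_nonneg_measurable)
  show ?thesis
    unfolding exp_functional_def population_def transition_def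
    by (subst integral_distr) (auto intro!: measurable_process_law)
qed

lemma integrable_exp_sum:
  assumes f: "f \<in> bfun_nonneg"
  shows "integrable (population t x) (\<lambda>Z. exp (- (\<Sum>z\<in>#Z. f z)))"
proof -
  interpret prob_space "population t x" by (rule prob_space_population)
  have [measurable]: "f \<in> borel_measurable borel" using f by (rule bfun_nonneg_measurable)
  show ?thesis
    by (rule integrable_const_bound[where B = 1]) (auto simp: sum_mset_nonneg bfun_nonneg_pos[OF f])
qed

lemma laplace_gap_less_1:
  assumes f: "f \<in> bfun_nonneg"
  shows "laplace_gap f t x < 1"
proof -
  interpret prob_space "population t x" by (rule prob_space_population)
  let ?I = "\<integral>Z. exp (- (\<Sum>z\<in>#Z. f z)) \<partial>population t x"
  have "?I \<noteq> 0"
    by (subst integral_nonneg_eq_0_iff_AE[OF integrable_exp_sum[OF f]]) auto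
  moreover have "0 \<le> ?I" by (rule Bochner_Integration.integral_nonneg) auto
  ultimately show ?thesis by (simp add: laplace_gap_def exp_functional_population[OF f] less_le)
qed

lemma ennreal_laplace_gap:
  assumes f: "f \<in> bfun_nonneg"
  shows "ennreal (laplace_gap f t x) = (\<integral>\<^sup>+Z. ennreal (1 - exp (- (\<Sum>z\<in>#Z. f z))) \<partial>population t x)"
    and laplace_gap_nonneg: "0 \<le> laplace_gap f t x"
proof -
  interpret prob_space "population t x" by (rule prob_space_population)
  have eq: "laplace_gap f t x = (\<integral>Z. 1 - exp (- (\<Sum>z\<in>#Z. f z)) \<partial>population t x)"
    using integrable_exp_sum[OF f]
    by (simp add: laplace_gap_def exp_functional_population[OF f] prob_space)
  have nn: "0 \<le> 1 - exp (- (\<Sum>z\<in>#Z. f z))" for Z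
    by (auto simp: sum_mset_nonneg bfun_nonneg_pos[OF f])
  show "ennreal (laplace_gap f t x) = (\<integral>\<^sup>+Z. ennreal (1 - exp (- (\<Sum>z\<in>#Z. f z))) \<partial>population t x)"
    unfolding eq using integrable_exp_sum[OF f] nn by (intro nn_integral_eq_integral[symmetric]) auto
  show "0 \<le> laplace_gap f t x" unfolding eq using nn by (intro Bochner_Integration.integral_nonneg) auto
qed

lemma measurable_laplace_gap:
  assumes f: "f \<in> bfun_nonneg" and [measurable]: "t \<in> borel_measurable M" "x \<in> M \<rightarrow>\<^sub>M borel"
  shows "(\<lambda>p. laplace_gap f (t p) (x p)) \<in> borel_measurable M"
proof -
  have [measurable]: "f \<in> borel_measurable borel" using f by (rule bfun_nonneg_measurable)
  have "laplace_gap f t x = enn2real (\<integral>\<^sup>+Z. ennreal (1 - exp (- (\<Sum>z\<in>#Z. f z))) \<partial>population t x)" for t x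
    using ennreal_laplace_gap[OF f] laplace_gap_nonneg[OF f] by (metis enn2real_ennreal)
  moreover have "(\<lambda>p. enn2real (\<integral>\<^sup>+Z. ennreal (1 - exp (- (\<Sum>z\<in>#Z. f z))) \<partial>population (t p) (x p)))
      \<in> borel_measurable M"
    by measurable
  ultimately show ?thesis by presburger
qed

lemma integrable_offspring:
  fixes k :: "'a multiset \<Rightarrow> real"
  assumes "k \<in> borel_measurable atomic_space" "\<And>Z. \<bar>k Z\<bar> \<le> C * 2 ^ size Z"
  shows "integrable (Off y) k"
proof (rule integrableI_bounded)
  show "k \<in> borel_measurable (Off y)" using assms(1) by (simp cong: measurable_cong_sets)
  have "0 \<le> C" using assms(2)[of "{#}"] by simp
  then have "(\<integral>\<^sup>+Z. ennreal (\<bar>k Z\<bar>) \<partial>Off y) \<le> ennreal (C * off_bound)"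
    using assms by (intro offspring_integral_le) auto
  then show "(\<integral>\<^sup>+Z. ennreal (norm (k Z)) \<partial>Off y) < \<infinity>"
    by (simp add: le_less_trans)
qed

lemma of_nat_less_two_power: "real n \<le> 2 ^ n"
  by (metis less_exp less_imp_le of_nat_le_iff of_nat_numeral of_nat_power)

lemma sum_atoms_le:
  assumes "\<And>z. f z \<le> c"
  shows "(\<Sum>z\<in>#Z. f z) \<le> c * real (size Z)"
  using assms by (induction Z) (auto simp: algebra_simps add_mono)

section \<open>The evolution equation for the gap\<close>

lemma duhamel_real:
  fixes k :: "real \<Rightarrow> 'a \<Rightarrow> real"
  assumes [measurable]: "(\<lambda>(s, y). k s y) \<in> borel_measurable (borel \<Otimes>\<^sub>M borel)"
    and k: "\<And>s y. 0 \<le> k s y" "\<And>s y. k s y \<le> M"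
  shows "set_integrable lborel {0..t} (\<lambda>s. \<integral>y. k (t - s) y \<partial>motion s x)"
    and "ennreal (LBINT s:{0..t}. \<integral>y. k (t - s) y \<partial>motion s x) = duhamel t (\<lambda>s y. ennreal (k s y)) x"
    and "0 \<le> (LBINT s:{0..t}. \<integral>y. k (t - s) y \<partial>motion s x)"
proof -
  define g where "g s = (\<integral>y. k (t - s) y \<partial>motion s x)" for s
  have M: "0 \<le> M" using k order_trans by blast
  have int: "integrable (motion s x) (k r)" for s r
  proof -
    interpret subprob_space "motion s x" by (rule subprob_space_motion)
    show ?thesis by (rule integrable_const_bound[where B = M]) (auto simp: k)
  qed
  have g: "ennreal (g s) = (\<integral>\<^sup>+y. ennreal (k (t - s) y) \<partial>motion s x)" for s
    unfolding g_def using int k by (intro nn_integral_eq_integral[symmetric]) auto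
  have g0: "0 \<le> g s" for s unfolding g_def using k by simp
  have gM: "g s \<le> M" for s
  proof -
    interpret subprob_space "motion s x" by (rule subprob_space_motion)
    have "ennreal (g s) \<le> (\<integral>\<^sup>+y. ennreal M \<partial>motion s x)"
      unfolding g using k by (intro nn_integral_mono ennreal_leI) auto
    also have "\<dots> \<le> ennreal M" using emeasure_space_le_1 mult_left_mono by (fastforce simp: M)
    finally show ?thesis using M by simp
  qed
  have "g s = enn2real (\<integral>\<^sup>+y. ennreal (k (t - s) y) \<partial>motion s x)" for s
    using g g0 by (metis enn2real_ennreal)
  moreover have "(\<lambda>s. enn2real (\<integral>\<^sup>+y. ennreal (k (t - s) y) \<partial>motion s x)) \<in> borel_measurable borel"
    by measurable
  ultimately have [measurable]: "g \<in> borel_measurable borel" by presburger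
  have int: "set_integrable lborel {0..t} g"
    unfolding set_integrable_def
    by (rule integrableI_bounded_set_indicator[where B = M]) (use g0 gM in \<open>auto simp: emeasure_lborel_Icc_eq\<close>)
  then show "set_integrable lborel {0..t} (\<lambda>s. \<integral>y. k (t - s) y \<partial>motion s x)"
    by (simp add: g_def[abs_def])
  have "ennreal (LBINT s:{0..t}. g s) = (\<integral>\<^sup>+s. ennreal (indicator {0..t} s *\<^sub>R g s) \<partial>lborel)"
    unfolding set_lebesgue_integral_def using int[unfolded set_integrable_def] g0
    by (intro nn_integral_eq_integral[symmetric]) auto
  also have "\<dots> = duhamel t (\<lambda>s y. ennreal (k s y)) x"
    unfolding duhamel_def by (intro nn_integral_cong) (auto simp: indicator_def g)
  finally show "ennreal (LBINT s:{0..t}. \<integral>y. k (t - s) y \<partial>motion s x) = duhamel t (\<lambda>s y. ennreal (k s y)) x"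
    by (simp add: g_def)
  show "0 \<le> (LBINT s:{0..t}. \<integral>y. k (t - s) y \<partial>motion s x)"
    unfolding set_lebesgue_integral_def g_def[symmetric] by (intro Bochner_Integration.integral_nonneg) (auto simp: g0)
qed

lemma offspring_sum_real:
  assumes w: "w \<in> borel_measurable borel" "\<And>z. 0 \<le> w z" "\<And>z. w z \<le> c"
  shows "integrable (Off y) (\<lambda>Z. \<Sum>z\<in>#Z. w z)"
    and "ennreal (\<integral>Z. (\<Sum>z\<in>#Z. w z) \<partial>Off y) = offspring_sum (\<lambda>z. ennreal (w z)) y"
    and "(\<integral>Z. (\<Sum>z\<in>#Z. w z) \<partial>Off y) \<le> c * off_bound"
proof -
  have c: "0 \<le> c" using w(2,3) order_trans by blast
  have le: "(\<Sum>z\<in>#Z. w z) \<le> c * 2 ^ size Z" for Z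
    using sum_atoms_le[of w c Z] w(3) mult_left_mono[OF of_nat_less_two_power c, of "size Z"] by simp
  have [measurable]: "w \<in> borel_measurable borel" by fact
  show int: "integrable (Off y) (\<lambda>Z. \<Sum>z\<in>#Z. w z)"
    by (rule integrable_offspring[where C = c]) (use le w in \<open>auto simp: sum_mset_nonneg\<close>)
  show eq: "ennreal (\<integral>Z. (\<Sum>z\<in>#Z. w z) \<partial>Off y) = offspring_sum (\<lambda>z. ennreal (w z)) y"
    unfolding offspring_sum_def using int w
    by (subst nn_integral_eq_integral[symmetric]) (auto simp: sum_mset_ennreal sum_mset_nonneg)
  have "offspring_sum (\<lambda>z. ennreal (w z)) y \<le> ennreal (c * off_bound)"
    unfolding offspring_sum_def using le w(2) c
    by (subst sum_mset_ennreal) (auto intro!: offspring_integral_le)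
  then show "(\<integral>Z. (\<Sum>z\<in>#Z. w z) \<partial>Off y) \<le> c * off_bound"
    using c by (simp add: eq[symmetric])
qed

lemma remainder_real:
  assumes w: "w \<in> borel_measurable borel" "\<And>z. 0 \<le> w z" "\<And>z. w z < 1"
  shows "integrable (Off y) (remainder w)"
    and "ennreal (branching_remainder w y) = ennreal (\<gamma> y) * (\<integral>\<^sup>+Z. ennreal (remainder w Z) \<partial>Off y)"
    and "0 \<le> branching_remainder w y"
proof -
  have [measurable]: "w \<in> borel_measurable borel" by fact
  have 0: "0 \<le> remainder w Z" for Z using w by (intro remainder_nonneg) (auto intro: less_imp_le)
  have le: "remainder w Z \<le> 1 * 2 ^ size Z" for Z
  proof -
    have "remainder w Z \<le> (\<Sum>z\<in>#Z. w z)"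
      using w by (intro remainder_le_sum) (auto intro: less_imp_le)
    also have "\<dots> \<le> 1 * real (size Z)"
      using w by (intro sum_atoms_le) (auto intro: less_imp_le)
    also have "\<dots> \<le> 1 * 2 ^ size Z" using of_nat_less_two_power by simp
    finally show ?thesis .
  qed
  have "remainder w \<in> borel_measurable atomic_space"
    by (rule borel_measurable_remainder) (use w in auto)
  then show int: "integrable (Off y) (remainder w)"
    using 0 le by (intro integrable_offspring[where C = 1]) auto
  show "ennreal (branching_remainder w y) = ennreal (\<gamma> y) * (\<integral>\<^sup>+Z. ennreal (remainder w Z) \<partial>Off y)"
    unfolding branching_remainder_def using int 0
    by (subst nn_integral_eq_integral) (auto simp: ennreal_mult Bochner_Integration.integral_nonneg)
  show "0 \<le> branching_remainder w y"
    unfolding branching_remainder_def using 0 by (simp add: integral_nonneg)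
qed

lemma measurable_branching_remainder:
  fixes w :: "'p \<Rightarrow> 'a \<Rightarrow> real"
  assumes w [measurable]: "(\<lambda>(p, y). w p y) \<in> borel_measurable (M \<Otimes>\<^sub>M borel)"
    and w01: "\<And>p z. 0 \<le> w p z" "\<And>p z. w p z < 1"
    and y [measurable]: "y \<in> M \<rightarrow>\<^sub>M borel"
  shows "(\<lambda>p. branching_remainder (w p) (y p)) \<in> borel_measurable M"
proof (subst measurable_cong)
  fix p assume p: "p \<in> space M"
  have "w p \<in> borel_measurable borel" using measurable_Pair2[OF w p] by simp
  from remainder_real(2,3)[OF this w01]
  show "branching_remainder (w p) (y p)
      = enn2real (ennreal (\<gamma> (y p)) * (\<integral>\<^sup>+Z. ennreal (remainder (w p) Z) \<partial>Off (y p)))"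
    by (metis enn2real_ennreal)
next
  have [measurable]: "(\<lambda>q. remainder (w (fst q)) (snd q)) \<in> borel_measurable (M \<Otimes>\<^sub>M atomic_space)"
    by (rule borel_measurable_remainder) (use w01 in auto)
  show "(\<lambda>p. enn2real (ennreal (\<gamma> (y p)) * (\<integral>\<^sup>+Z. ennreal (remainder (w p) Z) \<partial>Off (y p)))) \<in> borel_measurable M"
    by measurable
qed

lemma integrable_motion:
  fixes k :: "'a \<Rightarrow> real"
  assumes [measurable]: "k \<in> borel_measurable borel" and k: "\<And>y. \<bar>k y\<bar> \<le> M"
  shows "integrable (motion s x) k"
proof -
  interpret subprob_space "motion s x" by (rule subprob_space_motion)
  show ?thesis by (rule integrable_const_bound[where B = M]) (auto simp: k)
qed

text \<open>
  In terms of the gap \<open>w\<close> the branching operator is \<open>\<gamma> y\<close> times the expectation of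
  \<open>remainder w - \<Sum> w + w y\<close>. The negative terms are moved to the other side, so that the
  equation lives in the extended non-negative numbers. The two terms containing \<open>\<gamma> y * w y\<close> and
  \<open>offspring_sum\<close> are the loss and the gain of the mean equation; the one with
  \<open>branching_remainder\<close> is the nonlinear perturbation.
\<close>

lemma evolution_nn:
  assumes f: "f \<in> bfun_nonneg" and t: "0 \<le> t"
  shows "ennreal (laplace_gap f t x)
      + duhamel t (\<lambda>s y. ennreal (\<gamma> y) * ennreal (laplace_gap f s y)) x
      + duhamel t (\<lambda>s y. ennreal (branching_remainder (laplace_gap f s) y)) x
    = (\<integral>\<^sup>+y. ennreal (1 - exp (- f y)) \<partial>motion t x)
      + duhamel t (\<lambda>s y. ennreal (\<gamma> y) * offspring_sum (\<lambda>z. ennreal (laplace_gap f s z)) y) x"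
proof -
  define w where "w = laplace_gap f"
  define a where "a s y = \<gamma> y * (\<integral>Z. (\<Sum>z\<in>#Z. w s z) \<partial>Off y)" for s y
  define b where "b s y = branching_remainder (w s) y" for s y
  define c where "c s y = \<gamma> y * w s y" for s y
  have [measurable]: "f \<in> borel_measurable borel" using f by (rule bfun_nonneg_measurable)
  have w01: "0 \<le> w s y" "w s y < 1" "w s y \<le> 1" for s y
    using laplace_gap_nonneg[OF f] laplace_gap_less_1[OF f] by (auto simp: w_def less_imp_le)
  have w2 [measurable]: "(\<lambda>(s, y). w s y) \<in> borel_measurable (borel \<Otimes>\<^sub>M borel)"
    unfolding w_def split_beta by (rule measurable_laplace_gap[OF f]) auto
  have w1 [measurable]: "w s \<in> borel_measurable borel" for s
    unfolding w_def by (rule measurable_laplace_gap[OF f]) auto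
  have ea: "ennreal (a s y) = ennreal (\<gamma> y) * offspring_sum (\<lambda>z. ennreal (w s z)) y" and a0: "0 \<le> a s y"
    and aM: "a s y \<le> rate_bound * off_bound" for s y
  proof -
    have 0: "0 \<le> (\<integral>Z. (\<Sum>z\<in>#Z. w s z) \<partial>Off y)"
      by (intro Bochner_Integration.integral_nonneg) (simp add: sum_mset_nonneg w01)
    then show "0 \<le> a s y" by (simp add: a_def)
    show "ennreal (a s y) = ennreal (\<gamma> y) * offspring_sum (\<lambda>z. ennreal (w s z)) y"
      unfolding a_def using 0 offspring_sum_real(2)[OF w1 w01(1,3)] by (simp add: ennreal_mult)
    show "a s y \<le> rate_bound * off_bound"
      unfolding a_def using offspring_sum_real(3)[OF w1 w01(1,3)] 0 by (intro mult_mono gamma_le) auto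
  qed
  have b0: "0 \<le> b s y" and ba: "b s y \<le> a s y" for s y
  proof -
    show "0 \<le> b s y" unfolding b_def by (rule remainder_real(3)) (use w01 in auto)
    show "b s y \<le> a s y"
      unfolding b_def a_def branching_remainder_def using w01
      by (intro mult_left_mono integral_mono remainder_real(1) offspring_sum_real(1)[where c = 1]
          remainder_le_sum) auto
  qed
  have c0: "0 \<le> c s y" and cM: "c s y \<le> rate_bound" for s y
    unfolding c_def using w01 mult_mono[OF gamma_le[of y] w01(3)[of s y]] by auto
  have [measurable]: "(\<lambda>(s, y). c s y) \<in> borel_measurable (borel \<Otimes>\<^sub>M borel)"
    unfolding c_def by measurable
  have [measurable]: "(\<lambda>(s, y). a s y) \<in> borel_measurable (borel \<Otimes>\<^sub>M borel)"
  proof -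
    have "a s y = enn2real (ennreal (\<gamma> y) * offspring_sum (\<lambda>z. ennreal (w s z)) y)" for s y
      using ea a0 by (metis enn2real_ennreal)
    then show ?thesis by simp
  qed
  have [measurable]: "(\<lambda>(s, y). b s y) \<in> borel_measurable (borel \<Otimes>\<^sub>M borel)"
    unfolding b_def split_beta by (rule measurable_branching_remainder) (use w01 in auto)
  note A = duhamel_real[of a, OF _ a0 aM, of t x, simplified]
  note B = duhamel_real[of b, OF _ b0 order_trans[OF ba aM], of t x, simplified]
  note C = duhamel_real[of c, OF _ c0 cM, of t x, simplified]
  have op: "branching_op \<gamma> Off (\<lambda>z. exp_functional \<PP> X (t - s) f {#z#}) y = b (t - s) y - a (t - s) y + c (t - s) y"
    if "s \<in> {0..t}" for s y
  proof -
    have e: "exp_functional \<PP> X (t - s) f {#z#} = 1 - w (t - s) z" for z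
      using that by (simp add: w_def laplace_gap_def max_def)
    have i1: "integrable (Off y) (\<lambda>Z. \<Sum>z\<in>#Z. w (t - s) z)"
      by (rule offspring_sum_real(1)[OF w1 w01(1,3)])
    have i2: "integrable (Off y) (remainder (w (t - s)))"
      by (rule remainder_real(1)) (use w01 in auto)
    interpret prob_space "Off y" by (rule prob_space_Off)
    have "(\<integral>Z. (\<Prod>z\<in>#Z. 1 - w (t - s) z) - (1 - w (t - s) y) \<partial>Off y)
        = (\<integral>Z. remainder (w (t - s)) Z - (\<Sum>z\<in>#Z. w (t - s) z) + w (t - s) y \<partial>Off y)"
      by (simp add: remainder_def algebra_simps)
    also have "\<dots> = (\<integral>Z. remainder (w (t - s)) Z \<partial>Off y) - (\<integral>Z. (\<Sum>z\<in>#Z. w (t - s) z) \<partial>Off y) + w (t - s) y"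
      using i1 i2 by (simp add: prob_space)
    finally have "(\<integral>Z. (\<Prod>z\<in>#Z. 1 - w (t - s) z) - (1 - w (t - s) y) \<partial>Off y) = \<dots>" .
    then show ?thesis
      by (simp only: branching_op_def e a_def b_def c_def branching_remainder_def right_diff_distrib distrib_left)
  qed
  have int: "integrable (motion s x) (a r)" "integrable (motion s x) (b r)" "integrable (motion s x) (c r)" for s r
    by (rule integrable_motion[where M = "rate_bound * off_bound"], use a0 aM in auto)
       (rule integrable_motion[where M = "rate_bound * off_bound"], use b0 order_trans[OF ba aM] in auto,
        rule integrable_motion[where M = rate_bound], use c0 cM in auto)
  have intP: "integrable (P s x) (a r)" "integrable (P s x) (b r)" "integrable (P s x) (c r)" if "0 \<le> s" for s r
    using int[where s = s and r = r] that by (auto simp: motion_def)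
  have "(LBINT s:{0..t}. \<integral>y. branching_op \<gamma> Off (\<lambda>z. exp_functional \<PP> X (t - s) f {#z#}) y \<partial>P s x)
      = (LBINT s:{0..t}. (\<integral>y. b (t - s) y \<partial>motion s x) - (\<integral>y. a (t - s) y \<partial>motion s x) + (\<integral>y. c (t - s) y \<partial>motion s x))"
    by (rule set_lebesgue_integral_cong) (auto simp: op motion_def max_def intP)
  also have "\<dots> = (LBINT s:{0..t}. \<integral>y. b (t - s) y \<partial>motion s x) - (LBINT s:{0..t}. \<integral>y. a (t - s) y \<partial>motion s x)
      + (LBINT s:{0..t}. \<integral>y. c (t - s) y \<partial>motion s x)"
    using A(1) B(1) C(1) by (simp add: set_integral_add set_integral_diff)
  finally have I: "(LBINT s:{0..t}. \<integral>y. branching_op \<gamma> Off (\<lambda>z. exp_functional \<PP> X (t - s) f {#z#}) y \<partial>P s x) = \<dots>" .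
  have m: "motion t x = P t x" using t by (simp add: motion_def)
  have i3: "integrable (motion t x) (\<lambda>y. exp (- f y))"
    by (rule integrable_motion[where M = 1]) (use bfun_nonneg_pos[OF f] in auto)
  interpret M: subprob_space "motion t x" by (rule subprob_space_motion)
  have "(\<integral>y. 1 - exp (- f y) \<partial>motion t x) = measure (motion t x) UNIV - (\<integral>y. exp (- f y) \<partial>motion t x)"
    using i3 by (subst Bochner_Integration.integral_diff) (auto simp: sets_eq_imp_space_eq[OF sets_motion])
  then have "w t x + (LBINT s:{0..t}. \<integral>y. c (t - s) y \<partial>motion s x) + (LBINT s:{0..t}. \<integral>y. b (t - s) y \<partial>motion s x)
      = (\<integral>y. 1 - exp (- f y) \<partial>motion t x) + (LBINT s:{0..t}. \<integral>y. a (t - s) y \<partial>motion s x)"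
    using evolution[OF t f, of x] t unfolding I by (simp add: w_def laplace_gap_def m)
  then have "ennreal (w t x + (LBINT s:{0..t}. \<integral>y. c (t - s) y \<partial>motion s x) + (LBINT s:{0..t}. \<integral>y. b (t - s) y \<partial>motion s x))
      = ennreal ((\<integral>y. 1 - exp (- f y) \<partial>motion t x) + (LBINT s:{0..t}. \<integral>y. a (t - s) y \<partial>motion s x))"
    by simp
  moreover have "0 \<le> (\<integral>y. 1 - exp (- f y) \<partial>motion t x)"
    using bfun_nonneg_pos[OF f] by (intro Bochner_Integration.integral_nonneg) auto
  moreover have "ennreal (\<integral>y. 1 - exp (- f y) \<partial>motion t x) = (\<integral>\<^sup>+y. ennreal (1 - exp (- f y)) \<partial>motion t x)"
    using i3 bfun_nonneg_pos[OF f] by (intro nn_integral_eq_integral[symmetric]) auto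
  ultimately show ?thesis
    using A(2,3) B(2,3) C(2,3) w01(1)[of t x]
    by (simp add: ennreal_plus ea[symmetric] w_def[symmetric] b_def[symmetric])
       (simp add: c_def ennreal_mult w01)
qed

end

section \<open>First moments and the mean equation\<close>

lemma bfun_nonneg_scale: "f \<in> bfun_nonneg \<Longrightarrow> 0 \<le> c \<Longrightarrow> (\<lambda>x. c * f x) \<in> bfun_nonneg"
  by (auto simp: bfun_nonneg_def bfun_def bounded_scaleR_comp[where 'b = real, simplified])

lemma exp_secant_tendsto: "(\<lambda>n. real (Suc n) * (1 - exp (- (y / real (Suc n))))) \<longlonglongrightarrow> y"
  by real_asymp

lemma one_minus_exp_le: "1 - exp (- y) \<le> (y::real)"
  using exp_ge_add_one_self[of "- y"] by simp

context exponential_offspring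
begin

text \<open>A rate that dominates loss and gain in the mean equation together.\<close>

definition growth :: real where "growth = rate_bound * (1 + off_bound) + 1"

lemma growth_pos: "0 < growth"
  by (simp add: growth_def add_nonneg_pos)

lemma growth_ge: "rate_bound * off_bound \<le> growth"
  by (simp add: growth_def algebra_simps add_nonneg_pos less_imp_le)

lemma offspring_sum_le:
  assumes "\<And>z. g z \<le> ennreal a" "0 \<le> a"
  shows "offspring_sum g y \<le> ennreal (a * off_bound)"
proof -
  have "(\<Sum>z\<in>#Z. g z) \<le> ennreal (a * real (size Z))" for Z
  proof (induction Z)
    case (add x Z)
    have "(\<Sum>z\<in>#add_mset x Z. g z) \<le> ennreal a + ennreal (a * real (size Z))"
      using add assms by (auto intro: add_mono)
    also have "\<dots> = ennreal (a * real (size (add_mset x Z)))"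
      using assms by (subst ennreal_plus[symmetric]) (auto simp: algebra_simps)
    finally show ?case .
  qed simp
  then have "offspring_sum g y \<le> (\<integral>\<^sup>+Z. ennreal (a * real (size Z)) \<partial>Off y)"
    unfolding offspring_sum_def by (intro nn_integral_mono) auto
  also have "\<dots> \<le> ennreal (a * off_bound)"
    using assms of_nat_less_two_power by (intro offspring_integral_le mult_left_mono) auto
  finally show ?thesis .
qed

lemma duhamel_mono:
  assumes "\<And>s y. s \<in> {0..t} \<Longrightarrow> k s y \<le> k' s y"
  shows "duhamel t k x \<le> duhamel t k' x"
  unfolding duhamel_def
  by (intro nn_integral_mono) (auto simp: indicator_def intro!: nn_integral_mono assms)

lemma motion_integral_le:
  assumes "\<And>y. k y \<le> ennreal M"
  shows "(\<integral>\<^sup>+y. k y \<partial>motion s x) \<le> ennreal M"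
proof -
  interpret subprob_space "motion s x" by (rule subprob_space_motion)
  have "(\<integral>\<^sup>+y. k y \<partial>motion s x) \<le> (\<integral>\<^sup>+y. ennreal M \<partial>motion s x)"
    using assms by (intro nn_integral_mono) auto
  also have "\<dots> \<le> ennreal M * 1"
    using emeasure_space_le_1 by (subst nn_integral_const) (intro mult_left_mono, auto)
  finally show ?thesis by simp
qed

text \<open>
  In the norm weighted by \<open>exp (2 * c * s)\<close> a source bounded by \<open>c\<close> times the solution has half
  the norm of the solution. The Gronwall arguments below iterate this estimate.
\<close>

lemma duhamel_exp_bound:
  assumes k: "\<And>s y. s \<in> {0..t} \<Longrightarrow> k s y \<le> ennreal (c * S * exp (2 * c * s))"
    and c: "0 < c" and S: "0 \<le> S" and t: "0 \<le> t"
  shows "duhamel t k x \<le> ennreal (S * exp (2 * c * t) / 2)"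
proof -
  have "duhamel t k x \<le> (\<integral>\<^sup>+s. ennreal (c * S * exp (2 * c * (t - s))) * indicator {0..t} s \<partial>lborel)"
    unfolding duhamel_def using k
    by (intro nn_integral_mono) (auto simp: indicator_def intro!: motion_integral_le)
  also have "\<dots> = ennreal ((- (S * exp (2 * c * (t - t)) / 2)) - (- (S * exp (2 * c * (t - 0)) / 2)))"
    using c S t
    by (intro nn_integral_FTC_Icc) (auto intro!: derivative_eq_intros simp: field_simps)
  also have "\<dots> \<le> ennreal (S * exp (2 * c * t) / 2)"
    using S by (intro ennreal_leI) auto
  finally show ?thesis .
qed

lemma gamma_mult_le:
  assumes "g \<le> ennreal a" "0 \<le> a"
  shows "ennreal (\<gamma> y) * g \<le> ennreal (rate_bound * a)"
proof -
  have "ennreal (\<gamma> y) * g \<le> ennreal rate_bound * ennreal a"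
    using assms by (intro mult_mono ennreal_leI gamma_le) auto
  then show ?thesis using assms by (simp add: ennreal_mult)
qed

text \<open>
  Dropping the loss and the remainder leaves a linear inequality, which halves the excess over
  \<open>2 * a\<close> in the weighted norm each time it is applied; the iteration starts from the trivial
  bound one. The point is that the bound is proportional to \<open>a\<close>.
\<close>

lemma laplace_gap_le:
  assumes f: "f \<in> bfun_nonneg" "\<And>y. f y \<le> a" and t: "0 \<le> t"
  shows "laplace_gap f t x \<le> 2 * a * exp (2 * growth * t)"
proof -
  have a: "0 \<le> a" using f bfun_nonneg_pos order_trans by blast
  have "laplace_gap f t x \<le> (2 * a + 1 / 2 ^ n) * exp (2 * growth * t)" if "0 \<le> t" for n t x
    using that
  proof (induction n arbitrary: t x)
    case 0
    have "laplace_gap f t x \<le> 1" using laplace_gap_less_1[OF f(1)] by (rule less_imp_le)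
    also have "1 = 1 * (1::real)" by simp
    also have "\<dots> \<le> (2 * a + 1) * exp (2 * growth * t)"
      using a 0 growth_pos by (intro mult_mono) auto
    finally show ?case by simp
  next
    case (Suc n)
    let ?S = "2 * a + 1 / 2 ^ n"
    have S: "0 \<le> ?S" using a by simp
    have k: "ennreal (\<gamma> y) * offspring_sum (\<lambda>z. ennreal (laplace_gap f s z)) y
        \<le> ennreal (growth * ?S * exp (2 * growth * s))" if "s \<in> {0..t}" for s y
    proof -
      have "ennreal (\<gamma> y) * offspring_sum (\<lambda>z. ennreal (laplace_gap f s z)) y
          \<le> ennreal (rate_bound * (?S * exp (2 * growth * s) * off_bound))"
        using that Suc.IH[of s] S by (intro gamma_mult_le offspring_sum_le ennreal_leI mult_nonneg_nonneg) auto
      also have "rate_bound * (?S * exp (2 * growth * s) * off_bound) = rate_bound * off_bound * (?S * exp (2 * growth * s))"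
        by (simp only: ac_simps)
      also have "ennreal \<dots> \<le> ennreal (growth * (?S * exp (2 * growth * s)))"
        using S by (intro ennreal_leI mult_right_mono growth_ge) auto
      finally show ?thesis by (simp add: mult.assoc)
    qed
    have "ennreal (laplace_gap f t x) \<le> (\<integral>\<^sup>+y. ennreal (1 - exp (- f y)) \<partial>motion t x)
      + duhamel t (\<lambda>s y. ennreal (\<gamma> y) * offspring_sum (\<lambda>z. ennreal (laplace_gap f s z)) y) x"
      unfolding evolution_nn[OF f(1) Suc.prems, symmetric] by (simp add: add.assoc)
    also have "\<dots> \<le> ennreal a + ennreal (?S * exp (2 * growth * t) / 2)"
      using f order_trans[OF one_minus_exp_le f(2)] growth_pos S Suc.prems
      by (intro add_mono motion_integral_le duhamel_exp_bound k ennreal_leI) auto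
    also have "\<dots> = ennreal (a + ?S * exp (2 * growth * t) / 2)"
      using a S by (subst ennreal_plus) auto
    finally have "laplace_gap f t x \<le> a + ?S * exp (2 * growth * t) / 2"
      using a S by (subst (asm) ennreal_le_iff) auto
    also have "\<dots> \<le> a * exp (2 * growth * t) + ?S * exp (2 * growth * t) / 2"
      using a Suc.prems growth_pos mult_left_mono[of 1 "exp (2 * growth * t)" a] by simp
    also have "\<dots> = (2 * a + 1 / 2 ^ Suc n) * exp (2 * growth * t)"
      by (simp add: field_simps)
    finally show ?case .
  qed
  then have "laplace_gap f t x \<le> (2 * a + (1 / 2) ^ n) * exp (2 * growth * t)" for n
    using t by (simp add: power_one_over)
  moreover have "(\<lambda>n. (2 * a + (1 / 2) ^ n) * exp (2 * growth * t)) \<longlonglongrightarrow> (2 * a + 0) * exp (2 * growth * t)"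
    by (intro tendsto_intros LIMSEQ_realpow_zero) auto
  ultimately show ?thesis
    by (intro LIMSEQ_le_const[where X = "\<lambda>n. (2 * a + (1 / 2) ^ n) * exp (2 * growth * t)"]) auto
qed

text \<open>Difference quotients of the Laplace functional at zero, which converge to the mean.\<close>

definition scaled_gap :: "('a \<Rightarrow> real) \<Rightarrow> nat \<Rightarrow> real \<Rightarrow> 'a \<Rightarrow> real" where
  "scaled_gap f n t x = real (Suc n) * laplace_gap (\<lambda>y. 1 / real (Suc n) * f y) t x"

lemma ennreal_scaled_gap:
  assumes f: "f \<in> bfun_nonneg"
  shows "ennreal (scaled_gap f n t x)
    = (\<integral>\<^sup>+Z. ennreal (real (Suc n) * (1 - exp (- ((\<Sum>z\<in>#Z. f z) / real (Suc n))))) \<partial>population t x)"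
proof -
  have g: "(\<lambda>y. 1 / real (Suc n) * f y) \<in> bfun_nonneg" by (rule bfun_nonneg_scale[OF f]) simp
  have [measurable]: "f \<in> borel_measurable borel" using f by (rule bfun_nonneg_measurable)
  have s: "(\<Sum>z\<in>#Z. 1 / real (Suc n) * f z) = (\<Sum>z\<in>#Z. f z) / real (Suc n)" for Z
    by (simp only: sum_mset_distrib_left[symmetric]) simp
  show ?thesis
    unfolding scaled_gap_def
    by (subst ennreal_mult, simp, rule laplace_gap_nonneg[OF g], subst ennreal_laplace_gap[OF g],
        subst nn_integral_cmult[symmetric]) (auto simp only: s intro!: nn_integral_cong ennreal_mult'[symmetric], auto)
qed

text \<open>The bound on the gap survives division by \<open>n\<close>, and Fatou's lemma carries it over to the mean.\<close>

lemma mean_sum_le: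
  assumes f: "f \<in> bfun_nonneg" "\<And>y. f y \<le> a" and t: "0 \<le> t"
  shows "mean_sum t (\<lambda>z. ennreal (f z)) x \<le> ennreal (2 * a * exp (2 * growth * t))"
proof -
  have [measurable]: "f \<in> borel_measurable borel" using f(1) by (rule bfun_nonneg_measurable)
  have "mean_sum t (\<lambda>z. ennreal (f z)) x = (\<integral>\<^sup>+Z. liminf (\<lambda>n. ennreal (real (Suc n) * (1 - exp (- ((\<Sum>z\<in>#Z. f z) / real (Suc n)))))) \<partial>population t x)"
    unfolding mean_sum_def
  proof (intro nn_integral_cong)
    fix Z
    have "(\<lambda>n. ennreal (real (Suc n) * (1 - exp (- ((\<Sum>z\<in>#Z. f z) / real (Suc n)))))) \<longlonglongrightarrow> ennreal (\<Sum>z\<in>#Z. f z)"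
      by (intro tendsto_ennrealI exp_secant_tendsto)
    then show "(\<Sum>z\<in>#Z. ennreal (f z)) = liminf (\<lambda>n. ennreal (real (Suc n) * (1 - exp (- ((\<Sum>z\<in>#Z. f z) / real (Suc n))))))"
      using bfun_nonneg_pos[OF f(1)] by (simp add: lim_imp_Liminf sum_mset_ennreal)
  qed
  also have "\<dots> \<le> liminf (\<lambda>n. ennreal (scaled_gap f n t x))"
    unfolding ennreal_scaled_gap[OF f(1)] by (rule nn_integral_liminf) measurable
  also have "\<dots> \<le> ennreal (2 * a * exp (2 * growth * t))"
  proof (rule order_trans[OF Liminf_le_Limsup Limsup_bounded], simp, intro always_eventually allI ennreal_leI)
    fix n
    have "laplace_gap (\<lambda>y. 1 / real (Suc n) * f y) t x \<le> 2 * (1 / real (Suc n) * a) * exp (2 * growth * t)"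
      using f t by (intro laplace_gap_le bfun_nonneg_scale mult_left_mono) auto
    then have "real (Suc n) * laplace_gap (\<lambda>y. 1 / real (Suc n) * f y) t x
        \<le> real (Suc n) * (2 * (1 / real (Suc n) * a) * exp (2 * growth * t))"
      by (rule mult_left_mono) simp
    then show "scaled_gap f n t x \<le> 2 * a * exp (2 * growth * t)"
      by (simp add: scaled_gap_def)
  qed
  finally show ?thesis .
qed

lemma scaled_gap_tendsto:
  assumes f: "f \<in> bfun_nonneg" and t: "0 \<le> t"
  shows "(\<lambda>n. ennreal (scaled_gap f n t x)) \<longlonglongrightarrow> mean_sum t (\<lambda>z. ennreal (f z)) x"
proof -
  have [measurable]: "f \<in> borel_measurable borel" using f by (rule bfun_nonneg_measurable)
  obtain a where a: "\<And>y. f y \<le> a"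
    using f by (auto simp: bfun_nonneg_def bfun_def bounded_iff intro: order_trans[OF abs_ge_self])
  show ?thesis
    unfolding ennreal_scaled_gap[OF f] mean_sum_def
  proof (rule nn_integral_dominated_convergence[where w = "\<lambda>Z. (\<Sum>z\<in>#Z. ennreal (f z))"])
    show "(\<integral>\<^sup>+Z. (\<Sum>z\<in>#Z. ennreal (f z)) \<partial>population t x) < \<infinity>"
      using mean_sum_le[OF f a t, of x] by (auto simp: mean_sum_def intro: le_less_trans)
    show "AE Z in population t x. ennreal (real (Suc n) * (1 - exp (- ((\<Sum>z\<in>#Z. f z) / real (Suc n))))) \<le> (\<Sum>z\<in>#Z. ennreal (f z))" for n
    proof (rule AE_I2)
      fix Z
      have "real (Suc n) * (1 - exp (- ((\<Sum>z\<in>#Z. f z) / real (Suc n)))) \<le> real (Suc n) * ((\<Sum>z\<in>#Z. f z) / real (Suc n))"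
        by (intro mult_left_mono one_minus_exp_le) simp
      then show "ennreal (real (Suc n) * (1 - exp (- ((\<Sum>z\<in>#Z. f z) / real (Suc n))))) \<le> (\<Sum>z\<in>#Z. ennreal (f z))"
        using bfun_nonneg_pos[OF f] by (simp add: sum_mset_ennreal ennreal_leI)
    qed
    show "AE Z in population t x. (\<lambda>n. ennreal (real (Suc n) * (1 - exp (- ((\<Sum>z\<in>#Z. f z) / real (Suc n)))))) \<longlonglongrightarrow> (\<Sum>z\<in>#Z. ennreal (f z))"
      using bfun_nonneg_pos[OF f]
      by (intro AE_I2, subst sum_mset_ennreal) (auto simp only: intro!: tendsto_ennrealI exp_secant_tendsto)
  qed measurable
qed

lemma duhamel_cmult:
  assumes [measurable]: "(\<lambda>(s, y). k s y) \<in> borel_measurable (borel \<Otimes>\<^sub>M borel)"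
  shows "duhamel t (\<lambda>s y. c * k s y) x = c * duhamel t k x"
proof -
  have k': "(\<lambda>y. k s y) \<in> borel_measurable (motion r x)" for s r
    by measurable
  have "duhamel t (\<lambda>s y. c * k s y) x = (\<integral>\<^sup>+s. c * ((\<integral>\<^sup>+y. k (t - s) y \<partial>motion s x) * indicator {0..t} s) \<partial>lborel)"
    unfolding duhamel_def by (simp add: nn_integral_cmult k' mult.assoc)
  also have "\<dots> = c * duhamel t k x"
    unfolding duhamel_def by (rule nn_integral_cmult) measurable
  finally show ?thesis .
qed

lemma duhamel_add:
  assumes [measurable]: "(\<lambda>(s, y). k s y) \<in> borel_measurable (borel \<Otimes>\<^sub>M borel)"
    "(\<lambda>(s, y). l s y) \<in> borel_measurable (borel \<Otimes>\<^sub>M borel)"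
  shows "duhamel t (\<lambda>s y. k s y + l s y) x = duhamel t k x + duhamel t l x"
proof -
  have k': "(\<lambda>y. k s y) \<in> borel_measurable (motion r x)" "(\<lambda>y. l s y) \<in> borel_measurable (motion r x)" for s r
    by measurable
  have "duhamel t (\<lambda>s y. k s y + l s y) x = (\<integral>\<^sup>+s. (\<integral>\<^sup>+y. k (t - s) y \<partial>motion s x) * indicator {0..t} s
      + (\<integral>\<^sup>+y. l (t - s) y \<partial>motion s x) * indicator {0..t} s \<partial>lborel)"
    unfolding duhamel_def by (simp add: nn_integral_add k' distrib_right)
  also have "\<dots> = duhamel t k x + duhamel t l x"
    unfolding duhamel_def by (rule nn_integral_add) measurable
  finally show ?thesis .
qed

lemma offspring_sum_cmult:
  assumes [measurable]: "g \<in> borel_measurable borel"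
  shows "offspring_sum (\<lambda>z. c * g z) y = c * offspring_sum g y"
  unfolding offspring_sum_def sum_mset_distrib_left[symmetric] by (rule nn_integral_cmult) measurable

lemma offspring_sum_add:
  assumes [measurable]: "g \<in> borel_measurable borel" "h \<in> borel_measurable borel"
  shows "offspring_sum (\<lambda>z. g z + h z) y = offspring_sum g y + offspring_sum h y"
  unfolding offspring_sum_def sum_mset.distrib by (rule nn_integral_add) measurable

lemma offspring_sum_tendsto:
  assumes [measurable]: "\<And>n. g n \<in> borel_measurable borel" "h \<in> borel_measurable borel"
    and g: "\<And>n z. g n z \<le> ennreal a" "0 \<le> a" and lim: "\<And>z. (\<lambda>n. g n z) \<longlonglongrightarrow> h z"
  shows "(\<lambda>n. offspring_sum (g n) y) \<longlonglongrightarrow> offspring_sum h y"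
  unfolding offspring_sum_def
proof (rule nn_integral_dominated_convergence[where w = "\<lambda>Z. \<Sum>z\<in>#Z. ennreal a"])
  show "(\<integral>\<^sup>+Z. (\<Sum>z\<in>#Z. ennreal a) \<partial>Off y) < \<infinity>"
    using offspring_sum_le[of "\<lambda>_. ennreal a" a y] g(2) by (auto simp: offspring_sum_def intro: le_less_trans)
  show "AE Z in Off y. (\<Sum>z\<in>#Z. g n z) \<le> (\<Sum>z\<in>#Z. ennreal a)" for n
    by (intro AE_I2 sum_mset_mono g)
  show "AE Z in Off y. (\<lambda>n. \<Sum>z\<in>#Z. g n z) \<longlonglongrightarrow> (\<Sum>z\<in>#Z. h z)"
  proof (rule AE_I2)
    show "(\<lambda>n. \<Sum>z\<in>#Z. g n z) \<longlonglongrightarrow> (\<Sum>z\<in>#Z. h z)" for Z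
      by (induction Z) (auto intro!: tendsto_add lim)
  qed
qed measurable

lemma motion_tendsto:
  assumes [measurable]: "\<And>n. g n \<in> borel_measurable borel" "h \<in> borel_measurable borel"
    and g: "\<And>n z. g n z \<le> ennreal a" and lim: "\<And>z. (\<lambda>n. g n z) \<longlonglongrightarrow> h z"
  shows "(\<lambda>n. \<integral>\<^sup>+y. g n y \<partial>motion s x) \<longlonglongrightarrow> (\<integral>\<^sup>+y. h y \<partial>motion s x)"
proof (rule nn_integral_dominated_convergence[where w = "\<lambda>_. ennreal a"])
  show "(\<integral>\<^sup>+_. ennreal a \<partial>motion s x) < \<infinity>"
    using motion_integral_le[of "\<lambda>_. ennreal a" a s x] by (auto intro: le_less_trans)
qed (auto intro!: AE_I2 lim g)

lemma duhamel_tendsto: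
  assumes k [measurable]: "\<And>n. (\<lambda>(s, y). k n s y) \<in> borel_measurable (borel \<Otimes>\<^sub>M borel)"
    "(\<lambda>(s, y). l s y) \<in> borel_measurable (borel \<Otimes>\<^sub>M borel)"
    and le: "\<And>n s y. s \<in> {0..t} \<Longrightarrow> k n s y \<le> ennreal a"
    and lim: "\<And>s y. s \<in> {0..t} \<Longrightarrow> (\<lambda>n. k n s y) \<longlonglongrightarrow> l s y"
  shows "(\<lambda>n. duhamel t (k n) x) \<longlonglongrightarrow> duhamel t l x"
  unfolding duhamel_def
proof (rule nn_integral_dominated_convergence[where w = "\<lambda>s. ennreal a * indicator {0..t} s"])
  show "(\<integral>\<^sup>+s. ennreal a * indicator {0..t} s \<partial>lborel) < \<infinity>"
    by (subst nn_integral_cmult_indicator) (auto simp: emeasure_lborel_Icc_eq ennreal_mult_less_top)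
  show "AE s in lborel. (\<lambda>n. (\<integral>\<^sup>+y. k n (t - s) y \<partial>motion s x) * indicator {0..t} s)
      \<longlonglongrightarrow> (\<integral>\<^sup>+y. l (t - s) y \<partial>motion s x) * indicator {0..t} s"
  proof (rule AE_I2)
    fix s
    have k1: "k n r \<in> borel_measurable borel" "l r \<in> borel_measurable borel" for n r
      by measurable
    show "(\<lambda>n. (\<integral>\<^sup>+y. k n (t - s) y \<partial>motion s x) * indicator {0..t} s)
      \<longlonglongrightarrow> (\<integral>\<^sup>+y. l (t - s) y \<partial>motion s x) * indicator {0..t} s"
      by (cases "s \<in> {0..t}") (auto intro!: motion_tendsto[where a = a] le lim k1)
  qed
  show "AE s in lborel. (\<integral>\<^sup>+y. k n (t - s) y \<partial>motion s x) * indicator {0..t} s \<le> ennreal a * indicator {0..t} s" for n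
    by (rule AE_I2) (auto simp: indicator_def intro!: motion_integral_le le)
qed measurable

lemma branching_remainder_le:
  assumes w: "w \<in> borel_measurable borel" "\<And>z. 0 \<le> w z" "\<And>z. w z < 1" "\<And>z. w z \<le> \<eta>"
  shows "branching_remainder w y \<le> rate_bound * (18 * \<eta>\<^sup>2 * off_bound)"
proof -
  have eta: "0 \<le> \<eta>" using w order_trans by blast
  have le: "remainder w Z \<le> 18 * \<eta>\<^sup>2 * 2 ^ size Z" for Z
  proof -
    have "\<bar>1 - w z\<bar> \<le> 3/2" "\<bar>w z\<bar> \<le> \<eta>" for z
      using w(2,3,4)[of z] by linarith+
    then have "\<bar>remainder w Z\<bar> \<le> (real (size Z))\<^sup>2 * \<eta>\<^sup>2 * (3/2) ^ size Z"
      by (intro remainder_bound) auto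
    then have "remainder w Z \<le> (real (size Z))\<^sup>2 * \<eta>\<^sup>2 * (3/2) ^ size Z" by linarith
    also have "\<dots> = \<eta>\<^sup>2 * ((real (size Z))\<^sup>2 * (3/2) ^ size Z)" by (simp only: ac_simps)
    also have "\<dots> \<le> \<eta>\<^sup>2 * (18 * 2 ^ size Z)" by (intro mult_left_mono square_le_power_two) auto
    finally show ?thesis by (simp only: ac_simps)
  qed
  have "ennreal (branching_remainder w y) \<le> ennreal (rate_bound * (18 * \<eta>\<^sup>2 * off_bound))"
    unfolding remainder_real(2)[OF w(1,2,3)]
    by (intro gamma_mult_le offspring_integral_le le) auto
  then show ?thesis by (subst (asm) ennreal_le_iff) auto
qed

text \<open>
  The linearisation of the evolution equation at zero: with the test function \<open>f / n\<close> and after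
  multiplication by \<open>n\<close>, all terms converge to those of the mean equation, and the remainder,
  being of order \<open>n * (1 / n)\<^sup>2\<close>, disappears.
\<close>

lemma mean_sum_mild:
  assumes f: "f \<in> bfun_nonneg" and t: "0 \<le> t"
  defines "m \<equiv> \<lambda>s y. mean_sum s (\<lambda>z. ennreal (f z)) y"
  shows "m t x + duhamel t (\<lambda>s y. ennreal (\<gamma> y) * m s y) x
    = (\<integral>\<^sup>+y. ennreal (f y) \<partial>motion t x) + duhamel t (\<lambda>s y. ennreal (\<gamma> y) * offspring_sum (m s) y) x"
proof -
  have [measurable]: "f \<in> borel_measurable borel" using f by (rule bfun_nonneg_measurable)
  obtain a where a: "\<And>y. f y \<le> a"
    using f by (auto simp: bfun_nonneg_def bfun_def bounded_iff intro: order_trans[OF abs_ge_self])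
  have a0: "0 \<le> a" using a bfun_nonneg_pos[OF f] order_trans by blast
  let ?c = "\<lambda>n. 1 / real (Suc n)"
  define E where "E = 2 * a * exp (2 * growth * t)"
  have E0: "0 \<le> E" using a0 by (simp add: E_def)
  define w where "w n = laplace_gap (\<lambda>y. ?c n * f y)" for n
  have cf: "(\<lambda>y. ?c n * f y) \<in> bfun_nonneg" for n by (rule bfun_nonneg_scale[OF f]) simp
  have w01: "0 \<le> w n s y" "w n s y < 1" for n s y
    using laplace_gap_nonneg[OF cf] laplace_gap_less_1[OF cf] by (auto simp: w_def)
  have w2 [measurable]: "(\<lambda>(s, y). w n s y) \<in> borel_measurable (borel \<Otimes>\<^sub>M borel)" for n
    unfolding w_def split_beta by (rule measurable_laplace_gap[OF cf]) auto
  have sg: "scaled_gap f n s y = real (Suc n) * w n s y" for n s y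
    by (simp add: scaled_gap_def w_def)
  have [measurable]: "(\<lambda>(s, y). scaled_gap f n s y) \<in> borel_measurable (borel \<Otimes>\<^sub>M borel)" for n
    unfolding sg by measurable
  have [measurable]: "(\<lambda>(s, y). m s y) \<in> borel_measurable (borel \<Otimes>\<^sub>M borel)"
    unfolding m_def by measurable
  have w_le: "w n s y \<le> ?c n * E" if "s \<in> {0..t}" for n s y
  proof -
    have "w n s y \<le> 2 * (?c n * a) * exp (2 * growth * s)"
      unfolding w_def using that a by (intro laplace_gap_le cf mult_left_mono) auto
    also have "\<dots> \<le> 2 * (?c n * a) * exp (2 * growth * t)"
      using that a0 growth_pos by (intro mult_left_mono) auto
    also have "\<dots> = ?c n * E" by (simp add: E_def)
    finally show ?thesis .
  qed
  have sg_le: "scaled_gap f n s y \<le> E" if "s \<in> {0..t}" for n s y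
    using w_le[OF that, of n y] by (simp add: sg field_simps)
  have lim: "(\<lambda>n. ennreal (scaled_gap f n s y)) \<longlonglongrightarrow> m s y" if "s \<in> {0..t}" for s y
    unfolding m_def using that by (intro scaled_gap_tendsto f) auto
  have m1: "m s \<in> borel_measurable borel" for s by measurable
  have s1: "scaled_gap f n s \<in> borel_measurable borel" "w n s \<in> borel_measurable borel" for n s by measurable
  have rem_le: "real (Suc n) * branching_remainder (w n s) y \<le> ?c n * (rate_bound * (18 * E\<^sup>2 * off_bound))"
    if "s \<in> {0..t}" for n s y
  proof -
    have "branching_remainder (w n s) y \<le> rate_bound * (18 * (?c n * E)\<^sup>2 * off_bound)"
      by (rule branching_remainder_le[OF s1(2) w01 w_le[OF that]])
    then have "real (Suc n) * branching_remainder (w n s) y \<le> real (Suc n) * (rate_bound * (18 * (?c n * E)\<^sup>2 * off_bound))"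
      by (rule mult_left_mono) simp
    also have "\<dots> = (real (Suc n) * (?c n)\<^sup>2) * (rate_bound * (18 * E\<^sup>2 * off_bound))"
      by (simp only: power_mult_distrib ac_simps)
    also have "real (Suc n) * (?c n)\<^sup>2 = ?c n" by (simp add: power2_eq_square)
    finally show ?thesis .
  qed
  have rem_meas [measurable]: "(\<lambda>(s, y). branching_remainder (w n s) y) \<in> borel_measurable (borel \<Otimes>\<^sub>M borel)" for n
    unfolding split_beta by (rule measurable_branching_remainder) (use w01 in auto)
  have eq: "ennreal (scaled_gap f n t x)
      + duhamel t (\<lambda>s y. ennreal (\<gamma> y) * ennreal (scaled_gap f n s y)) x
      + duhamel t (\<lambda>s y. ennreal (real (Suc n) * branching_remainder (w n s) y)) x
    = (\<integral>\<^sup>+y. ennreal (real (Suc n) * (1 - exp (- (f y / real (Suc n))))) \<partial>motion t x)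
      + duhamel t (\<lambda>s y. ennreal (\<gamma> y) * offspring_sum (\<lambda>z. ennreal (scaled_gap f n s z)) y) x" for n
  proof -
    let ?N = "ennreal (real (Suc n))"
    have 1: "duhamel t (\<lambda>s y. ennreal (\<gamma> y) * ennreal (scaled_gap f n s y)) x
        = ?N * duhamel t (\<lambda>s y. ennreal (\<gamma> y) * ennreal (w n s y)) x"
      by (subst duhamel_cmult[symmetric], measurable)
         (simp only: sg ennreal_mult'[OF of_nat_0_le_iff] mult.left_commute)
    have 2: "duhamel t (\<lambda>s y. ennreal (\<gamma> y) * offspring_sum (\<lambda>z. ennreal (scaled_gap f n s z)) y) x
        = ?N * duhamel t (\<lambda>s y. ennreal (\<gamma> y) * offspring_sum (\<lambda>z. ennreal (w n s z)) y) x"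
      using s1 by (subst duhamel_cmult[symmetric], measurable)
         (simp add: sg ennreal_mult'[OF of_nat_0_le_iff] offspring_sum_cmult mult.left_commute del: of_nat_Suc)
    have 3: "duhamel t (\<lambda>s y. ennreal (real (Suc n) * branching_remainder (w n s) y)) x
        = ?N * duhamel t (\<lambda>s y. ennreal (branching_remainder (w n s) y)) x"
      by (subst duhamel_cmult[symmetric], measurable) (simp only: ennreal_mult'[OF of_nat_0_le_iff])
    have 4: "(\<integral>\<^sup>+y. ennreal (real (Suc n) * (1 - exp (- (f y / real (Suc n))))) \<partial>motion t x)
        = ?N * (\<integral>\<^sup>+y. ennreal (1 - exp (- (?c n * f y))) \<partial>motion t x)"
      by (subst nn_integral_cmult[symmetric]) (auto simp: ennreal_mult'[OF of_nat_0_le_iff] simp del: of_nat_Suc)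
    have 5: "ennreal (scaled_gap f n t x) = ?N * ennreal (w n t x)"
      by (simp only: sg ennreal_mult'[OF of_nat_0_le_iff])
    show ?thesis
      unfolding 1 2 3 4 5
      unfolding distrib_left[symmetric]
      unfolding w_def evolution_nn[OF cf t] ..
  qed
  have "(\<lambda>n. ennreal (scaled_gap f n t x)
      + duhamel t (\<lambda>s y. ennreal (\<gamma> y) * ennreal (scaled_gap f n s y)) x
      + duhamel t (\<lambda>s y. ennreal (real (Suc n) * branching_remainder (w n s) y)) x)
    \<longlonglongrightarrow> m t x + duhamel t (\<lambda>s y. ennreal (\<gamma> y) * m s y) x + duhamel t (\<lambda>s y. 0) x"
  proof (intro tendsto_add)
    show "(\<lambda>n. ennreal (scaled_gap f n t x)) \<longlonglongrightarrow> m t x" using t by (intro lim) auto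
    show "(\<lambda>n. duhamel t (\<lambda>s y. ennreal (\<gamma> y) * ennreal (scaled_gap f n s y)) x)
        \<longlonglongrightarrow> duhamel t (\<lambda>s y. ennreal (\<gamma> y) * m s y) x"
    proof (rule duhamel_tendsto[where a = "rate_bound * E"])
      fix s y assume s: "s \<in> {0..t}"
      show "ennreal (\<gamma> y) * ennreal (scaled_gap f n s y) \<le> ennreal (rate_bound * E)" for n
        by (intro gamma_mult_le ennreal_leI sg_le[OF s] E0)
      show "(\<lambda>n. ennreal (\<gamma> y) * ennreal (scaled_gap f n s y)) \<longlonglongrightarrow> ennreal (\<gamma> y) * m s y"
        by (rule ennreal_tendsto_cmult[OF ennreal_less_top lim[OF s]])
    qed measurable
    show "(\<lambda>n. duhamel t (\<lambda>s y. ennreal (real (Suc n) * branching_remainder (w n s) y)) x)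
        \<longlonglongrightarrow> duhamel t (\<lambda>s y. 0) x"
    proof (rule duhamel_tendsto[where a = "rate_bound * (18 * E\<^sup>2 * off_bound)"])
      fix s y assume s: "s \<in> {0..t}"
      let ?K = "rate_bound * (18 * E\<^sup>2 * off_bound)"
      have K: "0 \<le> ?K" by simp
      show "ennreal (real (Suc n) * branching_remainder (w n s) y) \<le> ennreal ?K" for n
      proof (rule ennreal_leI, rule order_trans[OF rem_le[OF s]])
        show "?c n * ?K \<le> ?K" using mult_right_mono[OF _ K, of "?c n" 1] by simp
      qed
      have "(\<lambda>n. ennreal (?c n * ?K)) \<longlonglongrightarrow> ennreal (0 * ?K)"
        by (intro tendsto_ennrealI tendsto_mult tendsto_const) real_asymp
      then have "(\<lambda>n. ennreal (?c n * ?K)) \<longlonglongrightarrow> 0" by simp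
      then show "(\<lambda>n. ennreal (real (Suc n) * branching_remainder (w n s) y)) \<longlonglongrightarrow> 0"
        by (rule tendsto_sandwich[OF always_eventually always_eventually tendsto_const, rotated 2])
           (intro allI ennreal_leI rem_le[OF s] zero_le)+
    qed measurable
  qed
  moreover have "(\<lambda>n. (\<integral>\<^sup>+y. ennreal (real (Suc n) * (1 - exp (- (f y / real (Suc n))))) \<partial>motion t x)
      + duhamel t (\<lambda>s y. ennreal (\<gamma> y) * offspring_sum (\<lambda>z. ennreal (scaled_gap f n s z)) y) x)
    \<longlonglongrightarrow> (\<integral>\<^sup>+y. ennreal (f y) \<partial>motion t x) + duhamel t (\<lambda>s y. ennreal (\<gamma> y) * offspring_sum (m s) y) x"
  proof (intro tendsto_add)
    show "(\<lambda>n. \<integral>\<^sup>+y. ennreal (real (Suc n) * (1 - exp (- (f y / real (Suc n))))) \<partial>motion t x)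
        \<longlonglongrightarrow> (\<integral>\<^sup>+y. ennreal (f y) \<partial>motion t x)"
    proof (rule motion_tendsto[where a = a])
      fix n y
      have "real (Suc n) * (1 - exp (- (f y / real (Suc n)))) \<le> real (Suc n) * (f y / real (Suc n))"
        by (intro mult_left_mono one_minus_exp_le) simp
      also have "\<dots> = f y" by simp
      also have "f y \<le> a" by (rule a)
      finally show "ennreal (real (Suc n) * (1 - exp (- (f y / real (Suc n))))) \<le> ennreal a" by (rule ennreal_leI)
    next
      show "(\<lambda>n. ennreal (real (Suc n) * (1 - exp (- (f y / real (Suc n)))))) \<longlonglongrightarrow> ennreal (f y)" for y
        by (intro tendsto_ennrealI exp_secant_tendsto)
    qed measurable
    show "(\<lambda>n. duhamel t (\<lambda>s y. ennreal (\<gamma> y) * offspring_sum (\<lambda>z. ennreal (scaled_gap f n s z)) y) x)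
        \<longlonglongrightarrow> duhamel t (\<lambda>s y. ennreal (\<gamma> y) * offspring_sum (m s) y) x"
    proof (rule duhamel_tendsto[where a = "rate_bound * (E * off_bound)"])
      fix s y assume s: "s \<in> {0..t}"
      show "ennreal (\<gamma> y) * offspring_sum (\<lambda>z. ennreal (scaled_gap f n s z)) y \<le> ennreal (rate_bound * (E * off_bound))" for n
        using E0 by (intro gamma_mult_le offspring_sum_le ennreal_leI sg_le[OF s]) auto
      show "(\<lambda>n. ennreal (\<gamma> y) * offspring_sum (\<lambda>z. ennreal (scaled_gap f n s z)) y)
          \<longlonglongrightarrow> ennreal (\<gamma> y) * offspring_sum (m s) y"
      proof (rule ennreal_tendsto_cmult[OF ennreal_less_top], rule offspring_sum_tendsto[where a = E])
        show "(\<lambda>z. ennreal (scaled_gap f n s z)) \<in> borel_measurable borel" for n using s1(1) by measurable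
      qed (use E0 m1 in \<open>auto intro: ennreal_leI sg_le[OF s] lim[OF s]\<close>)
    qed measurable
  qed
  ultimately have "m t x + duhamel t (\<lambda>s y. ennreal (\<gamma> y) * m s y) x + duhamel t (\<lambda>s y. 0) x
    = (\<integral>\<^sup>+y. ennreal (f y) \<partial>motion t x) + duhamel t (\<lambda>s y. ennreal (\<gamma> y) * offspring_sum (m s) y) x"
    unfolding eq by (rule LIMSEQ_unique)
  then show ?thesis by (simp add: duhamel_def)
qed

end

lemma nn_integral_sum_mset:
  fixes k :: "'s \<Rightarrow> 'b \<Rightarrow> ennreal"
  assumes "\<And>z. (\<lambda>s. k s z) \<in> borel_measurable M"
  shows "(\<integral>\<^sup>+s. (\<Sum>z\<in>#Z. k s z) \<partial>M) = (\<Sum>z\<in>#Z. \<integral>\<^sup>+s. k s z \<partial>M)"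
    and "(\<lambda>s. \<Sum>z\<in>#Z. k s z) \<in> borel_measurable M"
proof -
  have "(\<lambda>s. \<Sum>z\<in>#Z. k s z) \<in> borel_measurable M \<and> (\<integral>\<^sup>+s. (\<Sum>z\<in>#Z. k s z) \<partial>M) = (\<Sum>z\<in>#Z. \<integral>\<^sup>+s. k s z \<partial>M)"
    using assms by (induction Z) (auto simp: nn_integral_add)
  then show "(\<integral>\<^sup>+s. (\<Sum>z\<in>#Z. k s z) \<partial>M) = (\<Sum>z\<in>#Z. \<integral>\<^sup>+s. k s z \<partial>M)"
    and "(\<lambda>s. \<Sum>z\<in>#Z. k s z) \<in> borel_measurable M" by auto
qed

lemma nn_integral_lborel_swap:
  fixes k :: "real \<Rightarrow> 'b \<Rightarrow> ennreal"
  assumes M: "finite_measure M" and [measurable]: "(\<lambda>(s, y). k s y) \<in> borel_measurable (borel \<Otimes>\<^sub>M M)"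
  shows "(\<integral>\<^sup>+y. (\<integral>\<^sup>+s. k s y \<partial>lborel) \<partial>M) = (\<integral>\<^sup>+s. (\<integral>\<^sup>+y. k s y \<partial>M) \<partial>lborel)"
proof -
  interpret M: finite_measure M by fact
  interpret pair_sigma_finite lborel M ..
  have "(\<lambda>(s, y). k s y) \<in> borel_measurable (lborel \<Otimes>\<^sub>M M)"
    unfolding measurable_cong_sets[OF sets_pair_measure_cong[OF sets_lborel refl] refl] by fact
  then show ?thesis by (rule Fubini')
qed

text \<open>
  Finiteness of \<open>d\<close>, which occurs on opposite sides of the two equations, replaces the
  subtraction that the extended numbers lack.
\<close>

lemma ennreal_add_eqs_cancel:
  fixes a b c d e f g h :: ennreal
  assumes "a + b + d = c + e" "f + g = d + h" "d < \<infinity>"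
  shows "a + f + (b + g) = c + (e + h)"
proof -
  have "d + (a + f + (b + g)) = (a + b + d) + (f + g)" by (simp only: ac_simps)
  also have "\<dots> = d + (c + (e + h))" unfolding assms(1,2) by (simp only: ac_simps)
  finally show ?thesis using assms(3) by (subst (asm) ennreal_add_left_cancel) auto
qed

context exponential_offspring
begin

lemma finite_measure_motion: "finite_measure (motion s x)"
proof -
  interpret subprob_space "motion s x" by (rule subprob_space_motion)
  show ?thesis by (rule finite_measure_axioms)
qed

lemma finite_measure_Off: "finite_measure (Off y)"
proof -
  interpret prob_space "Off y" by (rule prob_space_Off)
  show ?thesis by (rule finite_measure_axioms)
qed

text \<open>Fubini's theorem on the triangle \<open>0 \<le> r \<le> s \<le> t\<close>, followed by the shift of \<open>s\<close> by \<open>r\<close>.\<close>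

lemma duhamel_iterate:
  fixes k :: "real \<Rightarrow> real \<Rightarrow> 'a \<Rightarrow> ennreal"
  assumes k: "(\<lambda>(s, q, y). k s q y) \<in> borel_measurable (borel \<Otimes>\<^sub>M borel \<Otimes>\<^sub>M borel)"
  shows "(\<integral>\<^sup>+s\<in>{0..t}. duhamel s (\<lambda>r. k r (t - s)) x \<partial>lborel)
    = duhamel t (\<lambda>q y. \<integral>\<^sup>+s\<in>{0..q}. k s (q - s) y \<partial>lborel) x"
proof -
  note [measurable (raw)] = measurable_triple_compose[OF k]
  define M where "M r a b = (\<integral>\<^sup>+y. k a b y \<partial>motion r x)" for r a b
  have M [measurable (raw)]: "(\<lambda>q. M (r q) (a q) (b q)) \<in> borel_measurable N"
    if [measurable]: "r \<in> borel_measurable N" "a \<in> borel_measurable N" "b \<in> borel_measurable N" for N :: "'n measure" and r a b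
    unfolding M_def by measurable
  define F where "F r s = M r (s - r) (t - s) * (if 0 \<le> r \<and> r \<le> s \<and> s \<le> t then 1 else 0)" for r s
  have F [measurable]: "(\<lambda>(r, s). F r s) \<in> borel_measurable (borel \<Otimes>\<^sub>M borel)"
    unfolding F_def by measurable
  have "(\<integral>\<^sup>+s\<in>{0..t}. duhamel s (\<lambda>r. k r (t - s)) x \<partial>lborel) = (\<integral>\<^sup>+s. (\<integral>\<^sup>+r. F r s \<partial>lborel) \<partial>lborel)"
  proof (intro nn_integral_cong)
    fix s
    show "duhamel s (\<lambda>r. k r (t - s)) x * indicator {0..t} s = (\<integral>\<^sup>+r. F r s \<partial>lborel)"
    proof (cases "s \<in> {0..t}")
      case True
      then show ?thesis
        by (auto simp: duhamel_def F_def M_def indicator_def intro!: nn_integral_cong)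
    next
      case False
      then have "F r s = 0" for r by (auto simp: F_def)
      then show ?thesis using False by simp
    qed
  qed
  also have "\<dots> = (\<integral>\<^sup>+r. (\<integral>\<^sup>+s. F r s \<partial>lborel) \<partial>lborel)"
    by (rule lborel_pair.Fubini') (simp add: F cong: measurable_cong_sets sets_pair_measure_cong)
  also have "\<dots> = duhamel t (\<lambda>q y. \<integral>\<^sup>+s\<in>{0..q}. k s (q - s) y \<partial>lborel) x"
    unfolding duhamel_def
  proof (intro nn_integral_cong)
    fix r
    show "(\<integral>\<^sup>+s. F r s \<partial>lborel) = (\<integral>\<^sup>+y. (\<integral>\<^sup>+s\<in>{0..t - r}. k s (t - r - s) y \<partial>lborel) \<partial>motion r x) * indicator {0..t} r"
    proof (cases "r \<in> {0..t}")
      case True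
      have Fr [measurable]: "F r \<in> borel_measurable borel" by measurable
      have "(\<integral>\<^sup>+s. F r s \<partial>lborel) = (\<integral>\<^sup>+s. F r (r + s) \<partial>lborel)"
        using nn_integral_real_affine[of "F r" 1 r] Fr by simp
      also have "\<dots> = (\<integral>\<^sup>+s. (\<integral>\<^sup>+y. k s (t - r - s) y * indicator {0..t - r} s \<partial>motion r x) \<partial>lborel)"
        using True by (intro nn_integral_cong) (auto simp: F_def M_def indicator_def diff_diff_eq nn_integral_multc)
      also have "\<dots> = (\<integral>\<^sup>+y. (\<integral>\<^sup>+s. k s (t - r - s) y * indicator {0..t - r} s \<partial>lborel) \<partial>motion r x)"
        by (rule nn_integral_lborel_swap[symmetric, OF finite_measure_motion]) measurable
      finally show ?thesis using True by simp
    next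
      case False
      then have "F r s = 0" for s by (auto simp: F_def)
      then show ?thesis using False by simp
    qed
  qed
  finally show ?thesis .
qed

text \<open>
  The analogue of \<open>duhamel\<close> with the mean of the whole population in place of the motion of one
  particle.
\<close>

definition mean_duhamel :: "real \<Rightarrow> (real \<Rightarrow> 'a \<Rightarrow> ennreal) \<Rightarrow> 'a \<Rightarrow> ennreal" where
  "mean_duhamel t b x = (\<integral>\<^sup>+s\<in>{0..t}. mean_sum s (b (t - s)) x \<partial>lborel)"

lemma measurable_mean_duhamel [measurable]:
  assumes [measurable]: "(\<lambda>(s, y). b s y) \<in> borel_measurable (borel \<Otimes>\<^sub>M borel)"
  shows "(\<lambda>(t, x). mean_duhamel t b x) \<in> borel_measurable (borel \<Otimes>\<^sub>M borel)"
  unfolding mean_duhamel_def by measurable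

text \<open>
  For every \<open>s\<close> the mean started from the source \<open>b (t - s)\<close> solves the mean equation;
  integrating these equations over \<open>s\<close> gives the mean equation with the accumulated sources as
  inhomogeneity.
\<close>

lemma mean_duhamel_mild:
  assumes b [measurable]: "(\<lambda>(s, y). b s y) \<in> borel_measurable (borel \<Otimes>\<^sub>M borel)"
    and b01: "\<And>s y. 0 \<le> b s y" "\<And>s y. b s y \<le> B"
  defines "I \<equiv> \<lambda>s y. mean_duhamel s (\<lambda>r z. ennreal (b r z)) y"
  shows "I t x + duhamel t (\<lambda>s y. ennreal (\<gamma> y) * I s y) x
    = duhamel t (\<lambda>s y. ennreal (b s y)) x + duhamel t (\<lambda>s y. ennreal (\<gamma> y) * offspring_sum (I s) y) x"
proof -
  have bf: "b r \<in> bfun_nonneg" for r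
  proof -
    have "b r \<in> borel_measurable borel" by measurable
    moreover have "bounded (range (b r))"
      using b01 by (intro boundedI[of _ B]) auto
    ultimately show ?thesis using b01 by (auto simp: bfun_nonneg_def bfun_def)
  qed
  define m where "m s q y = mean_sum s (\<lambda>z. ennreal (b q z)) y" for s q y
  have m [measurable (raw)]: "(\<lambda>p. m (s p) (q p) (y p)) \<in> borel_measurable N"
    if [measurable]: "s \<in> borel_measurable N" "q \<in> borel_measurable N" "y \<in> N \<rightarrow>\<^sub>M borel" for N :: "'n measure" and s q y
    unfolding m_def by measurable
  have I: "I t x = (\<integral>\<^sup>+s\<in>{0..t}. m s (t - s) x \<partial>lborel)" for t x
    unfolding I_def mean_duhamel_def m_def ..
  have i1: "(\<integral>\<^sup>+s\<in>{0..t}. duhamel s (\<lambda>r y. ennreal (\<gamma> y) * m r (t - s) y) x \<partial>lborel)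
      = duhamel t (\<lambda>s y. ennreal (\<gamma> y) * I s y) x"
  proof (subst duhamel_iterate[where k = "\<lambda>r q y. ennreal (\<gamma> y) * m r q y"])
    show "duhamel t (\<lambda>q y. \<integral>\<^sup>+s\<in>{0..q}. (ennreal (\<gamma> y) * m s (q - s) y) \<partial>lborel) x
        = duhamel t (\<lambda>s y. ennreal (\<gamma> y) * I s y) x"
      unfolding I by (simp add: nn_integral_cmult mult.assoc)
  qed measurable
  have off: "(\<integral>\<^sup>+s\<in>{0..q}. offspring_sum (m s (q - s)) y \<partial>lborel) = offspring_sum (I q) y" for q y
  proof -
    have "(\<integral>\<^sup>+s\<in>{0..q}. offspring_sum (m s (q - s)) y \<partial>lborel)
        = (\<integral>\<^sup>+s. (\<integral>\<^sup>+Z. (\<Sum>z\<in>#Z. m s (q - s) z) * indicator {0..q} s \<partial>Off y) \<partial>lborel)"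
      unfolding offspring_sum_def by (intro nn_integral_cong nn_integral_multc[symmetric]) measurable
    also have "\<dots> = (\<integral>\<^sup>+Z. (\<integral>\<^sup>+s. (\<Sum>z\<in>#Z. m s (q - s) z) * indicator {0..q} s \<partial>lborel) \<partial>Off y)"
      by (rule nn_integral_lborel_swap[symmetric, OF finite_measure_Off]) measurable
    also have "\<dots> = offspring_sum (I q) y"
      unfolding offspring_sum_def I sum_mset_distrib_right
      by (intro nn_integral_cong nn_integral_sum_mset(1)) measurable
    finally show ?thesis .
  qed
  have i2: "(\<integral>\<^sup>+s\<in>{0..t}. duhamel s (\<lambda>r y. ennreal (\<gamma> y) * offspring_sum (m r (t - s)) y) x \<partial>lborel)
      = duhamel t (\<lambda>s y. ennreal (\<gamma> y) * offspring_sum (I s) y) x"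
  proof (subst duhamel_iterate[where k = "\<lambda>r q y. ennreal (\<gamma> y) * offspring_sum (m r q) y"])
    show "duhamel t (\<lambda>q y. \<integral>\<^sup>+s\<in>{0..q}. (ennreal (\<gamma> y) * offspring_sum (m s (q - s)) y) \<partial>lborel) x
        = duhamel t (\<lambda>s y. ennreal (\<gamma> y) * offspring_sum (I s) y) x"
      unfolding off[symmetric] by (simp add: nn_integral_cmult mult.assoc)
  qed measurable
  have "I t x + duhamel t (\<lambda>s y. ennreal (\<gamma> y) * I s y) x
      = (\<integral>\<^sup>+s. m s (t - s) x * indicator {0..t} s
          + duhamel s (\<lambda>r y. ennreal (\<gamma> y) * m r (t - s) y) x * indicator {0..t} s \<partial>lborel)"
    unfolding i1[symmetric] unfolding I by (rule nn_integral_add[symmetric]) measurable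
  also have "\<dots> = (\<integral>\<^sup>+s. (\<integral>\<^sup>+y. ennreal (b (t - s) y) \<partial>motion s x) * indicator {0..t} s
          + duhamel s (\<lambda>r y. ennreal (\<gamma> y) * offspring_sum (m r (t - s)) y) x * indicator {0..t} s \<partial>lborel)"
    by (intro nn_integral_cong) (auto simp: indicator_def m_def[abs_def] mean_sum_mild[OF bf])
  also have "\<dots> = duhamel t (\<lambda>s y. ennreal (b s y)) x + duhamel t (\<lambda>s y. ennreal (\<gamma> y) * offspring_sum (I s) y) x"
    unfolding i2[symmetric] duhamel_def[of t "\<lambda>s y. ennreal (b s y)"] by (rule nn_integral_add) measurable
  finally show ?thesis .
qed

text \<open>
  One round of Gronwall's argument for the difference of two solutions. The loss terms stand on
  the left of the equations, so they are compared as well; the one belonging to \<open>J\<close> occurs on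
  both sides of the resulting inequality and is cancelled, which is why it has to be finite.
\<close>

lemma mild_unique_step:
  assumes J [measurable]: "(\<lambda>(s, y). J s y) \<in> borel_measurable (borel \<Otimes>\<^sub>M borel)"
    and K [measurable]: "(\<lambda>(s, y). K s y) \<in> borel_measurable (borel \<Otimes>\<^sub>M borel)"
    and eqJ: "J t x + duhamel t (\<lambda>s y. ennreal (\<gamma> y) * J s y) x = c + duhamel t (\<lambda>s y. ennreal (\<gamma> y) * offspring_sum (J s) y) x"
    and eqK: "K t x + duhamel t (\<lambda>s y. ennreal (\<gamma> y) * K s y) x = c + duhamel t (\<lambda>s y. ennreal (\<gamma> y) * offspring_sum (K s) y) x"
    and fin: "duhamel t (\<lambda>s y. ennreal (\<gamma> y) * J s y) x < \<infinity>"
    and JK: "\<And>s y. s \<in> {0..t} \<Longrightarrow> J s y \<le> K s y + ennreal (S * exp (2 * growth * s))"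
    and KJ: "\<And>s y. s \<in> {0..t} \<Longrightarrow> K s y \<le> J s y + ennreal (S * exp (2 * growth * s))"
    and S: "0 \<le> S" and t: "0 \<le> t"
  shows "J t x \<le> K t x + ennreal (S / 2 * exp (2 * growth * t))"
proof -
  define e where "e s = ennreal (S * exp (2 * growth * s))" for s
  have [measurable]: "e \<in> borel_measurable borel" unfolding e_def by measurable
  let ?a = "\<lambda>J. duhamel t (\<lambda>s y. ennreal (\<gamma> y) * J s y) x"
  let ?b = "\<lambda>J. duhamel t (\<lambda>s y. ennreal (\<gamma> y) * offspring_sum (J s) y) x"
  have J1: "J s \<in> borel_measurable borel" "K s \<in> borel_measurable borel" for s by measurable
  have "?b J \<le> duhamel t (\<lambda>s y. ennreal (\<gamma> y) * offspring_sum (\<lambda>z. K s z + e s) y) x"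
    unfolding offspring_sum_def using JK
    by (intro duhamel_mono mult_left_mono nn_integral_mono sum_mset_mono) (auto simp: e_def)
  also have "\<dots> = ?b K + ?b (\<lambda>s _. e s)"
    using J1 by (subst duhamel_add[symmetric], measurable) (simp add: offspring_sum_add distrib_left)
  finally have bJ: "?b J \<le> ?b K + ?b (\<lambda>s _. e s)" .
  have "?a K \<le> duhamel t (\<lambda>s y. ennreal (\<gamma> y) * (J s y + e s)) x"
    using KJ by (intro duhamel_mono mult_left_mono) (auto simp: e_def)
  also have "\<dots> = ?a J + ?a (\<lambda>s _. e s)"
    by (subst duhamel_add[symmetric], measurable) (simp add: distrib_left)
  finally have aK: "?a K \<le> ?a J + ?a (\<lambda>s _. e s)" .
  have "?a (\<lambda>s _. e s) + ?b (\<lambda>s _. e s)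
      = duhamel t (\<lambda>s y. ennreal (\<gamma> y) * e s + ennreal (\<gamma> y) * offspring_sum (\<lambda>z. e s) y) x"
    by (rule duhamel_add[symmetric]) measurable
  also have "\<dots> \<le> ennreal (S * exp (2 * growth * t) / 2)"
  proof (rule duhamel_exp_bound[OF _ growth_pos S t])
    fix s y
    let ?E = "S * exp (2 * growth * s)"
    have E: "0 \<le> ?E" using S by simp
    have "ennreal (\<gamma> y) * e s + ennreal (\<gamma> y) * offspring_sum (\<lambda>z. e s) y
        \<le> ennreal (rate_bound * ?E) + ennreal (rate_bound * (?E * off_bound))"
      using E unfolding e_def by (intro add_mono gamma_mult_le offspring_sum_le) auto
    also have "\<dots> = ennreal (rate_bound * (1 + off_bound) * ?E)"
    proof (subst ennreal_plus[symmetric])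
      show "0 \<le> rate_bound * ?E" "0 \<le> rate_bound * (?E * off_bound)"
        by (intro mult_nonneg_nonneg E rate_bound_nonneg off_bound_nonneg)+
      show "ennreal (rate_bound * ?E + rate_bound * (?E * off_bound)) = ennreal (rate_bound * (1 + off_bound) * ?E)"
        by (simp only: distrib_left distrib_right mult_1_right mult_1_left ac_simps)
    qed
    also have "\<dots> \<le> ennreal (growth * ?E)"
      using E by (intro ennreal_leI mult_right_mono) (auto simp: growth_def)
    finally show "ennreal (\<gamma> y) * e s + ennreal (\<gamma> y) * offspring_sum (\<lambda>z. e s) y
        \<le> ennreal (growth * S * exp (2 * growth * s))" by (simp add: mult.assoc)
  qed
  finally have ab: "?a (\<lambda>s _. e s) + ?b (\<lambda>s _. e s) \<le> ennreal (S * exp (2 * growth * t) / 2)" .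
  have "?a J + J t x = c + ?b J" using eqJ by (simp add: add.commute)
  also have "\<dots> \<le> c + (?b K + ?b (\<lambda>s _. e s))" using bJ by (rule add_left_mono)
  also have "\<dots> = K t x + ?a K + ?b (\<lambda>s _. e s)" by (simp add: eqK add.assoc)
  also have "\<dots> \<le> K t x + (?a J + ?a (\<lambda>s _. e s)) + ?b (\<lambda>s _. e s)"
    using aK by (intro add_mono) auto
  also have "\<dots> = ?a J + (K t x + (?a (\<lambda>s _. e s) + ?b (\<lambda>s _. e s)))" by (simp only: ac_simps)
  also have "\<dots> \<le> ?a J + (K t x + ennreal (S * exp (2 * growth * t) / 2))"
    using ab by (intro add_left_mono)
  finally have "J t x \<le> K t x + ennreal (S * exp (2 * growth * t) / 2)"
    using fin by (subst (asm) ennreal_add_left_cancel_le) auto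
  then show ?thesis by simp
qed

lemma duhamel_bounded:
  assumes "\<And>s y. s \<in> {0..t} \<Longrightarrow> k s y \<le> ennreal M"
  shows "duhamel t k x < \<infinity>"
proof -
  have "duhamel t k x \<le> (\<integral>\<^sup>+s. ennreal M * indicator {0..t} s \<partial>lborel)"
    unfolding duhamel_def
    by (intro nn_integral_mono) (auto simp: indicator_def intro!: motion_integral_le assms)
  also have "\<dots> < \<infinity>"
    by (subst nn_integral_cmult_indicator) (auto simp: emeasure_lborel_Icc_eq ennreal_mult_less_top)
  finally show ?thesis .
qed

lemma mild_unique:
  assumes J [measurable]: "(\<lambda>(s, y). J s y) \<in> borel_measurable (borel \<Otimes>\<^sub>M borel)"
    and K [measurable]: "(\<lambda>(s, y). K s y) \<in> borel_measurable (borel \<Otimes>\<^sub>M borel)"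
    and eqJ: "\<And>t x. t \<in> {0..T} \<Longrightarrow> J t x + duhamel t (\<lambda>s y. ennreal (\<gamma> y) * J s y) x
      = c t x + duhamel t (\<lambda>s y. ennreal (\<gamma> y) * offspring_sum (J s) y) x"
    and eqK: "\<And>t x. t \<in> {0..T} \<Longrightarrow> K t x + duhamel t (\<lambda>s y. ennreal (\<gamma> y) * K s y) x
      = c t x + duhamel t (\<lambda>s y. ennreal (\<gamma> y) * offspring_sum (K s) y) x"
    and M: "\<And>t x. t \<in> {0..T} \<Longrightarrow> J t x \<le> ennreal M" "\<And>t x. t \<in> {0..T} \<Longrightarrow> K t x \<le> ennreal M" "0 \<le> M"
    and T: "0 \<le> T"
  shows "J T x = K T x"
proof -
  have fin: "duhamel t (\<lambda>s y. ennreal (\<gamma> y) * J s y) x < \<infinity>" "duhamel t (\<lambda>s y. ennreal (\<gamma> y) * K s y) x < \<infinity>"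
    if "t \<in> {0..T}" for t x
    by (rule duhamel_bounded[where M = "rate_bound * M"], use that M in \<open>intro gamma_mult_le; auto\<close>)+
  have *: "J t x \<le> K t x + ennreal (M / 2 ^ n * exp (2 * growth * t)) \<and>
      K t x \<le> J t x + ennreal (M / 2 ^ n * exp (2 * growth * t))" if "t \<in> {0..T}" for n t x
    using that
  proof (induction n arbitrary: t x)
    case 0
    have "M * 1 \<le> M * exp (2 * growth * t)"
      using M(3) growth_pos 0 by (intro mult_left_mono) auto
    then have "ennreal M \<le> ennreal (M / 2 ^ 0 * exp (2 * growth * t))"
      by (intro ennreal_leI) simp
    then show ?case using M(1,2)[OF 0, of x] by (meson add_increasing order_trans zero_le)
  next
    case (Suc n)
    have "J t x \<le> K t x + ennreal (M / 2 ^ n / 2 * exp (2 * growth * t))"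
      using Suc M(3) by (intro mild_unique_step[OF J K eqJ eqK fin(1)]) auto
    moreover have "K t x \<le> J t x + ennreal (M / 2 ^ n / 2 * exp (2 * growth * t))"
      using Suc M(3) by (intro mild_unique_step[OF K J eqK eqJ fin(2)]) auto
    ultimately show ?case by (simp add: mult.commute)
  qed
  have lim: "(\<lambda>n. K' + ennreal (M / 2 ^ n * exp (2 * growth * T))) \<longlonglongrightarrow> K' + ennreal (0 * exp (2 * growth * T))" for K'
  proof (intro tendsto_add tendsto_const tendsto_ennrealI tendsto_mult)
    have "(\<lambda>n. M * (1 / 2) ^ n) \<longlonglongrightarrow> M * 0"
      by (intro tendsto_mult tendsto_const LIMSEQ_realpow_zero) auto
    then show "(\<lambda>n. M / 2 ^ n) \<longlonglongrightarrow> 0" by (simp add: power_one_over)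
  qed
  have "J T x \<le> K T x + ennreal (0 * exp (2 * growth * T))"
    using * T by (intro LIMSEQ_le_const[OF lim]) auto
  moreover have "K T x \<le> J T x + ennreal (0 * exp (2 * growth * T))"
    using * T by (intro LIMSEQ_le_const[OF lim]) auto
  ultimately show ?thesis by simp
qed

text \<open>
  Variation of constants. Both sides solve the mean equation with initial value \<open>1 - exp (- f)\<close>:
  on the left the nonlinear term in the equation of the gap is compensated by the source in that
  of \<open>mean_duhamel\<close>. Bounded solutions being unique, the sides agree. All later estimates use
  the evolution equation in this form, in which the motion of the particles no longer occurs.
\<close>

lemma laplace_gap_mild:
  assumes f: "f \<in> bfun_nonneg" and T: "0 \<le> T"
  shows "ennreal (laplace_gap f T x) + mean_duhamel T (\<lambda>s y. ennreal (branching_remainder (laplace_gap f s) y)) x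
    = mean_sum T (\<lambda>y. ennreal (1 - exp (- f y))) x"
proof -
  define w where "w = laplace_gap f"
  define b where "b s y = branching_remainder (w s) y" for s y
  define I where "I s y = mean_duhamel s (\<lambda>r z. ennreal (b r z)) y" for s y
  define g where "g y = 1 - exp (- f y)" for y
  have [measurable]: "f \<in> borel_measurable borel" using f by (rule bfun_nonneg_measurable)
  have w01: "0 \<le> w s y" "w s y < 1" "w s y \<le> 1" for s y
    using laplace_gap_nonneg[OF f] laplace_gap_less_1[OF f] by (auto simp: w_def less_imp_le)
  have w2 [measurable]: "(\<lambda>(s, y). w s y) \<in> borel_measurable (borel \<Otimes>\<^sub>M borel)"
    unfolding w_def split_beta by (rule measurable_laplace_gap[OF f]) auto
  have w1: "w s \<in> borel_measurable borel" for s by measurable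
  define B where "B = rate_bound * (18 * 1\<^sup>2 * off_bound)"
  have B0: "0 \<le> B" by (simp add: B_def)
  have b0: "0 \<le> b s y" for s y unfolding b_def by (rule remainder_real(3)[OF w1 w01(1,2)])
  have bB: "b s y \<le> B" for s y
    unfolding b_def B_def by (rule branching_remainder_le[OF w1 w01])
  have b2 [measurable]: "(\<lambda>(s, y). b s y) \<in> borel_measurable (borel \<Otimes>\<^sub>M borel)"
    unfolding b_def split_beta by (rule measurable_branching_remainder) (use w01 in auto)
  have g01: "0 \<le> g y" "g y \<le> 1" for y using bfun_nonneg_pos[OF f] by (auto simp: g_def)
  have [measurable]: "g \<in> borel_measurable borel" unfolding g_def by measurable
  have g: "g \<in> bfun_nonneg"
    using g01 by (auto simp: bfun_nonneg_def bfun_def intro!: boundedI[of _ 1])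
  have bf: "b r \<in> bfun_nonneg" for r
  proof -
    have "b r \<in> borel_measurable borel" by measurable
    then show ?thesis using b0 bB by (auto simp: bfun_nonneg_def bfun_def intro!: boundedI[of _ B])
  qed
  \<comment> \<open>a common bound on \<open>{0..T}\<close> for both solutions\<close>
  define M where "M = max (2 * exp (2 * growth * T)) (1 + 2 * B * exp (2 * growth * T) * T)"
  have [measurable]: "(\<lambda>(s, y). I s y) \<in> borel_measurable (borel \<Otimes>\<^sub>M borel)"
    unfolding I_def by measurable
  have I1: "I s \<in> borel_measurable borel" for s by measurable
  have mean_le: "mean_sum s (\<lambda>z. ennreal (h z)) x \<le> ennreal (2 * A * exp (2 * growth * T))"
    if "h \<in> bfun_nonneg" "\<And>y. h y \<le> A" "s \<in> {0..T}" for h A s x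
  proof -
    have "0 \<le> A" using that bfun_nonneg_pos order_trans by blast
    then have "2 * A * exp (2 * growth * s) \<le> 2 * A * exp (2 * growth * T)"
      using growth_pos that(3) by (intro mult_left_mono) auto
    moreover have "mean_sum s (\<lambda>z. ennreal (h z)) x \<le> ennreal (2 * A * exp (2 * growth * s))"
      using that by (intro mean_sum_le) auto
    ultimately show ?thesis using ennreal_leI order_trans by blast
  qed
  have "mean_sum T (\<lambda>y. ennreal (g y)) x = ennreal (w T x) + I T x"
  proof (rule mild_unique[where M = M and c = "\<lambda>t x. \<integral>\<^sup>+y. ennreal (g y) \<partial>motion t x"])
    fix t x assume t: "t \<in> {0..T}"
    show "mean_sum t (\<lambda>y. ennreal (g y)) x + duhamel t (\<lambda>s y. ennreal (\<gamma> y) * mean_sum s (\<lambda>y. ennreal (g y)) y) x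
      = (\<integral>\<^sup>+y. ennreal (g y) \<partial>motion t x) + duhamel t (\<lambda>s y. ennreal (\<gamma> y) * offspring_sum (mean_sum s (\<lambda>y. ennreal (g y))) y) x"
      using mean_sum_mild[OF g] t by auto
    show "mean_sum t (\<lambda>y. ennreal (g y)) x \<le> ennreal M"
      using mean_le[OF g g01(2) t, of x] by (rule order_trans) (auto intro!: ennreal_leI simp: M_def)
    have "I t x \<le> (\<integral>\<^sup>+s. ennreal (2 * B * exp (2 * growth * T)) * indicator {0..t} s \<partial>lborel)"
      unfolding I_def mean_duhamel_def using t
      by (intro nn_integral_mono) (auto simp: indicator_def intro!: mean_le bf bB)
    also have "\<dots> = ennreal (2 * B * exp (2 * growth * T) * t)"
      using t B0 by (subst nn_integral_cmult_indicator) (auto simp: ennreal_mult)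
    also have "\<dots> \<le> ennreal (2 * B * exp (2 * growth * T) * T)"
      using t B0 by (intro ennreal_leI mult_left_mono) auto
    finally have "ennreal (w t x) + I t x \<le> ennreal 1 + ennreal (2 * B * exp (2 * growth * T) * T)"
      using w01 by (intro add_mono ennreal_leI) auto
    also have "\<dots> = ennreal (1 + 2 * B * exp (2 * growth * T) * T)"
      using B0 T by (subst ennreal_plus) auto
    also have "\<dots> \<le> ennreal M" by (intro ennreal_leI) (simp add: M_def)
    finally show "ennreal (w t x) + I t x \<le> ennreal M" .
    have "ennreal (w t x) + I t x + duhamel t (\<lambda>s y. ennreal (\<gamma> y) * (ennreal (w s y) + I s y)) x
        = ennreal (w t x) + I t x + (duhamel t (\<lambda>s y. ennreal (\<gamma> y) * ennreal (w s y)) x + duhamel t (\<lambda>s y. ennreal (\<gamma> y) * I s y) x)"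
      by (subst duhamel_add[symmetric], measurable) (simp add: distrib_left)
    moreover have "duhamel t (\<lambda>s y. ennreal (\<gamma> y) * offspring_sum (\<lambda>z. ennreal (w s z) + I s z) y) x
        = duhamel t (\<lambda>s y. ennreal (\<gamma> y) * offspring_sum (\<lambda>z. ennreal (w s z)) y) x + duhamel t (\<lambda>s y. ennreal (\<gamma> y) * offspring_sum (I s) y) x"
      using I1 w1 by (subst duhamel_add[symmetric], measurable) (simp add: offspring_sum_add distrib_left)
    moreover have "ennreal (w t x) + I t x + (duhamel t (\<lambda>s y. ennreal (\<gamma> y) * ennreal (w s y)) x + duhamel t (\<lambda>s y. ennreal (\<gamma> y) * I s y) x)
        = (\<integral>\<^sup>+y. ennreal (g y) \<partial>motion t x) + (duhamel t (\<lambda>s y. ennreal (\<gamma> y) * offspring_sum (\<lambda>z. ennreal (w s z)) y) x + duhamel t (\<lambda>s y. ennreal (\<gamma> y) * offspring_sum (I s) y) x)"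
    proof (rule ennreal_add_eqs_cancel)
      show "ennreal (w t x) + duhamel t (\<lambda>s y. ennreal (\<gamma> y) * ennreal (w s y)) x + duhamel t (\<lambda>s y. ennreal (b s y)) x
        = (\<integral>\<^sup>+y. ennreal (g y) \<partial>motion t x) + duhamel t (\<lambda>s y. ennreal (\<gamma> y) * offspring_sum (\<lambda>z. ennreal (w s z)) y) x"
      unfolding w_def b_def g_def using t by (intro evolution_nn[OF f]) auto
      show "I t x + duhamel t (\<lambda>s y. ennreal (\<gamma> y) * I s y) x
        = duhamel t (\<lambda>s y. ennreal (b s y)) x + duhamel t (\<lambda>s y. ennreal (\<gamma> y) * offspring_sum (I s) y) x"
      unfolding I_def by (rule mean_duhamel_mild[OF b2 b0 bB])
      show "duhamel t (\<lambda>s y. ennreal (b s y)) x < \<infinity>"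
      by (rule duhamel_bounded[where M = B]) (auto intro: ennreal_leI bB)
    qed
    ultimately show "ennreal (w t x) + I t x + duhamel t (\<lambda>s y. ennreal (\<gamma> y) * (ennreal (w s y) + I s y)) x
      = (\<integral>\<^sup>+y. ennreal (g y) \<partial>motion t x) + duhamel t (\<lambda>s y. ennreal (\<gamma> y) * offspring_sum (\<lambda>z. ennreal (w s z) + I s z) y) x"
      by simp
  qed (use T in \<open>auto simp: M_def le_max_iff_disj\<close>)
  then show ?thesis by (simp add: I_def w_def b_def g_def)
qed

end

lemma bfun_nonneg_const: "0 \<le> c \<Longrightarrow> (\<lambda>_. c) \<in> bfun_nonneg"
  by (auto simp: bfun_nonneg_def bfun_def)

context exponential_offspring
begin

lemma mean_sum_finite:
  assumes f: "f \<in> bfun_nonneg" and t: "0 \<le> t"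
  shows "mean_sum t (\<lambda>z. ennreal (f z)) x < \<infinity>"
proof -
  obtain a where a: "\<And>y. f y \<le> a"
    using f by (auto simp: bfun_nonneg_def bfun_def bounded_iff intro: order_trans[OF abs_ge_self])
  from mean_sum_le[OF f a t, of x] show ?thesis by (auto intro: le_less_trans)
qed

lemma population_law:
  assumes "0 \<le> t"
  shows "population t x = distr (\<PP> {#x#}) atomic_space (X t)"
  using assms by (simp add: population_def transition_def)

lemma nn_integral_population:
  assumes [measurable]: "k \<in> borel_measurable atomic_space" and t: "0 \<le> t"
  shows "(\<integral>\<^sup>+Z. k Z \<partial>population t x) = (\<integral>\<^sup>+\<omega>. k (X t \<omega>) \<partial>\<PP> {#x#})"
  unfolding population_law[OF t] by (rule nn_integral_distr) (auto intro: measurable_process_law t)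

lemma ennreal_mean_semigroup:
  assumes f: "f \<in> bfun_nonneg" and t: "0 \<le> t"
  shows "ennreal (mean_semigroup \<PP> X t f x) = mean_sum t (\<lambda>z. ennreal (f z)) x"
    and "0 \<le> mean_semigroup \<PP> X t f x"
    and "integrable (\<PP> {#x#}) (\<lambda>\<omega>. \<Sum>z\<in>#X t \<omega>. f z)"
proof -
  have [measurable]: "f \<in> borel_measurable borel" using f by (rule bfun_nonneg_measurable)
  note [measurable] = measurable_process_law[OF t]
  have s0: "0 \<le> (\<Sum>z\<in>#X t \<omega>. f z)" for \<omega> by (simp add: sum_mset_nonneg bfun_nonneg_pos[OF f])
  have eq: "mean_sum t (\<lambda>z. ennreal (f z)) x = (\<integral>\<^sup>+\<omega>. ennreal (\<Sum>z\<in>#X t \<omega>. f z) \<partial>\<PP> {#x#})"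
    unfolding mean_sum_def
    by (subst nn_integral_population[OF _ t]) (auto simp: sum_mset_ennreal bfun_nonneg_pos[OF f])
  show int: "integrable (\<PP> {#x#}) (\<lambda>\<omega>. \<Sum>z\<in>#X t \<omega>. f z)"
    using mean_sum_finite[OF f t, of x] s0 unfolding eq by (intro integrableI_nonneg) auto
  show "ennreal (mean_semigroup \<PP> X t f x) = mean_sum t (\<lambda>z. ennreal (f z)) x"
    unfolding eq mean_semigroup_def by (rule nn_integral_eq_integral[symmetric, OF int]) (simp add: s0)
  show "0 \<le> mean_semigroup \<PP> X t f x"
    unfolding mean_semigroup_def by (intro Bochner_Integration.integral_nonneg s0)
qed

lemma mean_sum_cmult:
  assumes [measurable]: "g \<in> borel_measurable borel"
  shows "mean_sum t (\<lambda>z. c * g z) x = c * mean_sum t g x"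
  unfolding mean_sum_def sum_mset_distrib_left[symmetric]
  by (rule nn_integral_cmult) (simp cong: measurable_cong_sets)

lemma mean_sum_mono:
  assumes "\<And>z. f z \<le> g z"
  shows "mean_sum t f x \<le> mean_sum t g x"
  unfolding mean_sum_def by (intro nn_integral_mono sum_mset_mono assms)

end

section \<open>Exponential growth of the first two moments\<close>

locale supercritical_branching = exponential_offspring P \<gamma> Off F \<PP> X
  for P :: "real \<Rightarrow> 'a::polish_space \<Rightarrow> 'a measure" and \<gamma> Off and F :: "'w measure" and \<PP> X +
  fixes lam :: real and \<phi> :: "'a \<Rightarrow> real" and \<phi>t :: "'a measure"
  assumes lam_pos: "0 < lam"
    and phi: "\<phi> \<in> bfun_nonneg" and phi_pos: "\<And>x. 0 < \<phi> x"
    and phit: "prob_space \<phi>t" "sets \<phi>t = sets borel"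
    and right_eigen: "\<And>t x. 0 \<le> t \<Longrightarrow> mean_semigroup \<PP> X t \<phi> x = exp (lam * t) * \<phi> x"
    and ergodic: "((\<lambda>t. SUP (x, f) \<in> UNIV \<times> bfun_unit.
        ennreal \<bar>exp (- lam * t) * inverse (\<phi> x) * mean_semigroup \<PP> X t f x - (\<integral>y. f y \<partial>\<phi>t)\<bar>)
      \<longlongrightarrow> 0) at_top"

context supercritical_branching
begin

text \<open>
  The supremum is known to be finite only for large \<open>t\<close>. Where it is infinite the value is zero
  and bounds nothing, so that estimates with this function hold eventually.
\<close>

definition ergodic_error :: "real \<Rightarrow> real" where
  "ergodic_error t = enn2real (SUP (x, f) \<in> UNIV \<times> bfun_unit.
        ennreal \<bar>exp (- lam * t) * inverse (\<phi> x) * mean_semigroup \<PP> X t f x - (\<integral>y. f y \<partial>\<phi>t)\<bar>)"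

definition phi_bound :: real where "phi_bound = (SUP x. \<phi> x)"

lemma phi_le: "\<phi> x \<le> phi_bound"
  unfolding phi_bound_def
  using phi by (intro cSUP_upper bounded_imp_bdd_above) (auto simp: bfun_nonneg_def bfun_def)

lemma phi_bound_pos: "0 < phi_bound"
  using phi_pos phi_le less_le_trans by blast

lemma ergodic_error_nonneg [simp]: "0 \<le> ergodic_error t"
  by (simp add: ergodic_error_def)

lemma ergodic_error_tendsto: "(ergodic_error \<longlongrightarrow> 0) at_top"
  unfolding ergodic_error_def[abs_def] by (rule tendsto_enn2real) (use ergodic in simp_all)

lemma mean_semigroup_scale:
  fixes f :: "'a \<Rightarrow> real"
  shows "mean_semigroup \<PP> X t (\<lambda>y. c * f y) x = c * mean_semigroup \<PP> X t f x"
  unfolding mean_semigroup_def by (simp add: sum_mset_distrib_left[symmetric])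

text \<open>
  The convergence assumption, extended from the unit ball by homogeneity. The error keeps the
  factor \<open>\<phi> x\<close>, so that it can be summed over a population, giving a multiple of the martingale.
\<close>

lemma mean_semigroup_ergodic:
  "\<forall>\<^sub>F t in at_top. \<forall>A f x. f \<in> bfun_nonneg \<longrightarrow> (\<forall>y. f y \<le> A) \<longrightarrow>
    \<bar>exp (- lam * t) * mean_semigroup \<PP> X t f x - (\<integral>y. f y \<partial>\<phi>t) * \<phi> x\<bar> \<le> A * ergodic_error t * \<phi> x"
proof -
  let ?S = "\<lambda>t. SUP (x, f) \<in> UNIV \<times> bfun_unit.
        ennreal \<bar>exp (- lam * t) * inverse (\<phi> x) * mean_semigroup \<PP> X t f x - (\<integral>y. f y \<partial>\<phi>t)\<bar>"
  have "\<forall>\<^sub>F t in at_top. ?S t < \<infinity>"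
    using order_tendstoD(2)[OF ergodic, of \<infinity>] by simp
  then show ?thesis
  proof eventually_elim
    case (elim t)
    show ?case
    proof (intro allI impI)
      fix A :: real and f :: "'a \<Rightarrow> real" and x assume f: "f \<in> bfun_nonneg" and A: "\<forall>y. f y \<le> A"
      have A0: "0 \<le> A" using A bfun_nonneg_pos[OF f] order_trans by blast
      show "\<bar>exp (- lam * t) * mean_semigroup \<PP> X t f x - (\<integral>y. f y \<partial>\<phi>t) * \<phi> x\<bar> \<le> A * ergodic_error t * \<phi> x"
      proof (cases "A = 0")
        case True
        then have "f = (\<lambda>_. 0)" using A bfun_nonneg_pos[OF f] by (intro ext antisym) auto
        then show ?thesis using True by (simp add: mean_semigroup_def)
      next
        case False
        then have Ap: "0 < A" using A0 by simp
        define g where "g = (\<lambda>y. inverse A * f y)"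
        have "g \<in> bfun_nonneg" unfolding g_def using A0 by (intro bfun_nonneg_scale f) auto
        then have "g \<in> bfun_unit"
          using A Ap by (auto simp: bfun_nonneg_def bfun_unit_def g_def field_simps)
        then have "ennreal \<bar>exp (- lam * t) * inverse (\<phi> x) * mean_semigroup \<PP> X t g x - (\<integral>y. g y \<partial>\<phi>t)\<bar> \<le> ?S t"
          by (intro SUP_upper2[of "(x, g)"]) auto
        also have "?S t = ennreal (ergodic_error t)"
          unfolding ergodic_error_def using elim by (subst ennreal_enn2real) auto
        finally have "\<bar>exp (- lam * t) * inverse (\<phi> x) * mean_semigroup \<PP> X t g x - (\<integral>y. g y \<partial>\<phi>t)\<bar> \<le> ergodic_error t"
          by (subst (asm) ennreal_le_iff) auto
        then have "(A * \<phi> x) * \<bar>exp (- lam * t) * inverse (\<phi> x) * mean_semigroup \<PP> X t g x - (\<integral>y. g y \<partial>\<phi>t)\<bar>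
            \<le> (A * \<phi> x) * ergodic_error t"
          using Ap phi_pos[of x] by (intro mult_left_mono) auto
        moreover have "(A * \<phi> x) * \<bar>exp (- lam * t) * inverse (\<phi> x) * mean_semigroup \<PP> X t g x - (\<integral>y. g y \<partial>\<phi>t)\<bar>
            = \<bar>(A * \<phi> x) * (exp (- lam * t) * inverse (\<phi> x) * mean_semigroup \<PP> X t g x - (\<integral>y. g y \<partial>\<phi>t))\<bar>"
          using Ap phi_pos[of x] by (simp add: abs_mult)
        moreover have "(A * \<phi> x) * (exp (- lam * t) * inverse (\<phi> x) * mean_semigroup \<PP> X t g x - (\<integral>y. g y \<partial>\<phi>t))
            = exp (- lam * t) * mean_semigroup \<PP> X t f x - (\<integral>y. f y \<partial>\<phi>t) * \<phi> x"
        proof -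
          have e1: "mean_semigroup \<PP> X t g x = inverse A * mean_semigroup \<PP> X t f x"
            unfolding g_def by (rule mean_semigroup_scale)
          have e2: "(\<integral>y. g y \<partial>\<phi>t) = inverse A * (\<integral>y. f y \<partial>\<phi>t)"
            unfolding g_def by simp
          show ?thesis unfolding e1 e2 using Ap phi_pos[of x] by (simp add: field_simps)
        qed
        ultimately show ?thesis by (simp add: ac_simps)
      qed
    qed
  qed
qed

text \<open>
  For large times the expected size is close to \<open>\<phi> x * exp (lam * t)\<close> by ergodicity; the crude
  exponential bound is used only on a bounded interval of times, where its rate does not matter.
\<close>

lemma mean_growth_exists:
  "\<exists>C>0. \<forall>t\<ge>0. \<forall>x. mean_sum t (\<lambda>_. 1) x \<le> ennreal (C * exp (lam * t))"
proof -
  interpret phit: prob_space \<phi>t by (rule phit(1))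
  have one: "(\<lambda>_. 1) \<in> (bfun_nonneg :: ('a \<Rightarrow> real) set)" by (rule bfun_nonneg_const) simp
  have "\<forall>\<^sub>F t in at_top. ergodic_error t < 1"
    using order_tendstoD(2)[OF ergodic_error_tendsto, of 1] by simp
  then obtain T where T: "\<And>t. T \<le> t \<Longrightarrow> ergodic_error t < 1 \<and> (\<forall>A f x. f \<in> bfun_nonneg \<longrightarrow> (\<forall>y. f y \<le> A) \<longrightarrow>
    \<bar>exp (- lam * t) * mean_semigroup \<PP> X t f x - (\<integral>y. f y \<partial>\<phi>t) * \<phi> x\<bar> \<le> A * ergodic_error t * \<phi> x)"
    using eventually_conj[OF \<open>\<forall>\<^sub>F t in at_top. ergodic_error t < 1\<close> mean_semigroup_ergodic] by (auto simp: eventually_at_top_linorder)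
  define C where "C = max (2 * phi_bound) (2 * exp (2 * growth * max 0 T))"
  have C: "0 < C" using phi_bound_pos by (simp add: C_def less_max_iff_disj)
  have "mean_sum t (\<lambda>_. 1) x \<le> ennreal (C * exp (lam * t))" if t: "0 \<le> t" for t x
  proof (cases "T \<le> t")
    case True
    have "\<bar>exp (- lam * t) * mean_semigroup \<PP> X t (\<lambda>_. 1) x - (\<integral>y. 1 \<partial>\<phi>t) * \<phi> x\<bar> \<le> 1 * ergodic_error t * \<phi> x"
      using T[OF True] one by blast
    also have "\<dots> \<le> 1 * 1 * \<phi> x"
      using T[OF True] phi_pos[of x] by (intro mult_mono) auto
    finally have "exp (- lam * t) * mean_semigroup \<PP> X t (\<lambda>_. 1) x \<le> 2 * \<phi> x"
      by (simp add: phit.prob_space)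
    also have "\<dots> \<le> C" using phi_le[of x] by (simp add: C_def le_max_iff_disj)
    finally have "mean_semigroup \<PP> X t (\<lambda>_. 1) x \<le> C * exp (lam * t)"
      by (simp add: exp_minus field_simps)
    then have "ennreal (mean_semigroup \<PP> X t (\<lambda>_. 1) x) \<le> ennreal (C * exp (lam * t))" by (rule ennreal_leI)
    then show ?thesis by (simp add: ennreal_mean_semigroup(1)[OF one t])
  next
    case False
    have "mean_sum t (\<lambda>_. ennreal 1) x \<le> ennreal (2 * 1 * exp (2 * growth * t))"
      by (rule mean_sum_le[OF one _ t]) simp
    also have "\<dots> \<le> ennreal (C * exp (lam * t))"
    proof (rule ennreal_leI)
      have "2 * exp (2 * growth * t) \<le> 2 * exp (2 * growth * max 0 T)"
        using False growth_pos by simp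
      also have "\<dots> \<le> C" by (simp add: C_def)
      also have "\<dots> \<le> C * exp (lam * t)"
        using C t lam_pos mult_left_mono[of 1 "exp (lam * t)" C] by simp
      finally show "2 * 1 * exp (2 * growth * t) \<le> C * exp (lam * t)" by simp
    qed
    finally show ?thesis by simp
  qed
  then show ?thesis using C by blast
qed

definition mean_const :: real where
  "mean_const = (SOME C. 0 < C \<and> (\<forall>t\<ge>0. \<forall>x. mean_sum t (\<lambda>_. 1) x \<le> ennreal (C * exp (lam * t))))"

lemma mean_const_pos: "0 < mean_const"
  and mean_sum_one_le: "0 \<le> t \<Longrightarrow> mean_sum t (\<lambda>_. 1) x \<le> ennreal (mean_const * exp (lam * t))"
  using someI_ex[OF mean_growth_exists, folded mean_const_def] by blast+

lemma mean_sum_growth: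
  assumes f: "\<And>z. f z \<le> ennreal a" and a: "0 \<le> a" and t: "0 \<le> t"
  shows "mean_sum t f x \<le> ennreal (a * (mean_const * exp (lam * t)))"
proof -
  have "mean_sum t f x \<le> mean_sum t (\<lambda>_. ennreal a * 1) x"
    using f by (intro mean_sum_mono) simp
  also have "\<dots> = ennreal a * mean_sum t (\<lambda>_. 1) x" by (rule mean_sum_cmult) simp
  also have "\<dots> \<le> ennreal a * ennreal (mean_const * exp (lam * t))"
    by (intro mult_left_mono mean_sum_one_le t) simp
  finally show ?thesis using a mean_const_pos by (simp add: ennreal_mult)
qed

lemma exp_second_order:
  fixes y :: real
  assumes "0 \<le> y"
  shows "0 \<le> exp (- y) - 1 + y" "exp (- y) - 1 + y \<le> y\<^sup>2 / 2"
proof -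
  show "0 \<le> exp (- y) - 1 + y" using exp_ge_add_one_self[of "- y"] by simp
  obtain t where t: "\<bar>t\<bar> \<le> \<bar>- y\<bar>" "exp (- y) = (\<Sum>m<3. (- y) ^ m / fact m) + exp t / fact 3 * (- y) ^ 3"
    using Maclaurin_exp_le[of "- y" 3] by blast
  have "(- y) ^ 3 \<le> 0" using assms by (simp add: power3_eq_cube)
  then have "exp t / fact 3 * (- y) ^ 3 \<le> 0" by (intro mult_nonneg_nonpos) auto
  moreover have "(\<Sum>m<3. (- y) ^ m / fact m) = 1 - y + y\<^sup>2 / 2"
    by (simp add: eval_nat_numeral)
  ultimately show "exp (- y) - 1 + y \<le> y\<^sup>2 / 2"
    using t(2) by linarith
qed

lemma exp_curvature_tendsto:
  "(\<lambda>n. (real (Suc n))\<^sup>2 * (exp (- (y / real (Suc n))) - 1 + y / real (Suc n))) \<longlonglongrightarrow> y\<^sup>2 / 2"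
  unfolding power2_eq_square by real_asymp

text \<open>
  Comparing the formula of \<open>laplace_gap_mild\<close> with the mean expresses the left-hand side, the
  second order part of the Laplace transform of the population size, through quadratic
  quantities only. The gap at time \<open>t - s\<close> is at most of order \<open>\<theta> * exp (lam * (t - s))\<close>, its
  remainder of order the square, and the mean over the time \<open>s\<close> adds \<open>exp (lam * s)\<close>; as
  \<open>lam > 0\<close>, the integral over \<open>s\<close> is of order \<open>exp (2 * lam * t)\<close>, the square of the mean.
\<close>

lemma second_moment_laplace:
  fixes \<theta> :: real
  assumes t: "0 \<le> t" and th: "0 \<le> \<theta>"
  shows "(\<integral>\<^sup>+Z. ennreal (exp (- (\<theta> * size Z)) - 1 + \<theta> * size Z) \<partial>population t x)
    \<le> ennreal (\<theta>\<^sup>2 * (mean_const * exp (2 * lam * t) * (1 / 2 + rate_bound * (18 * mean_const\<^sup>2 * off_bound) / lam)))"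
proof -
  define f where "f = (\<lambda>_::'a. \<theta>)"
  have f: "f \<in> bfun_nonneg" unfolding f_def by (rule bfun_nonneg_const[OF th])
  define w where "w = laplace_gap f"
  define Q where "Q = (\<integral>\<^sup>+Z. ennreal (exp (- (\<theta> * size Z)) - 1 + \<theta> * size Z) \<partial>population t x)"
  define I where "I = mean_duhamel t (\<lambda>s y. ennreal (branching_remainder (w s) y)) x"
  define K where "K = rate_bound * (18 * mean_const\<^sup>2 * off_bound)"
  have K0: "0 \<le> K" by (simp add: K_def)
  have sumf: "(\<Sum>z\<in>#Z. f z) = \<theta> * size Z" for Z
    by (induction Z) (auto simp: f_def algebra_simps)
  have m: "(\<lambda>Z. real (size Z)) \<in> borel_measurable (population s y)" for s y
    by (simp cong: measurable_cong_sets)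
  have size_sum: "ennreal \<theta> * mean_sum s (\<lambda>_. 1) y = (\<integral>\<^sup>+Z. ennreal (\<theta> * size Z) \<partial>population s y)" for s y
  proof -
    have "ennreal \<theta> * mean_sum s (\<lambda>_. 1) y = mean_sum s (\<lambda>_. ennreal \<theta> * 1) y"
      by (rule mean_sum_cmult[symmetric]) simp
    then show ?thesis
      using th by (simp add: mean_sum_def ennreal_mult ennreal_of_nat_eq_real_of_nat mult.commute)
  qed
  have w: "ennreal (w s y) = (\<integral>\<^sup>+Z. ennreal (1 - exp (- (\<theta> * size Z))) \<partial>population s y)" for s y
    unfolding w_def ennreal_laplace_gap[OF f] sumf ..
  have w_le: "w s y \<le> \<theta> * (mean_const * exp (lam * s))" if "0 \<le> s" for s y
  proof -
    have "ennreal (w s y) \<le> ennreal \<theta> * mean_sum s (\<lambda>_. 1) y"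
      unfolding w size_sum by (intro nn_integral_mono ennreal_leI one_minus_exp_le)
    also have "\<dots> \<le> ennreal \<theta> * ennreal (mean_const * exp (lam * s))"
      by (intro mult_left_mono mean_sum_one_le that) simp
    finally show ?thesis using th mean_const_pos by (subst (asm) ennreal_mult[symmetric]) auto
  qed
  have w01: "0 \<le> w s y" "w s y < 1" for s y
    using laplace_gap_nonneg[OF f] laplace_gap_less_1[OF f] by (auto simp: w_def)
  have w1: "w s \<in> borel_measurable borel" for s
    unfolding w_def by (rule measurable_laplace_gap[OF f]) auto
  have I_le: "I \<le> ennreal (\<theta>\<^sup>2 * K * mean_const * exp (2 * lam * t) / lam)"
  proof -
    have "I \<le> (\<integral>\<^sup>+s. ennreal (\<theta>\<^sup>2 * K * mean_const * exp (2 * lam * t) * exp (- lam * s)) * indicator {0..t} s \<partial>lborel)"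
      unfolding I_def mean_duhamel_def
    proof (intro nn_integral_mono)
      fix s
      show "mean_sum s (\<lambda>y. ennreal (branching_remainder (w (t - s)) y)) x * indicator {0..t} s
        \<le> ennreal (\<theta>\<^sup>2 * K * mean_const * exp (2 * lam * t) * exp (- lam * s)) * indicator {0..t} s"
      proof (cases "s \<in> {0..t}")
        case True
        then have ts: "0 \<le> t - s" "0 \<le> s" by auto
        define a where "a = rate_bound * (18 * (\<theta> * (mean_const * exp (lam * (t - s))))\<^sup>2 * off_bound)"
        have "branching_remainder (w (t - s)) y \<le> a" for y
          unfolding a_def by (rule branching_remainder_le[OF w1 w01 w_le[OF ts(1)]])
        then have "mean_sum s (\<lambda>y. ennreal (branching_remainder (w (t - s)) y)) x \<le> ennreal (a * (mean_const * exp (lam * s)))"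
          by (intro mean_sum_growth ennreal_leI ts) (auto simp: a_def)
        also have "a * (mean_const * exp (lam * s))
            = \<theta>\<^sup>2 * K * mean_const * (exp (lam * (t - s)) * exp (lam * (t - s)) * exp (lam * s))"
          by (simp add: a_def K_def power2_eq_square)
        also have "exp (lam * (t - s)) * exp (lam * (t - s)) * exp (lam * s) = exp (2 * lam * t) * exp (- lam * s)"
          by (simp add: exp_add[symmetric] algebra_simps)
        finally show ?thesis using True by (simp add: mult.assoc)
      qed simp
    qed
    also have "\<dots> = ennreal (- (\<theta>\<^sup>2 * K * mean_const * exp (2 * lam * t) * exp (- lam * t) / lam)
        - (- (\<theta>\<^sup>2 * K * mean_const * exp (2 * lam * t) * exp (- lam * 0) / lam)))"
      using lam_pos t K0 mean_const_pos
      by (intro nn_integral_FTC_Icc) (auto intro!: derivative_eq_intros simp: field_simps)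
    also have "\<dots> \<le> ennreal (\<theta>\<^sup>2 * K * mean_const * exp (2 * lam * t) / lam)"
      using lam_pos K0 mean_const_pos by (intro ennreal_leI) auto
    finally show ?thesis .
  qed
  \<comment> \<open>for a constant test function the right-hand side of the formula is a multiple of the mean\<close>
  have mild: "ennreal (w t x) + I = ennreal (1 - exp (- \<theta>)) * mean_sum t (\<lambda>_. 1) x"
    using laplace_gap_mild[OF f t, of x] mean_sum_cmult[of "\<lambda>_. 1" t "ennreal (1 - exp (- \<theta>))" x]
    by (simp add: w_def I_def f_def)
  have "ennreal (w t x) + Q = ennreal \<theta> * mean_sum t (\<lambda>_. 1) x"
    unfolding w Q_def size_sum using th exp_second_order(1)
  proof (subst nn_integral_add[symmetric])
    show "(\<integral>\<^sup>+Z. ennreal (1 - exp (- (\<theta> * size Z))) + ennreal (exp (- (\<theta> * size Z)) - 1 + \<theta> * size Z) \<partial>population t x)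
        = (\<integral>\<^sup>+Z. ennreal (\<theta> * size Z) \<partial>population t x)"
      using th exp_second_order(1) by (intro nn_integral_cong) (simp add: ennreal_plus[symmetric] del: ennreal_plus)
  qed (use m in measurable)
  also have "\<dots> = (ennreal (1 - exp (- \<theta>)) + ennreal (exp (- \<theta>) - 1 + \<theta>)) * mean_sum t (\<lambda>_. 1) x"
    using th exp_second_order(1)[OF th] by (subst ennreal_plus[symmetric]) auto
  also have "\<dots> = ennreal (w t x) + (I + ennreal (exp (- \<theta>) - 1 + \<theta>) * mean_sum t (\<lambda>_. 1) x)"
    unfolding distrib_right mild[symmetric] by (simp only: add.assoc)
  finally have "Q = I + ennreal (exp (- \<theta>) - 1 + \<theta>) * mean_sum t (\<lambda>_. 1) x"
    by (subst (asm) ennreal_add_left_cancel) auto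
  also have "\<dots> \<le> ennreal (\<theta>\<^sup>2 * K * mean_const * exp (2 * lam * t) / lam) + ennreal (\<theta>\<^sup>2 / 2) * ennreal (mean_const * exp (2 * lam * t))"
  proof (intro add_mono mult_mono I_le ennreal_leI exp_second_order(2)[OF th])
    have "mean_sum t (\<lambda>_. 1) x \<le> ennreal (mean_const * exp (lam * t))" by (rule mean_sum_one_le[OF t])
    also have "\<dots> \<le> ennreal (mean_const * exp (2 * lam * t))"
      using lam_pos t mean_const_pos by (intro ennreal_leI mult_left_mono) auto
    finally show "mean_sum t (\<lambda>_. 1) x \<le> ennreal (mean_const * exp (2 * lam * t))" .
  qed auto
  also have "\<dots> = ennreal (\<theta>\<^sup>2 * (mean_const * exp (2 * lam * t) * (1 / 2 + K / lam)))"
    using K0 lam_pos mean_const_pos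
    by (subst ennreal_mult[symmetric], simp, simp, subst ennreal_plus[symmetric]) (auto simp: field_simps)
  finally show ?thesis by (simp add: Q_def K_def)
qed

definition second_const :: real where
  "second_const = 2 * mean_const * (1 / 2 + rate_bound * (18 * mean_const\<^sup>2 * off_bound) / lam)"

lemma second_const_nonneg: "0 \<le> second_const"
  using mean_const_pos lam_pos by (simp add: second_const_def)

text \<open>Division by \<open>\<theta>\<^sup>2\<close> and Fatou's lemma as \<open>\<theta>\<close> tends to zero.\<close>

lemma second_moment_le:
  assumes t: "0 \<le> t"
  shows "(\<integral>\<^sup>+Z. ennreal ((real (size Z))\<^sup>2) \<partial>population t x) \<le> ennreal (second_const * exp (2 * lam * t))"
proof -
  let ?q = "\<lambda>n Z. (real (Suc n))\<^sup>2 * (exp (- (real (size Z) / real (Suc n))) - 1 + real (size Z) / real (Suc n))"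
  have m: "(\<lambda>Z. ennreal (h (real (size Z)))) \<in> borel_measurable (population t x)" for h
    by (subst measurable_cong_sets[OF sets_population refl]) (rule measurable_compose[OF measurable_size_atoms], simp)
  have "(\<integral>\<^sup>+Z. ennreal ((real (size Z))\<^sup>2 / 2) \<partial>population t x)
      = (\<integral>\<^sup>+Z. liminf (\<lambda>n. ennreal (?q n Z)) \<partial>population t x)"
    by (intro nn_integral_cong lim_imp_Liminf[symmetric] tendsto_ennrealI exp_curvature_tendsto) simp
  also have "\<dots> \<le> liminf (\<lambda>n. (\<integral>\<^sup>+Z. ennreal (?q n Z) \<partial>population t x))"
    by (rule nn_integral_liminf) (rule m)
  also have "\<dots> \<le> ennreal (second_const / 2 * exp (2 * lam * t))"
  proof (rule order_trans[OF Liminf_le_Limsup Limsup_bounded], simp, intro always_eventually allI)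
    fix n
    let ?N = "real (Suc n)"
    let ?C = "mean_const * exp (2 * lam * t) * (1 / 2 + rate_bound * (18 * mean_const\<^sup>2 * off_bound) / lam)"
    have C0: "0 \<le> ?C" using mean_const_pos lam_pos by simp
    have "(\<integral>\<^sup>+Z. ennreal (?q n Z) \<partial>population t x)
        = ennreal (?N\<^sup>2) * (\<integral>\<^sup>+Z. ennreal (exp (- (1 / ?N * size Z)) - 1 + 1 / ?N * size Z) \<partial>population t x)"
      by (subst nn_integral_cmult[symmetric])
         (auto intro!: nn_integral_cong m[of "\<lambda>r. exp (- (1 / ?N * r)) - 1 + 1 / ?N * r"] simp: ennreal_mult' simp del: of_nat_Suc)
    also have "\<dots> \<le> ennreal (?N\<^sup>2) * ennreal ((1 / ?N)\<^sup>2 * ?C)"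
      by (rule mult_left_mono[OF second_moment_laplace[OF t]]) auto
    also have "\<dots> = ennreal (?N\<^sup>2 * ((1 / ?N)\<^sup>2 * ?C))"
      by (rule ennreal_mult'[symmetric]) simp
    also have "?N\<^sup>2 * ((1 / ?N)\<^sup>2 * ?C) = ?C"
      by (simp only: mult.assoc[symmetric] power_mult_distrib[symmetric]) simp
    also have "?C = second_const / 2 * exp (2 * lam * t)" by (simp add: second_const_def)
    finally show "(\<integral>\<^sup>+Z. ennreal (?q n Z) \<partial>population t x) \<le> ennreal (second_const / 2 * exp (2 * lam * t))" .
  qed
  finally have *: "(\<integral>\<^sup>+Z. ennreal ((real (size Z))\<^sup>2 / 2) \<partial>population t x) \<le> ennreal (second_const / 2 * exp (2 * lam * t))" .
  have "(\<integral>\<^sup>+Z. ennreal ((real (size Z))\<^sup>2) \<partial>population t x) = (\<integral>\<^sup>+Z. 2 * ennreal ((real (size Z))\<^sup>2 / 2) \<partial>population t x)"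
    by (intro nn_integral_cong) (simp add: ennreal_mult'[symmetric] ennreal_numeral[symmetric] del: ennreal_numeral)
  also have "\<dots> = 2 * (\<integral>\<^sup>+Z. ennreal ((real (size Z))\<^sup>2 / 2) \<partial>population t x)"
    by (rule nn_integral_cmult) (rule m)
  also have "\<dots> \<le> 2 * ennreal (second_const / 2 * exp (2 * lam * t))"
    using * by (rule mult_left_mono) simp
  also have "\<dots> = ennreal (second_const * exp (2 * lam * t))"
    using second_const_nonneg by (simp add: ennreal_mult'[symmetric] ennreal_numeral[symmetric] del: ennreal_numeral)
  finally show ?thesis .
qed

end

section \<open>Branching and Markov properties for moments\<close>

text \<open>
  The second order Bonferroni inequality. Unlike \<open>remainder_bound\<close> it has the sharp constant
  \<open>1/2\<close>, so that second moments of a population are bounded with the exact square of the mean as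
  leading term.
\<close>

lemma remainder_le_square:
  assumes w: "\<And>z. 0 \<le> w z" "\<And>z. w z \<le> 1"
  shows "remainder w Z \<le> (\<Sum>z\<in>#Z. w z)\<^sup>2 / 2"
proof (induction Z)
  case (add x Z)
  let ?S = "\<Sum>z\<in>#Z. w z"
  have "1 - (\<Prod>z\<in>#Z. 1 - w z) \<le> ?S"
    using remainder_nonneg[of w Z] w by (simp add: remainder_def)
  then have "remainder w (add_mset x Z) \<le> ?S\<^sup>2 / 2 + w x * ?S"
    using add w(1)[of x] by (simp add: remainder_add add_mono mult_left_mono)
  also have "\<dots> \<le> (\<Sum>z\<in>#add_mset x Z. w z)\<^sup>2 / 2"
    by (simp add: power2_sum field_simps)
  finally show ?case .
qed simp

lemma tendsto_sum_mset:
  fixes g :: "nat \<Rightarrow> 'b \<Rightarrow> 'c::topological_comm_monoid_add"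
  assumes "\<And>z. (\<lambda>n. g n z) \<longlonglongrightarrow> h z"
  shows "(\<lambda>n. \<Sum>z\<in>#Z. g n z) \<longlonglongrightarrow> (\<Sum>z\<in>#Z. h z)"
  by (induction Z) (auto intro!: tendsto_add assms)

context branching_markov_process
begin

lemma space_law: "space (\<PP> \<mu>) = space F"
  by (rule sets_eq_imp_space_eq[OF sets_law])

lemma prob_space_transition: "0 \<le> t \<Longrightarrow> prob_space (transition \<PP> X t \<mu>)"
  unfolding transition_def by (intro prob_space.prob_space_distr prob measurable_process_law)

lemma sets_transition [simp, measurable_cong]: "sets (transition \<PP> X t \<mu>) = sets atomic_space"
  by (simp add: transition_def)

lemma measurable_transition:
  assumes "0 \<le> t"
  shows "transition \<PP> X t \<in> atomic_space \<rightarrow>\<^sub>M subprob_algebra atomic_space"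
proof -
  have "(\<lambda>\<mu>. (t, \<mu>)) \<in> atomic_space \<rightarrow>\<^sub>M restrict_space borel {0::real..} \<Otimes>\<^sub>M (atomic_space :: 'a multiset measure)"
    using assms by (intro measurable_Pair measurable_restrict_space2) auto
  from measurable_compose[OF this measurable_prob_algebraD[OF transition_kernel]] show ?thesis
    by simp
qed

lemma subalgebra_history:
  "subalgebra (\<PP> \<mu>) (history F X s)"
proof -
  have "sigma_sets (space F) {X u -` B \<inter> space F | u B. 0 \<le> u \<and> u \<le> s \<and> B \<in> sets atomic_space} \<subseteq> sets F"
    by (rule sets.sigma_sets_subset) (auto intro: measurable_sets process)
  then show ?thesis
    by (auto simp: subalgebra_def history_def space_law sets_measure_of_conv space_measure_of_conv)
qed

lemma measurable_history:
  assumes "0 \<le> u" "u \<le> s"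
  shows "X u \<in> history F X s \<rightarrow>\<^sub>M atomic_space"
proof (rule measurableI)
  fix B :: "'a multiset set" assume B: "B \<in> sets atomic_space"
  have "{X u -` B \<inter> space F | u B. 0 \<le> u \<and> u \<le> s \<and> B \<in> sets atomic_space} \<subseteq> Pow (space F)" by auto
  then show "X u -` B \<inter> space (history F X s) \<in> sets (history F X s)"
    using assms B unfolding history_def by (auto simp: sets_measure_of space_measure_of intro!: sigma_sets.Basic)
qed simp

text \<open>
  The Markov property says that two finite measures on the space of configurations agree on all
  sets; so they integrate all functions alike.
\<close>

lemma markov_set_integral:
  assumes s: "0 \<le> s" and t: "0 \<le> t" and A: "A \<in> sets (history F X s)"
    and h: "h \<in> borel_measurable atomic_space"
  shows "(\<integral>\<^sup>+\<omega>\<in>A. h (X (s + t) \<omega>) \<partial>\<PP> \<mu>) = (\<integral>\<^sup>+\<omega>\<in>A. (\<integral>\<^sup>+Z. h Z \<partial>transition \<PP> X t (X s \<omega>)) \<partial>\<PP> \<mu>)"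
proof -
  interpret prob_space "\<PP> \<mu>" by (rule prob)
  have A' [measurable]: "A \<in> sets (\<PP> \<mu>)" using A subalgebra_history[of \<mu> s] by (auto simp: subalgebra_def)
  note [measurable] = h measurable_process_law[of "s + t" \<mu>] measurable_process_law[OF s, of \<mu>] measurable_transition[OF t]
  have [measurable]: "X (s + t) \<in> \<PP> \<mu> \<rightarrow>\<^sub>M atomic_space" using s t by (intro measurable_process_law) simp
  let ?D = "density (\<PP> \<mu>) (indicator A)"
  let ?k = "\<lambda>\<omega>. transition \<PP> X t (X s \<omega>)"
  have k: "?k \<in> ?D \<rightarrow>\<^sub>M subprob_algebra atomic_space" by measurable
  have ne: "space ?D \<noteq> {}" using not_empty by simp
  have "distr ?D atomic_space (X (s + t)) = ?D \<bind> ?k"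
  proof (rule measure_eqI)
    show "sets (distr ?D atomic_space (X (s + t))) = sets (?D \<bind> ?k)"
      using ne by (simp add: sets_bind[OF sets_kernel[OF k]])
  next
    fix B assume "B \<in> sets (distr ?D atomic_space (X (s + t)))"
    then have B [measurable]: "B \<in> sets atomic_space" by simp
    let ?S = "X (s + t) -` B \<inter> space (\<PP> \<mu>)"
    have S [measurable]: "?S \<in> sets (\<PP> \<mu>)" by measurable
    have "emeasure (distr ?D atomic_space (X (s + t))) B = emeasure ?D ?S"
      by (subst emeasure_distr) auto
    also have "\<dots> = (\<integral>\<^sup>+\<omega>. indicator (A \<inter> ?S) \<omega> \<partial>\<PP> \<mu>)"
      by (subst emeasure_density[OF _ S]) (auto simp: indicator_inter_arith[symmetric])
    also have "\<dots> = emeasure (\<PP> \<mu>) (A \<inter> ?S)" by (rule nn_integral_indicator) measurable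
    also have "\<dots> = emeasure (\<PP> \<mu>) (A \<inter> X (s + t) -` B)"
      using sets.sets_into_space[OF A'] by (intro arg_cong[where f = "emeasure (\<PP> \<mu>)"]) auto
    also have "\<dots> = (\<integral>\<^sup>+\<omega>\<in>A. emeasure (?k \<omega>) B \<partial>\<PP> \<mu>)" by (rule markov[OF s t A B])
    also have "\<dots> = (\<integral>\<^sup>+\<omega>. emeasure (?k \<omega>) B \<partial>?D)"
      by (subst nn_integral_density) (auto simp: mult.commute intro!: measurable_emeasure_kernel[OF _ B])
    also have "\<dots> = emeasure (?D \<bind> ?k) B" by (rule emeasure_bind[symmetric, OF ne k B])
    finally show "emeasure (distr ?D atomic_space (X (s + t))) B = emeasure (?D \<bind> ?k) B" .
  qed
  then have "(\<integral>\<^sup>+Z. h Z \<partial>distr ?D atomic_space (X (s + t))) = (\<integral>\<^sup>+Z. h Z \<partial>(?D \<bind> ?k))" by simp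
  then show ?thesis
    by (simp add: nn_integral_distr nn_integral_bind[OF h k] nn_integral_density mult.commute)
qed

text \<open>
  The same passage, now on the space carrying the process: two densities have the same
  restriction to the history.
\<close>

lemma markov_product_integral:
  assumes s: "0 \<le> s" and t: "0 \<le> t" and g: "g \<in> borel_measurable (history F X s)"
    and h: "h \<in> borel_measurable atomic_space"
  shows "(\<integral>\<^sup>+\<omega>. g \<omega> * h (X (s + t) \<omega>) \<partial>\<PP> \<mu>) = (\<integral>\<^sup>+\<omega>. g \<omega> * (\<integral>\<^sup>+Z. h Z \<partial>transition \<PP> X t (X s \<omega>)) \<partial>\<PP> \<mu>)"
proof -
  note sub = subalgebra_history[of \<mu> s]
  note [measurable] = h measurable_process_law[OF s, of \<mu>] measurable_transition[OF t]
  have [measurable]: "X (s + t) \<in> \<PP> \<mu> \<rightarrow>\<^sub>M atomic_space" using s t by (intro measurable_process_law) simp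
  have g' [measurable]: "g \<in> borel_measurable (\<PP> \<mu>)" using measurable_from_subalg[OF sub g] .
  let ?u = "\<lambda>\<omega>. h (X (s + t) \<omega>)"
  let ?v = "\<lambda>\<omega>. \<integral>\<^sup>+Z. h Z \<partial>transition \<PP> X t (X s \<omega>)"
  have v [measurable]: "?v \<in> borel_measurable (\<PP> \<mu>)" by measurable
  have sub': "subalgebra (density (\<PP> \<mu>) k) (history F X s)" for k
    using sub by (simp add: subalgebra_def)
  have "restr_to_subalg (density (\<PP> \<mu>) ?u) (history F X s) = restr_to_subalg (density (\<PP> \<mu>) ?v) (history F X s)"
  proof (rule measure_eqI)
    fix A assume "A \<in> sets (restr_to_subalg (density (\<PP> \<mu>) ?u) (history F X s))"
    then have A: "A \<in> sets (history F X s)" by (simp add: sets_restr_to_subalg[OF sub'])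
    then have A' [measurable]: "A \<in> sets (\<PP> \<mu>)" using sub by (auto simp: subalgebra_def)
    have "emeasure (density (\<PP> \<mu>) ?u) A = (\<integral>\<^sup>+\<omega>\<in>A. ?u \<omega> \<partial>\<PP> \<mu>)"
      by (rule emeasure_density) measurable
    moreover have "emeasure (density (\<PP> \<mu>) ?v) A = (\<integral>\<^sup>+\<omega>\<in>A. ?v \<omega> \<partial>\<PP> \<mu>)"
      by (rule emeasure_density) measurable
    ultimately show "emeasure (restr_to_subalg (density (\<PP> \<mu>) ?u) (history F X s)) A
        = emeasure (restr_to_subalg (density (\<PP> \<mu>) ?v) (history F X s)) A"
      unfolding emeasure_restr_to_subalg[OF sub' A] by (simp only: markov_set_integral[OF s t A h])
  qed (simp add: sets_restr_to_subalg[OF sub'])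
  then have "(\<integral>\<^sup>+\<omega>. g \<omega> \<partial>restr_to_subalg (density (\<PP> \<mu>) ?u) (history F X s))
      = (\<integral>\<^sup>+\<omega>. g \<omega> \<partial>restr_to_subalg (density (\<PP> \<mu>) ?v) (history F X s))" by simp
  then show ?thesis
    unfolding nn_integral_subalgebra2[OF sub' g]
    by (simp add: nn_integral_density mult.commute)
qed

end

context supercritical_branching
begin

lemma second_moment_sum_le:
  assumes f: "f \<in> bfun_nonneg" "\<And>y. f y \<le> A" and t: "0 \<le> t"
  shows "(\<integral>\<^sup>+Z. ennreal ((\<Sum>z\<in>#Z. f z)\<^sup>2) \<partial>population t x) \<le> ennreal (A\<^sup>2 * second_const * exp (2 * lam * t))"
proof -
  have "(\<integral>\<^sup>+Z. ennreal ((\<Sum>z\<in>#Z. f z)\<^sup>2) \<partial>population t x) \<le> (\<integral>\<^sup>+Z. ennreal (A\<^sup>2) * ennreal ((real (size Z))\<^sup>2) \<partial>population t x)"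
  proof (intro nn_integral_mono)
    fix Z
    have "(\<Sum>z\<in>#Z. f z)\<^sup>2 \<le> (A * real (size Z))\<^sup>2"
      using sum_atoms_le[of f A Z] f by (intro power_mono) (auto simp: sum_mset_nonneg bfun_nonneg_pos)
    then show "ennreal ((\<Sum>z\<in>#Z. f z)\<^sup>2) \<le> ennreal (A\<^sup>2) * ennreal ((real (size Z))\<^sup>2)"
      by (subst ennreal_mult'[symmetric]) (auto simp: power_mult_distrib intro!: ennreal_leI)
  qed
  also have "\<dots> = ennreal (A\<^sup>2) * (\<integral>\<^sup>+Z. ennreal ((real (size Z))\<^sup>2) \<partial>population t x)"
    by (rule nn_integral_cmult) (simp cong: measurable_cong_sets)
  also have "\<dots> \<le> ennreal (A\<^sup>2) * ennreal (second_const * exp (2 * lam * t))"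
    by (intro mult_left_mono second_moment_le t) simp
  finally show ?thesis by (simp add: ennreal_mult'[symmetric] mult.assoc)
qed

lemma measurable_mean_semigroup:
  assumes f: "f \<in> bfun_nonneg" and t: "0 \<le> t"
  shows "mean_semigroup \<PP> X t f \<in> borel_measurable borel"
proof -
  have [measurable]: "f \<in> borel_measurable borel" using f by (rule bfun_nonneg_measurable)
  have "mean_semigroup \<PP> X t f = (\<lambda>x. enn2real (mean_sum t (\<lambda>z. ennreal (f z)) x))"
    using ennreal_mean_semigroup(1,2)[OF f t] by (auto simp: fun_eq_iff) (metis enn2real_ennreal)
  then show ?thesis by simp
qed

lemma mean_semigroup_le:
  assumes f: "f \<in> bfun_nonneg" "\<And>y. f y \<le> A" and t: "0 \<le> t"
  shows "mean_semigroup \<PP> X t f x \<le> A * (mean_const * exp (lam * t))"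
proof -
  have A: "0 \<le> A" using f bfun_nonneg_pos order_trans by blast
  have "ennreal (mean_semigroup \<PP> X t f x) \<le> ennreal (A * (mean_const * exp (lam * t)))"
    unfolding ennreal_mean_semigroup(1)[OF f(1) t] using f A t
    by (intro mean_sum_growth ennreal_leI) auto
  then show ?thesis using A mean_const_pos by (subst (asm) ennreal_le_iff) auto
qed

lemma mean_semigroup_bfun_nonneg:
  assumes f: "f \<in> bfun_nonneg" and t: "0 \<le> t"
  shows "mean_semigroup \<PP> X t f \<in> bfun_nonneg"
proof -
  obtain a where a: "\<And>y. f y \<le> a"
    using f by (auto simp: bfun_nonneg_def bfun_def bounded_iff intro: order_trans[OF abs_ge_self])
  have "\<bar>mean_semigroup \<PP> X t f x\<bar> \<le> a * (mean_const * exp (lam * t))" for x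
    using mean_semigroup_le[OF f a t, of x] ennreal_mean_semigroup(2)[OF f t, of x] by simp
  then show ?thesis
    using measurable_mean_semigroup[OF f t] ennreal_mean_semigroup(2)[OF f t]
    by (auto simp: bfun_nonneg_def bfun_def intro!: boundedI)
qed

lemma exp_functional_atoms:
  assumes f: "f \<in> bfun_nonneg" and t: "0 \<le> t"
  shows "(\<integral>Z. exp (- (\<Sum>z\<in>#Z. f z)) \<partial>transition \<PP> X t \<mu>) = (\<Prod>x\<in>#\<mu>. 1 - laplace_gap f t x)"
proof -
  have [measurable]: "f \<in> borel_measurable borel" using f by (rule bfun_nonneg_measurable)
  have "(\<integral>Z. exp (- (\<Sum>z\<in>#Z. f z)) \<partial>transition \<PP> X t \<mu>) = exp_functional \<PP> X t f \<mu>"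
    unfolding exp_functional_def transition_def
    by (rule integral_distr) (auto intro!: measurable_process_law t)
  also have "\<dots> = (\<Prod>x\<in>#\<mu>. 1 - laplace_gap f t x)"
    using t by (subst branching[OF t f]) (simp add: laplace_gap_def)
  finally show ?thesis .
qed

lemma laplace_gap_scaled_le:
  assumes f: "f \<in> bfun_nonneg" and t: "0 \<le> t" and c: "0 \<le> c"
  shows "laplace_gap (\<lambda>y. c * f y) t x \<le> c * mean_semigroup \<PP> X t f x"
    and "c * mean_semigroup \<PP> X t f x - laplace_gap (\<lambda>y. c * f y) t x
      = (\<integral>\<omega>. exp (- (c * (\<Sum>z\<in>#X t \<omega>. f z))) - 1 + c * (\<Sum>z\<in>#X t \<omega>. f z) \<partial>\<PP> {#x#})"
proof -
  interpret prob_space "\<PP> {#x#}" by (rule prob)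
  have cf: "(\<lambda>y. c * f y) \<in> bfun_nonneg" by (rule bfun_nonneg_scale[OF f c])
  have [measurable]: "f \<in> borel_measurable borel" using f by (rule bfun_nonneg_measurable)
  note [measurable] = measurable_process_law[OF t]
  have s0: "0 \<le> c * (\<Sum>z\<in>#X t \<omega>. f z)" for \<omega> using c by (simp add: sum_mset_nonneg bfun_nonneg_pos[OF f])
  have int: "integrable (\<PP> {#x#}) (\<lambda>\<omega>. exp (- (c * (\<Sum>z\<in>#X t \<omega>. f z))))"
    by (rule integrable_const_bound[where B = 1]) (use s0 in auto)
  have "laplace_gap (\<lambda>y. c * f y) t x = 1 - (\<integral>\<omega>. exp (- (c * (\<Sum>z\<in>#X t \<omega>. f z))) \<partial>\<PP> {#x#})"
    using t by (simp add: laplace_gap_def exp_functional_def sum_mset_distrib_left)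
  then show eq: "c * mean_semigroup \<PP> X t f x - laplace_gap (\<lambda>y. c * f y) t x
      = (\<integral>\<omega>. exp (- (c * (\<Sum>z\<in>#X t \<omega>. f z))) - 1 + c * (\<Sum>z\<in>#X t \<omega>. f z) \<partial>\<PP> {#x#})"
    using int ennreal_mean_semigroup(3)[OF f t] by (simp add: mean_semigroup_def prob_space)
  have "0 \<le> (\<integral>\<omega>. exp (- (c * (\<Sum>z\<in>#X t \<omega>. f z))) - 1 + c * (\<Sum>z\<in>#X t \<omega>. f z) \<partial>\<PP> {#x#})"
    using s0 by (intro Bochner_Integration.integral_nonneg exp_second_order(1))
  then show "laplace_gap (\<lambda>y. c * f y) t x \<le> c * mean_semigroup \<PP> X t f x"
    using eq by simp
qed

text \<open>
  The branching property is available for Laplace functionals only, and is differentiated at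
  zero. The derivative of the product over the initial particles is the sum, because the
  remainder of the product is of second order.
\<close>

lemma mean_atoms:
  assumes f: "f \<in> bfun_nonneg" and t: "0 \<le> t"
  shows "(\<integral>\<^sup>+Z. ennreal (\<Sum>z\<in>#Z. f z) \<partial>transition \<PP> X t \<mu>) = ennreal (\<Sum>x\<in>#\<mu>. mean_semigroup \<PP> X t f x)"
proof -
  interpret prob_space "transition \<PP> X t \<mu>" by (rule prob_space_transition[OF t])
  have [measurable]: "f \<in> borel_measurable borel" using f by (rule bfun_nonneg_measurable)
  obtain a where a: "\<And>y. f y \<le> a"
    using f by (auto simp: bfun_nonneg_def bfun_def bounded_iff intro: order_trans[OF abs_ge_self])
  have s0: "0 \<le> (\<Sum>z\<in>#Z. f z)" for Z by (simp add: sum_mset_nonneg bfun_nonneg_pos[OF f])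
  let ?c = "\<lambda>n. 1 / real (Suc n)"
  let ?w = "\<lambda>n. laplace_gap (\<lambda>y. ?c n * f y) t"
  let ?u = "\<lambda>n Z. real (Suc n) * (1 - exp (- ((\<Sum>z\<in>#Z. f z) / real (Suc n))))"
  have cf: "(\<lambda>y. ?c n * f y) \<in> bfun_nonneg" for n by (rule bfun_nonneg_scale[OF f]) simp
  have w01: "0 \<le> ?w n y" "?w n y \<le> 1" for n y
    using laplace_gap_nonneg[OF cf] less_imp_le[OF laplace_gap_less_1[OF cf]] by auto
  have u: "(\<integral>\<^sup>+Z. ennreal (?u n Z) \<partial>transition \<PP> X t \<mu>) = ennreal (real (Suc n) * ((\<Sum>x\<in>#\<mu>. ?w n x) - remainder (?w n) \<mu>))" for n
  proof -
    have s: "(\<Sum>z\<in>#Z. ?c n * f z) = (\<Sum>z\<in>#Z. f z) / real (Suc n)" for Z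
      by (simp only: sum_mset_distrib_left[symmetric]) simp
    have int: "integrable (transition \<PP> X t \<mu>) (\<lambda>Z. exp (- ((\<Sum>z\<in>#Z. f z) / real (Suc n))))"
      by (rule integrable_const_bound[where B = 1]) (use s0 in \<open>auto simp: divide_nonneg_pos\<close>)
    have "(\<integral>\<^sup>+Z. ennreal (?u n Z) \<partial>transition \<PP> X t \<mu>) = ennreal (\<integral>Z. ?u n Z \<partial>transition \<PP> X t \<mu>)"
      using int s0 by (intro nn_integral_eq_integral) (auto simp del: of_nat_Suc simp: divide_nonneg_pos)
    also have "(\<integral>Z. ?u n Z \<partial>transition \<PP> X t \<mu>) = real (Suc n) * (1 - (\<Prod>x\<in>#\<mu>. 1 - ?w n x))"
      using int unfolding exp_functional_atoms[OF cf t, symmetric] s by (simp add: prob_space del: of_nat_Suc)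
    finally show ?thesis by (simp add: remainder_def)
  qed
  have lim_u: "(\<lambda>n. ennreal (?u n Z)) \<longlonglongrightarrow> ennreal (\<Sum>z\<in>#Z. f z)" for Z
    by (intro tendsto_ennrealI exp_secant_tendsto)
  have lim: "(\<lambda>n. ennreal (real (Suc n) * ((\<Sum>x\<in>#\<mu>. ?w n x) - remainder (?w n) \<mu>)))
      \<longlonglongrightarrow> ennreal ((\<Sum>x\<in>#\<mu>. mean_semigroup \<PP> X t f x) - 0)"
    unfolding right_diff_distrib
  proof (intro tendsto_ennrealI tendsto_diff)
    have sg: "(\<lambda>n. scaled_gap f n t x) \<longlonglongrightarrow> mean_semigroup \<PP> X t f x" for x
    proof (rule tendsto_ennrealD)
      show "(\<lambda>n. ennreal (scaled_gap f n t x)) \<longlonglongrightarrow> ennreal (mean_semigroup \<PP> X t f x)"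
        using scaled_gap_tendsto[OF f t] by (simp add: ennreal_mean_semigroup(1)[OF f t])
      show "\<forall>\<^sub>F n in sequentially. 0 \<le> scaled_gap f n t x"
        unfolding scaled_gap_def by (intro always_eventually allI mult_nonneg_nonneg laplace_gap_nonneg cf) simp
    qed (rule ennreal_mean_semigroup(2)[OF f t])
    show "(\<lambda>n. real (Suc n) * (\<Sum>x\<in>#\<mu>. ?w n x)) \<longlonglongrightarrow> (\<Sum>x\<in>#\<mu>. mean_semigroup \<PP> X t f x)"
      using tendsto_sum_mset[OF sg, where Z = \<mu>] by (simp add: scaled_gap_def sum_mset_distrib_left)
    define E where "E = 2 * a * exp (2 * growth * t)"
    have wE: "?w n y \<le> ?c n * E" for n y
    proof -
      have "?w n y \<le> 2 * (?c n * a) * exp (2 * growth * t)"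
        by (rule laplace_gap_le[OF cf _ t]) (intro mult_left_mono a, simp)
      also have "\<dots> = ?c n * E" by (simp add: E_def)
      finally show ?thesis .
    qed
    have bound: "\<bar>real (Suc n) * remainder (?w n) \<mu>\<bar> \<le> ?c n * ((real (size \<mu>))\<^sup>2 * E\<^sup>2)" for n
    proof -
      have "\<bar>remainder (?w n) \<mu>\<bar> \<le> (real (size \<mu>))\<^sup>2 * (?c n * E)\<^sup>2 * 1 ^ size \<mu>"
        using w01 wE by (intro remainder_bound) (auto simp: abs_le_iff)
      then have "real (Suc n) * \<bar>remainder (?w n) \<mu>\<bar> \<le> real (Suc n) * ((real (size \<mu>))\<^sup>2 * (?c n * E)\<^sup>2 * 1 ^ size \<mu>)"
        by (rule mult_left_mono) simp
      also have "\<dots> = (real (Suc n) * (?c n)\<^sup>2) * ((real (size \<mu>))\<^sup>2 * E\<^sup>2)"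
        by (simp only: power_mult_distrib power_one mult_1_right ac_simps)
      also have "real (Suc n) * (?c n)\<^sup>2 = ?c n" by (simp add: power2_eq_square)
      finally show ?thesis by (simp only: abs_mult abs_of_nat)
    qed
    have "(\<lambda>n. ?c n * ((real (size \<mu>))\<^sup>2 * E\<^sup>2)) \<longlonglongrightarrow> 0 * ((real (size \<mu>))\<^sup>2 * E\<^sup>2)"
      by (intro tendsto_mult tendsto_const) real_asymp
    then have "(\<lambda>n. ?c n * ((real (size \<mu>))\<^sup>2 * E\<^sup>2)) \<longlonglongrightarrow> 0" by simp
    then show "(\<lambda>n. real (Suc n) * remainder (?w n) \<mu>) \<longlonglongrightarrow> 0"
      by (rule Lim_null_comparison[OF always_eventually, rotated]) (unfold real_norm_def, intro allI bound)
  qed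
  have "(\<integral>\<^sup>+Z. ennreal (\<Sum>z\<in>#Z. f z) \<partial>transition \<PP> X t \<mu>) = (\<integral>\<^sup>+Z. liminf (\<lambda>n. ennreal (?u n Z)) \<partial>transition \<PP> X t \<mu>)"
    by (intro nn_integral_cong lim_imp_Liminf[symmetric] lim_u) simp
  also have "\<dots> \<le> liminf (\<lambda>n. \<integral>\<^sup>+Z. ennreal (?u n Z) \<partial>transition \<PP> X t \<mu>)"
    by (rule nn_integral_liminf) measurable
  also have "\<dots> = ennreal ((\<Sum>x\<in>#\<mu>. mean_semigroup \<PP> X t f x) - 0)"
    unfolding u by (rule lim_imp_Liminf[OF _ lim]) simp
  \<comment> \<open>finiteness, from Fatou, is needed before dominated convergence can give equality\<close>
  finally have fin: "(\<integral>\<^sup>+Z. ennreal (\<Sum>z\<in>#Z. f z) \<partial>transition \<PP> X t \<mu>) < \<infinity>"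
    by (rule le_less_trans) simp
  have "(\<lambda>n. \<integral>\<^sup>+Z. ennreal (?u n Z) \<partial>transition \<PP> X t \<mu>) \<longlonglongrightarrow> (\<integral>\<^sup>+Z. ennreal (\<Sum>z\<in>#Z. f z) \<partial>transition \<PP> X t \<mu>)"
  proof (rule nn_integral_dominated_convergence[where w = "\<lambda>Z. ennreal (\<Sum>z\<in>#Z. f z)"])
    show "AE Z in transition \<PP> X t \<mu>. ennreal (?u n Z) \<le> ennreal (\<Sum>z\<in>#Z. f z)" for n
    proof (intro AE_I2 ennreal_leI)
      fix Z
      have "?u n Z \<le> real (Suc n) * ((\<Sum>z\<in>#Z. f z) / real (Suc n))"
        by (intro mult_left_mono one_minus_exp_le) simp
      then show "?u n Z \<le> (\<Sum>z\<in>#Z. f z)" by simp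
    qed
    show "AE Z in transition \<PP> X t \<mu>. (\<lambda>n. ennreal (?u n Z)) \<longlonglongrightarrow> ennreal (\<Sum>z\<in>#Z. f z)"
      by (rule AE_I2) (rule lim_u)
    show "(\<integral>\<^sup>+Z. ennreal (\<Sum>z\<in>#Z. f z) \<partial>transition \<PP> X t \<mu>) < \<infinity>" by (rule fin)
  qed measurable
  from LIMSEQ_unique[OF this[unfolded u] lim] show ?thesis by simp
qed

section \<open>Fluctuations around the conditional mean\<close>

text \<open>
  Particles reproduce independently, so their variances add up: the excess over the squared mean
  is linear in the size of \<open>\<mu>\<close>. The proof takes the second order part of the Laplace transform
  of the sum and writes the product over the initial particles as one minus the sum of the gaps
  plus a remainder: the remainder is bounded by half a square, and each particle contributes its
  own second order part, bounded by its second moment.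
\<close>

lemma second_moment_atoms:
  assumes f: "f \<in> bfun_nonneg" "\<And>y. f y \<le> A" and t: "0 \<le> t"
  shows "(\<integral>\<^sup>+Z. ennreal ((\<Sum>z\<in>#Z. f z)\<^sup>2) \<partial>transition \<PP> X t \<mu>)
    \<le> ennreal ((\<Sum>x\<in>#\<mu>. mean_semigroup \<PP> X t f x)\<^sup>2 + A\<^sup>2 * second_const * exp (2 * lam * t) * size \<mu>)"
proof -
  interpret T: prob_space "transition \<PP> X t \<mu>" by (rule prob_space_transition[OF t])
  have [measurable]: "f \<in> borel_measurable borel" using f(1) by (rule bfun_nonneg_measurable)
  note [measurable] = measurable_process_law[OF t]
  have s0: "0 \<le> (\<Sum>z\<in>#Z. f z)" for Z by (simp add: sum_mset_nonneg bfun_nonneg_pos[OF f(1)])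
  define V where "V = A\<^sup>2 * second_const * exp (2 * lam * t)"
  have V0: "0 \<le> V" using second_const_nonneg by (simp add: V_def)
  let ?c = "\<lambda>n. 1 / real (Suc n)"
  let ?w = "\<lambda>n. laplace_gap (\<lambda>y. ?c n * f y) t"
  let ?m = "mean_semigroup \<PP> X t f"
  let ?S = "\<Sum>x\<in>#\<mu>. ?m x"
  let ?q = "\<lambda>n Z. (real (Suc n))\<^sup>2 * (exp (- ((\<Sum>z\<in>#Z. f z) / real (Suc n))) - 1 + (\<Sum>z\<in>#Z. f z) / real (Suc n))"
  have cf: "(\<lambda>y. ?c n * f y) \<in> bfun_nonneg" for n by (rule bfun_nonneg_scale[OF f(1)]) simp
  have w01: "0 \<le> ?w n y" "?w n y \<le> 1" for n y
    using laplace_gap_nonneg[OF cf] less_imp_le[OF laplace_gap_less_1[OF cf]] by auto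
  have int_sum: "integrable (transition \<PP> X t \<mu>) (\<lambda>Z. \<Sum>z\<in>#Z. f z)"
    using mean_atoms[OF f(1) t, of \<mu>] s0 by (intro integrableI_nonneg) auto
  have eq_sum: "(\<integral>Z. (\<Sum>z\<in>#Z. f z) \<partial>transition \<PP> X t \<mu>) = ?S"
    using mean_atoms[OF f(1) t, of \<mu>] nn_integral_eq_integral[OF int_sum] s0 ennreal_mean_semigroup(2)[OF f(1) t]
    by (auto simp: sum_mset_nonneg)
  have gap: "?c n * ?m x - ?w n x \<le> (?c n)\<^sup>2 * (V / 2)" for n x
  proof -
    interpret prob_space "\<PP> {#x#}" by (rule prob)
    have Y0: "0 \<le> ?c n * (\<Sum>z\<in>#X t \<omega>. f z)" for \<omega> using s0 by simp
    have nn: "(\<integral>\<^sup>+\<omega>. ennreal ((\<Sum>z\<in>#X t \<omega>. f z)\<^sup>2) \<partial>\<PP> {#x#}) \<le> ennreal V"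
      using second_moment_sum_le[OF f t, of x] by (subst (asm) nn_integral_population[OF _ t]) (auto simp: V_def)
    have int2: "integrable (\<PP> {#x#}) (\<lambda>\<omega>. (\<Sum>z\<in>#X t \<omega>. f z)\<^sup>2)"
      using nn by (intro integrableI_nonneg) (auto intro: le_less_trans)
    have le2: "(\<integral>\<omega>. (\<Sum>z\<in>#X t \<omega>. f z)\<^sup>2 \<partial>\<PP> {#x#}) \<le> V"
      using nn V0 by (subst (asm) nn_integral_eq_integral[OF int2]) auto
    have "?c n * ?m x - ?w n x = (\<integral>\<omega>. exp (- (?c n * (\<Sum>z\<in>#X t \<omega>. f z))) - 1 + ?c n * (\<Sum>z\<in>#X t \<omega>. f z) \<partial>\<PP> {#x#})"
      by (rule laplace_gap_scaled_le(2)[OF f(1) t]) simp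
    also have "\<dots> \<le> (\<integral>\<omega>. (?c n)\<^sup>2 / 2 * (\<Sum>z\<in>#X t \<omega>. f z)\<^sup>2 \<partial>\<PP> {#x#})"
    proof (rule integral_mono)
      have "integrable (\<PP> {#x#}) (\<lambda>\<omega>. exp (- (?c n * (\<Sum>z\<in>#X t \<omega>. f z))))"
        by (rule integrable_const_bound[where B = 1]) (use Y0 in auto)
      then show "integrable (\<PP> {#x#}) (\<lambda>\<omega>. exp (- (?c n * (\<Sum>z\<in>#X t \<omega>. f z))) - 1 + ?c n * (\<Sum>z\<in>#X t \<omega>. f z))"
        using ennreal_mean_semigroup(3)[OF f(1) t] by simp
      show "integrable (\<PP> {#x#}) (\<lambda>\<omega>. (?c n)\<^sup>2 / 2 * (\<Sum>z\<in>#X t \<omega>. f z)\<^sup>2)" using int2 by simp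
      show "exp (- (?c n * (\<Sum>z\<in>#X t \<omega>. f z))) - 1 + ?c n * (\<Sum>z\<in>#X t \<omega>. f z) \<le> (?c n)\<^sup>2 / 2 * (\<Sum>z\<in>#X t \<omega>. f z)\<^sup>2" for \<omega>
        using exp_second_order(2)[OF Y0, of \<omega>] unfolding power_mult_distrib by (simp only: times_divide_eq_left)
    qed
    also have "\<dots> \<le> (?c n)\<^sup>2 / 2 * V"
      unfolding integral_mult_right_zero using le2 by (intro mult_left_mono) auto
    finally show ?thesis by simp
  qed
  have int_q: "(\<integral>\<^sup>+Z. ennreal (?q n Z) \<partial>transition \<PP> X t \<mu>) \<le> ennreal ((?S\<^sup>2 + V * size \<mu>) / 2)" for n
  proof -
    have s: "(\<Sum>z\<in>#Z. ?c n * f z) = (\<Sum>z\<in>#Z. f z) / real (Suc n)" for Z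
      by (simp only: sum_mset_distrib_left[symmetric]) simp
    have int: "integrable (transition \<PP> X t \<mu>) (\<lambda>Z. exp (- ((\<Sum>z\<in>#Z. f z) / real (Suc n))))"
      by (rule T.integrable_const_bound[where B = 1]) (use s0 in \<open>auto simp: divide_nonneg_pos\<close>)
    have q0: "0 \<le> ?q n Z" for Z
      using s0 by (intro mult_nonneg_nonneg exp_second_order(1)) (auto simp: divide_nonneg_pos)
    have "(\<integral>\<^sup>+Z. ennreal (?q n Z) \<partial>transition \<PP> X t \<mu>) = ennreal (\<integral>Z. ?q n Z \<partial>transition \<PP> X t \<mu>)"
      using int int_sum by (intro nn_integral_eq_integral AE_I2 q0) (auto simp del: of_nat_Suc)
    also have "(\<integral>Z. ?q n Z \<partial>transition \<PP> X t \<mu>) = (real (Suc n))\<^sup>2 * ((\<Prod>x\<in>#\<mu>. 1 - ?w n x) - 1 + ?S / real (Suc n))"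
      using int int_sum unfolding exp_functional_atoms[OF cf t, symmetric] s
      by (simp add: T.prob_space eq_sum del: of_nat_Suc)
    finally have eq: "(\<integral>\<^sup>+Z. ennreal (?q n Z) \<partial>transition \<PP> X t \<mu>)
        = ennreal ((real (Suc n))\<^sup>2 * ((\<Prod>x\<in>#\<mu>. 1 - ?w n x) - 1 + ?S / real (Suc n)))" .
    have "(\<Prod>x\<in>#\<mu>. 1 - ?w n x) - 1 + ?S / real (Suc n) = remainder (?w n) \<mu> + (\<Sum>x\<in>#\<mu>. ?c n * ?m x - ?w n x)"
      by (simp only: remainder_def sum_mset_subtractf sum_mset_distrib_left[symmetric]) simp
    also have "\<dots> \<le> (?c n)\<^sup>2 * (?S\<^sup>2 / 2) + (?c n)\<^sup>2 * (V / 2) * size \<mu>"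
    proof (rule add_mono)
      have "remainder (?w n) \<mu> \<le> (\<Sum>x\<in>#\<mu>. ?w n x)\<^sup>2 / 2"
        by (rule remainder_le_square[OF w01])
      also have "\<dots> \<le> (\<Sum>x\<in>#\<mu>. ?c n * ?m x)\<^sup>2 / 2"
        using laplace_gap_scaled_le(1)[OF f(1) t, of "?c n"] w01
        by (intro divide_right_mono power_mono sum_mset_mono sum_mset_nonneg) auto
      also have "\<dots> = (?c n)\<^sup>2 * (?S\<^sup>2 / 2)"
        by (simp only: sum_mset_distrib_left[symmetric] power_mult_distrib times_divide_eq_right)
      finally show "remainder (?w n) \<mu> \<le> (?c n)\<^sup>2 * (?S\<^sup>2 / 2)" .
      show "(\<Sum>x\<in>#\<mu>. ?c n * ?m x - ?w n x) \<le> (?c n)\<^sup>2 * (V / 2) * size \<mu>"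
        by (rule sum_atoms_le) (rule gap)
    qed
    finally have le: "(\<Prod>x\<in>#\<mu>. 1 - ?w n x) - 1 + ?S / real (Suc n)
        \<le> (?c n)\<^sup>2 * (?S\<^sup>2 / 2) + (?c n)\<^sup>2 * (V / 2) * size \<mu>" .
    have arith: "p * (q * (u / 2) + q * (v / 2) * k) = (p * q) * ((u + v * k) / 2)" for p q u v k :: real
      by (simp add: field_simps)
    have "(\<integral>\<^sup>+Z. ennreal (?q n Z) \<partial>transition \<PP> X t \<mu>)
        \<le> ennreal ((real (Suc n))\<^sup>2 * ((?c n)\<^sup>2 * (?S\<^sup>2 / 2) + (?c n)\<^sup>2 * (V / 2) * size \<mu>))"
      unfolding eq by (intro ennreal_leI mult_left_mono le zero_le_power2)
    also have "(real (Suc n))\<^sup>2 * ((?c n)\<^sup>2 * (?S\<^sup>2 / 2) + (?c n)\<^sup>2 * (V / 2) * size \<mu>)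
        = ((real (Suc n))\<^sup>2 * (?c n)\<^sup>2) * ((?S\<^sup>2 + V * size \<mu>) / 2)"
      by (rule arith)
    also have "(real (Suc n))\<^sup>2 * (?c n)\<^sup>2 = 1" by (simp only: power_mult_distrib[symmetric]) simp
    finally show ?thesis unfolding mult_1_left .
  qed
  have "(\<integral>\<^sup>+Z. ennreal ((\<Sum>z\<in>#Z. f z)\<^sup>2 / 2) \<partial>transition \<PP> X t \<mu>)
      = (\<integral>\<^sup>+Z. liminf (\<lambda>n. ennreal (?q n Z)) \<partial>transition \<PP> X t \<mu>)"
    by (intro nn_integral_cong lim_imp_Liminf[symmetric] tendsto_ennrealI exp_curvature_tendsto) simp
  also have "\<dots> \<le> liminf (\<lambda>n. (\<integral>\<^sup>+Z. ennreal (?q n Z) \<partial>transition \<PP> X t \<mu>))"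
    by (rule nn_integral_liminf) measurable
  also have "\<dots> \<le> ennreal ((?S\<^sup>2 + V * size \<mu>) / 2)"
    by (rule order_trans[OF Liminf_le_Limsup Limsup_bounded], simp, intro always_eventually allI int_q)
  finally have half: "(\<integral>\<^sup>+Z. ennreal ((\<Sum>z\<in>#Z. f z)\<^sup>2 / 2) \<partial>transition \<PP> X t \<mu>) \<le> ennreal ((?S\<^sup>2 + V * size \<mu>) / 2)" .
  have "(\<integral>\<^sup>+Z. ennreal ((\<Sum>z\<in>#Z. f z)\<^sup>2) \<partial>transition \<PP> X t \<mu>)
      = (\<integral>\<^sup>+Z. ennreal 2 * ennreal ((\<Sum>z\<in>#Z. f z)\<^sup>2 / 2) \<partial>transition \<PP> X t \<mu>)"
    by (intro nn_integral_cong) (subst ennreal_mult'[symmetric], auto)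
  also have "\<dots> = ennreal 2 * (\<integral>\<^sup>+Z. ennreal ((\<Sum>z\<in>#Z. f z)\<^sup>2 / 2) \<partial>transition \<PP> X t \<mu>)"
    by (rule nn_integral_cmult) measurable
  also have "\<dots> \<le> ennreal 2 * ennreal ((?S\<^sup>2 + V * size \<mu>) / 2)"
    by (rule mult_left_mono[OF half]) simp
  also have "\<dots> = ennreal (2 * ((?S\<^sup>2 + V * size \<mu>) / 2))" by (rule ennreal_mult'[symmetric]) simp
  also have "2 * ((?S\<^sup>2 + V * size \<mu>) / 2) = ?S\<^sup>2 + V * size \<mu>" by (rule field_sum_of_halves[unfolded mult_2[symmetric]])
  finally show ?thesis by (simp add: V_def)
qed

text \<open>
  Given the population at time \<open>s\<close>, the sum at time \<open>s + t\<close> has mean \<open>V\<close> and second moment at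
  most \<open>V\<^sup>2\<close> plus a multiple of the size. When the square of the difference is expanded, the
  terms with \<open>V\<^sup>2\<close> cancel; they are finite by the second moment bound.
\<close>

lemma markov_variance:
  assumes f: "f \<in> bfun_nonneg" "\<And>y. f y \<le> A" and s: "0 \<le> s" and t: "0 \<le> t"
  shows "(\<integral>\<^sup>+\<omega>. ennreal (((\<Sum>z\<in>#X (s + t) \<omega>. f z) - (\<Sum>z\<in>#X s \<omega>. mean_semigroup \<PP> X t f z))\<^sup>2) \<partial>\<PP> {#x#})
    \<le> ennreal (A\<^sup>2 * second_const * mean_const * exp (2 * lam * t + lam * s))"
proof -
  let ?M = "\<PP> {#x#}"
  let ?m = "mean_semigroup \<PP> X t f"
  define U where "U \<omega> = (\<Sum>z\<in>#X (s + t) \<omega>. f z)" for \<omega>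
  define V where "V \<omega> = (\<Sum>z\<in>#X s \<omega>. ?m z)" for \<omega>
  define c where "c = A\<^sup>2 * second_const * exp (2 * lam * t)"
  have c0: "0 \<le> c" using second_const_nonneg by (simp add: c_def)
  have [measurable]: "f \<in> borel_measurable borel" using f(1) by (rule bfun_nonneg_measurable)
  have mb: "?m \<in> bfun_nonneg" by (rule mean_semigroup_bfun_nonneg[OF f(1) t])
  have [measurable]: "?m \<in> borel_measurable borel" using mb by (rule bfun_nonneg_measurable)
  have m0: "0 \<le> ?m y" for y by (rule bfun_nonneg_pos[OF mb])
  note [measurable] = measurable_process_law[OF s] measurable_transition[OF t]
  have [measurable]: "X (s + t) \<in> \<PP> \<mu> \<rightarrow>\<^sub>M atomic_space" for \<mu> using s t by (intro measurable_process_law) simp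
  have U0: "0 \<le> U \<omega>" and V0: "0 \<le> V \<omega>" for \<omega>
    by (auto simp: U_def V_def sum_mset_nonneg bfun_nonneg_pos[OF f(1)] m0)
  have [measurable]: "U \<in> borel_measurable ?M" "V \<in> borel_measurable ?M"
    unfolding U_def V_def by measurable
  have Vh: "(\<lambda>\<omega>. ennreal (V \<omega>)) \<in> borel_measurable (history F X s)"
    unfolding V_def using measurable_history[OF s order_refl] by measurable
  have VV: "(\<integral>\<^sup>+\<omega>. ennreal (V \<omega>) * ennreal (V \<omega>) \<partial>?M) = (\<integral>\<^sup>+\<omega>. ennreal (V \<omega>) * ennreal (U \<omega>) \<partial>?M)"
    unfolding U_def
    by (subst markov_product_integral[OF s t Vh, of "\<lambda>Z. ennreal (\<Sum>z\<in>#Z. f z)"])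
       (simp_all add: mean_atoms[OF f(1) t] V_def)
  obtain B where B: "\<And>y. ?m y \<le> B"
    using mb by (auto simp: bfun_nonneg_def bfun_def bounded_iff intro: order_trans[OF abs_ge_self])
  have VV_fin: "(\<integral>\<^sup>+\<omega>. ennreal (V \<omega>) * ennreal (V \<omega>) \<partial>?M) < \<infinity>"
  proof -
    have "(\<integral>\<^sup>+\<omega>. ennreal (V \<omega>) * ennreal (V \<omega>) \<partial>?M) = (\<integral>\<^sup>+Z. ennreal ((\<Sum>z\<in>#Z. ?m z)\<^sup>2) \<partial>population s x)"
      using V0 by (subst nn_integral_population[OF _ s]) (auto simp: ennreal_mult[symmetric] power2_eq_square V_def)
    also have "\<dots> < \<infinity>" using second_moment_sum_le[OF mb B s, of x] by (rule le_less_trans) simp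
    finally show ?thesis .
  qed
  have size_le: "(\<integral>\<^sup>+\<omega>. ennreal (real (size (X s \<omega>))) \<partial>?M) \<le> ennreal (mean_const * exp (lam * s))"
  proof -
    have "(\<integral>\<^sup>+\<omega>. ennreal (real (size (X s \<omega>))) \<partial>?M) = (\<integral>\<^sup>+Z. ennreal (real (size Z)) \<partial>population s x)"
      by (subst nn_integral_population[OF _ s]) auto
    also have "\<dots> = mean_sum s (\<lambda>_. 1) x" by (simp add: mean_sum_def ennreal_of_nat_eq_real_of_nat)
    finally show ?thesis using mean_sum_one_le[OF s, of x] by simp
  qed
  have UU: "(\<integral>\<^sup>+\<omega>. ennreal ((U \<omega>)\<^sup>2) \<partial>?M) \<le> (\<integral>\<^sup>+\<omega>. ennreal (V \<omega>) * ennreal (V \<omega>) \<partial>?M) + ennreal c * ennreal (mean_const * exp (lam * s))"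
  proof -
    have "(\<integral>\<^sup>+\<omega>. ennreal ((U \<omega>)\<^sup>2) \<partial>?M) = (\<integral>\<^sup>+\<omega>. 1 * (\<integral>\<^sup>+Z. ennreal ((\<Sum>z\<in>#Z. f z)\<^sup>2) \<partial>transition \<PP> X t (X s \<omega>)) \<partial>?M)"
      unfolding U_def by (subst markov_product_integral[OF s t, of "\<lambda>_. 1", symmetric]) simp_all
    also have "\<dots> \<le> (\<integral>\<^sup>+\<omega>. ennreal (V \<omega>) * ennreal (V \<omega>) + ennreal c * ennreal (real (size (X s \<omega>))) \<partial>?M)"
    proof (intro nn_integral_mono)
      fix \<omega>
      have "(\<integral>\<^sup>+Z. ennreal ((\<Sum>z\<in>#Z. f z)\<^sup>2) \<partial>transition \<PP> X t (X s \<omega>)) \<le> ennreal ((V \<omega>)\<^sup>2 + c * size (X s \<omega>))"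
        using second_moment_atoms[OF f t, of "X s \<omega>"] by (simp add: V_def c_def)
      also have "\<dots> = ennreal (V \<omega>) * ennreal (V \<omega>) + ennreal c * ennreal (real (size (X s \<omega>)))"
        using V0[of \<omega>] c0 by (simp add: ennreal_plus ennreal_mult[symmetric] power2_eq_square)
      finally show "1 * (\<integral>\<^sup>+Z. ennreal ((\<Sum>z\<in>#Z. f z)\<^sup>2) \<partial>transition \<PP> X t (X s \<omega>))
          \<le> ennreal (V \<omega>) * ennreal (V \<omega>) + ennreal c * ennreal (real (size (X s \<omega>)))" by simp
    qed
    also have "\<dots> = (\<integral>\<^sup>+\<omega>. ennreal (V \<omega>) * ennreal (V \<omega>) \<partial>?M) + ennreal c * (\<integral>\<^sup>+\<omega>. ennreal (real (size (X s \<omega>))) \<partial>?M)"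
      by (subst nn_integral_add) (auto simp: nn_integral_cmult)
    finally show ?thesis using size_le by (meson add_left_mono mult_left_mono order_trans zero_le)
  qed
  let ?D = "\<integral>\<^sup>+\<omega>. ennreal ((U \<omega> - V \<omega>)\<^sup>2) \<partial>?M"
  let ?VV = "\<integral>\<^sup>+\<omega>. ennreal (V \<omega>) * ennreal (V \<omega>) \<partial>?M"
  have "?D + (?VV + ?VV) = (\<integral>\<^sup>+\<omega>. ennreal ((U \<omega> - V \<omega>)\<^sup>2) + (ennreal (V \<omega>) * ennreal (U \<omega>) + ennreal (V \<omega>) * ennreal (U \<omega>)) \<partial>?M)"
    unfolding VV by (simp add: nn_integral_add)
  also have "\<dots> = (\<integral>\<^sup>+\<omega>. ennreal ((U \<omega>)\<^sup>2) + ennreal (V \<omega>) * ennreal (V \<omega>) \<partial>?M)"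
  proof (intro nn_integral_cong)
    fix \<omega>
    have "(U \<omega> - V \<omega>)\<^sup>2 + (V \<omega> * U \<omega> + V \<omega> * U \<omega>) = (U \<omega>)\<^sup>2 + V \<omega> * V \<omega>"
      by (simp add: power2_eq_square algebra_simps)
    then show "ennreal ((U \<omega> - V \<omega>)\<^sup>2) + (ennreal (V \<omega>) * ennreal (U \<omega>) + ennreal (V \<omega>) * ennreal (U \<omega>))
        = ennreal ((U \<omega>)\<^sup>2) + ennreal (V \<omega>) * ennreal (V \<omega>)"
      using U0[of \<omega>] V0[of \<omega>] by (simp add: ennreal_mult[symmetric] ennreal_plus[symmetric] del: ennreal_plus)
  qed
  also have "\<dots> = (\<integral>\<^sup>+\<omega>. ennreal ((U \<omega>)\<^sup>2) \<partial>?M) + ?VV" by (rule nn_integral_add) measurable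
  also have "\<dots> \<le> (?VV + ennreal c * ennreal (mean_const * exp (lam * s))) + ?VV"
    by (rule add_right_mono[OF UU])
  also have "\<dots> = ennreal c * ennreal (mean_const * exp (lam * s)) + (?VV + ?VV)" by (simp only: ac_simps)
  finally have "(?VV + ?VV) + ?D \<le> (?VV + ?VV) + ennreal c * ennreal (mean_const * exp (lam * s))" by (simp only: ac_simps)
  then have "?D \<le> ennreal c * ennreal (mean_const * exp (lam * s))"
    using VV_fin by (subst (asm) ennreal_add_left_cancel_le) auto
  also have "\<dots> = ennreal (c * (mean_const * exp (lam * s)))" by (rule ennreal_mult'[symmetric, OF c0])
  also have "c * (mean_const * exp (lam * s)) = A\<^sup>2 * second_const * mean_const * exp (2 * lam * t + lam * s)"
    by (simp add: c_def exp_add)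
  finally show ?thesis by (simp add: U_def V_def)
qed

definition increment_const :: "real \<Rightarrow> real" where
  "increment_const A = (1 + A\<^sup>2 * second_const * mean_const) / 2"

lemma increment_const_pos: "0 < increment_const A"
  using second_const_nonneg mean_const_pos by (simp add: increment_const_def add_pos_nonneg)

text \<open>
  After normalisation, the variance of the preceding lemma is of order \<open>exp (- lam * s)\<close>,
  uniformly in \<open>t\<close>: fluctuations are decided early. The square root of this rate remains in mean
  absolute deviation.
\<close>

lemma conditional_mean_L1:
  assumes f: "f \<in> bfun_nonneg" "\<And>y. f y \<le> A" and s: "0 \<le> s" and t: "0 \<le> t"
  shows "(\<integral>\<^sup>+\<omega>. ennreal \<bar>exp (- lam * (s + t)) * (\<Sum>z\<in>#X (s + t) \<omega>. f z)
      - exp (- lam * (s + t)) * (\<Sum>z\<in>#X s \<omega>. mean_semigroup \<PP> X t f z)\<bar> \<partial>\<PP> {#x#})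
    \<le> ennreal (increment_const A * exp (- lam * s / 2))"
proof -
  interpret prob_space "\<PP> {#x#}" by (rule prob)
  let ?M = "\<PP> {#x#}"
  define D where "D \<omega> = (\<Sum>z\<in>#X (s + t) \<omega>. f z) - (\<Sum>z\<in>#X s \<omega>. mean_semigroup \<PP> X t f z)" for \<omega>
  define e where "e = exp (- lam * (s + t))"
  define a where "a = exp (- lam * s / 2)"
  have a: "0 < a" "a * a = exp (- lam * s)" by (auto simp: a_def exp_add[symmetric])
  have [measurable]: "f \<in> borel_measurable borel" using f(1) by (rule bfun_nonneg_measurable)
  note [measurable] = measurable_mean_semigroup[OF f(1) t] measurable_process_law[OF s]
  have [measurable]: "X (s + t) \<in> ?M \<rightarrow>\<^sub>M atomic_space" using s t by (intro measurable_process_law) simp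
  have [measurable]: "D \<in> borel_measurable ?M" unfolding D_def by measurable
  have "(\<integral>\<^sup>+\<omega>. ennreal \<bar>e * D \<omega>\<bar> \<partial>?M) \<le> (\<integral>\<^sup>+\<omega>. ennreal (a / 2) + ennreal (e\<^sup>2 / (2 * a)) * ennreal ((D \<omega>)\<^sup>2) \<partial>?M)"
  proof (intro nn_integral_mono)
    fix \<omega>
    \<comment> \<open>comparing the square with \<open>a\<^sup>2\<close>, its expected order of magnitude, replaces the inequality of Cauchy and Schwarz\<close>
    have "0 \<le> (\<bar>e * D \<omega>\<bar> - a)\<^sup>2" by simp
    then have "2 * a * \<bar>e * D \<omega>\<bar> \<le> a * a + (e * D \<omega>)\<^sup>2" by (simp add: power2_diff power2_eq_square algebra_simps)
    then have "\<bar>e * D \<omega>\<bar> \<le> a / 2 + e\<^sup>2 / (2 * a) * (D \<omega>)\<^sup>2"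
      using a(1) by (simp add: field_simps power_mult_distrib)
    then show "ennreal \<bar>e * D \<omega>\<bar> \<le> ennreal (a / 2) + ennreal (e\<^sup>2 / (2 * a)) * ennreal ((D \<omega>)\<^sup>2)"
      using a(1) by (subst ennreal_mult[symmetric], simp, simp, subst ennreal_plus[symmetric])
        (simp_all add: ennreal_leI del: ennreal_plus)
  qed
  also have "\<dots> = ennreal (a / 2) + ennreal (e\<^sup>2 / (2 * a)) * (\<integral>\<^sup>+\<omega>. ennreal ((D \<omega>)\<^sup>2) \<partial>?M)"
    by (simp add: nn_integral_add nn_integral_cmult emeasure_space_1)
  also have "\<dots> \<le> ennreal (a / 2) + ennreal (e\<^sup>2 / (2 * a)) * ennreal (A\<^sup>2 * second_const * mean_const * exp (2 * lam * t + lam * s))"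
    unfolding D_def by (intro add_left_mono mult_left_mono markov_variance f s t) auto
  also have "\<dots> = ennreal (a / 2 + e\<^sup>2 / (2 * a) * (A\<^sup>2 * second_const * mean_const * exp (2 * lam * t + lam * s)))"
    using a second_const_nonneg mean_const_pos by (subst ennreal_mult[symmetric], simp, simp, subst ennreal_plus[symmetric]) auto
  also have "e\<^sup>2 / (2 * a) * (A\<^sup>2 * second_const * mean_const * exp (2 * lam * t + lam * s))
      = A\<^sup>2 * second_const * mean_const / (2 * a) * (e\<^sup>2 * exp (2 * lam * t + lam * s))" by simp
  also have "e\<^sup>2 * exp (2 * lam * t + lam * s) = a * a"
    unfolding a(2) by (simp add: e_def power2_eq_square exp_add[symmetric] algebra_simps)
  also have "A\<^sup>2 * second_const * mean_const / (2 * a) * (a * a) = A\<^sup>2 * second_const * mean_const / 2 * a"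
    using a(1) by simp
  also have "a / 2 + A\<^sup>2 * second_const * mean_const / 2 * a = increment_const A * a"
    by (simp only: increment_const_def add_divide_distrib distrib_right times_divide_eq_left mult_1_left)
  finally show ?thesis unfolding e_def[symmetric] a_def[symmetric] D_def right_diff_distrib .
qed

end

section \<open>The martingale and its limit\<close>

context supercritical_branching
begin

definition mart :: "real \<Rightarrow> 'w \<Rightarrow> real" where
  "mart t \<omega> = exp (- lam * t) * (\<Sum>y\<in>#X t \<omega>. \<phi> y)"

text \<open>
  The maximum with zero has an effect only on the null set of paths without a limit, where \<open>lim\<close>
  is arbitrary. It makes the limit non-negative everywhere.
\<close>

definition mart_limit :: "'w \<Rightarrow> real" where
  "mart_limit \<omega> = max 0 (lim (\<lambda>n. mart (real n) \<omega>))"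

lemma measurable_phi [measurable]: "\<phi> \<in> borel_measurable borel"
  using phi by (rule bfun_nonneg_measurable)

lemma mart_nonneg: "0 \<le> mart t \<omega>"
  unfolding mart_def using phi_pos by (intro mult_nonneg_nonneg sum_mset_nonneg) (auto intro: less_imp_le)

lemma measurable_mart_F: "0 \<le> t \<Longrightarrow> mart t \<in> borel_measurable F"
  unfolding mart_def using process[of t] by measurable

lemma measurable_mart: "0 \<le> t \<Longrightarrow> mart t \<in> borel_measurable (\<PP> \<mu>)"
  using measurable_mart_F by (simp cong: measurable_cong_sets)

lemma measurable_mart_history: "0 \<le> s \<Longrightarrow> s \<le> t \<Longrightarrow> mart s \<in> borel_measurable (history F X t)"
  unfolding mart_def using measurable_history[of s t] by measurable

lemma mean_semigroup_phi: "0 \<le> t \<Longrightarrow> mean_semigroup \<PP> X t \<phi> = (\<lambda>x. exp (lam * t) * \<phi> x)"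
  by (rule ext) (rule right_eigen)

lemma nn_integral_mart:
  assumes s: "0 \<le> s" and t: "0 \<le> t" and A: "A \<in> sets (history F X s)"
  shows "(\<integral>\<^sup>+\<omega>\<in>A. ennreal (mart (s + t) \<omega>) \<partial>\<PP> \<mu>) = (\<integral>\<^sup>+\<omega>\<in>A. ennreal (mart s \<omega>) \<partial>\<PP> \<mu>)"
proof -
  have inner: "(\<integral>\<^sup>+Z. ennreal (exp (- lam * (s + t)) * (\<Sum>y\<in>#Z. \<phi> y)) \<partial>transition \<PP> X t (X s \<omega>)) = ennreal (mart s \<omega>)" for \<omega>
  proof -
    have "(\<integral>\<^sup>+Z. ennreal (exp (- lam * (s + t)) * (\<Sum>y\<in>#Z. \<phi> y)) \<partial>transition \<PP> X t (X s \<omega>))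
        = ennreal (exp (- lam * (s + t))) * (\<integral>\<^sup>+Z. ennreal (\<Sum>y\<in>#Z. \<phi> y) \<partial>transition \<PP> X t (X s \<omega>))"
      by (subst nn_integral_cmult[symmetric]) (auto simp: ennreal_mult'[symmetric])
    also have "\<dots> = ennreal (exp (- lam * (s + t))) * ennreal (exp (lam * t) * (\<Sum>y\<in>#X s \<omega>. \<phi> y))"
      unfolding mean_atoms[OF phi t] mean_semigroup_phi[OF t] sum_mset_distrib_left ..
    also have "\<dots> = ennreal (exp (- lam * (s + t)) * (exp (lam * t) * (\<Sum>y\<in>#X s \<omega>. \<phi> y)))"
      by (rule ennreal_mult'[symmetric]) simp
    also have "exp (- lam * (s + t)) * (exp (lam * t) * (\<Sum>y\<in>#X s \<omega>. \<phi> y)) = mart s \<omega>"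
      by (simp add: mart_def mult.assoc[symmetric] exp_add[symmetric] algebra_simps)
    finally show ?thesis .
  qed
  have "(\<integral>\<^sup>+\<omega>\<in>A. ennreal (mart (s + t) \<omega>) \<partial>\<PP> \<mu>)
      = (\<integral>\<^sup>+\<omega>\<in>A. (\<integral>\<^sup>+Z. ennreal (exp (- lam * (s + t)) * (\<Sum>y\<in>#Z. \<phi> y)) \<partial>transition \<PP> X t (X s \<omega>)) \<partial>\<PP> \<mu>)"
    unfolding mart_def
    by (rule markov_set_integral[OF s t A, of "\<lambda>Z. ennreal (exp (- lam * (s + t)) * (\<Sum>y\<in>#Z. \<phi> y))"]) measurable
  also have "\<dots> = (\<integral>\<^sup>+\<omega>\<in>A. ennreal (mart s \<omega>) \<partial>\<PP> \<mu>)" unfolding inner ..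
  finally show ?thesis .
qed

lemma nn_integral_mart_total:
  assumes t: "0 \<le> t"
  shows "(\<integral>\<^sup>+\<omega>. ennreal (mart t \<omega>) \<partial>\<PP> {#x#}) = ennreal (\<phi> x)"
proof -
  have "(\<integral>\<^sup>+\<omega>. ennreal (mart t \<omega>) \<partial>\<PP> {#x#}) = ennreal (exp (- lam * t)) * (\<integral>\<^sup>+\<omega>. ennreal (\<Sum>y\<in>#X t \<omega>. \<phi> y) \<partial>\<PP> {#x#})"
    unfolding mart_def using measurable_process_law[OF t]
    by (subst nn_integral_cmult[symmetric]) (auto simp: ennreal_mult'[symmetric])
  also have "(\<integral>\<^sup>+\<omega>. ennreal (\<Sum>y\<in>#X t \<omega>. \<phi> y) \<partial>\<PP> {#x#}) = ennreal (mean_semigroup \<PP> X t \<phi> x)"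
    unfolding mean_semigroup_def using phi_pos
    by (intro nn_integral_eq_integral ennreal_mean_semigroup(3)[OF phi t] AE_I2 sum_mset_nonneg) (auto intro: less_imp_le)
  also have "ennreal (exp (- lam * t)) * ennreal (mean_semigroup \<PP> X t \<phi> x) = ennreal (exp (- lam * t) * (exp (lam * t) * \<phi> x))"
    unfolding right_eigen[OF t] by (rule ennreal_mult'[symmetric]) simp
  also have "exp (- lam * t) * (exp (lam * t) * \<phi> x) = \<phi> x"
    by (simp add: mult.assoc[symmetric] exp_add[symmetric])
  finally show ?thesis .
qed

lemma integrable_mart:
  assumes "0 \<le> t" shows "integrable (\<PP> {#x#}) (mart t)"
  using nn_integral_mart_total[OF assms, of x] measurable_mart[OF assms] mart_nonneg
  by (intro integrableI_nonneg) auto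

lemma mart_set_integral:
  assumes s: "0 \<le> s" "s \<le> u" and A: "A \<in> sets (history F X s)"
  shows "(\<integral>\<omega>. indicator A \<omega> * mart u \<omega> \<partial>\<PP> {#x#}) = (\<integral>\<omega>. indicator A \<omega> * mart s \<omega> \<partial>\<PP> {#x#})"
proof -
  have A' [measurable]: "A \<in> sets (\<PP> {#x#})" using A subalgebra_history[of "{#x#}" s] by (auto simp: subalgebra_def)
  have eq: "(\<integral>\<omega>. indicator A \<omega> * mart t \<omega> \<partial>\<PP> {#x#}) = enn2real (\<integral>\<^sup>+\<omega>\<in>A. ennreal (mart t \<omega>) \<partial>\<PP> {#x#})" if "0 \<le> t" for t
  proof -
    have [measurable]: "mart t \<in> borel_measurable (\<PP> {#x#})" by (rule measurable_mart[OF that])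
    have "(\<integral>\<omega>. indicator A \<omega> * mart t \<omega> \<partial>\<PP> {#x#}) = enn2real (\<integral>\<^sup>+\<omega>. ennreal (indicator A \<omega> * mart t \<omega>) \<partial>\<PP> {#x#})"
      using mart_nonneg by (intro integral_eq_nn_integral) auto
    also have "(\<integral>\<^sup>+\<omega>. ennreal (indicator A \<omega> * mart t \<omega>) \<partial>\<PP> {#x#}) = (\<integral>\<^sup>+\<omega>\<in>A. ennreal (mart t \<omega>) \<partial>\<PP> {#x#})"
      by (intro nn_integral_cong) (auto simp: indicator_def)
    finally show ?thesis .
  qed
  show ?thesis
    using nn_integral_mart[OF s(1) _ A, of "u - s" "{#x#}"] s by (simp add: eq)
qed

lemma mart_L1:
  assumes s: "0 \<le> s" and st: "s \<le> t"
  shows "(\<integral>\<^sup>+\<omega>. ennreal \<bar>mart t \<omega> - mart s \<omega>\<bar> \<partial>\<PP> {#x#}) \<le> ennreal (increment_const phi_bound * exp (- lam * s / 2))"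
proof -
  have "exp (- lam * t) * (\<Sum>z\<in>#X s \<omega>. mean_semigroup \<PP> X (t - s) \<phi> z) = mart s \<omega>" for \<omega>
  proof -
    have "exp (- lam * t) * (\<Sum>z\<in>#X s \<omega>. mean_semigroup \<PP> X (t - s) \<phi> z)
        = exp (- lam * t) * exp (lam * (t - s)) * (\<Sum>z\<in>#X s \<omega>. \<phi> z)"
      using st by (simp add: mean_semigroup_phi sum_mset_distrib_left mult.assoc)
    also have "exp (- lam * t) * exp (lam * (t - s)) = exp (- lam * s)"
      by (simp add: exp_add[symmetric] algebra_simps)
    finally show ?thesis by (simp add: mart_def)
  qed
  with conditional_mean_L1[OF phi phi_le s, of "t - s" x] st show ?thesis
    by (simp add: mart_def)
qed

text \<open>
  Doob's inequality. The event is split according to the first time in \<open>D\<close> at which the level is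
  exceeded; on each part the martingale property moves the increment to the final time \<open>u\<close>. The
  sign \<open>\<sigma>\<close> serves to treat exceedances above and below alike.
\<close>

lemma maximal_inequality:
  assumes D: "finite D" "\<And>t. t \<in> D \<Longrightarrow> s \<le> t \<and> t \<le> u" and s: "0 \<le> s" "s \<le> u"
    and sg: "\<bar>\<sigma>\<bar> = 1" and \<epsilon>: "0 < \<epsilon>"
  shows "\<epsilon> * measure (\<PP> {#x#}) {\<omega> \<in> space F. \<exists>t\<in>D. \<epsilon> < \<sigma> * (mart t \<omega> - mart s \<omega>)}
    \<le> (\<integral>\<omega>. \<bar>mart u \<omega> - mart s \<omega>\<bar> \<partial>\<PP> {#x#})"
proof -
  interpret prob_space "\<PP> {#x#}" by (rule prob)
  let ?M = "\<PP> {#x#}"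
  define Z where "Z t \<omega> = \<sigma> * (mart t \<omega> - mart s \<omega>)" for t \<omega>
  \<comment> \<open>the event that \<open>t\<close> is the first time in \<open>D\<close> at which the level is exceeded\<close>
  define A where "A t = {\<omega> \<in> space (history F X t). \<epsilon> < Z t \<omega> \<and> (\<forall>r\<in>D. r < t \<longrightarrow> Z r \<omega> \<le> \<epsilon>)}" for t
  have spF: "space (history F X t) = space F" for t
    using subalgebra_history[of "{#x#}" t] by (simp add: subalgebra_def space_law)
  have mZ: "Z r \<in> borel_measurable (history F X t)" if "s \<le> r" "r \<le> t" for r t
  proof -
    have [measurable]: "mart r \<in> borel_measurable (history F X t)" "mart s \<in> borel_measurable (history F X t)"
      using that s by (auto intro: measurable_mart_history)
    show ?thesis unfolding Z_def by measurable
  qed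
  have A: "A t \<in> sets (history F X t)" if t: "t \<in> D" for t
  proof -
    have e: "A t = {\<omega> \<in> space (history F X t). \<epsilon> < Z t \<omega>} \<inter>
        {\<omega> \<in> space (history F X t). \<forall>r\<in>{r\<in>D. r < t}. Z r \<omega> \<le> \<epsilon>}" by (auto simp: A_def)
    have [measurable]: "Z t \<in> borel_measurable (history F X t)" using D(2)[OF t] by (intro mZ) auto
    show ?thesis unfolding e
    proof (intro sets.Int sets.sets_Collect_finite_All)
      show "{\<omega> \<in> space (history F X t). \<epsilon> < Z t \<omega>} \<in> sets (history F X t)" by measurable
      show "{\<omega> \<in> space (history F X t). Z r \<omega> \<le> \<epsilon>} \<in> sets (history F X t)" if "r \<in> {r\<in>D. r < t}" for r
      proof -
        have [measurable]: "Z r \<in> borel_measurable (history F X t)" using that D(2)[of r] by (intro mZ) auto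
        show ?thesis by measurable
      qed
    qed (use D in auto)
  qed
  have A' [measurable]: "A t \<in> sets ?M" if "t \<in> D" for t
    using A[OF that] subalgebra_history[of "{#x#}" t] by (auto simp: subalgebra_def)
  have intZ: "integrable ?M (Z t)" if "0 \<le> t" for t
    unfolding Z_def using integrable_mart[OF that] integrable_mart[OF s(1)] by simp
  have disj: "disjoint_family_on A D"
    unfolding disjoint_family_on_def
  proof (intro ballI impI)
    fix t r assume tr: "t \<in> D" "r \<in> D" "t \<noteq> r"
    then consider "t < r" | "r < t" by linarith
    then show "A t \<inter> A r = {}" using tr by cases (force simp: A_def)+
  qed
  have un: "{\<omega> \<in> space F. \<exists>t\<in>D. \<epsilon> < \<sigma> * (mart t \<omega> - mart s \<omega>)} = (\<Union>t\<in>D. A t)"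
  proof (intro equalityI subsetI)
    fix \<omega> assume w: "\<omega> \<in> {\<omega> \<in> space F. \<exists>t\<in>D. \<epsilon> < \<sigma> * (mart t \<omega> - mart s \<omega>)}"
    define T where "T = {t \<in> D. \<epsilon> < Z t \<omega>}"
    have T: "finite T" "T \<noteq> {}" using D w by (auto simp: T_def Z_def)
    have "Min T \<in> T" using T by simp
    moreover have "Z r \<omega> \<le> \<epsilon>" if "r \<in> D" "r < Min T" for r
      using that T Min_le[of T r] by (force simp: T_def)
    ultimately have "\<omega> \<in> A (Min T)" "Min T \<in> D" using w by (auto simp: A_def T_def spF)
    then show "\<omega> \<in> (\<Union>t\<in>D. A t)" by blast
  qed (auto simp: A_def Z_def spF)
  have each: "\<epsilon> * measure ?M (A t) \<le> (\<integral>\<omega>. indicator (A t) \<omega> * \<bar>mart u \<omega> - mart s \<omega>\<bar> \<partial>?M)" if t: "t \<in> D" for t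
  proof -
    have ts: "0 \<le> t" "s \<le> t" "t \<le> u" "0 \<le> u" using D(2)[OF t] s by auto
    have int: "integrable ?M (\<lambda>\<omega>. indicator (A t) \<omega> * Z r \<omega>)" if "0 \<le> r" for r
      using integrable_mult_indicator[OF A'[OF t] intZ[OF that]] by simp
    have intm: "integrable ?M (\<lambda>\<omega>. indicator (A t) \<omega> * mart r \<omega>)" if "0 \<le> r" for r
      using integrable_mult_indicator[OF A'[OF t] integrable_mart[OF that]] by simp
    have zint: "(\<integral>\<omega>. indicator (A t) \<omega> * Z r \<omega> \<partial>?M)
        = \<sigma> * ((\<integral>\<omega>. indicator (A t) \<omega> * mart r \<omega> \<partial>?M) - (\<integral>\<omega>. indicator (A t) \<omega> * mart s \<omega> \<partial>?M))" if "0 \<le> r" for r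
    proof -
      have "indicator (A t) \<omega> * Z r \<omega> = \<sigma> * (indicator (A t) \<omega> * mart r \<omega> - indicator (A t) \<omega> * mart s \<omega>)" for \<omega>
        by (simp add: Z_def indicator_def)
      then show ?thesis using intm[OF that] intm[OF s(1)] by simp
    qed
    have "\<epsilon> * measure ?M (A t) = (\<integral>\<omega>. indicator (A t) \<omega> * \<epsilon> \<partial>?M)"
      using sets.sets_into_space[OF A'[OF t]] by (simp add: mult.commute Int_absorb2)
    also have "\<dots> \<le> (\<integral>\<omega>. indicator (A t) \<omega> * Z t \<omega> \<partial>?M)"
    proof (rule integral_mono[OF _ int[OF ts(1)]])
      show "integrable ?M (\<lambda>\<omega>. indicator (A t) \<omega> * \<epsilon>)"
        using integrable_mult_indicator[OF A'[OF t], of "\<lambda>_. \<epsilon>"] by simp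
      show "indicator (A t) \<omega> * \<epsilon> \<le> indicator (A t) \<omega> * Z t \<omega>" for \<omega>
        by (simp add: A_def indicator_def)
    qed
    also have "\<dots> = \<sigma> * ((\<integral>\<omega>. indicator (A t) \<omega> * mart t \<omega> \<partial>?M) - (\<integral>\<omega>. indicator (A t) \<omega> * mart s \<omega> \<partial>?M))"
      by (rule zint[OF ts(1)])
    also have "\<dots> = \<sigma> * ((\<integral>\<omega>. indicator (A t) \<omega> * mart u \<omega> \<partial>?M) - (\<integral>\<omega>. indicator (A t) \<omega> * mart s \<omega> \<partial>?M))"
      using mart_set_integral[OF ts(1,3) A[OF t]] by simp
    also have "\<dots> = (\<integral>\<omega>. indicator (A t) \<omega> * Z u \<omega> \<partial>?M)"
      by (rule zint[OF ts(4), symmetric])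
    also have "\<dots> \<le> (\<integral>\<omega>. indicator (A t) \<omega> * \<bar>mart u \<omega> - mart s \<omega>\<bar> \<partial>?M)"
    proof (rule integral_mono[OF int[OF ts(4)]])
      show "integrable ?M (\<lambda>\<omega>. indicator (A t) \<omega> * \<bar>mart u \<omega> - mart s \<omega>\<bar>)"
        using integrable_mult_indicator[OF A'[OF t], of "\<lambda>\<omega>. \<bar>mart u \<omega> - mart s \<omega>\<bar>"] integrable_mart[OF ts(4)] integrable_mart[OF s(1)] by simp
      show "indicator (A t) \<omega> * Z u \<omega> \<le> indicator (A t) \<omega> * \<bar>mart u \<omega> - mart s \<omega>\<bar>" for \<omega>
        using sg abs_ge_self[of "Z u \<omega>"] by (intro mult_left_mono) (auto simp: Z_def abs_mult)
    qed
    finally show ?thesis .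
  qed
  have intabs: "integrable ?M (\<lambda>\<omega>. \<bar>mart u \<omega> - mart s \<omega>\<bar>)"
    using integrable_mart[of u] integrable_mart[of s] s by auto
  have "\<epsilon> * measure ?M (\<Union>t\<in>D. A t) = (\<Sum>t\<in>D. \<epsilon> * measure ?M (A t))"
    unfolding sum_distrib_left[symmetric] using A'
    by (intro arg_cong[where f = "\<lambda>r. \<epsilon> * r"] finite_measure_finite_Union[OF D(1) _ disj]) auto
  also have "\<dots> \<le> (\<Sum>t\<in>D. \<integral>\<omega>. indicator (A t) \<omega> * \<bar>mart u \<omega> - mart s \<omega>\<bar> \<partial>?M)"
    by (rule sum_mono) (rule each)
  also have "\<dots> = (\<integral>\<omega>. (\<Sum>t\<in>D. indicator (A t) \<omega> * \<bar>mart u \<omega> - mart s \<omega>\<bar>) \<partial>?M)"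
    using integrable_mult_indicator[OF A' intabs] by (intro Bochner_Integration.integral_sum[symmetric]) simp
  also have "\<dots> \<le> (\<integral>\<omega>. \<bar>mart u \<omega> - mart s \<omega>\<bar> \<partial>?M)"
  proof (rule integral_mono[OF _ intabs])
    show "integrable ?M (\<lambda>\<omega>. \<Sum>t\<in>D. indicator (A t) \<omega> * \<bar>mart u \<omega> - mart s \<omega>\<bar>)"
      using integrable_mult_indicator[OF A' intabs] by (intro Bochner_Integration.integrable_sum) simp
    fix \<omega>
    have "(\<Sum>t\<in>D. indicator (A t) \<omega>) = (indicator (\<Union>t\<in>D. A t) \<omega> :: real)"
      by (rule indicator_UN_disjoint[OF D(1) disj, symmetric])
    then have "(\<Sum>t\<in>D. indicator (A t) \<omega> * \<bar>mart u \<omega> - mart s \<omega>\<bar>) = indicator (\<Union>t\<in>D. A t) \<omega> * \<bar>mart u \<omega> - mart s \<omega>\<bar>"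
      by (simp add: sum_distrib_right[symmetric])
    then show "(\<Sum>t\<in>D. indicator (A t) \<omega> * \<bar>mart u \<omega> - mart s \<omega>\<bar>) \<le> \<bar>mart u \<omega> - mart s \<omega>\<bar>"
      by (simp add: indicator_def)
  qed
  finally show ?thesis unfolding un .
qed

lemma maximal_inequality_abs:
  assumes D: "finite D" "\<And>t. t \<in> D \<Longrightarrow> s \<le> t" and s: "0 \<le> s" and \<epsilon>: "0 < \<epsilon>"
  shows "measure (\<PP> {#x#}) {\<omega> \<in> space F. \<exists>t\<in>D. \<epsilon> < \<bar>mart t \<omega> - mart s \<omega>\<bar>}
    \<le> 2 * increment_const phi_bound * exp (- lam * s / 2) / \<epsilon>"
proof -
  interpret prob_space "\<PP> {#x#}" by (rule prob)
  let ?M = "\<PP> {#x#}"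
  define u where "u = Max (insert s D)"
  have u: "t \<le> u" if "t \<in> D" for t using D that by (simp add: u_def)
  have su: "s \<le> u" using D by (simp add: u_def)
  let ?B = "\<lambda>\<sigma>. {\<omega> \<in> space F. \<exists>t\<in>D. \<epsilon> < \<sigma> * (mart t \<omega> - mart s \<omega>)}"
  let ?I = "increment_const phi_bound * exp (- lam * s / 2)"
  have intabs: "integrable ?M (\<lambda>\<omega>. \<bar>mart u \<omega> - mart s \<omega>\<bar>)"
    using integrable_mart[of u] integrable_mart[of s] s su by auto
  have L1: "(\<integral>\<omega>. \<bar>mart u \<omega> - mart s \<omega>\<bar> \<partial>?M) \<le> ?I"
  proof -
    have "ennreal (\<integral>\<omega>. \<bar>mart u \<omega> - mart s \<omega>\<bar> \<partial>?M) \<le> ennreal ?I"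
      using mart_L1[OF s su, of x] by (subst (asm) nn_integral_eq_integral[OF intabs]) auto
    then show ?thesis using increment_const_pos[of phi_bound] by (subst (asm) ennreal_le_iff) auto
  qed
  have B: "measure ?M (?B \<sigma>) \<le> ?I / \<epsilon>" if "\<bar>\<sigma>\<bar> = 1" for \<sigma>
  proof -
    have "\<epsilon> * measure ?M (?B \<sigma>) \<le> ?I"
      using maximal_inequality[OF D(1) _ s su that \<epsilon>, of x] D(2) u L1 by force
    then show ?thesis using \<epsilon> by (simp add: field_simps)
  qed
  have meas: "?B \<sigma> \<in> sets ?M" for \<sigma>
  proof -
    have "?B \<sigma> = (\<Union>t\<in>D. {\<omega> \<in> space ?M. \<epsilon> < \<sigma> * (mart t \<omega> - mart s \<omega>)})" by (auto simp: space_law)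
    also have "\<dots> \<in> sets ?M"
    proof (intro sets.finite_UN D(1))
      fix t assume "t \<in> D"
      then have [measurable]: "mart t \<in> borel_measurable ?M" "mart s \<in> borel_measurable ?M"
        using D(2)[of t] s by (auto intro!: measurable_mart)
      show "{\<omega> \<in> space ?M. \<epsilon> < \<sigma> * (mart t \<omega> - mart s \<omega>)} \<in> sets ?M" by measurable
    qed
    finally show ?thesis .
  qed
  have un: "{\<omega> \<in> space F. \<exists>t\<in>D. \<epsilon> < \<bar>mart t \<omega> - mart s \<omega>\<bar>} = ?B 1 \<union> ?B (- 1)"
  proof -
    have "\<epsilon> < \<bar>a\<bar> \<longleftrightarrow> \<epsilon> < 1 * a \<or> \<epsilon> < (- 1) * a" for a :: real by linarith
    then show ?thesis by blast
  qed
  have "measure ?M (?B 1 \<union> ?B (- 1)) \<le> measure ?M (?B 1) + measure ?M (?B (- 1))"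
    by (rule measure_Un_le[OF meas meas])
  also have "\<dots> \<le> ?I / \<epsilon> + ?I / \<epsilon>"
  proof (rule add_mono)
    show "measure ?M (?B 1) \<le> ?I / \<epsilon>" by (rule B) (rule abs_one)
    show "measure ?M (?B (- 1)) \<le> ?I / \<epsilon>" by (rule B) (simp only: abs_minus_cancel abs_one)
  qed
  also have "?I / \<epsilon> + ?I / \<epsilon> = 2 * ?I / \<epsilon>" by (metis add_divide_distrib mult_2)
  also have "2 * ?I = 2 * increment_const phi_bound * exp (- lam * s / 2)" by (rule mult.assoc[symmetric])
  finally show ?thesis unfolding un .
qed

text \<open>Exhaustion of \<open>D\<close> by finite sets, for which the bound is uniform.\<close>

lemma countable_maximal_inequality:
  assumes D: "countable D" "\<And>t. t \<in> D \<Longrightarrow> s \<le> t" and s: "0 \<le> s" and \<epsilon>: "0 < \<epsilon>"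
  shows "{\<omega> \<in> space F. \<exists>t\<in>D. \<epsilon> < \<bar>mart t \<omega> - mart s \<omega>\<bar>} \<in> sets F"
    and "measure (\<PP> {#x#}) {\<omega> \<in> space F. \<exists>t\<in>D. \<epsilon> < \<bar>mart t \<omega> - mart s \<omega>\<bar>}
      \<le> 2 * increment_const phi_bound * exp (- lam * s / 2) / \<epsilon>"
proof -
  interpret prob_space "\<PP> {#x#}" by (rule prob)
  let ?B = "\<lambda>t. {\<omega> \<in> space F. \<epsilon> < \<bar>mart t \<omega> - mart s \<omega>\<bar>}"
  have B: "?B t \<in> sets F" if "t \<in> D" for t
  proof -
    have [measurable]: "mart t \<in> borel_measurable F" "mart s \<in> borel_measurable F"
      using D(2)[OF that] s by (auto intro!: measurable_mart_F)
    show ?thesis by measurable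
  qed
  have un: "{\<omega> \<in> space F. \<exists>t\<in>D. \<epsilon> < \<bar>mart t \<omega> - mart s \<omega>\<bar>} = (\<Union>t\<in>D. ?B t)" by auto
  then show "{\<omega> \<in> space F. \<exists>t\<in>D. \<epsilon> < \<bar>mart t \<omega> - mart s \<omega>\<bar>} \<in> sets F"
    using sets.countable_UN'[of D ?B F] D(1) B by auto
  show "measure (\<PP> {#x#}) {\<omega> \<in> space F. \<exists>t\<in>D. \<epsilon> < \<bar>mart t \<omega> - mart s \<omega>\<bar>}
      \<le> 2 * increment_const phi_bound * exp (- lam * s / 2) / \<epsilon>"
  proof (cases "D = {}")
    case True
    then show ?thesis using \<epsilon> increment_const_pos[of phi_bound] by simp
  next
    case False
    let ?E = "\<lambda>n. {\<omega> \<in> space F. \<exists>t\<in>from_nat_into D ` {..n}. \<epsilon> < \<bar>mart t \<omega> - mart s \<omega>\<bar>}"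
    have mem: "from_nat_into D i \<in> D" for i using False by (rule from_nat_into)
    have "(\<Union>n. ?E n) = {\<omega> \<in> space F. \<exists>t\<in>D. \<epsilon> < \<bar>mart t \<omega> - mart s \<omega>\<bar>}"
    proof (intro equalityI subsetI)
      fix \<omega> assume "\<omega> \<in> {\<omega> \<in> space F. \<exists>t\<in>D. \<epsilon> < \<bar>mart t \<omega> - mart s \<omega>\<bar>}"
      then obtain t where t: "\<omega> \<in> space F" "t \<in> D" "\<epsilon> < \<bar>mart t \<omega> - mart s \<omega>\<bar>" by auto
      have "t \<in> from_nat_into D ` {..to_nat_on D t}"
        using t D(1) by (intro image_eqI[where x = "to_nat_on D t"]) auto
      then show "\<omega> \<in> (\<Union>n. ?E n)" using t by blast
    qed (use mem in auto)
    moreover have "(\<lambda>n. measure (\<PP> {#x#}) (?E n)) \<longlonglongrightarrow> measure (\<PP> {#x#}) (\<Union>n. ?E n)"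
    proof (rule finite_Lim_measure_incseq)
      have "?E n = (\<Union>t\<in>from_nat_into D ` {..n}. ?B t)" for n by auto
      then have "?E n \<in> sets F" for n using B mem by (auto intro!: sets.finite_UN)
      then show "range ?E \<subseteq> events" by auto
      show "incseq ?E" by (force simp: incseq_def)
    qed
    moreover have "measure (\<PP> {#x#}) (?E n) \<le> 2 * increment_const phi_bound * exp (- lam * s / 2) / \<epsilon>" for n
      using D(2) mem by (intro maximal_inequality_abs s \<epsilon>) auto
    ultimately show ?thesis by (intro LIMSEQ_le_const2) auto
  qed
qed

text \<open>
  The bound on the maximal increment after time \<open>n\<close> tends to zero, so almost surely it is
  eventually small.
\<close>

lemma AE_mart_Cauchy:
  assumes D: "countable D"
  shows "AE \<omega> in \<PP> {#x#}. \<forall>k. \<exists>n. \<forall>t\<in>D. real n \<le> t \<longrightarrow> \<bar>mart t \<omega> - mart (real n) \<omega>\<bar> \<le> 1 / real (Suc k)"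
  unfolding AE_all_countable
proof
  fix k
  interpret prob_space "\<PP> {#x#}" by (rule prob)
  define \<epsilon> where "\<epsilon> = 1 / real (Suc k)"
  have \<epsilon>: "0 < \<epsilon>" by (simp add: \<epsilon>_def)
  let ?E = "\<lambda>n::nat. {\<omega> \<in> space F. \<exists>t\<in>{t \<in> D. real n \<le> t}. \<epsilon> < \<bar>mart t \<omega> - mart (real n) \<omega>\<bar>}"
  have cD: "countable {t \<in> D. real n \<le> t}" for n using D by (rule countable_subset[rotated]) auto
  have E: "?E n \<in> sets F" for n by (rule countable_maximal_inequality(1)[OF cD _ _ \<epsilon>]) auto
  have le: "measure (\<PP> {#x#}) (?E n) \<le> 2 * increment_const phi_bound * exp (- lam * real n / 2) / \<epsilon>" for n
    by (rule countable_maximal_inequality(2)[OF cD _ _ \<epsilon>]) auto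
  have I: "(\<Inter>n. ?E n) \<in> sets (\<PP> {#x#})" using E by auto
  have "measure (\<PP> {#x#}) (\<Inter>n. ?E n) \<le> 2 * increment_const phi_bound * exp (- lam * real n / 2) / \<epsilon>" for n
    by (rule order_trans[OF finite_measure_mono[of _ "?E n"] le]) (use E in auto)
  moreover have "(\<lambda>n. 2 * increment_const phi_bound * exp (- lam * real n / 2) / \<epsilon>) \<longlonglongrightarrow> 0"
  proof -
    have "(\<lambda>n. exp (- lam * real n / 2)) \<longlonglongrightarrow> 0" using lam_pos by real_asymp
    from tendsto_mult_right_zero[OF this, of "2 * increment_const phi_bound / \<epsilon>"] show ?thesis by simp
  qed
  ultimately have "measure (\<PP> {#x#}) (\<Inter>n. ?E n) \<le> 0"
    by (intro LIMSEQ_le_const[where X = "\<lambda>n. 2 * increment_const phi_bound * exp (- lam * real n / 2) / \<epsilon>"]) auto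
  then have "emeasure (\<PP> {#x#}) (\<Inter>n. ?E n) = 0"
    by (simp add: emeasure_eq_measure measure_le_0_iff)
  then show "AE \<omega> in \<PP> {#x#}. \<exists>n. \<forall>t\<in>D. real n \<le> t \<longrightarrow> \<bar>mart t \<omega> - mart (real n) \<omega>\<bar> \<le> 1 / real (Suc k)"
    by (intro AE_I[OF _ _ I]) (auto simp: space_law \<epsilon>_def not_le)
qed

text \<open>
  The limit is taken along the integers. That it does not depend on \<open>D\<close> follows by adjoining the
  integers to \<open>D\<close> in the Cauchy property.
\<close>

lemma AE_mart_limit:
  assumes D: "countable D"
  shows "AE \<omega> in \<PP> {#x#}. ((\<lambda>t. mart t \<omega>) \<longlongrightarrow> mart_limit \<omega>) (inf at_top (principal D))"
proof -
  have "countable (D \<union> range real)" using D by auto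
  from AE_mart_Cauchy[OF this, of x] show ?thesis
  proof eventually_elim
    case (elim \<omega>)
    have "Cauchy (\<lambda>n. mart (real n) \<omega>)"
    proof (rule metric_CauchyI)
      fix e :: real assume "0 < e"
      then obtain k where k: "1 / real (Suc k) < e / 2"
        using nat_approx_posE[of "e / 2"] by auto
      obtain n where n: "\<forall>t\<in>D \<union> range real. real n \<le> t \<longrightarrow> \<bar>mart t \<omega> - mart (real n) \<omega>\<bar> \<le> 1 / real (Suc k)"
        using elim by blast
      have "dist (mart (real i) \<omega>) (mart (real j) \<omega>) < e" if "n \<le> i" "n \<le> j" for i j
      proof -
        have "\<bar>mart (real i) \<omega> - mart (real n) \<omega>\<bar> \<le> 1 / real (Suc k)" "\<bar>mart (real j) \<omega> - mart (real n) \<omega>\<bar> \<le> 1 / real (Suc k)"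
          using n that by auto
        then show ?thesis using k unfolding dist_real_def by linarith
      qed
      then show "\<exists>M. \<forall>m\<ge>M. \<forall>n\<ge>M. dist (mart (real m) \<omega>) (mart (real n) \<omega>) < e" by blast
    qed
    then have conv: "(\<lambda>n. mart (real n) \<omega>) \<longlonglongrightarrow> lim (\<lambda>n. mart (real n) \<omega>)"
      by (simp add: Cauchy_convergent convergent_LIMSEQ_iff[symmetric])
    then have "0 \<le> lim (\<lambda>n. mart (real n) \<omega>)"
      by (rule LIMSEQ_le_const) (auto simp: mart_nonneg)
    with conv have conv: "(\<lambda>n. mart (real n) \<omega>) \<longlonglongrightarrow> mart_limit \<omega>" by (simp add: mart_limit_def)
    show ?case
    proof (rule tendstoI)
      fix e :: real assume "0 < e"
      then obtain k where k: "1 / real (Suc k) < e / 2"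
        using nat_approx_posE[of "e / 2"] by auto
      obtain n where n: "\<forall>t\<in>D \<union> range real. real n \<le> t \<longrightarrow> \<bar>mart t \<omega> - mart (real n) \<omega>\<bar> \<le> 1 / real (Suc k)"
        using elim by blast
      have "(\<lambda>m. \<bar>mart (real m) \<omega> - mart (real n) \<omega>\<bar>) \<longlonglongrightarrow> \<bar>mart_limit \<omega> - mart (real n) \<omega>\<bar>"
        by (intro tendsto_intros conv)
      then have W: "\<bar>mart_limit \<omega> - mart (real n) \<omega>\<bar> \<le> 1 / real (Suc k)"
        by (rule LIMSEQ_le_const2) (use n in \<open>auto intro!: exI[of _ n]\<close>)
      have "dist (mart t \<omega>) (mart_limit \<omega>) < e" if "real n \<le> t" "t \<in> D" for t
      proof -
        have "\<bar>mart t \<omega> - mart (real n) \<omega>\<bar> \<le> 1 / real (Suc k)" using n that by auto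
        then show ?thesis using k W unfolding dist_real_def by linarith
      qed
      then show "\<forall>\<^sub>F t in inf at_top (principal D). dist (mart t \<omega>) (mart_limit \<omega>) < e"
        unfolding eventually_inf_principal by (auto simp: eventually_at_top_linorder)
    qed
  qed
qed

lemma measurable_mart_limit: "mart_limit \<in> borel_measurable (\<PP> \<mu>)"
proof -
  have [measurable]: "mart (real n) \<in> borel_measurable (\<PP> \<mu>)" for n by (rule measurable_mart) simp
  show ?thesis unfolding mart_limit_def by measurable
qed

lemma mart_limit_nonneg: "0 \<le> mart_limit \<omega>"
  by (simp add: mart_limit_def)

lemma AE_mart_limit_seq: "AE \<omega> in \<PP> {#x#}. (\<lambda>n. mart (real n) \<omega>) \<longlonglongrightarrow> mart_limit \<omega>"
proof -
  have "filterlim real (inf at_top (principal (range real))) sequentially"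
    by (auto simp: filterlim_inf filterlim_principal filterlim_real_sequentially)
  with AE_mart_limit[of "range real" x] show ?thesis
    by (auto elim!: eventually_mono intro: filterlim_compose)
qed

text \<open>Fatou's lemma, as the rate in \<open>mart_L1\<close> is uniform in the later time.\<close>

lemma mart_limit_L1:
  assumes s: "0 \<le> s"
  shows "(\<integral>\<^sup>+\<omega>. ennreal \<bar>mart s \<omega> - mart_limit \<omega>\<bar> \<partial>\<PP> {#x#}) \<le> ennreal (increment_const phi_bound * exp (- lam * s / 2))"
proof -
  have [measurable]: "mart (real n) \<in> borel_measurable (\<PP> {#x#})" for n by (rule measurable_mart) simp
  have [measurable]: "mart s \<in> borel_measurable (\<PP> {#x#})" by (rule measurable_mart[OF s])
  have "(\<integral>\<^sup>+\<omega>. ennreal \<bar>mart s \<omega> - mart_limit \<omega>\<bar> \<partial>\<PP> {#x#})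
      = (\<integral>\<^sup>+\<omega>. liminf (\<lambda>n. ennreal \<bar>mart (real n) \<omega> - mart s \<omega>\<bar>) \<partial>\<PP> {#x#})"
  proof (rule nn_integral_cong_AE)
    show "AE \<omega> in \<PP> {#x#}. ennreal \<bar>mart s \<omega> - mart_limit \<omega>\<bar> = liminf (\<lambda>n. ennreal \<bar>mart (real n) \<omega> - mart s \<omega>\<bar>)"
      using AE_mart_limit_seq[of x]
    proof eventually_elim
      case (elim \<omega>)
      have "(\<lambda>n. ennreal \<bar>mart (real n) \<omega> - mart s \<omega>\<bar>) \<longlonglongrightarrow> ennreal \<bar>mart_limit \<omega> - mart s \<omega>\<bar>"
        by (intro tendsto_ennrealI tendsto_intros elim)
      from lim_imp_Liminf[OF _ this] show ?case by (simp only: abs_minus_commute trivial_limit_sequentially not_False_eq_True)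
    qed
  qed
  also have "\<dots> \<le> liminf (\<lambda>n. \<integral>\<^sup>+\<omega>. ennreal \<bar>mart (real n) \<omega> - mart s \<omega>\<bar> \<partial>\<PP> {#x#})"
    by (rule nn_integral_liminf) measurable
  also have "\<dots> \<le> ennreal (increment_const phi_bound * exp (- lam * s / 2))"
  proof (rule order_trans[OF Liminf_le_Limsup Limsup_bounded], simp)
    have "\<forall>\<^sub>F n in sequentially. s \<le> real n"
      using filterlim_real_sequentially by (auto simp: filterlim_at_top)
    then show "\<forall>\<^sub>F n in sequentially. (\<integral>\<^sup>+\<omega>. ennreal \<bar>mart (real n) \<omega> - mart s \<omega>\<bar> \<partial>\<PP> {#x#})
        \<le> ennreal (increment_const phi_bound * exp (- lam * s / 2))"
      by eventually_elim (rule mart_L1[OF s])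
  qed
  finally show ?thesis .
qed

text \<open>
  Any late time can be approached from the right through rational times, at which the martingale
  is already close to its limit.
\<close>

lemma AE_mart_limit_right_continuous:
  assumes rc: "AE \<omega> in \<PP> {#x#}. \<forall>t\<ge>0. continuous (at_right t) (\<lambda>t. \<Sum>y\<in>#X t \<omega>. \<phi> y)"
  shows "AE \<omega> in \<PP> {#x#}. ((\<lambda>t. mart t \<omega>) \<longlongrightarrow> mart_limit \<omega>) at_top"
  using rc AE_mart_limit[OF countable_rat, of x]
proof eventually_elim
  case (elim \<omega>)
  show ?case
  proof (rule tendstoI)
    fix e :: real assume e: "0 < e"
    have "\<forall>\<^sub>F t in inf at_top (principal \<rat>). dist (mart t \<omega>) (mart_limit \<omega>) < e / 2"
      using elim(2) e by (intro tendstoD) auto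
    then obtain N where N: "\<And>t. N \<le> t \<Longrightarrow> t \<in> \<rat> \<Longrightarrow> dist (mart t \<omega>) (mart_limit \<omega>) < e / 2"
      unfolding eventually_inf_principal by (auto simp: eventually_at_top_linorder)
    have "dist (mart t \<omega>) (mart_limit \<omega>) < e" if t: "max 0 N \<le> t" for t
    proof -
      have "((\<lambda>r. \<Sum>y\<in>#X r \<omega>. \<phi> y) \<longlongrightarrow> (\<Sum>y\<in>#X t \<omega>. \<phi> y)) (at_right t)"
        using elim(1) t by (auto simp: continuous_within)
      then have "((\<lambda>r. mart r \<omega>) \<longlongrightarrow> mart t \<omega>) (at_right t)"
        unfolding mart_def by (intro tendsto_intros)
      then have "\<forall>\<^sub>F r in at_right t. dist (mart r \<omega>) (mart t \<omega>) < e / 2"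
        using e by (intro tendstoD) auto
      then obtain b where b: "t < b" "\<And>r. t < r \<Longrightarrow> r < b \<Longrightarrow> dist (mart r \<omega>) (mart t \<omega>) < e / 2"
        unfolding eventually_at_right_field by blast
      obtain r where r: "r \<in> \<rat>" "t < r" "r < b" using Rats_dense_in_real[OF b(1)] by blast
      have "dist (mart r \<omega>) (mart_limit \<omega>) < e / 2" using r t by (intro N) auto
      moreover have "dist (mart r \<omega>) (mart t \<omega>) < e / 2" using r b by auto
      ultimately show ?thesis unfolding dist_real_def by linarith
    qed
    then show "\<forall>\<^sub>F t in at_top. dist (mart t \<omega>) (mart_limit \<omega>) < e"
      unfolding eventually_at_top_linorder by blast
  qed
qed

end

section \<open>Convergence in distribution\<close>

lemma iexp_lipschitz: "cmod (iexp a - iexp b) \<le> \<bar>a - b\<bar>"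
proof -
  have "iexp a - iexp b = iexp b * (iexp (a - b) - 1)"
    by (simp add: algebra_simps exp_add[symmetric])
  then have "cmod (iexp a - iexp b) = cmod (iexp (a - b) - 1)"
    by (simp add: norm_mult)
  also have "\<dots> \<le> \<bar>a - b\<bar>" using iexp_approx1[of "a - b" 0] by simp
  finally show ?thesis .
qed

text \<open>
  Characteristic functions are Lipschitz with respect to mean absolute deviation, so Levy's
  continuity theorem applies.
\<close>

lemma weak_conv_m_if_L1:
  fixes U :: "nat \<Rightarrow> 'b \<Rightarrow> real"
  assumes M: "prob_space M" and U: "\<forall>\<^sub>F n in sequentially. U n \<in> borel_measurable M"
    and V [measurable]: "V \<in> borel_measurable M"
    and lim: "(\<lambda>n. \<integral>\<^sup>+x. ennreal \<bar>U n x - V x\<bar> \<partial>M) \<longlonglongrightarrow> 0"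
  shows "weak_conv_m (\<lambda>n. distr M borel (U n)) (distr M borel V)"
proof -
  interpret prob_space M by fact
  \<comment> \<open>an arbitrary measurable value replaces the finitely many functions that may fail to be measurable\<close>
  define U' where "U' n = (if U n \<in> borel_measurable M then U n else V)" for n
  have U' [measurable]: "U' n \<in> borel_measurable M" for n by (simp add: U'_def)
  have ev: "\<forall>\<^sub>F n in sequentially. U' n = U n" using U by eventually_elim (simp add: U'_def)
  have lim': "(\<lambda>n. \<integral>\<^sup>+x. ennreal \<bar>U' n x - V x\<bar> \<partial>M) \<longlonglongrightarrow> 0"
    using lim by (rule Lim_transform_eventually) (use ev in \<open>auto elim: eventually_mono\<close>)
  have rd: "real_distribution (distr M borel W)" if "W \<in> borel_measurable M" for W
    using that by (rule real_distribution_distr)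
  have "weak_conv_m (\<lambda>n. distr M borel (U' n)) (distr M borel V)"
  proof (rule levy_continuity[OF rd[OF U'] rd[OF V]])
    fix t
    have ch: "char (distr M borel W) t = (\<integral>x. iexp (t * W x) \<partial>M)" if [measurable]: "W \<in> borel_measurable M" for W
      unfolding char_def by (subst integral_distr) auto
    have int: "integrable M (\<lambda>x. iexp (t * W x))" if [measurable]: "W \<in> borel_measurable M" for W
      by (rule integrable_const_bound[where B = 1]) auto
    have bd: "ennreal (cmod (char (distr M borel (U' n)) t - char (distr M borel V) t))
        \<le> ennreal \<bar>t\<bar> * (\<integral>\<^sup>+x. ennreal \<bar>U' n x - V x\<bar> \<partial>M)" for n
    proof -
      have "char (distr M borel (U' n)) t - char (distr M borel V) t = (\<integral>x. iexp (t * U' n x) - iexp (t * V x) \<partial>M)"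
        unfolding ch[OF U'] ch[OF V] by (rule Bochner_Integration.integral_diff[symmetric, OF int[OF U'] int[OF V]])
      then have "ennreal (cmod (char (distr M borel (U' n)) t - char (distr M borel V) t))
          \<le> (\<integral>\<^sup>+x. ennreal (cmod (iexp (t * U' n x) - iexp (t * V x))) \<partial>M)"
        using integral_norm_bound_ennreal[of M "\<lambda>x. iexp (t * U' n x) - iexp (t * V x)"] int by simp
      also have "\<dots> \<le> (\<integral>\<^sup>+x. ennreal \<bar>t\<bar> * ennreal \<bar>U' n x - V x\<bar> \<partial>M)"
      proof (intro nn_integral_mono)
        fix x
        have "cmod (iexp (t * U' n x) - iexp (t * V x)) \<le> \<bar>t\<bar> * \<bar>U' n x - V x\<bar>"
          using iexp_lipschitz[of "t * U' n x" "t * V x"] by (simp only: right_diff_distrib[symmetric] abs_mult)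
        then show "ennreal (cmod (iexp (t * U' n x) - iexp (t * V x))) \<le> ennreal \<bar>t\<bar> * ennreal \<bar>U' n x - V x\<bar>"
          by (simp only: ennreal_mult'[symmetric] abs_ge_zero ennreal_leI)
      qed
      also have "\<dots> = ennreal \<bar>t\<bar> * (\<integral>\<^sup>+x. ennreal \<bar>U' n x - V x\<bar> \<partial>M)"
        by (rule nn_integral_cmult) measurable
      finally show ?thesis .
    qed
    have "(\<lambda>n. ennreal \<bar>t\<bar> * (\<integral>\<^sup>+x. ennreal \<bar>U' n x - V x\<bar> \<partial>M)) \<longlonglongrightarrow> ennreal \<bar>t\<bar> * 0"
      by (rule ennreal_tendsto_cmult[OF _ lim']) simp
    then have up: "(\<lambda>n. ennreal \<bar>t\<bar> * (\<integral>\<^sup>+x. ennreal \<bar>U' n x - V x\<bar> \<partial>M)) \<longlonglongrightarrow> 0" by simp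
    have "(\<lambda>n. ennreal (cmod (char (distr M borel (U' n)) t - char (distr M borel V) t))) \<longlonglongrightarrow> 0"
      by (rule tendsto_sandwich[OF always_eventually always_eventually tendsto_const up]) (simp_all only: bd zero_le simp_thms)
    then have "(\<lambda>n. ennreal (cmod (char (distr M borel (U' n)) t - char (distr M borel V) t))) \<longlonglongrightarrow> ennreal 0"
      by (simp only: ennreal_0)
    then have "(\<lambda>n. cmod (char (distr M borel (U' n)) t - char (distr M borel V) t)) \<longlonglongrightarrow> 0"
      by (rule tendsto_ennrealD) auto
    then show "(\<lambda>n. char (distr M borel (U' n)) t) \<longlonglongrightarrow> char (distr M borel V) t"
      unfolding LIM_zero_iff[symmetric, of _ "char (distr M borel V) t"] by (rule tendsto_norm_zero_cancel)
  qed
  then show ?thesis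
    unfolding weak_conv_m_def weak_conv_def
  proof (intro allI impI, elim allE impE)
    fix y
    assume "(\<lambda>n. cdf (distr M borel (U' n)) y) \<longlonglongrightarrow> cdf (distr M borel V) y"
    then show "(\<lambda>n. cdf (distr M borel (U n)) y) \<longlonglongrightarrow> cdf (distr M borel V) y"
      by (rule Lim_transform_eventually) (use ev in \<open>auto elim: eventually_mono\<close>)
  qed
qed

context supercritical_branching
begin

text \<open>
  Three errors add up: at time \<open>s + t\<close> the population is close to its conditional mean given the
  time \<open>s\<close>, this mean is close to \<open>(\<integral>y. f y \<partial>\<phi>t)\<close> times the martingale at time \<open>s\<close> by ergodicity
  over the remaining time \<open>t\<close>, and the martingale at time \<open>s\<close> is close to its limit.
\<close>

lemma population_L1_bound:
  assumes f: "f \<in> bfun_nonneg" "\<And>y. f y \<le> A" and s: "0 \<le> s" and t: "0 \<le> t"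
    and erg: "\<And>y. \<bar>exp (- lam * t) * mean_semigroup \<PP> X t f y - (\<integral>y. f y \<partial>\<phi>t) * \<phi> y\<bar> \<le> A * \<epsilon> * \<phi> y"
    and \<epsilon>: "0 \<le> \<epsilon>"
  shows "(\<integral>\<^sup>+\<omega>. ennreal \<bar>exp (- lam * (s + t)) * (\<Sum>y\<in>#X (s + t) \<omega>. f y) - mart_limit \<omega> * (\<integral>y. f y \<partial>\<phi>t)\<bar> \<partial>\<PP> {#x#})
    \<le> ennreal (increment_const A * exp (- lam * s / 2) + A * \<epsilon> * \<phi> x
        + (\<integral>y. f y \<partial>\<phi>t) * (increment_const phi_bound * exp (- lam * s / 2)))"
proof -
  let ?M = "\<PP> {#x#}"
  define c where "c = (\<integral>y. f y \<partial>\<phi>t)"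
  have c0: "0 \<le> c" unfolding c_def by (intro Bochner_Integration.integral_nonneg bfun_nonneg_pos f)
  have A0: "0 \<le> A" using f bfun_nonneg_pos order_trans by blast
  define U where "U \<omega> = exp (- lam * (s + t)) * (\<Sum>y\<in>#X (s + t) \<omega>. f y)" for \<omega>
  define V where "V \<omega> = exp (- lam * (s + t)) * (\<Sum>y\<in>#X s \<omega>. mean_semigroup \<PP> X t f y)" for \<omega>
  have [measurable]: "f \<in> borel_measurable borel" using f(1) by (rule bfun_nonneg_measurable)
  note [measurable] = measurable_mean_semigroup[OF f(1) t] measurable_process_law[OF s] measurable_mart[OF s] measurable_mart_limit
  have [measurable]: "X (s + t) \<in> ?M \<rightarrow>\<^sub>M atomic_space" using s t by (intro measurable_process_law) simp
  have [measurable]: "U \<in> borel_measurable ?M" "V \<in> borel_measurable ?M"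
    unfolding U_def V_def by measurable
  have VY: "\<bar>V \<omega> - c * mart s \<omega>\<bar> \<le> A * \<epsilon> * mart s \<omega>" for \<omega>
  proof -
    have sum: "\<bar>\<Sum>y\<in>#Z. g y\<bar> \<le> (\<Sum>y\<in>#Z. h y)" if "\<And>y. \<bar>g y\<bar> \<le> h y" for Z and g h :: "'a \<Rightarrow> real"
    proof (induction Z)
      case (add y Z)
      then show ?case using that[of y] by simp
    qed simp
    have "V \<omega> - c * mart s \<omega> = exp (- lam * s) * (\<Sum>y\<in>#X s \<omega>. exp (- lam * t) * mean_semigroup \<PP> X t f y - c * \<phi> y)"
    proof -
      have "(\<Sum>y\<in>#X s \<omega>. exp (- lam * t) * mean_semigroup \<PP> X t f y - c * \<phi> y)
          = exp (- lam * t) * (\<Sum>y\<in>#X s \<omega>. mean_semigroup \<PP> X t f y) - c * (\<Sum>y\<in>#X s \<omega>. \<phi> y)"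
        by (simp only: sum_mset_subtractf sum_mset_distrib_left)
      moreover have "exp (- lam * (s + t)) = exp (- lam * s) * exp (- lam * t)"
        by (simp add: exp_add[symmetric] algebra_simps)
      ultimately show ?thesis by (simp add: V_def mart_def right_diff_distrib)
    qed
    also have "\<bar>\<dots>\<bar> = exp (- lam * s) * \<bar>\<Sum>y\<in>#X s \<omega>. exp (- lam * t) * mean_semigroup \<PP> X t f y - c * \<phi> y\<bar>"
      by (simp add: abs_mult)
    also have "\<dots> \<le> exp (- lam * s) * (\<Sum>y\<in>#X s \<omega>. A * \<epsilon> * \<phi> y)"
      using erg by (intro mult_left_mono sum) (auto simp: c_def)
    also have "\<dots> = A * \<epsilon> * mart s \<omega>"
      by (simp add: mart_def sum_mset_distrib_left[symmetric])
    finally show ?thesis .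
  qed
  have "(\<integral>\<^sup>+\<omega>. ennreal \<bar>U \<omega> - mart_limit \<omega> * c\<bar> \<partial>?M)
      \<le> (\<integral>\<^sup>+\<omega>. ennreal \<bar>U \<omega> - V \<omega>\<bar> + (ennreal (A * \<epsilon>) * ennreal (mart s \<omega>) + ennreal c * ennreal \<bar>mart s \<omega> - mart_limit \<omega>\<bar>) \<partial>?M)"
  proof (intro nn_integral_mono)
    fix \<omega>
    have "\<bar>U \<omega> - mart_limit \<omega> * c\<bar> \<le> \<bar>U \<omega> - V \<omega>\<bar> + (\<bar>V \<omega> - c * mart s \<omega>\<bar> + \<bar>c * (mart s \<omega> - mart_limit \<omega>)\<bar>)"
      by (simp add: algebra_simps)
    also have "\<dots> \<le> \<bar>U \<omega> - V \<omega>\<bar> + (A * \<epsilon> * mart s \<omega> + c * \<bar>mart s \<omega> - mart_limit \<omega>\<bar>)"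
      using VY c0 by (simp add: abs_mult)
    finally have "ennreal \<bar>U \<omega> - mart_limit \<omega> * c\<bar> \<le> ennreal (\<bar>U \<omega> - V \<omega>\<bar> + (A * \<epsilon> * mart s \<omega> + c * \<bar>mart s \<omega> - mart_limit \<omega>\<bar>))"
      by (rule ennreal_leI)
    also have "\<dots> = ennreal \<bar>U \<omega> - V \<omega>\<bar> + (ennreal (A * \<epsilon>) * ennreal (mart s \<omega>) + ennreal c * ennreal \<bar>mart s \<omega> - mart_limit \<omega>\<bar>)"
      using A0 \<epsilon> c0 mart_nonneg by (simp add: ennreal_plus ennreal_mult)
    finally show "ennreal \<bar>U \<omega> - mart_limit \<omega> * c\<bar> \<le> \<dots>" .
  qed
  also have "\<dots> = (\<integral>\<^sup>+\<omega>. ennreal \<bar>U \<omega> - V \<omega>\<bar> \<partial>?M) + (ennreal (A * \<epsilon>) * (\<integral>\<^sup>+\<omega>. ennreal (mart s \<omega>) \<partial>?M)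
      + ennreal c * (\<integral>\<^sup>+\<omega>. ennreal \<bar>mart s \<omega> - mart_limit \<omega>\<bar> \<partial>?M))"
    by (simp add: nn_integral_add nn_integral_cmult)
  also have "\<dots> \<le> ennreal (increment_const A * exp (- lam * s / 2)) + (ennreal (A * \<epsilon>) * ennreal (\<phi> x)
      + ennreal c * ennreal (increment_const phi_bound * exp (- lam * s / 2)))"
    using conditional_mean_L1[OF f s t, of x] nn_integral_mart_total[OF s, of x] mart_limit_L1[OF s, of x]
    by (intro add_mono mult_left_mono) (auto simp: U_def V_def)
  also have "\<dots> = ennreal (increment_const A * exp (- lam * s / 2) + (A * \<epsilon> * \<phi> x
        + c * (increment_const phi_bound * exp (- lam * s / 2))))"
    using A0 \<epsilon> c0 phi_pos[of x] increment_const_pos[of A] increment_const_pos[of phi_bound]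
    by (simp add: ennreal_plus ennreal_mult less_imp_le)
  finally show ?thesis by (simp add: U_def c_def add.assoc)
qed

text \<open>The time is divided into halves, so that both phases become long.\<close>

lemma population_L1_limit:
  assumes f: "f \<in> bfun_nonneg"
  shows "((\<lambda>t. \<integral>\<^sup>+\<omega>. ennreal \<bar>exp (- lam * t) * (\<Sum>y\<in>#X t \<omega>. f y) - mart_limit \<omega> * (\<integral>y. f y \<partial>\<phi>t)\<bar> \<partial>\<PP> {#x#}) \<longlongrightarrow> 0) at_top"
proof -
  obtain A where A: "\<And>y. f y \<le> A"
    using f by (auto simp: bfun_nonneg_def bfun_def bounded_iff intro: order_trans[OF abs_ge_self])
  define c where "c = (\<integral>y. f y \<partial>\<phi>t)"
  let ?B = "\<lambda>t. increment_const A * exp (- lam * (t / 2) / 2) + A * ergodic_error (t / 2) * \<phi> x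
        + c * (increment_const phi_bound * exp (- lam * (t / 2) / 2))"
  have half: "filterlim (\<lambda>t::real. t / 2) at_top at_top" by real_asymp
  have e: "((\<lambda>t. exp (- lam * (t / 2) / 2)) \<longlongrightarrow> 0) at_top" using lam_pos by real_asymp
  have "(?B \<longlongrightarrow> increment_const A * 0 + A * 0 * \<phi> x + c * (increment_const phi_bound * 0)) at_top"
    by (intro tendsto_intros e filterlim_compose[OF ergodic_error_tendsto half])
  then have B: "((\<lambda>t. ennreal (?B t)) \<longlongrightarrow> 0) at_top" using tendsto_ennrealI by fastforce
  show ?thesis
  proof (rule tendsto_sandwich[OF _ _ tendsto_const B])
    have "\<forall>\<^sub>F t in at_top. \<forall>A f x. f \<in> bfun_nonneg \<longrightarrow> (\<forall>y. f y \<le> A) \<longrightarrow>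
      \<bar>exp (- lam * (t / 2)) * mean_semigroup \<PP> X (t / 2) f x - (\<integral>y. f y \<partial>\<phi>t) * \<phi> x\<bar> \<le> A * ergodic_error (t / 2) * \<phi> x"
      using half mean_semigroup_ergodic by (rule filterlim_iff[THEN iffD1, rule_format])
    then show "\<forall>\<^sub>F t in at_top. (\<integral>\<^sup>+\<omega>. ennreal \<bar>exp (- lam * t) * (\<Sum>y\<in>#X t \<omega>. f y) - mart_limit \<omega> * (\<integral>y. f y \<partial>\<phi>t)\<bar> \<partial>\<PP> {#x#}) \<le> ennreal (?B t)"
      using eventually_ge_at_top[of 0]
    proof eventually_elim
      case (elim t)
      then show ?case
        using population_L1_bound[OF f A, of "t / 2" "t / 2" "ergodic_error (t / 2)" x] f A by (auto simp: c_def)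
    qed
  qed simp
qed

lemma population_weak_conv:
  assumes f: "f \<in> bfun_nonneg" and tau: "filterlim \<tau> at_top sequentially"
  shows "weak_conv_m
    (\<lambda>n. distr (\<PP> {#x#}) borel (\<lambda>\<omega>. exp (- lam * \<tau> n) * (\<Sum>y\<in>#X (\<tau> n) \<omega>. f y)))
    (distr (\<PP> {#x#}) borel (\<lambda>\<omega>. mart_limit \<omega> * (\<integral>y. f y \<partial>\<phi>t)))"
proof (rule weak_conv_m_if_L1[OF prob])
  have [measurable]: "f \<in> borel_measurable borel" using f by (rule bfun_nonneg_measurable)
  note [measurable] = measurable_mart_limit
  have "\<forall>\<^sub>F n in sequentially. 0 \<le> \<tau> n" using tau by (auto simp: filterlim_at_top)
  then show "\<forall>\<^sub>F n in sequentially. (\<lambda>\<omega>. exp (- lam * \<tau> n) * (\<Sum>y\<in>#X (\<tau> n) \<omega>. f y)) \<in> borel_measurable (\<PP> {#x#})"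
  proof eventually_elim
    case (elim n)
    note [measurable] = measurable_process_law[OF elim]
    show ?case by measurable
  qed
  show "(\<lambda>\<omega>. mart_limit \<omega> * (\<integral>y. f y \<partial>\<phi>t)) \<in> borel_measurable (\<PP> {#x#})" by measurable
qed (rule filterlim_compose[OF population_L1_limit[OF f] tau])

end

section \<open>Integrals of the mean semigroup over all times\<close>

lemma nn_integral_exp_neg:
  assumes "0 < (c::real)"
  shows "(\<integral>\<^sup>+s. ennreal (exp (- c * s)) * indicator {0..} s \<partial>lborel) = ennreal (1 / c)"
proof -
  have "((\<lambda>s. - exp (- c * s) / c) \<longlongrightarrow> - 0 / c) at_top"
  proof (intro tendsto_intros)
    show "((\<lambda>s. exp (- c * s)) \<longlongrightarrow> 0) at_top" using assms by real_asymp
  qed (use assms in simp)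
  then have "(\<integral>\<^sup>+s. ennreal (exp (- c * s)) * indicator {0..} s \<partial>lborel) = ennreal (- 0 / c - - exp (- c * 0) / c)"
    using assms by (intro nn_integral_FTC_atLeast) (auto intro!: derivative_eq_intros)
  then show ?thesis by simp
qed

lemma set_integrable_exp_neg:
  assumes "0 < (c::real)"
  shows "set_integrable lborel {0..} (\<lambda>s. exp (- c * s))"
    and "(LBINT s:{0..}. exp (- c * s)) = 1 / c"
proof -
  have "(\<integral>\<^sup>+s. ennreal (indicator {0..} s *\<^sub>R exp (- c * s)) \<partial>lborel)
      = (\<integral>\<^sup>+s. ennreal (exp (- c * s)) * indicator {0..} s \<partial>lborel)"
    by (intro nn_integral_cong) (simp add: indicator_def)
  then have e: "(\<integral>\<^sup>+s. ennreal (indicator {0..} s *\<^sub>R exp (- c * s)) \<partial>lborel) = ennreal (1 / c)"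
    using nn_integral_exp_neg[OF assms] by simp
  show "set_integrable lborel {0..} (\<lambda>s. exp (- c * s))"
    unfolding set_integrable_def
  proof (rule integrableI_nonneg)
    show "AE s in lborel. 0 \<le> indicator {0..} s *\<^sub>R exp (- c * s)" by (rule AE_I2) (simp add: indicator_def)
    show "(\<integral>\<^sup>+s. ennreal (indicator {0..} s *\<^sub>R exp (- c * s)) \<partial>lborel) < \<infinity>"
      unfolding e by simp
  qed measurable
  show "(LBINT s:{0..}. exp (- c * s)) = 1 / c"
    unfolding set_lebesgue_integral_def
  proof (subst integral_eq_nn_integral)
    show "enn2real (\<integral>\<^sup>+s. ennreal (indicator {0..} s *\<^sub>R exp (- c * s)) \<partial>lborel) = 1 / c"
      unfolding e using assms by simp
    show "AE s in lborel. 0 \<le> indicator {0..} s *\<^sub>R exp (- c * s)" by (rule AE_I2) (simp add: indicator_def)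
  qed measurable
qed

lemma abs_sum_atoms_bound:
  fixes f :: "'b \<Rightarrow> real"
  assumes "\<And>z. \<bar>f z\<bar> \<le> c"
  shows "\<bar>\<Sum>z\<in>#Z. f z\<bar> \<le> c * real (size Z)"
proof (induction Z)
  case (add x Z)
  then show ?case using assms[of x] by (simp add: algebra_simps)
qed simp

context supercritical_branching
begin

lemma mean_semigroup_one_le: "0 \<le> t \<Longrightarrow> mean_semigroup \<PP> X t (\<lambda>_. 1) x \<le> mean_const * exp (lam * t)"
  using mean_semigroup_le[OF bfun_nonneg_const, of 1 1 t x] by simp

lemma integrable_size: "0 \<le> t \<Longrightarrow> integrable (\<PP> {#x#}) (\<lambda>\<omega>. real (size (X t \<omega>)))"
  using ennreal_mean_semigroup(3)[OF bfun_nonneg_const, of 1 t x] by simp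

lemma mean_semigroup_signed:
  assumes h [measurable]: "h \<in> borel_measurable borel" and B: "\<And>y. \<bar>h y\<bar> \<le> B" and t: "0 \<le> t"
  shows "integrable (\<PP> {#x#}) (\<lambda>\<omega>. \<Sum>y\<in>#X t \<omega>. h y)"
    and "\<bar>mean_semigroup \<PP> X t h x\<bar> \<le> B * (mean_const * exp (lam * t))"
proof -
  note [measurable] = measurable_process_law[OF t]
  have bd: "\<bar>\<Sum>y\<in>#X t \<omega>. h y\<bar> \<le> B * real (size (X t \<omega>))" for \<omega>
    by (rule abs_sum_atoms_bound) (rule B)
  have B0: "0 \<le> B" using B order_trans[OF abs_ge_zero] by blast
  show int: "integrable (\<PP> {#x#}) (\<lambda>\<omega>. \<Sum>y\<in>#X t \<omega>. h y)"
  proof (rule Bochner_Integration.integrable_bound)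
    show "integrable (\<PP> {#x#}) (\<lambda>\<omega>. B * real (size (X t \<omega>)))" using integrable_size[OF t] by simp
    show "AE \<omega> in \<PP> {#x#}. norm (\<Sum>y\<in>#X t \<omega>. h y) \<le> norm (B * real (size (X t \<omega>)))"
    proof (rule AE_I2)
      fix \<omega>
      show "norm (\<Sum>y\<in>#X t \<omega>. h y) \<le> norm (B * real (size (X t \<omega>)))"
        unfolding real_norm_def by (rule order_trans[OF bd abs_ge_self])
    qed
  qed measurable
  have "\<bar>mean_semigroup \<PP> X t h x\<bar> \<le> (\<integral>\<omega>. B * real (size (X t \<omega>)) \<partial>\<PP> {#x#})"
    unfolding mean_semigroup_def
    by (rule order_trans[OF integral_abs_bound integral_mono]) (use int integrable_size[OF t] bd in auto)
  also have "\<dots> = B * mean_semigroup \<PP> X t (\<lambda>_. 1) x" by (simp add: mean_semigroup_def)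
  also have "\<dots> \<le> B * (mean_const * exp (lam * t))"
    by (intro mult_left_mono mean_semigroup_one_le t B0)
  finally show "\<bar>mean_semigroup \<PP> X t h x\<bar> \<le> B * (mean_const * exp (lam * t))" .
qed

text \<open>
  The mean semigroup grows like \<open>exp (lam * s)\<close>. Functions that decay like the square of the
  inverse of this rate can be integrated against it over all times, and the nonlinear terms
  below, being quadratic, are of this kind.
\<close>

definition discounted :: "real \<Rightarrow> (real \<Rightarrow> 'a \<Rightarrow> real) \<Rightarrow> bool" where
  "discounted M k \<longleftrightarrow> (\<lambda>(s, y). k s y) \<in> borel_measurable (borel \<Otimes>\<^sub>M borel) \<and>
    (\<forall>s\<ge>0. \<forall>y. \<bar>k s y\<bar> \<le> M * exp (- 2 * lam * s))"

definition time_mean :: "(real \<Rightarrow> 'a \<Rightarrow> real) \<Rightarrow> 'a \<Rightarrow> real" where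
  "time_mean k x = (LBINT s:{0..}. mean_semigroup \<PP> X s (k s) x)"

lemma discountedD:
  assumes "discounted M k"
  shows "(\<lambda>(s, y). k s y) \<in> borel_measurable (borel \<Otimes>\<^sub>M borel)"
    and "k s \<in> borel_measurable borel"
    and "0 \<le> s \<Longrightarrow> \<bar>k s y\<bar> \<le> M * exp (- 2 * lam * s)"
    and "0 \<le> M"
proof -
  show [measurable]: "(\<lambda>(s, y). k s y) \<in> borel_measurable (borel \<Otimes>\<^sub>M borel)" using assms by (simp add: discounted_def)
  show "k s \<in> borel_measurable borel" by measurable
  show b: "0 \<le> s \<Longrightarrow> \<bar>k s y\<bar> \<le> M * exp (- 2 * lam * s)" for s using assms by (simp add: discounted_def)
  show "0 \<le> M" using order_trans[OF abs_ge_zero b[of 0]] by simp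
qed

lemma discounted_mean_bound:
  assumes k: "discounted M k" and s: "0 \<le> s"
  shows "\<bar>mean_semigroup \<PP> X s (k s) x\<bar> \<le> M * mean_const * exp (- lam * s)"
proof -
  have "\<bar>mean_semigroup \<PP> X s (k s) x\<bar> \<le> M * exp (- 2 * lam * s) * (mean_const * exp (lam * s))"
    using discountedD[OF k] s by (intro mean_semigroup_signed(2)) auto
  also have "\<dots> = M * mean_const * (exp (- 2 * lam * s) * exp (lam * s))" by simp
  also have "exp (- 2 * lam * s) * exp (lam * s) = exp (- lam * s)" by (simp add: exp_add[symmetric])
  finally show ?thesis .
qed

lemma measurable_time_mean_integrand:
  assumes k: "discounted M k"
  shows "(\<lambda>(x, s). indicator {0..} s *\<^sub>R mean_semigroup \<PP> X s (k s) x) \<in> borel_measurable (borel \<Otimes>\<^sub>M borel)"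
proof -
  note [measurable] = discountedD(1)[OF k]
  have eq: "indicator {0..} s *\<^sub>R mean_semigroup \<PP> X s (k s) x = (if 0 \<le> s then
      enn2real (mean_sum s (\<lambda>y. ennreal (k s y)) x) - enn2real (mean_sum s (\<lambda>y. ennreal (- k s y)) x) else 0)" for s x
  proof (cases "0 \<le> s")
    case True
    have m [measurable]: "k s \<in> borel_measurable borel" by (rule discountedD(2)[OF k])
    have p: "(\<lambda>y. max 0 (k s y)) \<in> bfun_nonneg" and n: "(\<lambda>y. max 0 (- k s y)) \<in> bfun_nonneg"
      using discountedD(3)[OF k True] discountedD(4)[OF k]
      by (auto simp: bfun_nonneg_def bfun_def abs_le_iff intro!: boundedI[of _ "M * exp (- 2 * lam * s)"])
    have "(\<Sum>y\<in>#X s \<omega>. k s y) = (\<Sum>y\<in>#X s \<omega>. max 0 (k s y)) - (\<Sum>y\<in>#X s \<omega>. max 0 (- k s y))" for \<omega>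
      by (subst sum_mset_subtractf[symmetric]) (auto intro!: arg_cong[where f = sum_mset] image_mset_cong)
    then have "mean_semigroup \<PP> X s (k s) x = mean_semigroup \<PP> X s (\<lambda>y. max 0 (k s y)) x - mean_semigroup \<PP> X s (\<lambda>y. max 0 (- k s y)) x"
      unfolding mean_semigroup_def using ennreal_mean_semigroup(3)[OF p True, of x] ennreal_mean_semigroup(3)[OF n True, of x] by simp
    moreover have "mean_semigroup \<PP> X s (\<lambda>y. max 0 (k s y)) x = enn2real (mean_sum s (\<lambda>y. ennreal (k s y)) x)"
    proof -
      have e: "(\<lambda>y. ennreal (max 0 (k s y))) = (\<lambda>y. ennreal (k s y))" by (auto simp: fun_eq_iff max_def ennreal_neg)
      show ?thesis using ennreal_mean_semigroup(2)[OF p True, of x]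
        unfolding e[symmetric] ennreal_mean_semigroup(1)[OF p True, symmetric] by simp
    qed
    moreover have "mean_semigroup \<PP> X s (\<lambda>y. max 0 (- k s y)) x = enn2real (mean_sum s (\<lambda>y. ennreal (- k s y)) x)"
    proof -
      have e: "(\<lambda>y. ennreal (max 0 (- k s y))) = (\<lambda>y. ennreal (- k s y))" by (auto simp: fun_eq_iff max_def ennreal_neg)
      show ?thesis using ennreal_mean_semigroup(2)[OF n True, of x]
        unfolding e[symmetric] ennreal_mean_semigroup(1)[OF n True, symmetric] by simp
    qed
    ultimately show ?thesis using True by simp
  qed simp
  show ?thesis unfolding eq by measurable
qed

lemma time_mean_integrable:
  assumes k: "discounted M k"
  shows "set_integrable lborel {0..} (\<lambda>s. mean_semigroup \<PP> X s (k s) x)"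
  unfolding set_integrable_def
proof (rule Bochner_Integration.integrable_bound)
  show "integrable lborel (\<lambda>s. M * mean_const * (indicator {0..} s *\<^sub>R exp (- lam * s)))"
    using set_integrable_exp_neg(1)[OF lam_pos] unfolding set_integrable_def by (rule integrable_mult_right)
  have "(\<lambda>s. indicator {0..} s *\<^sub>R mean_semigroup \<PP> X s (k s) x) \<in> borel_measurable borel"
    using measurable_Pair2[OF measurable_time_mean_integrand[OF k], of x] by simp
  then show "(\<lambda>s. indicator {0..} s *\<^sub>R mean_semigroup \<PP> X s (k s) x) \<in> borel_measurable lborel" by simp
  show "AE s in lborel. norm (indicator {0..} s *\<^sub>R mean_semigroup \<PP> X s (k s) x)
      \<le> norm (M * mean_const * (indicator {0..} s *\<^sub>R exp (- lam * s)))"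
    using discounted_mean_bound[OF k] discountedD(4)[OF k] mean_const_pos
    by (intro AE_I2) (auto simp: indicator_def abs_mult)
qed

lemma time_mean_bound:
  assumes k: "discounted M k"
  shows "\<bar>time_mean k x\<bar> \<le> M * mean_const / lam"
proof -
  have "\<bar>time_mean k x\<bar> \<le> (LBINT s:{0..}. M * mean_const * exp (- lam * s))"
    unfolding time_mean_def set_lebesgue_integral_def
  proof (rule order_trans[OF integral_abs_bound integral_mono])
    show "integrable lborel (\<lambda>s. \<bar>indicator {0..} s *\<^sub>R mean_semigroup \<PP> X s (k s) x\<bar>)"
      using time_mean_integrable[OF k] unfolding set_integrable_def by (rule integrable_abs)
    show "integrable lborel (\<lambda>s. indicator {0..} s *\<^sub>R (M * mean_const * exp (- lam * s)))"
      using set_integrable_mult_right[of "M * mean_const", OF set_integrable_exp_neg(1)[OF lam_pos]] unfolding set_integrable_def by simp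
    show "\<bar>indicator {0..} s *\<^sub>R mean_semigroup \<PP> X s (k s) x\<bar> \<le> indicator {0..} s *\<^sub>R (M * mean_const * exp (- lam * s))" for s
      using discounted_mean_bound[OF k] by (auto simp: indicator_def)
  qed
  also have "\<dots> = M * mean_const * (1 / lam)"
    unfolding set_integral_mult_right using set_integrable_exp_neg(2)[OF lam_pos] by simp
  finally show ?thesis by simp
qed

lemma measurable_time_mean:
  assumes k: "discounted M k"
  shows "time_mean k \<in> borel_measurable borel"
proof -
  have "(\<lambda>x. \<integral>s. indicator {0..} s *\<^sub>R mean_semigroup \<PP> X s (k s) x \<partial>lborel) \<in> borel_measurable borel"
    using measurable_time_mean_integrand[OF k]
    by (intro lborel.borel_measurable_lebesgue_integral) (simp cong: measurable_cong_sets sets_pair_measure_cong)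
  then show ?thesis unfolding time_mean_def[abs_def] set_lebesgue_integral_def .
qed

lemma discounted_diff:
  assumes k: "discounted M k" and l: "discounted N l"
  shows "discounted (M + N) (\<lambda>s y. k s y - l s y)"
    and "time_mean (\<lambda>s y. k s y - l s y) x = time_mean k x - time_mean l x"
proof -
  note [measurable] = discountedD(1)[OF k] discountedD(1)[OF l]
  have "\<bar>k s y - l s y\<bar> \<le> (M + N) * exp (- 2 * lam * s)" if "0 \<le> s" for s y
    using discountedD(3)[OF k that, of y] discountedD(3)[OF l that, of y] abs_triangle_ineq4[of "k s y" "l s y"]
    unfolding distrib_right by linarith
  then show "discounted (M + N) (\<lambda>s y. k s y - l s y)"
    unfolding discounted_def by (auto simp: split_beta)
  have "mean_semigroup \<PP> X s (\<lambda>y. k s y - l s y) x = mean_semigroup \<PP> X s (k s) x - mean_semigroup \<PP> X s (l s) x" if "0 \<le> s" for s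
    unfolding mean_semigroup_def sum_mset_subtractf
    by (intro Bochner_Integration.integral_diff
        mean_semigroup_signed(1)[OF discountedD(2)[OF k] discountedD(3)[OF k that] that]
        mean_semigroup_signed(1)[OF discountedD(2)[OF l] discountedD(3)[OF l that] that])
  then have "time_mean (\<lambda>s y. k s y - l s y) x = (LBINT s:{0..}. mean_semigroup \<PP> X s (k s) x - mean_semigroup \<PP> X s (l s) x)"
    unfolding time_mean_def by (intro set_lebesgue_integral_cong) auto
  then show "time_mean (\<lambda>s y. k s y - l s y) x = time_mean k x - time_mean l x"
    using time_mean_integrable[OF k] time_mean_integrable[OF l] by (simp add: set_integral_diff time_mean_def)
qed

lemma discounted_cmult:
  assumes k: "discounted M k"
  shows "discounted (\<bar>c\<bar> * M) (\<lambda>s y. c * k s y)"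
    and "time_mean (\<lambda>s y. c * k s y) x = c * time_mean k x"
proof -
  note [measurable] = discountedD(1)[OF k]
  show "discounted (\<bar>c\<bar> * M) (\<lambda>s y. c * k s y)"
    unfolding discounted_def using discountedD(3)[OF k]
    by (auto simp: split_beta abs_mult mult.assoc intro!: mult_left_mono)
  show "time_mean (\<lambda>s y. c * k s y) x = c * time_mean k x"
    unfolding time_mean_def mean_semigroup_scale by (rule set_integral_mult_right)
qed

lemma discounted_sum:
  assumes k: "\<And>i. i \<in> I \<Longrightarrow> discounted (M i) (k i)" and I: "finite I"
  shows "discounted (\<Sum>i\<in>I. M i) (\<lambda>s y. \<Sum>i\<in>I. k i s y)"
    and "time_mean (\<lambda>s y. \<Sum>i\<in>I. k i s y) x = (\<Sum>i\<in>I. time_mean (k i) x)"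
proof -
  have "discounted (\<Sum>i\<in>I. M i) (\<lambda>s y. \<Sum>i\<in>I. k i s y) \<and>
      time_mean (\<lambda>s y. \<Sum>i\<in>I. k i s y) x = (\<Sum>i\<in>I. time_mean (k i) x)"
    using I k
  proof (induction I)
    case empty
    show ?case by (simp add: discounted_def time_mean_def mean_semigroup_def)
  next
    case (insert i I)
    have 1: "discounted (M i) (k i)" using insert by simp
    have IH: "discounted (\<Sum>i\<in>I. M i) (\<lambda>s y. \<Sum>i\<in>I. k i s y)"
      "time_mean (\<lambda>s y. \<Sum>i\<in>I. k i s y) x = (\<Sum>i\<in>I. time_mean (k i) x)"
      using insert by auto
    have 2: "discounted (\<Sum>i\<in>I. M i) (\<lambda>s y. - 1 * (\<Sum>i\<in>I. k i s y))"
      using discounted_cmult(1)[OF IH(1), of "- 1"] by simp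
    have 3: "time_mean (\<lambda>s y. - 1 * (\<Sum>i\<in>I. k i s y)) x = - 1 * (\<Sum>i\<in>I. time_mean (k i) x)"
      unfolding discounted_cmult(2)[OF IH(1)] IH(2) ..
    show ?case
      using discounted_diff[OF 1 2] 3 insert.hyps by simp
  qed
  then show "discounted (\<Sum>i\<in>I. M i) (\<lambda>s y. \<Sum>i\<in>I. k i s y)"
    and "time_mean (\<lambda>s y. \<Sum>i\<in>I. k i s y) x = (\<Sum>i\<in>I. time_mean (k i) x)" by auto
qed

lemma time_mean_tendsto:
  assumes k: "\<And>n. discounted M (k n)" and l: "discounted M l"
    and lim: "\<And>s y. 0 \<le> s \<Longrightarrow> (\<lambda>n. k n s y) \<longlonglongrightarrow> l s y"
  shows "(\<lambda>n. time_mean (k n) x) \<longlonglongrightarrow> time_mean l x"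
  unfolding time_mean_def set_lebesgue_integral_def
proof (rule integral_dominated_convergence[where w = "\<lambda>s. M * mean_const * (indicator {0..} s *\<^sub>R exp (- lam * s))"])
  show "(\<lambda>s. indicator {0..} s *\<^sub>R mean_semigroup \<PP> X s (l s) x) \<in> borel_measurable lborel"
    using time_mean_integrable[OF l] unfolding set_integrable_def by (rule borel_measurable_integrable)
  show "(\<lambda>s. indicator {0..} s *\<^sub>R mean_semigroup \<PP> X s (k n s) x) \<in> borel_measurable lborel" for n
    using time_mean_integrable[OF k] unfolding set_integrable_def by (rule borel_measurable_integrable)
  show "integrable lborel (\<lambda>s. M * mean_const * (indicator {0..} s *\<^sub>R exp (- lam * s)))"
    using set_integrable_exp_neg(1)[OF lam_pos] unfolding set_integrable_def by (rule integrable_mult_right)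
  show "AE s in lborel. norm (indicator {0..} s *\<^sub>R mean_semigroup \<PP> X s (k n s) x)
      \<le> M * mean_const * (indicator {0..} s *\<^sub>R exp (- lam * s))" for n
    using discounted_mean_bound[OF k] by (intro AE_I2) (auto simp: indicator_def)
  show "AE s in lborel. (\<lambda>n. indicator {0..} s *\<^sub>R mean_semigroup \<PP> X s (k n s) x)
      \<longlonglongrightarrow> indicator {0..} s *\<^sub>R mean_semigroup \<PP> X s (l s) x"
  proof (rule AE_I2)
    fix s :: real
    show "(\<lambda>n. indicator {0..} s *\<^sub>R mean_semigroup \<PP> X s (k n s) x) \<longlonglongrightarrow> indicator {0..} s *\<^sub>R mean_semigroup \<PP> X s (l s) x"
    proof (cases "0 \<le> s")
      case True
      let ?B = "M * exp (- 2 * lam * s)"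
      have "(\<lambda>n. mean_semigroup \<PP> X s (k n s) x) \<longlonglongrightarrow> mean_semigroup \<PP> X s (l s) x"
        unfolding mean_semigroup_def
      proof (rule integral_dominated_convergence[where w = "\<lambda>\<omega>. ?B * real (size (X s \<omega>))"])
        show "(\<lambda>\<omega>. \<Sum>y\<in>#X s \<omega>. l s y) \<in> borel_measurable (\<PP> {#x#})"
          "(\<lambda>\<omega>. \<Sum>y\<in>#X s \<omega>. k n s y) \<in> borel_measurable (\<PP> {#x#})" for n
          by (rule borel_measurable_integrable, rule mean_semigroup_signed(1)[OF discountedD(2)[OF l] discountedD(3)[OF l True] True],
              rule borel_measurable_integrable, rule mean_semigroup_signed(1)[OF discountedD(2)[OF k] discountedD(3)[OF k True] True])
        show "integrable (\<PP> {#x#}) (\<lambda>\<omega>. ?B * real (size (X s \<omega>)))"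
          using integrable_size[OF True] by simp
        show "AE \<omega> in \<PP> {#x#}. (\<lambda>n. \<Sum>y\<in>#X s \<omega>. k n s y) \<longlonglongrightarrow> (\<Sum>y\<in>#X s \<omega>. l s y)"
          by (rule AE_I2, rule tendsto_sum_mset, rule lim[OF True])
        show "AE \<omega> in \<PP> {#x#}. norm (\<Sum>y\<in>#X s \<omega>. k n s y) \<le> ?B * real (size (X s \<omega>))" for n
          unfolding real_norm_def by (rule AE_I2, rule abs_sum_atoms_bound, rule discountedD(3)[OF k True])
      qed
      then show ?thesis using True by simp
    qed simp
  qed
qed

lemma ennreal_time_mean:
  assumes k: "discounted M k" and k0: "\<And>s y. 0 \<le> s \<Longrightarrow> 0 \<le> k s y"
  shows "ennreal (time_mean k x) = (\<integral>\<^sup>+s. mean_sum s (\<lambda>y. ennreal (k s y)) x * indicator {0..} s \<partial>lborel)"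
    and "0 \<le> time_mean k x"
proof -
  have b: "k s \<in> bfun_nonneg" if "0 \<le> s" for s
    using discountedD(2)[OF k] discountedD(3)[OF k that] k0[OF that]
    by (auto simp: bfun_nonneg_def bfun_def intro!: boundedI[of _ "M * exp (- 2 * lam * s)"])
  have nn: "0 \<le> indicator {0..} s *\<^sub>R mean_semigroup \<PP> X s (k s) x" for s
    using ennreal_mean_semigroup(2)[OF b] by (simp add: indicator_def)
  show "0 \<le> time_mean k x"
    unfolding time_mean_def set_lebesgue_integral_def by (intro Bochner_Integration.integral_nonneg nn)
  have "ennreal (time_mean k x) = (\<integral>\<^sup>+s. ennreal (indicator {0..} s *\<^sub>R mean_semigroup \<PP> X s (k s) x) \<partial>lborel)"
    unfolding time_mean_def set_lebesgue_integral_def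
    using time_mean_integrable[OF k] nn unfolding set_integrable_def by (intro nn_integral_eq_integral[symmetric] AE_I2)
  also have "\<dots> = (\<integral>\<^sup>+s. mean_sum s (\<lambda>y. ennreal (k s y)) x * indicator {0..} s \<partial>lborel)"
    using ennreal_mean_semigroup(1)[OF b] by (intro nn_integral_cong) (simp add: indicator_def)
  finally show "ennreal (time_mean k x) = (\<integral>\<^sup>+s. mean_sum s (\<lambda>y. ennreal (k s y)) x * indicator {0..} s \<partial>lborel)" .
qed

text \<open>
  The lower bound \<open>- 1/2\<close> allows for the power series considered later, whose values can have
  either sign.
\<close>

lemma branching_remainder_lipschitz:
  assumes w [measurable]: "w \<in> borel_measurable borel" and v [measurable]: "v \<in> borel_measurable borel"
    and b: "\<And>z. \<bar>w z\<bar> \<le> \<eta>" "\<And>z. \<bar>v z\<bar> \<le> \<eta>" "\<And>z. \<bar>w z - v z\<bar> \<le> \<delta>"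
    and h: "\<And>z. - (1/2) \<le> w z" "\<And>z. - (1/2) \<le> v z" "\<And>z. w z < 1" "\<And>z. v z < 1"
  shows "\<bar>branching_remainder w y - branching_remainder v y\<bar> \<le> rate_bound * (18 * (\<eta> * \<delta>) * off_bound)"
    and "integrable (Off y) (remainder w)"
proof -
  have nn: "0 \<le> \<eta>" "0 \<le> \<delta>" using b(1,3) order_trans[OF abs_ge_zero] by blast+
  have q: "\<bar>1 - w z\<bar> \<le> 3/2" "\<bar>1 - v z\<bar> \<le> 3/2" for z
    using h(1)[of z] h(2)[of z] h(3)[of z] h(4)[of z] by linarith+
  have scale: "(real n)\<^sup>2 * c * (3/2) ^ n \<le> 18 * c * 2 ^ n" if "0 \<le> c" for n c
    using mult_left_mono[OF square_le_power_two[of n] that] by (simp add: ac_simps)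
  have mw: "remainder w \<in> borel_measurable atomic_space" "remainder v \<in> borel_measurable atomic_space"
    by (rule borel_measurable_remainder; use h in simp)+
  have bd: "\<bar>remainder u Z\<bar> \<le> 18 * \<eta>\<^sup>2 * 2 ^ size Z"
    if "\<And>z. \<bar>u z\<bar> \<le> \<eta>" "\<And>z. \<bar>1 - u z\<bar> \<le> 3/2" for u :: "'a \<Rightarrow> real" and Z
    by (rule order_trans[OF remainder_bound[OF that] scale]) auto
  have iw: "integrable (Off y) (remainder w)" and iv: "integrable (Off y) (remainder v)"
    by (rule integrable_offspring[OF mw(1) bd[OF b(1) q(1)]], rule integrable_offspring[OF mw(2) bd[OF b(2) q(2)]])
  show "integrable (Off y) (remainder w)" by (rule iw)
  have D: "\<bar>remainder w Z - remainder v Z\<bar> \<le> 18 * (\<eta> * \<delta>) * 2 ^ size Z" for Z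
    by (rule order_trans[OF remainder_lipschitz[OF b q] scale]) (use nn in auto)
  have "ennreal \<bar>\<integral>Z. remainder w Z - remainder v Z \<partial>Off y\<bar> \<le> (\<integral>\<^sup>+Z. ennreal \<bar>remainder w Z - remainder v Z\<bar> \<partial>Off y)"
    using integral_norm_bound_ennreal[of "Off y" "\<lambda>Z. remainder w Z - remainder v Z"] iw iv by simp
  also have "\<dots> \<le> ennreal (18 * (\<eta> * \<delta>) * off_bound)"
    using D nn by (intro offspring_integral_le) auto
  finally have I: "\<bar>\<integral>Z. remainder w Z - remainder v Z \<partial>Off y\<bar> \<le> 18 * (\<eta> * \<delta>) * off_bound"
    using nn by (subst (asm) ennreal_le_iff) auto
  have "branching_remainder w y - branching_remainder v y = \<gamma> y * (\<integral>Z. remainder w Z - remainder v Z \<partial>Off y)"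
    using iw iv by (simp add: branching_remainder_def right_diff_distrib)
  then show "\<bar>branching_remainder w y - branching_remainder v y\<bar> \<le> rate_bound * (18 * (\<eta> * \<delta>) * off_bound)"
    using I gamma_le[of y] by (simp add: abs_mult mult_mono)
qed

section \<open>The Laplace transform of the limit\<close>

text \<open>The Laplace transform of the limit, again as distance from one.\<close>

definition limit_gap :: "real \<Rightarrow> 'a \<Rightarrow> real" where
  "limit_gap \<theta> x = 1 - (\<integral>\<omega>. exp (- (\<theta> * mart_limit \<omega>)) \<partial>\<PP> {#x#})"

lemma phi_scaled: "0 \<le> c \<Longrightarrow> (\<lambda>y. c * \<phi> y) \<in> bfun_nonneg"
  by (rule bfun_nonneg_scale[OF phi])

lemma laplace_gap_phi:
  assumes "0 \<le> t"
  shows "laplace_gap (\<lambda>y. \<theta> * exp (- lam * t) * \<phi> y) t x = 1 - (\<integral>\<omega>. exp (- (\<theta> * mart t \<omega>)) \<partial>\<PP> {#x#})"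
  using assms by (simp add: laplace_gap_def exp_functional_def mart_def sum_mset_distrib_left[symmetric] mult.assoc)

lemma integrable_exp_neg_mult:
  fixes V :: "'w \<Rightarrow> real"
  assumes "V \<in> borel_measurable (\<PP> {#x#})" "\<And>\<omega>. 0 \<le> V \<omega>" "0 \<le> \<theta>"
  shows "integrable (\<PP> {#x#}) (\<lambda>\<omega>. exp (- (\<theta> * V \<omega>)))"
proof -
  interpret prob_space "\<PP> {#x#}" by (rule prob)
  note [measurable] = assms(1)
  have "norm (exp (- (\<theta> * V \<omega>))) \<le> 1" for \<omega>
    using mult_nonneg_nonneg[OF assms(3) assms(2)[of \<omega>]] by simp
  then show ?thesis by (intro integrable_const_bound[where B = 1] AE_I2) measurable
qed

lemma exp_neg_lipschitz:
  fixes a b :: real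
  assumes "0 \<le> a" "0 \<le> b"
  shows "\<bar>exp (- a) - exp (- b)\<bar> \<le> \<bar>a - b\<bar>"
proof -
  have *: "exp (- a) - exp (- b) \<le> b - a" if "0 \<le> a" "a \<le> b" for a b :: real
  proof -
    have "exp (- a) - exp (- b) = exp (- a) * (1 - exp (- (b - a)))" by (simp add: algebra_simps exp_add[symmetric])
    also have "\<dots> \<le> 1 * (b - a)" using that one_minus_exp_le[of "b - a"] by (intro mult_mono) auto
    finally show ?thesis by simp
  qed
  show ?thesis
    using *[of a b] *[of b a] assms by (cases "a \<le> b") auto
qed

lemma limit_gap_nonneg: "0 \<le> \<theta> \<Longrightarrow> 0 \<le> limit_gap \<theta> x"
  and limit_gap_less_1: "0 \<le> \<theta> \<Longrightarrow> limit_gap \<theta> x < 1"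
proof -
  interpret prob_space "\<PP> {#x#}" by (rule prob)
  assume th: "0 \<le> \<theta>"
  let ?I = "\<integral>\<omega>. exp (- (\<theta> * mart_limit \<omega>)) \<partial>\<PP> {#x#}"
  have int: "integrable (\<PP> {#x#}) (\<lambda>\<omega>. exp (- (\<theta> * mart_limit \<omega>)))"
    by (rule integrable_exp_neg_mult[OF measurable_mart_limit mart_limit_nonneg th])
  have "?I \<le> (\<integral>\<omega>. 1 \<partial>\<PP> {#x#})"
    using mart_limit_nonneg th by (intro integral_mono int) auto
  then show "0 \<le> limit_gap \<theta> x" by (simp add: limit_gap_def prob_space)
  have "?I \<noteq> 0" by (subst integral_nonneg_eq_0_iff_AE[OF int]) auto
  moreover have "0 \<le> ?I" by (rule Bochner_Integration.integral_nonneg) auto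
  ultimately show "limit_gap \<theta> x < 1" by (simp add: limit_gap_def less_le)
qed

lemma laplace_gap_limit:
  assumes t: "0 \<le> t" and th: "0 \<le> \<theta>"
  shows "\<bar>laplace_gap (\<lambda>y. \<theta> * exp (- lam * t) * \<phi> y) t x - limit_gap \<theta> x\<bar>
    \<le> \<theta> * (increment_const phi_bound * exp (- lam * t / 2))"
proof -
  let ?M = "\<PP> {#x#}"
  note [measurable] = measurable_mart_limit measurable_mart[OF t]
  have i1: "integrable ?M (\<lambda>\<omega>. exp (- (\<theta> * mart_limit \<omega>)))" and i2: "integrable ?M (\<lambda>\<omega>. exp (- (\<theta> * mart t \<omega>)))"
    by (rule integrable_exp_neg_mult; simp add: mart_limit_nonneg mart_nonneg th measurable_mart_limit measurable_mart[OF t])+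
  have "laplace_gap (\<lambda>y. \<theta> * exp (- lam * t) * \<phi> y) t x - limit_gap \<theta> x
      = (\<integral>\<omega>. exp (- (\<theta> * mart_limit \<omega>)) - exp (- (\<theta> * mart t \<omega>)) \<partial>?M)"
    unfolding laplace_gap_phi[OF t] limit_gap_def using i1 i2 by simp
  then have "ennreal \<bar>laplace_gap (\<lambda>y. \<theta> * exp (- lam * t) * \<phi> y) t x - limit_gap \<theta> x\<bar>
      \<le> (\<integral>\<^sup>+\<omega>. ennreal \<bar>exp (- (\<theta> * mart_limit \<omega>)) - exp (- (\<theta> * mart t \<omega>))\<bar> \<partial>?M)"
    using integral_norm_bound_ennreal[of ?M "\<lambda>\<omega>. exp (- (\<theta> * mart_limit \<omega>)) - exp (- (\<theta> * mart t \<omega>))"] i1 i2 by simp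
  also have "\<dots> \<le> (\<integral>\<^sup>+\<omega>. ennreal \<theta> * ennreal \<bar>mart t \<omega> - mart_limit \<omega>\<bar> \<partial>?M)"
  proof (intro nn_integral_mono)
    fix \<omega>
    have "\<bar>exp (- (\<theta> * mart_limit \<omega>)) - exp (- (\<theta> * mart t \<omega>))\<bar> \<le> \<bar>\<theta> * mart_limit \<omega> - \<theta> * mart t \<omega>\<bar>"
      using th mart_nonneg mart_limit_nonneg by (intro exp_neg_lipschitz) auto
    also have "\<dots> = \<theta> * \<bar>mart t \<omega> - mart_limit \<omega>\<bar>"
      using th by (simp add: right_diff_distrib[symmetric] abs_mult abs_minus_commute)
    finally show "ennreal \<bar>exp (- (\<theta> * mart_limit \<omega>)) - exp (- (\<theta> * mart t \<omega>))\<bar> \<le> ennreal \<theta> * ennreal \<bar>mart t \<omega> - mart_limit \<omega>\<bar>"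
      unfolding ennreal_mult'[OF th, symmetric] by (rule ennreal_leI)
  qed
  also have "\<dots> = ennreal \<theta> * (\<integral>\<^sup>+\<omega>. ennreal \<bar>mart t \<omega> - mart_limit \<omega>\<bar> \<partial>?M)"
    by (rule nn_integral_cmult) measurable
  also have "\<dots> \<le> ennreal \<theta> * ennreal (increment_const phi_bound * exp (- lam * t / 2))"
    by (intro mult_left_mono mart_limit_L1 t) simp
  also have "\<dots> = ennreal (\<theta> * (increment_const phi_bound * exp (- lam * t / 2)))"
    by (rule ennreal_mult'[OF th, symmetric])
  finally show ?thesis
    using th increment_const_pos[of phi_bound] by (subst (asm) ennreal_le_iff) auto
qed

lemma laplace_gap_phi_le:
  assumes t: "0 \<le> t" and th: "0 \<le> \<theta>"
  shows "laplace_gap (\<lambda>y. \<theta> * exp (- lam * t) * \<phi> y) t x \<le> \<theta> * \<phi> x"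
proof -
  have "laplace_gap (\<lambda>y. \<theta> * exp (- lam * t) * \<phi> y) t x \<le> \<theta> * exp (- lam * t) * mean_semigroup \<PP> X t \<phi> x"
    using th by (intro laplace_gap_scaled_le(1) phi t) auto
  also have "\<dots> = \<theta> * \<phi> x"
    unfolding right_eigen[OF t] by (simp add: mult.assoc mult.left_commute[of "exp (- lam * t)"] exp_minus)
  finally show ?thesis .
qed

lemma laplace_gap_phi_tendsto:
  assumes th: "0 \<le> \<theta>"
  shows "((\<lambda>t. laplace_gap (\<lambda>y. \<theta> * exp (- lam * t) * \<phi> y) t x) \<longlongrightarrow> limit_gap \<theta> x) at_top"
proof (rule LIM_zero_cancel, rule Lim_null_comparison)
  show "\<forall>\<^sub>F t in at_top. norm (laplace_gap (\<lambda>y. \<theta> * exp (- lam * t) * \<phi> y) t x - limit_gap \<theta> x)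
      \<le> \<theta> * (increment_const phi_bound * exp (- lam * t / 2))"
    using eventually_ge_at_top[of 0] by eventually_elim (unfold real_norm_def, rule laplace_gap_limit[OF _ th])
  have "((\<lambda>t. exp (- lam * t / 2)) \<longlongrightarrow> 0) at_top" using lam_pos by real_asymp
  then have "((\<lambda>t. \<theta> * (increment_const phi_bound * exp (- lam * t / 2))) \<longlongrightarrow> \<theta> * (increment_const phi_bound * 0)) at_top"
    by (intro tendsto_intros)
  then show "((\<lambda>t. \<theta> * (increment_const phi_bound * exp (- lam * t / 2))) \<longlongrightarrow> 0) at_top" by simp
qed

lemma limit_gap_le:
  assumes th: "0 \<le> \<theta>"
  shows "limit_gap \<theta> x \<le> \<theta> * \<phi> x"
proof (rule tendsto_upperbound[OF laplace_gap_phi_tendsto[OF th]])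
  show "\<forall>\<^sub>F t in at_top. laplace_gap (\<lambda>y. \<theta> * exp (- lam * t) * \<phi> y) t x \<le> \<theta> * \<phi> x"
    using eventually_ge_at_top[of 0] by eventually_elim (rule laplace_gap_phi_le[OF _ th])
qed simp

lemma measurable_limit_gap:
  assumes [measurable]: "\<theta> \<in> borel_measurable M" "x \<in> M \<rightarrow>\<^sub>M borel" and th: "\<And>p. 0 \<le> \<theta> p"
  shows "(\<lambda>p. limit_gap (\<theta> p) (x p)) \<in> borel_measurable M"
proof (rule borel_measurable_LIMSEQ_real)
  let ?u = "\<lambda>n p. laplace_gap (\<lambda>y. \<theta> p * exp (- lam * real n) * \<phi> y) (real n) (x p)"
  show "(\<lambda>n. ?u n p) \<longlonglongrightarrow> limit_gap (\<theta> p) (x p)" for p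
    by (rule filterlim_compose[OF laplace_gap_phi_tendsto[OF th] filterlim_real_sequentially])
  have u: "?u n p = enn2real (\<integral>\<^sup>+Z. ennreal (1 - exp (- (\<Sum>z\<in>#Z. \<theta> p * exp (- lam * real n) * \<phi> z))) \<partial>population (real n) (x p))" for n p
  proof -
    have f: "(\<lambda>y. \<theta> p * exp (- lam * real n) * \<phi> y) \<in> bfun_nonneg" using th by (intro phi_scaled) auto
    show ?thesis using ennreal_laplace_gap[OF f] laplace_gap_nonneg[OF f] by (metis enn2real_ennreal)
  qed
  show "?u n \<in> borel_measurable M" for n unfolding u by measurable
qed

text \<open>
  At time \<open>n\<close> the formula of \<open>laplace_gap_mild\<close> is applied to the test function
  \<open>\<theta> * exp (- lam * n) * \<phi>\<close>, for which the gap is that of the martingale. Since \<open>\<phi>\<close> is an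
  eigenfunction, the gap at the remaining time \<open>n - s\<close> is that of the martingale with parameter
  \<open>\<theta> * exp (- lam * s)\<close>. As \<open>n\<close> tends to infinity, both become gaps of the limit, and the mean
  of \<open>1 - exp (- f)\<close> differs from that of \<open>f\<close>, which is \<open>\<theta> * \<phi> x\<close>, by a second order term.
\<close>

theorem limit_gap_equation:
  assumes th: "0 \<le> \<theta>"
  defines "k \<equiv> \<lambda>s. branching_remainder (limit_gap (\<theta> * exp (- lam * s)))"
  shows "discounted (rate_bound * (18 * (\<theta> * phi_bound)\<^sup>2 * off_bound)) k"
    and "\<theta> * \<phi> x - limit_gap \<theta> x = time_mean k x"
proof -
  let ?M = "rate_bound * (18 * (\<theta> * phi_bound)\<^sup>2 * off_bound)"
  have ths: "0 \<le> \<theta> * exp (- lam * s)" for s using th by simp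
  have th_le: "r * \<phi> y \<le> r * phi_bound" if "0 \<le> r" for r y
    by (rule mult_left_mono[OF phi_le that])
  have scale: "rate_bound * (18 * (\<theta> * exp (- lam * s) * phi_bound)\<^sup>2 * off_bound) = ?M * exp (- 2 * lam * s)" for s
    by (simp add: power_mult_distrib exp_double[symmetric] power2_eq_square[of "exp _"] exp_add[symmetric])
  have mlg [measurable]: "(\<lambda>(s, y). limit_gap (\<theta> * exp (- lam * s)) y) \<in> borel_measurable (borel \<Otimes>\<^sub>M borel)"
    unfolding split_beta by (rule measurable_limit_gap) (use ths in auto)
  have mlg1: "limit_gap (\<theta> * exp (- lam * s)) \<in> borel_measurable borel" for s by measurable
  have lg01: "0 \<le> limit_gap (\<theta> * exp (- lam * s)) y" "limit_gap (\<theta> * exp (- lam * s)) y < 1" for s y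
    by (rule limit_gap_nonneg[OF ths], rule limit_gap_less_1[OF ths])
  have lg_le: "limit_gap (\<theta> * exp (- lam * s)) y \<le> \<theta> * exp (- lam * s) * phi_bound" for s y
    by (rule order_trans[OF limit_gap_le[OF ths] th_le[OF ths]])
  have k0: "0 \<le> k s y" for s y
    unfolding k_def by (rule remainder_real(3)[OF mlg1 lg01])
  have k_le: "k s y \<le> ?M * exp (- 2 * lam * s)" for s y
    unfolding k_def scale[symmetric] by (rule branching_remainder_le[OF mlg1 lg01 lg_le])
  show dk: "discounted ?M k"
  proof -
    have "(\<lambda>(s, y). k s y) \<in> borel_measurable (borel \<Otimes>\<^sub>M borel)"
      unfolding k_def split_beta
    proof (rule measurable_branching_remainder)
      show "(\<lambda>(p, y). limit_gap (\<theta> * exp (- lam * fst p)) y) \<in> borel_measurable ((borel \<Otimes>\<^sub>M borel) \<Otimes>\<^sub>M borel)"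
        unfolding split_beta by (rule measurable_limit_gap) (use ths in auto)
    qed (use lg01 in auto)
    then show ?thesis unfolding discounted_def using k0 k_le by (auto simp: abs_of_nonneg)
  qed
  define f where "f n y = \<theta> * exp (- lam * real n) * \<phi> y" for n y
  have f: "f n \<in> bfun_nonneg" for n unfolding f_def by (rule phi_scaled[OF ths])
  have f_shift: "f n = (\<lambda>y. (\<theta> * exp (- lam * s)) * exp (- lam * (real n - s)) * \<phi> y)" for n s
    unfolding f_def by (simp add: mult.assoc exp_add[symmetric] algebra_simps)
  \<comment> \<open>the integrand of \<open>laplace_gap_mild\<close> at time \<open>n\<close>, continued by zero to all later times\<close>
  define kn where "kn n s y = (if 0 \<le> s \<and> s \<le> real n then branching_remainder (laplace_gap (f n) (real n - s)) y else 0)" for n s y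
  have w01: "0 \<le> laplace_gap (f n) s y" "laplace_gap (f n) s y < 1" for n s y
    by (rule laplace_gap_nonneg[OF f], rule laplace_gap_less_1[OF f])
  have w1: "laplace_gap (f n) s \<in> borel_measurable borel" for n s
    by (rule measurable_laplace_gap[OF f]) auto
  have w_le: "laplace_gap (f n) (real n - s) y \<le> \<theta> * exp (- lam * s) * phi_bound" if "s \<le> real n" for n s y
    unfolding f_shift[of n s]
    by (rule order_trans[OF laplace_gap_phi_le[OF _ ths] th_le[OF ths]]) (use that in simp)
  have dkn: "discounted ?M (kn n)" for n
  proof -
    have [measurable]: "(\<lambda>p. branching_remainder (laplace_gap (f n) (real n - fst p)) (snd p)) \<in> borel_measurable (borel \<Otimes>\<^sub>M borel)"
    proof (rule measurable_branching_remainder)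
      show "(\<lambda>(p, y). laplace_gap (f n) (real n - fst p) y) \<in> borel_measurable ((borel \<Otimes>\<^sub>M borel) \<Otimes>\<^sub>M borel)"
        unfolding split_beta by (rule measurable_laplace_gap[OF f]) measurable
    qed (use w01 in auto)
    have "(\<lambda>(s, y). kn n s y) \<in> borel_measurable (borel \<Otimes>\<^sub>M borel)"
      unfolding kn_def split_beta by measurable
    moreover have "\<bar>kn n s y\<bar> \<le> ?M * exp (- 2 * lam * s)" if "0 \<le> s" for s y
    proof (cases "s \<le> real n")
      case True
      then have "kn n s y = branching_remainder (laplace_gap (f n) (real n - s)) y" using that by (simp add: kn_def)
      moreover have "0 \<le> branching_remainder (laplace_gap (f n) (real n - s)) y"
        by (rule remainder_real(3)[OF w1 w01])
      moreover have "branching_remainder (laplace_gap (f n) (real n - s)) y \<le> ?M * exp (- 2 * lam * s)"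
        unfolding scale[symmetric] by (rule branching_remainder_le[OF w1 w01 w_le[OF True]])
      ultimately show ?thesis by simp
    qed (simp add: kn_def)
    ultimately show ?thesis by (simp add: discounted_def)
  qed
  have kn0: "0 \<le> kn n s y" for n s y
    unfolding kn_def using remainder_real(3)[OF w1 w01] by simp
  have lim_k: "(\<lambda>n. kn n s y) \<longlonglongrightarrow> k s y" if s: "0 \<le> s" for s y
  proof (rule LIM_zero_cancel, rule Lim_null_comparison)
    let ?\<eta> = "\<theta> * exp (- lam * s) * phi_bound"
    let ?\<delta> = "\<lambda>n. \<theta> * exp (- lam * s) * (increment_const phi_bound * exp (- lam * (real n - s) / 2))"
    have "\<forall>\<^sub>F n in sequentially. s \<le> real n"
      using filterlim_real_sequentially by (auto simp: filterlim_at_top)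
    then show "\<forall>\<^sub>F n in sequentially. norm (kn n s y - k s y) \<le> rate_bound * (18 * (?\<eta> * ?\<delta> n) * off_bound)"
    proof eventually_elim
      case (elim n)
      have "\<bar>branching_remainder (laplace_gap (f n) (real n - s)) y - branching_remainder (limit_gap (\<theta> * exp (- lam * s))) y\<bar>
          \<le> rate_bound * (18 * (?\<eta> * ?\<delta> n) * off_bound)"
      proof (rule branching_remainder_lipschitz(1)[OF w1 mlg1])
        show "\<bar>laplace_gap (f n) (real n - s) z - limit_gap (\<theta> * exp (- lam * s)) z\<bar> \<le> ?\<delta> n" for z
          unfolding f_shift[of n s] by (rule laplace_gap_limit[OF _ ths]) (use elim in simp)
        show "\<bar>laplace_gap (f n) (real n - s) z\<bar> \<le> ?\<eta>" "\<bar>limit_gap (\<theta> * exp (- lam * s)) z\<bar> \<le> ?\<eta>" for z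
          using w01 w_le[OF elim] lg01 lg_le by simp_all
        show "- (1 / 2) \<le> laplace_gap (f n) (real n - s) z" "- (1 / 2) \<le> limit_gap (\<theta> * exp (- lam * s)) z" for z
          using w01(1)[of n "real n - s" z] lg01(1)[of s z] by linarith+
      qed (rule w01 lg01)+
      then show ?case using elim s by (simp add: kn_def k_def)
    qed
    have "(\<lambda>n. exp (- lam * (real n - s) / 2)) \<longlonglongrightarrow> 0" using lam_pos by real_asymp
    then have "(\<lambda>n. rate_bound * (18 * (?\<eta> * ?\<delta> n) * off_bound)) \<longlonglongrightarrow>
        rate_bound * (18 * (?\<eta> * (\<theta> * exp (- lam * s) * (increment_const phi_bound * 0))) * off_bound)"
      by (intro tendsto_intros)
    then show "(\<lambda>n. rate_bound * (18 * (?\<eta> * ?\<delta> n) * off_bound)) \<longlonglongrightarrow> 0" by simp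
  qed
  define g where "g n y = 1 - exp (- f n y)" for n y
  have g: "g n \<in> bfun_nonneg" for n
  proof -
    note [measurable] = bfun_nonneg_measurable[OF f]
    have "g n \<in> borel_measurable borel" unfolding g_def by measurable
    then show ?thesis
      using bfun_nonneg_pos[OF f]
      by (auto simp: bfun_nonneg_def bfun_def g_def intro!: boundedI[of _ 1])
  qed
  have eq: "laplace_gap (f n) (real n) x + time_mean (kn n) x = mean_semigroup \<PP> X (real n) (g n) x" for n
  proof -
    have "mean_duhamel (real n) (\<lambda>s y. ennreal (branching_remainder (laplace_gap (f n) s) y)) x
        = (\<integral>\<^sup>+s. mean_sum s (\<lambda>y. ennreal (kn n s y)) x * indicator {0..} s \<partial>lborel)"
      unfolding mean_duhamel_def
    proof (intro nn_integral_cong)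
      fix s
      show "mean_sum s (\<lambda>y. ennreal (branching_remainder (laplace_gap (f n) (real n - s)) y)) x * indicator {0..real n} s
          = mean_sum s (\<lambda>y. ennreal (kn n s y)) x * indicator {0..} s"
        by (auto simp: kn_def indicator_def mean_sum_def)
    qed
    also have "\<dots> = ennreal (time_mean (kn n) x)"
      by (rule ennreal_time_mean(1)[OF dkn kn0, symmetric])
    finally have "ennreal (laplace_gap (f n) (real n) x) + ennreal (time_mean (kn n) x) = ennreal (mean_semigroup \<PP> X (real n) (g n) x)"
      using laplace_gap_mild[OF f, of "real n" n x] ennreal_mean_semigroup(1)[OF g, of "real n" n x] by (simp add: g_def)
    then show ?thesis
      using w01(1)[of n "real n" x] ennreal_time_mean(2)[OF dkn kn0, of n x] ennreal_mean_semigroup(2)[OF g, of "real n" n x]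
      by (simp add: ennreal_plus[symmetric] del: ennreal_plus)
  qed
  have lim_g: "(\<lambda>n. mean_semigroup \<PP> X (real n) (g n) x) \<longlonglongrightarrow> \<theta> * \<phi> x"
  proof (rule LIM_zero_cancel, rule Lim_null_comparison[OF always_eventually], intro allI)
    fix n
    have n0: "0 \<le> real n" by simp
    let ?B = "(\<theta> * phi_bound)\<^sup>2 / 2 * exp (- 2 * lam * real n)"
    have fm: "mean_semigroup \<PP> X (real n) (f n) x = \<theta> * \<phi> x"
      unfolding f_def mean_semigroup_scale right_eigen[OF n0] by (simp add: exp_minus mult.assoc)
    have bd: "\<bar>g n y - f n y\<bar> \<le> ?B" for y
    proof -
      have fy: "0 \<le> f n y" "f n y \<le> \<theta> * exp (- lam * real n) * phi_bound"
        using bfun_nonneg_pos[OF f] th_le[OF ths] by (auto simp: f_def)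
      have "\<bar>g n y - f n y\<bar> = exp (- f n y) - 1 + f n y"
        using exp_second_order(1)[OF fy(1)] by (simp add: g_def)
      also have "\<dots> \<le> (f n y)\<^sup>2 / 2" by (rule exp_second_order(2)[OF fy(1)])
      also have "\<dots> \<le> (\<theta> * exp (- lam * real n) * phi_bound)\<^sup>2 / 2"
        using fy by (intro divide_right_mono power_mono) auto
      also have "\<dots> = ?B"
        by (simp add: power_mult_distrib power2_eq_square[of "exp _"] exp_add[symmetric])
      finally show ?thesis .
    qed
    have mg: "(\<lambda>y. g n y - f n y) \<in> borel_measurable borel"
      using bfun_nonneg_measurable[OF g] bfun_nonneg_measurable[OF f] by measurable
    have "mean_semigroup \<PP> X (real n) (g n) x - \<theta> * \<phi> x = mean_semigroup \<PP> X (real n) (\<lambda>y. g n y - f n y) x"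
      unfolding fm[symmetric] mean_semigroup_def sum_mset_subtractf
      by (intro Bochner_Integration.integral_diff[symmetric] ennreal_mean_semigroup(3) f g n0)
    then have "norm (mean_semigroup \<PP> X (real n) (g n) x - \<theta> * \<phi> x) \<le> ?B * (mean_const * exp (lam * real n))"
      using mean_semigroup_signed(2)[OF mg bd n0, of x] by simp
    also have "\<dots> = (\<theta> * phi_bound)\<^sup>2 / 2 * mean_const * (exp (- 2 * lam * real n) * exp (lam * real n))" by simp
    also have "exp (- 2 * lam * real n) * exp (lam * real n) = exp (- lam * real n)" by (simp add: exp_add[symmetric])
    finally show "norm (mean_semigroup \<PP> X (real n) (g n) x - \<theta> * \<phi> x) \<le> (\<theta> * phi_bound)\<^sup>2 / 2 * mean_const * exp (- lam * real n)" .
  next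
    have "(\<lambda>n. exp (- lam * real n)) \<longlonglongrightarrow> 0" using lam_pos by real_asymp
    from tendsto_mult_right_zero[OF this, of "(\<theta> * phi_bound)\<^sup>2 / 2 * mean_const"]
    show "(\<lambda>n. (\<theta> * phi_bound)\<^sup>2 / 2 * mean_const * exp (- lam * real n)) \<longlonglongrightarrow> 0" .
  qed
  have "(\<lambda>n. laplace_gap (f n) (real n) x + time_mean (kn n) x) \<longlonglongrightarrow> limit_gap \<theta> x + time_mean k x"
  proof (intro tendsto_add time_mean_tendsto[OF dkn dk lim_k])
    show "(\<lambda>n. laplace_gap (f n) (real n) x) \<longlonglongrightarrow> limit_gap \<theta> x"
      unfolding f_def by (rule filterlim_compose[OF laplace_gap_phi_tendsto[OF th] filterlim_real_sequentially])
  qed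
  with lim_g have "limit_gap \<theta> x + time_mean k x = \<theta> * \<phi> x"
    unfolding eq by (rule LIMSEQ_unique[symmetric])
  then show "\<theta> * \<phi> x - limit_gap \<theta> x = time_mean k x" by simp
qed

end

section \<open>Expansion of the remainder over splittings\<close>

text \<open>
  The summand of \<open>splitting_sum_list\<close>. Summed over all tuples with a given sum it gives the
  coefficients of the product of the power series \<open>1 + a 1 x * z + a 2 x * z\<^sup>2 + \<dots>\<close> over the
  list, which \<open>product_coeff\<close> computes recursively.
\<close>

definition composition_weight :: "(nat \<Rightarrow> 'a \<Rightarrow> real) \<Rightarrow> nat list \<Rightarrow> 'a list \<Rightarrow> real" where
  "composition_weight a ks xs = (\<Prod>j | j < length xs \<and> 0 < ks ! j. a (ks ! j) (xs ! j))"

definition compositions :: "nat \<Rightarrow> nat \<Rightarrow> nat list set" where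
  "compositions N k = {ks. length ks = N \<and> sum_list ks = k}"

fun product_coeff :: "(nat \<Rightarrow> 'a \<Rightarrow> real) \<Rightarrow> 'a list \<Rightarrow> nat \<Rightarrow> real" where
  "product_coeff a [] k = (if k = 0 then 1 else 0)"
| "product_coeff a (x # xs) k = (\<Sum>i\<le>k. (if i = 0 then 1 else a i x) * product_coeff a xs (k - i))"

lemma finite_compositions: "finite (compositions N k)"
proof (rule finite_subset)
  show "compositions N k \<subseteq> {ks. set ks \<subseteq> {..k} \<and> length ks = N}"
    by (auto simp: compositions_def intro: member_le_sum_list)
  show "finite {ks. set ks \<subseteq> {..k} \<and> length ks = N}"
    by (rule finite_lists_length_eq) simp
qed

lemma composition_weight_Cons:
  "composition_weight a (i # ks) (x # xs) = (if i = 0 then 1 else a i x) * composition_weight a ks xs"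
proof -
  have "{j. j < length (x # xs) \<and> 0 < (i # ks) ! j}
      = (if 0 < i then {0} else {}) \<union> Suc ` {j. j < length xs \<and> 0 < ks ! j}"
    by (auto simp: less_Suc_eq_0_disj)
  then show ?thesis
    unfolding composition_weight_def by (simp add: prod.reindex)
qed

lemma compositions_Suc:
  "compositions (Suc N) k = (\<Union>i\<le>k. (#) i ` compositions N (k - i))"
proof (intro equalityI subsetI)
  fix ks assume "ks \<in> compositions (Suc N) k"
  then obtain i ls where "ks = i # ls" "length ls = N" "i + sum_list ls = k"
    by (auto simp: compositions_def length_Suc_conv)
  then show "ks \<in> (\<Union>i\<le>k. (#) i ` compositions N (k - i))"
    by (auto simp: compositions_def intro!: bexI[of _ i])
qed (auto simp: compositions_def)

lemma sum_compositions:
  "(\<Sum>ks\<in>compositions (length xs) k. composition_weight a ks xs) = product_coeff a xs k"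
proof (induction xs arbitrary: k)
  case Nil
  have "compositions 0 k = (if k = 0 then {[]} else {})" by (auto simp: compositions_def)
  then show ?case by (simp add: composition_weight_def)
next
  case (Cons x xs)
  have "(\<Sum>ks\<in>compositions (length (x # xs)) k. composition_weight a ks (x # xs))
      = (\<Sum>i\<le>k. \<Sum>ks\<in>(#) i ` compositions (length xs) (k - i). composition_weight a ks (x # xs))"
    unfolding list.size(4) add.commute[of _ "Suc 0"] add_Suc_right add_0_right add_Suc add_0
    unfolding compositions_Suc by (rule sum.UNION_disjoint) (auto simp: finite_compositions)
  also have "\<dots> = (\<Sum>i\<le>k. \<Sum>ks\<in>compositions (length xs) (k - i). composition_weight a (i # ks) (x # xs))"
    by (rule sum.cong[OF refl], subst sum.reindex) auto
  also have "\<dots> = (\<Sum>i\<le>k. (if i = 0 then 1 else a i x) * product_coeff a xs (k - i))"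
    by (simp add: composition_weight_Cons sum_distrib_left[symmetric] Cons.IH)
  finally show ?case by simp
qed

text \<open>
  The tuples that are not splittings have at most one positive entry: this is the zero tuple, if
  the sum is zero, and otherwise the tuples with the single entry \<open>k\<close>, one for each position.
\<close>

lemma splitting_sum_list_eq_coeff:
  "splitting_sum_list k a xs = product_coeff a xs k - (if k = 0 then 1 else \<Sum>x\<leftarrow>xs. a k x)"
proof -
  let ?N = "length xs"
  let ?P = "\<lambda>ks::nat list. {j. j < ?N \<and> 0 < ks ! j}"
  let ?C = "{ks \<in> compositions ?N k. card (?P ks) < 2}"
  have part: "compositions ?N k = splittings ?N k \<union> ?C" "splittings ?N k \<inter> ?C = {}"
    by (auto simp: splittings_def compositions_def)
  have sum: "sum_list ks = (\<Sum>j\<in>?P ks. ks ! j)" if "length ks = ?N" for ks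
  proof -
    have "sum_list ks = (\<Sum>j<?N. ks ! j)" using that by (simp add: sum_list_sum_nth atLeast0LessThan)
    also have "\<dots> = (\<Sum>j\<in>?P ks. ks ! j)" by (rule sum.mono_neutral_right) auto
    finally show ?thesis .
  qed
  have C: "(\<Sum>ks\<in>?C. composition_weight a ks xs) = (if k = 0 then 1 else \<Sum>x\<leftarrow>xs. a k x)"
  proof (cases "k = 0")
    case True
    have "ks = replicate ?N 0" if "ks \<in> ?C" for ks
      using that True by (intro replicate_eqI) (auto simp: compositions_def)
    moreover have P: "?P (replicate ?N 0) = {}" by auto
    moreover have "replicate ?N 0 \<in> ?C"
      unfolding mem_Collect_eq P using True by (simp add: compositions_def sum_list_replicate)
    ultimately have "?C = {replicate ?N 0}" by blast
    moreover have "composition_weight a (replicate ?N 0) xs = 1" unfolding composition_weight_def P by simp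
    ultimately show ?thesis using True by simp
  next
    case False
    let ?e = "\<lambda>j. (replicate ?N 0)[j := k]"
    have e: "?P (?e j) = {j}" if "j < ?N" for j using that False by (auto simp: nth_list_update)
    have Ceq: "?C = ?e ` {..<?N}"
    proof (intro equalityI subsetI)
      fix ks assume "ks \<in> ?C"
      then have l: "length ks = ?N" "sum_list ks = k" and c: "card (?P ks) < 2" by (auto simp: compositions_def)
      have "?P ks \<noteq> {}" using sum[OF l(1)] l(2) False by auto
      moreover have "finite (?P ks)" by simp
      ultimately have "0 < card (?P ks)" by (simp only: card_gt_0_iff simp_thms)
      with c have "card (?P ks) = 1" by linarith
      then obtain j where j: "?P ks = {j}" by (rule card_1_singletonE)
      then have "ks ! j = k" "j < ?N" using sum[OF l(1)] l(2) by auto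
      moreover have "ks ! i = 0" if "i < ?N" "i \<noteq> j" for i
      proof -
        have "i \<notin> ?P ks" unfolding j using that(2) by simp
        then show ?thesis using that(1) by simp
      qed
      ultimately have "ks = ?e j"
        using l(1) by (intro nth_equalityI) (auto simp: nth_list_update)
      then show "ks \<in> ?e ` {..<?N}" using \<open>j < ?N\<close> by blast
    next
      fix ks assume "ks \<in> ?e ` {..<?N}"
      then obtain j where j: "j < ?N" "ks = ?e j" by auto
      then show "ks \<in> ?C" using e[OF j(1)] sum[of ks] by (simp add: compositions_def)
    qed
    have inj: "inj_on ?e {..<?N}" using e by (intro inj_onI) (metis lessThan_iff singleton_inject)
    have "(\<Sum>ks\<in>?C. composition_weight a ks xs) = (\<Sum>j<?N. composition_weight a (?e j) xs)"
      unfolding Ceq sum.reindex[OF inj] o_def ..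
    also have "\<dots> = (\<Sum>j<?N. a k (xs ! j))"
      by (intro sum.cong refl) (simp add: composition_weight_def e)
    also have "\<dots> = (\<Sum>x\<leftarrow>xs. a k x)" by (simp add: sum_list_sum_nth atLeast0LessThan)
    finally show ?thesis using False by simp
  qed
  have "product_coeff a xs k = (\<Sum>ks\<in>splittings ?N k \<union> ?C. composition_weight a ks xs)"
    by (simp only: part(1)[symmetric] sum_compositions)
  also have "\<dots> = (\<Sum>ks\<in>splittings ?N k. composition_weight a ks xs) + (\<Sum>ks\<in>?C. composition_weight a ks xs)"
  proof (rule sum.union_disjoint)
    show "finite (splittings ?N k)" by (rule finite_splittings)
    show "finite ?C" by (rule finite_subset[OF _ finite_compositions[of ?N k]]) blast
    show "splittings ?N k \<inter> ?C = {}" by (rule part(2))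
  qed
  finally have "product_coeff a xs k = (\<Sum>ks\<in>splittings ?N k. composition_weight a ks xs) + (\<Sum>ks\<in>?C. composition_weight a ks xs)" .
  then show ?thesis unfolding C by (simp add: splitting_sum_list_def composition_weight_def)
qed

lemma product_coeff_nonneg: "(\<And>k x. 0 \<le> a k x) \<Longrightarrow> 0 \<le> product_coeff a xs k"
  by (induction xs arbitrary: k) (auto intro!: sum_nonneg mult_nonneg_nonneg)

lemma abs_product_coeff_le: "\<bar>product_coeff a xs k\<bar> \<le> product_coeff (\<lambda>k x. \<bar>a k x\<bar>) xs k"
proof (induction xs arbitrary: k)
  case (Cons x xs)
  show ?case
    unfolding product_coeff.simps
    by (rule order_trans[OF sum_abs sum_mono]) (auto simp: abs_mult intro!: mult_mono Cons product_coeff_nonneg)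
qed simp

lemma leading_one_sums:
  fixes b :: "nat \<Rightarrow> real"
  assumes "summable (\<lambda>k. b (Suc k))"
  shows "(\<lambda>k. if k = 0 then c else b k) sums (c + (\<Sum>k. b (Suc k)))"
  using assms sums_Suc[of "\<lambda>k. if k = 0 then c else b k" "\<Sum>k. b (Suc k)"] by (simp add: summable_sums add.commute)

text \<open>Repeated Cauchy products of absolutely convergent series.\<close>

lemma product_coeff_sums:
  assumes a: "\<And>x. summable (\<lambda>k. \<bar>a (Suc k) x\<bar>)"
  shows "product_coeff a xs sums (\<Prod>x\<leftarrow>xs. 1 + (\<Sum>k. a (Suc k) x))"
    and "summable (\<lambda>k. \<bar>product_coeff a xs k\<bar>)"
proof -
  have Cauchy: "(\<lambda>k. product_coeff b (x # xs) k) sums ((1 + (\<Sum>k. b (Suc k) x)) * (\<Sum>k. product_coeff b xs k))"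
    if b: "\<And>x. summable (\<lambda>k. \<bar>b (Suc k) x\<bar>)" and s: "summable (\<lambda>k. \<bar>product_coeff b xs k\<bar>)"
    for b :: "nat \<Rightarrow> 'a \<Rightarrow> real" and x xs
  proof -
    let ?f = "\<lambda>i. if i = 0 then 1 else b i x"
    have "(\<lambda>i. if i = 0 then 1 else \<bar>b i x\<bar>) sums (1 + (\<Sum>k. \<bar>b (Suc k) x\<bar>))"
      by (rule leading_one_sums[OF b])
    moreover have "(\<lambda>i. if i = 0 then 1 else \<bar>b i x\<bar>) = (\<lambda>i. norm (?f i))" by auto
    ultimately have n: "summable (\<lambda>i. norm (?f i))" by (metis sums_summable)
    have "?f sums (1 + (\<Sum>k. b (Suc k) x))"
      using leading_one_sums[OF summable_rabs_cancel[OF b], of 1 x] by simp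
    then have "suminf ?f = 1 + (\<Sum>k. b (Suc k) x)" by (rule sums_unique[symmetric])
    then show ?thesis using Cauchy_product_sums[OF n, of "product_coeff b xs"] s by simp
  qed
  have nn: "summable (product_coeff (\<lambda>k x. \<bar>a k x\<bar>) xs)" for xs
  proof (induction xs)
    case Nil
    show ?case by (rule summable_finite[of "{0}"]) auto
  next
    case (Cons x xs)
    have "summable (\<lambda>k. \<bar>product_coeff (\<lambda>k x. \<bar>a k x\<bar>) xs k\<bar>)"
      using Cons product_coeff_nonneg[of "\<lambda>k x. \<bar>a k x\<bar>" xs] by simp
    from Cauchy[OF _ this] a show ?case by (auto simp: sums_iff)
  qed
  have abs: "summable (\<lambda>k. \<bar>product_coeff a xs k\<bar>)" for xs
    by (rule summable_comparison_test'[OF nn[of xs], of 0]) (simp add: abs_product_coeff_le)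
  then show "summable (\<lambda>k. \<bar>product_coeff a xs k\<bar>)" .
  show "product_coeff a xs sums (\<Prod>x\<leftarrow>xs. 1 + (\<Sum>k. a (Suc k) x))"
  proof (induction xs)
    case Nil
    show ?case using sums_If_finite_set[of "{0}" "\<lambda>_. 1 :: real"] by simp
  next
    case (Cons x xs)
    then have "(\<Sum>k. product_coeff a xs k) = (\<Prod>x\<leftarrow>xs. 1 + (\<Sum>k. a (Suc k) x))" by (rule sums_unique[symmetric])
    with Cauchy[OF a abs, of x xs] show ?case by simp
  qed
qed

text \<open>
  The reason for the recursion of the moments: splitting sums are the coefficients of the
  remainder of a power series. Omitting tuples with fewer than two positive entries removes from
  the product exactly the constant and the linear part.
\<close>

theorem splitting_sum_sums:
  assumes a: "\<And>x. summable (\<lambda>k. \<bar>a (Suc k) x\<bar>)"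
  shows "(\<lambda>k. splitting_sum k a Z) sums remainder (\<lambda>x. - (\<Sum>k. a (Suc k) x)) Z"
proof -
  obtain xs where xs: "Z = mset xs" using ex_mset[of Z] by auto
  let ?A = "\<lambda>x. \<Sum>k. a (Suc k) x"
  have "(\<lambda>k. if k = 0 then 1 else \<Sum>x\<leftarrow>xs. a k x) sums (1 + (\<Sum>k. \<Sum>x\<leftarrow>xs. a (Suc k) x)) \<and>
      (\<Sum>k. \<Sum>x\<leftarrow>xs. a (Suc k) x) = (\<Sum>x\<leftarrow>xs. ?A x)"
  proof -
    have S: "(\<lambda>k. \<Sum>x\<leftarrow>xs. a (Suc k) x) sums (\<Sum>x\<leftarrow>xs. ?A x)"
      using summable_sums[OF summable_rabs_cancel[OF a]] by (induction xs) (auto intro: sums_add)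
    show ?thesis
      using leading_one_sums[of "\<lambda>k. \<Sum>x\<leftarrow>xs. a k x" 1, OF sums_summable[OF S]] sums_unique[OF S] by simp
  qed
  then have "(\<lambda>k. splitting_sum k a Z) sums ((\<Prod>x\<leftarrow>xs. 1 + ?A x) - (1 + (\<Sum>x\<leftarrow>xs. ?A x)))"
    unfolding xs splitting_sum_mset splitting_sum_list_eq_coeff using product_coeff_sums(1)[OF a, where xs = xs]
    by (intro sums_diff) auto
  moreover have "(\<Sum>z\<in>#mset xs. - ?A z) = - (\<Sum>x\<leftarrow>xs. ?A x)"
    by (induction xs) auto
  ultimately show ?thesis
    by (simp add: xs remainder_def prod_mset_prod_list[symmetric] diff_diff_eq flip: mset_map)
qed

text \<open>Splitting sums are homogeneous, the indices in each summand adding up to \<open>k\<close>.\<close>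

lemma splitting_sum_scale:
  "splitting_sum k (\<lambda>i z. c ^ i * h i z) Z = c ^ k * splitting_sum k h Z"
proof -
  obtain xs where xs: "Z = mset xs" using ex_mset[of Z] by auto
  have "(\<Prod>j | j < length xs \<and> 0 < ks ! j. c ^ (ks ! j) * h (ks ! j) (xs ! j))
      = c ^ k * (\<Prod>j | j < length xs \<and> 0 < ks ! j. h (ks ! j) (xs ! j))"
    if ks: "ks \<in> splittings (length xs) k" for ks
  proof -
    have "(\<Sum>j | j < length xs \<and> 0 < ks ! j. ks ! j) = (\<Sum>j<length xs. ks ! j)"
      by (rule sum.mono_neutral_left) auto
    also have "\<dots> = k" using ks by (auto simp: splittings_def sum_list_sum_nth atLeast0LessThan)
    finally have "(\<Prod>j | j < length xs \<and> 0 < ks ! j. c ^ (ks ! j)) = c ^ k"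
      by (simp add: power_sum[symmetric])
    then show ?thesis by (simp add: prod.distrib)
  qed
  then show ?thesis
    unfolding xs splitting_sum_mset splitting_sum_list_def by (simp add: sum_distrib_left)
qed

lemma splitting_sum_nonneg:
  assumes "\<And>i z. 0 \<le> h i z"
  shows "0 \<le> splitting_sum k h Z"
  unfolding splitting_sum_def splitting_sum_list_def by (intro sum_nonneg prod_nonneg assms ballI)

lemma splitting_sum_small:
  assumes "k < 2"
  shows "splitting_sum k h Z = 0"
proof -
  have "splittings N k = {}" for N
  proof (rule equals0I)
    fix ks assume ks: "ks \<in> splittings N k"
    then have "2 \<le> card {j. j < N \<and> 0 < ks ! j}" by (simp add: splittings_def)
    then have "{j. j < N \<and> 0 < ks ! j} \<noteq> {}" by force
    then obtain j where "j < N" "0 < ks ! j" by auto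
    with splittings_less[OF ks, of j] assms show False by simp
  qed
  then show ?thesis by (simp add: splitting_sum_def splitting_sum_list_def)
qed

text \<open>
  Replacing the coefficients with index \<open>n\<close> and above by zero does not affect splitting sums of
  order at most \<open>n\<close>, and turns the power series into a polynomial; the splitting sums of higher
  order are then dropped, being non-negative.
\<close>

lemma splitting_sum_partial_le:
  assumes h: "\<And>i z. 0 < i \<Longrightarrow> i < n \<Longrightarrow> 0 \<le> h i z" and c: "0 \<le> (c::real)"
  shows "(\<Sum>k\<le>n. c ^ k * splitting_sum k h Z) \<le> remainder (\<lambda>z. - (\<Sum>i=1..<n. c ^ i * h i z)) Z"
proof -
  define a where "a i z = (if 0 < i \<and> i < n then c ^ i * h i z else 0)" for i z
  have a0: "0 \<le> a i z" for i z using h c by (simp add: a_def)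
  have fin: "a (Suc i) z = 0" if "i \<notin> {..<n}" for i z using that by (simp add: a_def)
  have sm: "summable (\<lambda>k. \<bar>a (Suc k) x\<bar>)" for x
    by (rule summable_finite[of "{..<n}"]) (use fin in auto)
  have suminf: "(\<Sum>k. a (Suc k) z) = (\<Sum>i=1..<n. c ^ i * h i z)" for z
  proof -
    have "(\<Sum>k. a (Suc k) z) = (\<Sum>k<n. a (Suc k) z)" by (rule suminf_finite) (use fin in auto)
    also have "\<dots> = (\<Sum>i=1..n. a i z)"
      by (rule sum.reindex_bij_witness[of _ "\<lambda>i. i - 1" Suc]) auto
    also have "\<dots> = (\<Sum>i=1..<n. a i z)" by (rule sum.mono_neutral_right) (auto simp: a_def)
    also have "\<dots> = (\<Sum>i=1..<n. c ^ i * h i z)" by (intro sum.cong refl) (simp add: a_def)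
    finally show ?thesis .
  qed
  have "(\<Sum>k\<le>n. c ^ k * splitting_sum k h Z) = (\<Sum>k\<le>n. splitting_sum k a Z)"
  proof (intro sum.cong refl)
    fix k assume k: "k \<in> {..n}"
    have "splitting_sum k a = splitting_sum k (\<lambda>i z. c ^ i * h i z)"
      using k by (intro splitting_sum_cong refl) (auto simp: a_def)
    then show "c ^ k * splitting_sum k h Z = splitting_sum k a Z" by (simp add: splitting_sum_scale)
  qed
  also have "\<dots> \<le> (\<Sum>k. splitting_sum k a Z)"
    using splitting_sum_sums[OF sm, where Z = Z] splitting_sum_nonneg[OF a0]
    by (intro sum_le_suminf) (auto simp: sums_iff)
  also have "\<dots> = remainder (\<lambda>z. - (\<Sum>i=1..<n. c ^ i * h i z)) Z"
    using splitting_sum_sums[OF sm, where Z = Z] by (simp add: sums_iff suminf)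
  finally show ?thesis .
qed

text \<open>
  The definition refers to an enumeration of the atoms, which need not be measurable. Instead,
  the splitting sums are recovered one after the other from the remainder, which is measurable
  and has them as Taylor coefficients at zero.
\<close>

lemma measurable_splitting_sum:
  fixes h :: "nat \<Rightarrow> 'a::topological_space \<Rightarrow> real"
  assumes h [measurable]: "\<And>i. 0 < i \<Longrightarrow> i < k \<Longrightarrow> h i \<in> borel_measurable borel"
    and h0: "\<And>i z. 0 < i \<Longrightarrow> i < k \<Longrightarrow> 0 \<le> h i z"
  shows "(\<lambda>Z. splitting_sum k h Z) \<in> borel_measurable atomic_space"
proof -
  define a where "a i z = (if 0 < i \<and> i < k then h i z else 0)" for i z
  have am [measurable]: "a i \<in> borel_measurable borel" for i
    unfolding a_def using h[of i] by (cases "0 < i \<and> i < k") auto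
  have a0: "0 \<le> a i z" for i z using h0 by (simp add: a_def)
  have fin: "a (Suc i) z = 0" if "i \<notin> {..<k}" for i z using that by (simp add: a_def)
  have ks: "splitting_sum k h = splitting_sum k a"
    by (intro splitting_sum_cong refl) (auto simp: a_def)
  define R where "R c Z = remainder (\<lambda>z. - (\<Sum>i<k. c ^ Suc i * a (Suc i) z)) Z" for c :: real and Z
  have R: "(\<lambda>j. splitting_sum j a Z * c ^ j) sums R c Z" for c Z
  proof -
    have "(\<lambda>j. splitting_sum j (\<lambda>i z. c ^ i * a i z) Z) sums remainder (\<lambda>x. - (\<Sum>i. c ^ Suc i * a (Suc i) x)) Z"
      by (intro splitting_sum_sums summable_finite[of "{..<k}"]) (use fin in auto)
    moreover have "(\<Sum>i. c ^ Suc i * a (Suc i) x) = (\<Sum>i<k. c ^ Suc i * a (Suc i) x)" for x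
      by (rule suminf_finite) (use fin in auto)
    ultimately show ?thesis by (simp add: R_def splitting_sum_scale mult.commute)
  qed
  have Rm: "R c \<in> borel_measurable atomic_space" if c: "0 \<le> c" for c
    unfolding R_def
  proof (rule borel_measurable_remainder)
    show "- (\<Sum>i<k. c ^ Suc i * a (Suc i) y) < 1" for y
      using sum_nonneg[of "{..<k}" "\<lambda>i. c ^ Suc i * a (Suc i) y"] a0 c by (simp add: less_le_trans[of "- (1::real)"] le_less_trans[OF _ zero_less_one])
  qed measurable
  have "(\<lambda>Z. splitting_sum j a Z) \<in> borel_measurable atomic_space" for j
  proof (induction j rule: less_induct)
    case (less j)
    let ?c = "\<lambda>m. 1 / real (Suc m)"
    let ?f = "\<lambda>Z c. (R c Z - (\<Sum>i<j. splitting_sum i a Z * c ^ i)) / c ^ j"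
    have lim: "(\<lambda>m. ?f Z (?c m)) \<longlonglongrightarrow> splitting_sum j a Z" for Z
    proof -
      let ?g = "\<lambda>c. \<Sum>i. splitting_sum (i + j) a Z * c ^ i"
      have s: "(\<lambda>i. splitting_sum (i + j) a Z * c ^ i) sums ?g c" for c
      proof (cases "c = 0")
        case True
        then show ?thesis by (intro summable_sums summable_finite[of "{0}"]) auto
      next
        case False
        have "(\<lambda>i. splitting_sum (i + j) a Z * c ^ (i + j)) sums (R c Z - (\<Sum>i<j. splitting_sum i a Z * c ^ i))"
          using sums_split_initial_segment[OF R, where n = j] .
        from sums_divide[OF this, of "c ^ j"] show ?thesis
          using False by (simp add: power_add sums_iff)
      qed
      have "(?g \<longlongrightarrow> splitting_sum (0 + j) a Z) (at 0)"
        by (rule powser_limit_0[of 1 "\<lambda>i. splitting_sum (i + j) a Z"]) (auto intro: s)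
      moreover have "filterlim ?c (at 0) sequentially"
        unfolding filterlim_at by (auto intro!: always_eventually) real_asymp
      ultimately have "(\<lambda>m. ?g (?c m)) \<longlonglongrightarrow> splitting_sum (0 + j) a Z" by (rule filterlim_compose)
      moreover have "?f Z c = ?g c" if "c \<noteq> 0" for c
      proof -
        have "(\<lambda>i. splitting_sum (i + j) a Z * c ^ (i + j)) sums (R c Z - (\<Sum>i<j. splitting_sum i a Z * c ^ i))"
          using sums_split_initial_segment[OF R, where n = j] .
        from sums_divide[OF this, of "c ^ j"] show ?thesis
          using that by (simp add: power_add sums_iff)
      qed
      ultimately show ?thesis by simp
    qed
    show ?case
    proof (rule borel_measurable_LIMSEQ_real[OF lim])
      fix m
      have [measurable]: "R (?c m) \<in> borel_measurable atomic_space" by (rule Rm) simp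
      have [measurable]: "(\<lambda>Z. \<Sum>i<j. splitting_sum i a Z * ?c m ^ i) \<in> borel_measurable atomic_space"
        using less by (intro borel_measurable_sum borel_measurable_times) auto
      show "(\<lambda>Z. ?f Z (?c m)) \<in> borel_measurable atomic_space" by measurable
    qed
  qed
  then show ?thesis unfolding ks .
qed

section \<open>The power series of the Laplace transform\<close>

lemma splitting_sum_nonneg_below:
  assumes "\<And>i z. 0 < i \<Longrightarrow> i < k \<Longrightarrow> (0::real) \<le> h i z"
  shows "0 \<le> splitting_sum k h Z"
proof -
  have "splitting_sum k h = splitting_sum k (\<lambda>i z. if 0 < i \<and> i < k then h i z else 0)"
    by (intro splitting_sum_cong) auto
  then show ?thesis using splitting_sum_nonneg[of "\<lambda>i z. if 0 < i \<and> i < k then h i z else 0"] assms by simp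
qed

context supercritical_branching
begin

lemma offspring_mean_bound:
  assumes k: "k \<in> borel_measurable atomic_space" "\<And>Z. \<bar>k Z\<bar> \<le> C * 2 ^ size Z"
  shows "\<bar>\<gamma> y * (\<integral>Z. k Z \<partial>Off y)\<bar> \<le> rate_bound * (C * off_bound)"
proof -
  have C: "0 \<le> C" using order_trans[OF abs_ge_zero k(2)[of "{#}"]] by simp
  have "ennreal \<bar>\<integral>Z. k Z \<partial>Off y\<bar> \<le> (\<integral>\<^sup>+Z. ennreal \<bar>k Z\<bar> \<partial>Off y)"
    using integral_norm_bound_ennreal[OF integrable_offspring[OF k, of y]] by simp
  also have "\<dots> \<le> ennreal (C * off_bound)" by (rule offspring_integral_le[OF k(2) C])
  finally have "\<bar>\<integral>Z. k Z \<partial>Off y\<bar> \<le> C * off_bound" using C by (subst (asm) ennreal_le_iff) auto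
  then show ?thesis
    using gamma_le[of y] bfun_nonneg_pos[OF rate, of y] C by (simp add: abs_mult mult_mono)
qed

lemma measurable_offspring_mean:
  fixes k :: "'a multiset \<Rightarrow> real"
  assumes k: "k \<in> borel_measurable atomic_space"
  shows "(\<lambda>y. \<gamma> y * (\<integral>Z. k Z \<partial>Off y)) \<in> borel_measurable borel"
proof -
  note [measurable] = bfun_nonneg_measurable[OF rate]
  have [measurable]: "(\<lambda>y. \<integral>Z. k Z \<partial>Off y) \<in> borel_measurable borel"
    by (rule measurable_compose[OF measurable_prob_algebraD[OF offspring] integral_measurable_subprob_algebra[OF k]])
  show ?thesis by measurable
qed

text \<open>
  The coefficient of \<open>(- \<theta>) ^ k\<close> in the Laplace transform of the limit, the moment of order \<open>k\<close>
  divided by \<open>fact k\<close>. The factor \<open>\<phi>\<close> is included, which turns the recursion for \<open>limit_moment\<close>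
  into one without denominators.
\<close>

definition limit_coeff :: "nat \<Rightarrow> 'a \<Rightarrow> real" where
  "limit_coeff k x = (if k = 0 then 1 else \<phi> x * limit_moment lam \<phi> \<gamma> Off \<PP> X k x)"

definition split_source :: "nat \<Rightarrow> 'a \<Rightarrow> real" where
  "split_source k y = \<gamma> y * (\<integral>Z. splitting_sum k limit_coeff Z \<partial>Off y)"

lemma limit_coeff_1: "limit_coeff (Suc 0) = \<phi>"
  by (rule ext) (simp add: limit_coeff_def limit_moment.simps)

lemma split_source_small: "k < 2 \<Longrightarrow> split_source k y = 0"
  by (simp add: split_source_def splitting_sum_small)

lemma limit_coeff_rec:
  assumes k: "2 \<le> k"
  shows "limit_coeff k x = time_mean (\<lambda>s y. exp (- lam * real k * s) * split_source k y) x"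
proof -
  have "splitting_sum k (\<lambda>i z. \<phi> z * limit_moment lam \<phi> \<gamma> Off \<PP> X i z) = splitting_sum k limit_coeff"
    by (intro splitting_sum_cong refl) (simp add: limit_coeff_def)
  then have L: "limit_moment lam \<phi> \<gamma> Off \<PP> X k x =
      (LBINT s:{0..}. exp (- lam * real k * s) * inverse (\<phi> x) * mean_semigroup \<PP> X s (split_source k) x)"
    using k by (subst limit_moment.simps) (simp add: split_source_def[abs_def])
  have "\<phi> x * (exp (- lam * real k * s) * inverse (\<phi> x) * mean_semigroup \<PP> X s (split_source k) x)
      = mean_semigroup \<PP> X s (\<lambda>y. exp (- lam * real k * s) * split_source k y) x" for s
    unfolding mean_semigroup_scale using phi_pos[of x] by simp
  then show ?thesis
    using k by (simp add: limit_coeff_def L time_mean_def flip: set_integral_mult_right)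
qed

text \<open>
  Suitably small arguments: for them the nonlinear term, whose size is measured by
  \<open>nonlinearity\<close>, reproduces the bound \<open>2 * phi_bound * \<theta>\<close> of the partial sums and contracts
  distances by the factor \<open>1/2\<close>.
\<close>

definition nonlinearity :: real where
  "nonlinearity = rate_bound * 18 * off_bound * mean_const / lam"

definition radius :: real where
  "radius = 1 / (4 * phi_bound * (1 + nonlinearity))"

lemma nonlinearity_nonneg: "0 \<le> nonlinearity"
  using lam_pos mean_const_pos by (simp add: nonlinearity_def)

lemma radius_pos: "0 < radius"
  using nonlinearity_nonneg phi_bound_pos by (simp add: radius_def)

lemma radius_small:
  assumes "0 \<le> \<theta>" "\<theta> \<le> radius"
  shows "2 * phi_bound * \<theta> \<le> 1 / 2" and "4 * nonlinearity * (phi_bound * \<theta>) \<le> 1"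
proof -
  have pos: "0 < 4 * phi_bound * (1 + nonlinearity)" using nonlinearity_nonneg phi_bound_pos by simp
  have "\<theta> * (4 * phi_bound * (1 + nonlinearity)) \<le> 1"
    using assms(2) pos unfolding radius_def by (simp add: pos_le_divide_eq)
  then have "4 * (phi_bound * \<theta>) + 4 * nonlinearity * (phi_bound * \<theta>) \<le> 1" by (simp add: algebra_simps)
  moreover have "0 \<le> phi_bound * \<theta>" using assms phi_bound_pos by simp
  moreover have "0 \<le> nonlinearity * (phi_bound * \<theta>)"
    using nonlinearity_nonneg \<open>0 \<le> phi_bound * \<theta>\<close> by (rule mult_nonneg_nonneg)
  ultimately show "2 * phi_bound * \<theta> \<le> 1 / 2" and "4 * nonlinearity * (phi_bound * \<theta>) \<le> 1" by linarith+
qed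

lemma radius_decay:
  assumes "0 \<le> \<theta>" "\<theta> \<le> radius" "0 \<le> s"
  shows "0 \<le> \<theta> * exp (- lam * s)" "\<theta> * exp (- lam * s) \<le> radius"
proof -
  have "exp (- lam * s) \<le> 1" using lam_pos assms(3) by simp
  then have "\<theta> * exp (- lam * s) \<le> \<theta> * 1" using assms(1) by (rule mult_left_mono)
  then show "\<theta> * exp (- lam * s) \<le> radius" using assms(2) by simp
  show "0 \<le> \<theta> * exp (- lam * s)" using assms(1) by simp
qed

text \<open>The nonlinearity maps the bound on the partial sums to a quadratic bound.\<close>

lemma splitting_sum_partial_bound:
  assumes nn: "\<And>i z. 0 < i \<Longrightarrow> i \<le> n \<Longrightarrow> 0 \<le> limit_coeff i z"
    and le: "\<And>z. (\<Sum>i=1..n. c ^ i * limit_coeff i z) \<le> 2 * phi_bound * c"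
    and c: "0 \<le> c" "c \<le> radius"
  shows "(\<Sum>k\<le>Suc n. c ^ k * splitting_sum k limit_coeff Z) \<le> 18 * (2 * phi_bound * c)\<^sup>2 * 2 ^ size Z"
proof -
  let ?w = "\<lambda>z. - (\<Sum>i=1..<Suc n. c ^ i * limit_coeff i z)"
  have s0: "0 \<le> (\<Sum>i=1..n. c ^ i * limit_coeff i z)" for z
    by (intro sum_nonneg mult_nonneg_nonneg nn) (use c in auto)
  have w: "\<bar>?w z\<bar> \<le> 2 * phi_bound * c" for z
    unfolding atLeastLessThanSuc_atLeastAtMost using s0[of z] le[of z] by linarith
  have q: "\<bar>1 - ?w z\<bar> \<le> 3/2" for z
    using w[of z] radius_small(1)[OF c] s0[of z] unfolding atLeastLessThanSuc_atLeastAtMost by linarith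
  have "(\<Sum>k\<le>Suc n. c ^ k * splitting_sum k limit_coeff Z) \<le> remainder ?w Z"
    by (rule splitting_sum_partial_le) (use nn c in auto)
  also have "\<dots> \<le> \<bar>remainder ?w Z\<bar>" by simp
  also have "\<dots> \<le> (real (size Z))\<^sup>2 * (2 * phi_bound * c)\<^sup>2 * (3/2) ^ size Z"
    by (rule remainder_bound[OF w q]) simp
  also have "\<dots> = (2 * phi_bound * c)\<^sup>2 * ((real (size Z))\<^sup>2 * (3/2) ^ size Z)" by (simp only: ac_simps)
  also have "\<dots> \<le> (2 * phi_bound * c)\<^sup>2 * (18 * 2 ^ size Z)"
    by (intro mult_left_mono square_le_power_two) auto
  finally show ?thesis by (simp only: ac_simps)
qed

lemma discount_square:
  "(a * (\<theta> * exp (- lam * s)))\<^sup>2 = (a * \<theta>)\<^sup>2 * exp (- 2 * lam * s)"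
proof -
  have "(exp (- lam * s))\<^sup>2 = exp (- 2 * lam * s)" by (simp add: exp_double[symmetric])
  then show ?thesis by (simp add: power_mult_distrib)
qed

text \<open>
  The induction hypothesis for the coefficients. The bound on the partial sums, uniform in their
  order, is the method of majorants; it passes through the splitting sums without any count of
  the splittings.
\<close>

definition tame :: "nat \<Rightarrow> bool" where
  "tame n \<longleftrightarrow> (\<forall>i. 0 < i \<longrightarrow> i \<le> n \<longrightarrow> limit_coeff i \<in> borel_measurable borel \<and> (\<forall>z. 0 \<le> limit_coeff i z)) \<and>
    (\<forall>\<theta> z. 0 \<le> \<theta> \<longrightarrow> \<theta> \<le> radius \<longrightarrow> (\<Sum>i=1..n. \<theta> ^ i * limit_coeff i z) \<le> 2 * phi_bound * \<theta>)"

lemma tameD: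
  assumes "tame n"
  shows "0 < i \<Longrightarrow> i \<le> n \<Longrightarrow> limit_coeff i \<in> borel_measurable borel"
    and "0 < i \<Longrightarrow> i \<le> n \<Longrightarrow> 0 \<le> limit_coeff i z"
    and "0 \<le> \<theta> \<Longrightarrow> \<theta> \<le> radius \<Longrightarrow> (\<Sum>i=1..n. \<theta> ^ i * limit_coeff i z) \<le> 2 * phi_bound * \<theta>"
  using assms by (auto simp: tame_def)

text \<open>
  The partial sums at \<open>radius\<close> bound each single splitting sum, since all terms are
  non-negative.
\<close>

lemma tame_splitting_sum:
  assumes t: "tame n" and k: "k \<le> Suc n"
  shows "splitting_sum k limit_coeff \<in> borel_measurable atomic_space"
    and "0 \<le> splitting_sum k limit_coeff Z"
    and "splitting_sum k limit_coeff Z \<le> 18 * (2 * phi_bound * radius)\<^sup>2 / radius ^ k * 2 ^ size Z"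
    and "0 \<le> \<theta> \<Longrightarrow> \<theta> \<le> radius \<Longrightarrow> (\<Sum>k\<le>Suc n. \<theta> ^ k * splitting_sum k limit_coeff Z) \<le> 18 * (2 * phi_bound * \<theta>)\<^sup>2 * 2 ^ size Z"
proof -
  show "splitting_sum k limit_coeff \<in> borel_measurable atomic_space"
    by (rule measurable_splitting_sum) (use k in \<open>auto intro: tameD[OF t]\<close>)
  have nn: "0 \<le> splitting_sum j limit_coeff Z" if "j \<le> Suc n" for j
    by (rule splitting_sum_nonneg_below) (use that in \<open>auto intro: tameD[OF t]\<close>)
  from nn[OF k] show "0 \<le> splitting_sum k limit_coeff Z" .
  show le: "(\<Sum>k\<le>Suc n. \<theta> ^ k * splitting_sum k limit_coeff Z) \<le> 18 * (2 * phi_bound * \<theta>)\<^sup>2 * 2 ^ size Z"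
    if "0 \<le> \<theta>" "\<theta> \<le> radius" for \<theta>
    using that tameD(2,3)[OF t] by (intro splitting_sum_partial_bound) auto
  have "radius ^ k * splitting_sum k limit_coeff Z \<le> (\<Sum>k\<le>Suc n. radius ^ k * splitting_sum k limit_coeff Z)"
  proof (rule member_le_sum)
    show "k \<in> {..Suc n}" using k by simp
    show "0 \<le> radius ^ j * splitting_sum j limit_coeff Z" if "j \<in> {..Suc n} - {k}" for j
      using that radius_pos nn[of j] by simp
  qed simp
  also have "\<dots> \<le> 18 * (2 * phi_bound * radius)\<^sup>2 * 2 ^ size Z" using radius_pos by (intro le) auto
  finally show "splitting_sum k limit_coeff Z \<le> 18 * (2 * phi_bound * radius)\<^sup>2 / radius ^ k * 2 ^ size Z"
    using radius_pos by (simp add: field_simps)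
qed

lemma tame_integrable:
  assumes t: "tame n" and k: "k \<le> Suc n"
  shows "integrable (Off y) (splitting_sum k limit_coeff)"
proof (rule integrable_offspring[OF tame_splitting_sum(1)[OF t k]])
  show "\<bar>splitting_sum k limit_coeff Z\<bar> \<le> 18 * (2 * phi_bound * radius)\<^sup>2 / radius ^ k * 2 ^ size Z" for Z
    using tame_splitting_sum(2,3)[OF t k, of Z] by (simp only: abs_of_nonneg)
qed

lemma tame_split_source:
  assumes t: "tame n" and k: "k \<le> Suc n"
  shows "split_source k \<in> borel_measurable borel" and "0 \<le> split_source k y"
    and "0 \<le> \<theta> \<Longrightarrow> \<theta> \<le> radius \<Longrightarrow> (\<Sum>k\<le>Suc n. \<theta> ^ k * split_source k y) \<le> rate_bound * (18 * (2 * phi_bound * \<theta>)\<^sup>2 * off_bound)"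
    and "2 \<le> k \<Longrightarrow> \<exists>M. discounted M (\<lambda>s y. exp (- lam * real k * s) * split_source k y)"
proof -
  let ?C = "18 * (2 * phi_bound * radius)\<^sup>2 / radius ^ k"
  show m [measurable]: "split_source k \<in> borel_measurable borel"
    unfolding split_source_def[abs_def] by (rule measurable_offspring_mean[OF tame_splitting_sum(1)[OF t k]])
  show nn: "0 \<le> split_source k y" for y
    unfolding split_source_def using bfun_nonneg_pos[OF rate, of y] tame_splitting_sum(2)[OF t k]
    by (intro mult_nonneg_nonneg Bochner_Integration.integral_nonneg) auto
  have "\<bar>splitting_sum k limit_coeff Z\<bar> \<le> ?C * 2 ^ size Z" for Z
    using tame_splitting_sum(2,3)[OF t k, of Z] by (simp only: abs_of_nonneg)
  from offspring_mean_bound[OF tame_splitting_sum(1)[OF t k] this]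
  have b: "\<bar>split_source k y\<bar> \<le> rate_bound * (?C * off_bound)" for y unfolding split_source_def .
  show "\<exists>M. discounted M (\<lambda>s y. exp (- lam * real k * s) * split_source k y)" if k2: "2 \<le> k"
  proof (intro exI[of _ "rate_bound * (?C * off_bound)"])
    have "\<bar>exp (- lam * real k * s) * split_source k y\<bar> \<le> rate_bound * (?C * off_bound) * exp (- 2 * lam * s)"
      if "0 \<le> s" for s y
    proof -
      have "2 * (lam * s) \<le> real k * (lam * s)" using k2 lam_pos that by (intro mult_right_mono) auto
      then have "exp (- lam * real k * s) \<le> exp (- 2 * lam * s)" by (simp add: ac_simps)
      then have "exp (- lam * real k * s) * \<bar>split_source k y\<bar> \<le> exp (- 2 * lam * s) * (rate_bound * (?C * off_bound))"
        using b[of y] by (intro mult_mono) auto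
      then show ?thesis by (simp add: abs_mult mult.commute)
    qed
    then show "discounted (rate_bound * (?C * off_bound)) (\<lambda>s y. exp (- lam * real k * s) * split_source k y)"
      unfolding discounted_def by (auto simp: split_beta)
  qed
  show "(\<Sum>k\<le>Suc n. \<theta> ^ k * split_source k y) \<le> rate_bound * (18 * (2 * phi_bound * \<theta>)\<^sup>2 * off_bound)"
    if th: "0 \<le> \<theta>" "\<theta> \<le> radius"
  proof -
    let ?S = "\<lambda>Z. \<Sum>k\<le>Suc n. \<theta> ^ k * splitting_sum k limit_coeff Z"
    have mS: "?S \<in> borel_measurable atomic_space"
      by (intro borel_measurable_sum borel_measurable_times borel_measurable_const tame_splitting_sum(1)[OF t]) simp
    have "0 \<le> ?S Z" for Z
      by (intro sum_nonneg mult_nonneg_nonneg zero_le_power th(1) tame_splitting_sum(2)[OF t]) simp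
    then have "\<bar>?S Z\<bar> \<le> 18 * (2 * phi_bound * \<theta>)\<^sup>2 * 2 ^ size Z" for Z
      using tame_splitting_sum(4)[OF t k th] by (simp only: abs_of_nonneg)
    from offspring_mean_bound[OF mS this, of y]
    have "\<gamma> y * (\<integral>Z. ?S Z \<partial>Off y) \<le> rate_bound * (18 * (2 * phi_bound * \<theta>)\<^sup>2 * off_bound)" by linarith
    moreover have "(\<integral>Z. ?S Z \<partial>Off y) = (\<Sum>k\<le>Suc n. \<integral>Z. \<theta> ^ k * splitting_sum k limit_coeff Z \<partial>Off y)"
      by (intro Bochner_Integration.integral_sum integrable_mult_right tame_integrable[OF t]) simp
    moreover have "\<gamma> y * (\<Sum>k\<le>Suc n. \<integral>Z. \<theta> ^ k * splitting_sum k limit_coeff Z \<partial>Off y)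
        = (\<Sum>k\<le>Suc n. \<theta> ^ k * split_source k y)"
      unfolding sum_distrib_left by (intro sum.cong refl) (simp add: split_source_def)
    ultimately show ?thesis by simp
  qed
qed

text \<open>Stated for \<open>a\<close> of either sign: \<open>\<theta>\<close> is used for the bounds and \<open>- \<theta>\<close> for the series.\<close>

lemma tame_partial_sum:
  assumes t: "tame n"
  shows "\<exists>M. discounted M (\<lambda>s y. \<Sum>k\<in>{2..Suc n}. a ^ k * (exp (- lam * real k * s) * split_source k y))"
    and "time_mean (\<lambda>s y. \<Sum>k\<in>{2..Suc n}. a ^ k * (exp (- lam * real k * s) * split_source k y)) x
      = (\<Sum>k\<in>{2..Suc n}. a ^ k * limit_coeff k x)"
proof -
  have "\<forall>k\<in>{2..Suc n}. \<exists>M. discounted M (\<lambda>s y. exp (- lam * real k * s) * split_source k y)"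
    using tame_split_source(4)[OF t] by simp
  then obtain M where "\<forall>k\<in>{2..Suc n}. discounted (M k) (\<lambda>s y. exp (- lam * real k * s) * split_source k y)"
    using bchoice by meson
  then have M: "discounted (M k) (\<lambda>s y. exp (- lam * real k * s) * split_source k y)" if "k \<in> {2..Suc n}" for k
    using that by blast
  note S = discounted_sum[OF discounted_cmult(1)[OF M], of "{2..Suc n}" "\<lambda>k. k" "\<lambda>k. a ^ k"]
  show "\<exists>M. discounted M (\<lambda>s y. \<Sum>k\<in>{2..Suc n}. a ^ k * (exp (- lam * real k * s) * split_source k y))"
    by (rule exI, rule S(1)) auto
  have "time_mean (\<lambda>s y. \<Sum>k\<in>{2..Suc n}. a ^ k * (exp (- lam * real k * s) * split_source k y)) x
      = (\<Sum>k\<in>{2..Suc n}. time_mean (\<lambda>s y. a ^ k * (exp (- lam * real k * s) * split_source k y)) x)"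
    by (rule S(2)) auto
  also have "\<dots> = (\<Sum>k\<in>{2..Suc n}. a ^ k * limit_coeff k x)"
    using discounted_cmult(2)[OF M] limit_coeff_rec by (intro sum.cong refl) simp
  finally show "time_mean (\<lambda>s y. \<Sum>k\<in>{2..Suc n}. a ^ k * (exp (- lam * real k * s) * split_source k y)) x
      = (\<Sum>k\<in>{2..Suc n}. a ^ k * limit_coeff k x)" .
qed

lemma split_source_sum:
  "(\<Sum>k\<in>{2..Suc n}. a ^ k * (exp (- lam * real k * s) * split_source k y)) = (\<Sum>k\<le>Suc n. (a * exp (- lam * s)) ^ k * split_source k y)"
proof -
  have "exp (- lam * real k * s) = exp (- lam * s) ^ k" for k
    by (simp add: exp_of_nat_mult[symmetric] ac_simps)
  then have "(\<Sum>k\<in>{2..Suc n}. a ^ k * (exp (- lam * real k * s) * split_source k y)) = (\<Sum>k\<in>{2..Suc n}. (a * exp (- lam * s)) ^ k * split_source k y)"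
    by (simp add: power_mult_distrib mult.assoc)
  also have "\<dots> = (\<Sum>k\<le>Suc n. (a * exp (- lam * s)) ^ k * split_source k y)"
    by (rule sum.mono_neutral_left) (auto simp: split_source_small)
  finally show ?thesis .
qed

text \<open>
  By the recursion, the partial sum of order \<open>Suc n\<close> is \<open>\<theta> * \<phi> x\<close> plus the time mean of a
  quantity which the partial sum of order \<open>n\<close> controls quadratically. Below \<open>radius\<close> the
  quadratic term is at most \<open>phi_bound * \<theta>\<close>.
\<close>

lemma tame_all: "tame n"
proof (induction n)
  case 0
  show ?case using phi_bound_pos by (simp add: tame_def)
next
  case (Suc n)
  have coeff: "limit_coeff i \<in> borel_measurable borel \<and> (\<forall>z. 0 \<le> limit_coeff i z)" if i: "0 < i" "i \<le> Suc n" for i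
  proof (cases "i = 1")
    case True
    then show ?thesis using phi_pos by (simp add: limit_coeff_1 less_imp_le)
  next
    case False
    with i have i2: "2 \<le> i" by simp
    obtain M where M: "discounted M (\<lambda>s y. exp (- lam * real i * s) * split_source i y)"
      using tame_split_source(4)[OF Suc.IH i(2) i2] by blast
    have e: "limit_coeff i = time_mean (\<lambda>s y. exp (- lam * real i * s) * split_source i y)"
      by (rule ext) (rule limit_coeff_rec[OF i2])
    show ?thesis
      unfolding e using measurable_time_mean[OF M] ennreal_time_mean(2)[OF M] tame_split_source(2)[OF Suc.IH i(2)] by simp
  qed
  have "(\<Sum>i=1..Suc n. \<theta> ^ i * limit_coeff i x) \<le> 2 * phi_bound * \<theta>" if th: "0 \<le> \<theta>" "\<theta> \<le> radius" for \<theta> x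
  proof -
    let ?k = "\<lambda>s y. \<Sum>k\<in>{2..Suc n}. \<theta> ^ k * (exp (- lam * real k * s) * split_source k y)"
    let ?M = "rate_bound * (18 * (2 * phi_bound * \<theta>)\<^sup>2 * off_bound)"
    obtain M' where M': "discounted M' ?k" using tame_partial_sum(1)[OF Suc.IH] by blast
    have bd: "\<bar>?k s y\<bar> \<le> ?M * exp (- 2 * lam * s)" if s: "0 \<le> s" for s y
    proof -
      have "0 \<le> ?k s y"
        using th tame_split_source(2)[OF Suc.IH] by (intro sum_nonneg mult_nonneg_nonneg) auto
      moreover have "?k s y \<le> rate_bound * (18 * (2 * phi_bound * (\<theta> * exp (- lam * s)))\<^sup>2 * off_bound)"
        unfolding split_source_sum
        by (rule tame_split_source(3)[OF Suc.IH order_refl radius_decay[OF th s]])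
      moreover have "rate_bound * (18 * (2 * phi_bound * (\<theta> * exp (- lam * s)))\<^sup>2 * off_bound) = ?M * exp (- 2 * lam * s)"
        unfolding discount_square by (simp only: ac_simps)
      ultimately show ?thesis by linarith
    qed
    have D: "discounted ?M ?k"
      unfolding discounted_def using discountedD(1)[OF M'] bd by blast
    have "(\<Sum>k\<in>{2..Suc n}. \<theta> ^ k * limit_coeff k x) \<le> ?M * mean_const / lam"
      using time_mean_bound[OF D, of x] unfolding tame_partial_sum(2)[OF Suc.IH] by linarith
    also have "\<dots> = (4 * nonlinearity * (phi_bound * \<theta>)) * (phi_bound * \<theta>)"
      by (simp add: nonlinearity_def power2_eq_square)
    also have "\<dots> \<le> 1 * (phi_bound * \<theta>)"
      using radius_small(2)[OF th] phi_bound_pos th by (intro mult_right_mono) auto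
    finally have "(\<Sum>k\<in>{2..Suc n}. \<theta> ^ k * limit_coeff k x) \<le> phi_bound * \<theta>" by simp
    moreover have "(\<Sum>i=1..Suc n. \<theta> ^ i * limit_coeff i x) = \<theta> * \<phi> x + (\<Sum>k\<in>{2..Suc n}. \<theta> ^ k * limit_coeff k x)"
      by (subst sum.atLeast_Suc_atMost) (simp_all add: limit_coeff_1 numeral_2_eq_2)
    moreover have "\<theta> * \<phi> x \<le> \<theta> * phi_bound" using th phi_le by (intro mult_left_mono) auto
    ultimately show ?thesis by (simp add: algebra_simps)
  qed
  with coeff show ?case unfolding tame_def by blast
qed

lemma limit_coeff_nonneg: "0 \<le> limit_coeff k z"
  using tameD(2)[OF tame_all[of k], of k z] by (cases "k = 0") (auto simp: limit_coeff_def)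

lemma measurable_limit_coeff: "limit_coeff (Suc k) \<in> borel_measurable borel"
  by (rule tameD(1)[OF tame_all[of "Suc k"]]) auto

lemma limit_coeff_partial_le:
  assumes "0 \<le> \<theta>" "\<theta> \<le> radius"
  shows "(\<Sum>k<n. \<theta> ^ Suc k * limit_coeff (Suc k) z) \<le> 2 * phi_bound * \<theta>"
proof -
  have "(\<Sum>k<n. \<theta> ^ Suc k * limit_coeff (Suc k) z) = (\<Sum>i=1..n. \<theta> ^ i * limit_coeff i z)"
    by (simp add: sum.atLeast1_atMost_eq)
  then show ?thesis using tameD(3)[OF tame_all assms] by simp
qed

lemma limit_coeff_summable:
  assumes "0 \<le> \<theta>" "\<theta> \<le> radius"
  shows "summable (\<lambda>k. \<theta> ^ Suc k * limit_coeff (Suc k) z)"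
    and "summable (\<lambda>k. \<bar>(- \<theta>) ^ Suc k * limit_coeff (Suc k) z\<bar>)"
    and "(\<Sum>k. \<theta> ^ Suc k * limit_coeff (Suc k) z) \<le> 2 * phi_bound * \<theta>"
proof -
  have nn: "0 \<le> \<theta> ^ Suc k * limit_coeff (Suc k) z" for k
    using assms(1) limit_coeff_nonneg by (intro mult_nonneg_nonneg) auto
  show s: "summable (\<lambda>k. \<theta> ^ Suc k * limit_coeff (Suc k) z)"
    by (rule summableI_nonneg_bounded[OF nn limit_coeff_partial_le[OF assms]])
  have "\<bar>(- \<theta>) ^ Suc k * limit_coeff (Suc k) z\<bar> = \<theta> ^ Suc k * limit_coeff (Suc k) z" for k
    unfolding abs_mult power_abs abs_minus_cancel abs_of_nonneg[OF assms(1)] abs_of_nonneg[OF limit_coeff_nonneg] ..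
  then show "summable (\<lambda>k. \<bar>(- \<theta>) ^ Suc k * limit_coeff (Suc k) z\<bar>)" using s by simp
  show "(\<Sum>k. \<theta> ^ Suc k * limit_coeff (Suc k) z) \<le> 2 * phi_bound * \<theta>"
    by (rule suminf_le_const[OF s limit_coeff_partial_le[OF assms]])
qed

text \<open>The candidate for \<open>limit_gap\<close>.\<close>

definition series_gap :: "real \<Rightarrow> 'a \<Rightarrow> real" where
  "series_gap \<theta> x = - (\<Sum>k. (- \<theta>) ^ Suc k * limit_coeff (Suc k) x)"

lemma measurable_series_gap: "series_gap \<theta> \<in> borel_measurable borel"
proof -
  note [measurable] = measurable_limit_coeff
  show ?thesis unfolding series_gap_def[abs_def] by measurable
qed

lemma abs_series_gap_le:
  assumes "0 \<le> \<theta>" "\<theta> \<le> radius"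
  shows "\<bar>series_gap \<theta> x\<bar> \<le> 2 * phi_bound * \<theta>"
proof -
  have "\<bar>(- \<theta>) ^ Suc k * limit_coeff (Suc k) x\<bar> = \<theta> ^ Suc k * limit_coeff (Suc k) x" for k
    unfolding abs_mult power_abs abs_minus_cancel abs_of_nonneg[OF assms(1)] abs_of_nonneg[OF limit_coeff_nonneg] ..
  then have "\<bar>\<Sum>k. (- \<theta>) ^ Suc k * limit_coeff (Suc k) x\<bar> \<le> (\<Sum>k. \<theta> ^ Suc k * limit_coeff (Suc k) x)"
    using summable_rabs[OF limit_coeff_summable(2)[OF assms, of x]] by simp
  then show ?thesis unfolding series_gap_def using limit_coeff_summable(3)[OF assms, of x] by linarith
qed

text \<open>
  Expansion of the nonlinear term, by dominated convergence: the partial sums with alternating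
  signs are bounded by those with non-negative terms.
\<close>

lemma branching_remainder_series_gap:
  assumes th: "0 \<le> \<theta>" "\<theta> \<le> radius"
  shows "(\<lambda>n. \<Sum>k\<le>Suc n. (- \<theta>) ^ k * split_source k y) \<longlonglongrightarrow> branching_remainder (series_gap \<theta>) y"
    and "\<bar>\<Sum>k\<le>Suc n. (- \<theta>) ^ k * split_source k y\<bar> \<le> rate_bound * (18 * (2 * phi_bound * \<theta>)\<^sup>2 * off_bound)"
proof -
  let ?S = "\<lambda>n Z. \<Sum>k\<le>Suc n. (- \<theta>) ^ k * splitting_sum k limit_coeff Z"
  let ?C = "18 * (2 * phi_bound * \<theta>)\<^sup>2"
  have ss: "splitting_sum k limit_coeff \<in> borel_measurable atomic_space" "0 \<le> splitting_sum k limit_coeff Z"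
    "integrable (Off y) (splitting_sum k limit_coeff)" for k Z
    using tame_splitting_sum(1)[OF tame_all[of k], of k] tame_splitting_sum(2)[OF tame_all[of k], of k Z] tame_integrable[OF tame_all[of k], of k y] by simp_all
  have mS: "?S n \<in> borel_measurable atomic_space" for n
    by (intro borel_measurable_sum borel_measurable_times borel_measurable_const ss)
  have bS: "\<bar>?S n Z\<bar> \<le> ?C * 2 ^ size Z" for n Z
  proof -
    have "\<bar>?S n Z\<bar> \<le> (\<Sum>k\<le>Suc n. \<bar>(- \<theta>) ^ k * splitting_sum k limit_coeff Z\<bar>)" by (rule sum_abs)
    also have "\<dots> = (\<Sum>k\<le>Suc n. \<theta> ^ k * splitting_sum k limit_coeff Z)"
      unfolding abs_mult power_abs abs_minus_cancel abs_of_nonneg[OF th(1)] abs_of_nonneg[OF ss(2)] ..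
    also have "\<dots> \<le> ?C * 2 ^ size Z" by (rule tame_splitting_sum(4)[OF tame_all order_refl th])
    finally show ?thesis .
  qed
  have src: "\<gamma> y * (\<integral>Z. ?S n Z \<partial>Off y) = (\<Sum>k\<le>Suc n. (- \<theta>) ^ k * split_source k y)" for n
  proof -
    have "(\<integral>Z. ?S n Z \<partial>Off y) = (\<Sum>k\<le>Suc n. \<integral>Z. (- \<theta>) ^ k * splitting_sum k limit_coeff Z \<partial>Off y)"
      by (intro Bochner_Integration.integral_sum integrable_mult_right ss)
    moreover have "\<gamma> y * (\<Sum>k\<le>Suc n. \<integral>Z. (- \<theta>) ^ k * splitting_sum k limit_coeff Z \<partial>Off y)
        = (\<Sum>k\<le>Suc n. (- \<theta>) ^ k * split_source k y)"
      unfolding sum_distrib_left by (intro sum.cong refl) (simp add: split_source_def)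
    ultimately show ?thesis by simp
  qed
  show "\<bar>\<Sum>k\<le>Suc n. (- \<theta>) ^ k * split_source k y\<bar> \<le> rate_bound * (?C * off_bound)"
  proof -
    have "\<bar>\<gamma> y * (\<integral>Z. ?S n Z \<partial>Off y)\<bar> \<le> rate_bound * (?C * off_bound)"
      by (rule offspring_mean_bound[OF mS bS])
    then show ?thesis unfolding src .
  qed
  have lim: "(\<lambda>n. ?S n Z) \<longlonglongrightarrow> remainder (series_gap \<theta>) Z" for Z
  proof -
    have "(\<lambda>k. splitting_sum k (\<lambda>i z. (- \<theta>) ^ i * limit_coeff i z) Z) sums remainder (series_gap \<theta>) Z"
      unfolding series_gap_def[abs_def] by (rule splitting_sum_sums, rule limit_coeff_summable(2)[OF th])
    then have "(\<lambda>n. \<Sum>k\<le>n. (- \<theta>) ^ k * splitting_sum k limit_coeff Z) \<longlonglongrightarrow> remainder (series_gap \<theta>) Z"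
      unfolding splitting_sum_scale sums_def_le .
    then show ?thesis by (rule LIMSEQ_Suc)
  qed
  have "(\<lambda>n. \<integral>Z. ?S n Z \<partial>Off y) \<longlonglongrightarrow> (\<integral>Z. remainder (series_gap \<theta>) Z \<partial>Off y)"
  proof (rule integral_dominated_convergence[where w = "\<lambda>Z. ?C * 2 ^ size Z"])
    have b: "\<bar>series_gap \<theta> z\<bar> \<le> 1 / 2" for z
      using abs_series_gap_le[OF th, of z] radius_small(1)[OF th] by linarith
    have "remainder (series_gap \<theta>) \<in> borel_measurable atomic_space"
    proof (rule borel_measurable_remainder)
      show "(\<lambda>(p, y). series_gap \<theta> y) \<in> borel_measurable (atomic_space \<Otimes>\<^sub>M borel)"
        unfolding split_beta by (rule measurable_compose[OF measurable_snd measurable_series_gap])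
      show "series_gap \<theta> y < 1" for y using b[of y] by linarith
    qed simp
    then show "remainder (series_gap \<theta>) \<in> borel_measurable (Off y)" by (simp cong: measurable_cong_sets)
    show "?S n \<in> borel_measurable (Off y)" for n using mS[of n] by (simp cong: measurable_cong_sets)
    show "integrable (Off y) (\<lambda>Z. ?C * 2 ^ size Z)"
    proof (rule integrable_offspring[where C = ?C])
      show "(\<lambda>Z. ?C * 2 ^ size Z) \<in> borel_measurable atomic_space"
        by (rule measurable_compose[OF measurable_size_atoms]) simp
    qed (simp add: abs_mult)
    show "AE Z in Off y. (\<lambda>n. ?S n Z) \<longlonglongrightarrow> remainder (series_gap \<theta>) Z" by (rule AE_I2) (rule lim)
    show "AE Z in Off y. norm (?S n Z) \<le> ?C * 2 ^ size Z" for n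
      unfolding real_norm_def by (rule AE_I2) (rule bS)
  qed
  from tendsto_mult_left[OF this, of "\<gamma> y"]
  show "(\<lambda>n. \<Sum>k\<le>Suc n. (- \<theta>) ^ k * split_source k y) \<longlonglongrightarrow> branching_remainder (series_gap \<theta>) y"
    unfolding src branching_remainder_def .
qed

lemma time_mean_cong:
  assumes "\<And>s. 0 \<le> s \<Longrightarrow> k s = l s"
  shows "time_mean k x = time_mean l x"
  unfolding time_mean_def by (intro set_lebesgue_integral_cong) (use assms in auto)

text \<open>
  The series satisfies the equation of \<open>limit_gap_equation\<close>: comparison of coefficients is the
  recursion of the moments. The case distinction makes the integrand vanish at negative times,
  where the argument may exceed the radius of convergence.
\<close>

theorem series_gap_equation:
  assumes th: "0 \<le> \<theta>" "\<theta> \<le> radius"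
  defines "k \<equiv> \<lambda>s y. if 0 \<le> s then branching_remainder (series_gap (\<theta> * exp (- lam * s))) y else 0"
  shows "discounted (rate_bound * (18 * (2 * phi_bound * \<theta>)\<^sup>2 * off_bound)) k"
    and "\<theta> * \<phi> x - series_gap \<theta> x = time_mean k x"
proof -
  let ?M = "rate_bound * (18 * (2 * phi_bound * \<theta>)\<^sup>2 * off_bound)"
  let ?g = "\<lambda>n s y. \<Sum>k\<in>{2..Suc n}. (- \<theta>) ^ k * (exp (- lam * real k * s) * split_source k y)"
  let ?h = "\<lambda>n s y. if 0 \<le> s then ?g n s y else (0::real)"
  have g: "?g n s y = (\<Sum>k\<le>Suc n. (- (\<theta> * exp (- lam * s))) ^ k * split_source k y)" for n s y
    unfolding split_source_sum by simp
  have lim: "(\<lambda>n. ?h n s y) \<longlonglongrightarrow> k s y" for s y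
  proof (cases "0 \<le> s")
    case True
    then show ?thesis
      unfolding g k_def using branching_remainder_series_gap(1)[OF radius_decay[OF th True]] by simp
  qed (simp add: k_def)
  have hb: "\<bar>?h n s y\<bar> \<le> ?M * exp (- 2 * lam * s)" if s: "0 \<le> s" for n s y
  proof -
    have "\<bar>?g n s y\<bar> \<le> rate_bound * (18 * (2 * phi_bound * (\<theta> * exp (- lam * s)))\<^sup>2 * off_bound)"
      unfolding g by (rule branching_remainder_series_gap(2)[OF radius_decay[OF th s]])
    also have "\<dots> = ?M * exp (- 2 * lam * s)" unfolding discount_square by (simp only: ac_simps)
    finally show ?thesis using s by simp
  qed
  have hm: "(\<lambda>(s, y). ?h n s y) \<in> borel_measurable (borel \<Otimes>\<^sub>M borel)" for n
  proof -
    obtain M' where "discounted M' (?g n)" using tame_partial_sum(1)[OF tame_all] by blast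
    from discountedD(1)[OF this] have [measurable]: "(\<lambda>p. ?g n (fst p) (snd p)) \<in> borel_measurable (borel \<Otimes>\<^sub>M borel)"
      by (simp add: split_beta)
    have "(\<lambda>p. if 0 \<le> fst p then ?g n (fst p) (snd p) else 0) \<in> borel_measurable (borel \<Otimes>\<^sub>M borel)"
      by (intro measurable_If) measurable
    then show ?thesis by (simp add: split_beta)
  qed
  have hD: "discounted ?M (?h n)" for n
    unfolding discounted_def using hm hb by blast
  show kD: "discounted ?M k"
    unfolding discounted_def
  proof (intro conjI allI impI)
    show "(\<lambda>(s, y). k s y) \<in> borel_measurable (borel \<Otimes>\<^sub>M borel)"
    proof (rule borel_measurable_LIMSEQ_real)
      show "(\<lambda>n. case p of (s, y) \<Rightarrow> ?h n s y) \<longlonglongrightarrow> (case p of (s, y) \<Rightarrow> k s y)" for p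
        unfolding split_beta by (rule lim)
    qed (rule hm)
    fix s :: real and y assume s: "0 \<le> s"
    show "\<bar>k s y\<bar> \<le> ?M * exp (- 2 * lam * s)"
      by (rule LIMSEQ_le_const2[OF tendsto_rabs[OF lim]]) (use hb[OF s] in blast)
  qed
  have "(\<lambda>n. time_mean (?h n) x) \<longlonglongrightarrow> time_mean k x"
    by (rule time_mean_tendsto[OF hD kD lim])
  moreover have "time_mean (?h n) x = \<theta> * \<phi> x + (\<Sum>j<Suc n. (- \<theta>) ^ Suc j * limit_coeff (Suc j) x)" for n
  proof -
    have "time_mean (?h n) x = time_mean (?g n) x" by (rule time_mean_cong) simp
    moreover have "\<dots> = (\<Sum>k\<in>{2..Suc n}. (- \<theta>) ^ k * limit_coeff k x)" by (rule tame_partial_sum(2)[OF tame_all])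
    moreover have "(\<Sum>i=1..Suc n. (- \<theta>) ^ i * limit_coeff i x) = - \<theta> * \<phi> x + (\<Sum>k\<in>{2..Suc n}. (- \<theta>) ^ k * limit_coeff k x)"
      by (subst sum.atLeast_Suc_atMost) (simp_all add: limit_coeff_1 numeral_2_eq_2)
    moreover have "(\<Sum>i=1..Suc n. (- \<theta>) ^ i * limit_coeff i x) = (\<Sum>j<Suc n. (- \<theta>) ^ Suc j * limit_coeff (Suc j) x)"
      unfolding One_nat_def by (rule sum.atLeast1_atMost_eq)
    ultimately show ?thesis by linarith
  qed
  moreover have "(\<lambda>n. \<theta> * \<phi> x + (\<Sum>j<Suc n. (- \<theta>) ^ Suc j * limit_coeff (Suc j) x)) \<longlonglongrightarrow> \<theta> * \<phi> x - series_gap \<theta> x"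
  proof -
    have "(\<lambda>n. \<Sum>j<n. (- \<theta>) ^ Suc j * limit_coeff (Suc j) x) \<longlonglongrightarrow> - series_gap \<theta> x"
      unfolding series_gap_def minus_minus
      by (rule summable_LIMSEQ[OF summable_rabs_cancel[OF limit_coeff_summable(2)[OF th]]])
    from tendsto_add[OF tendsto_const LIMSEQ_Suc[OF this], of "\<theta> * \<phi> x"] show ?thesis by simp
  qed
  ultimately have "(\<lambda>n. \<theta> * \<phi> x + (\<Sum>j<Suc n. (- \<theta>) ^ Suc j * limit_coeff (Suc j) x)) \<longlonglongrightarrow> time_mean k x" by simp
  then show "\<theta> * \<phi> x - series_gap \<theta> x = time_mean k x"
    by (rule LIMSEQ_unique[OF \<open>_ \<longlonglongrightarrow> \<theta> * \<phi> x - series_gap \<theta> x\<close>])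
qed

text \<open>
  Both gaps solve the same equation. The difference of the nonlinear terms is at most a multiple
  of their size times their distance, so each application of the equation gains a factor \<open>1/2\<close>.
  The bound has to be proportional to \<open>\<theta>\<close>, as this provides the decay in time.
\<close>

lemma gap_contraction:
  "0 \<le> \<theta> \<Longrightarrow> \<theta> \<le> radius \<Longrightarrow> \<bar>limit_gap \<theta> x - series_gap \<theta> x\<bar> \<le> 3 * (phi_bound * \<theta>) / 2 ^ m"
proof (induction m arbitrary: \<theta> x)
  case 0
  have "limit_gap \<theta> x \<le> phi_bound * \<theta>"
    using limit_gap_le[OF 0(1), of x] mult_left_mono[OF phi_le[of x] 0(1)] by (simp add: mult.commute)
  then show ?case
    using limit_gap_nonneg[OF 0(1), of x] abs_series_gap_le[OF 0, of x] by simp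
next
  case (Suc m)
  note th = Suc.prems
  let ?l = "\<lambda>s. branching_remainder (limit_gap (\<theta> * exp (- lam * s)))"
  let ?k = "\<lambda>s y. if 0 \<le> s then branching_remainder (series_gap (\<theta> * exp (- lam * s))) y else 0"
  let ?M = "rate_bound * (18 * (2 * phi_bound * \<theta> * (3 * (phi_bound * \<theta>) / 2 ^ m)) * off_bound)"
  note l = limit_gap_equation[OF th(1)]
  note k = series_gap_equation[OF th]
  have bd: "\<bar>?l s y - ?k s y\<bar> \<le> ?M * exp (- 2 * lam * s)" if s: "0 \<le> s" for s y
  proof -
    define r where "r = \<theta> * exp (- lam * s)"
    have r: "0 \<le> r" "r \<le> radius" using radius_decay[OF th s] by (auto simp: r_def)
    have g: "\<bar>limit_gap r z\<bar> \<le> 2 * phi_bound * r" for z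
    proof -
      have "limit_gap r z \<le> phi_bound * r"
        using limit_gap_le[OF r(1), of z] mult_left_mono[OF phi_le[of z] r(1)] by (simp add: mult.commute)
      moreover have "0 \<le> phi_bound * r" using r phi_bound_pos by simp
      ultimately show ?thesis using limit_gap_nonneg[OF r(1), of z] by linarith
    qed
    have "\<bar>branching_remainder (limit_gap r) y - branching_remainder (series_gap r) y\<bar>
        \<le> rate_bound * (18 * (2 * phi_bound * r * (3 * (phi_bound * r) / 2 ^ m)) * off_bound)"
    proof (rule branching_remainder_lipschitz(1))
      show "limit_gap r \<in> borel_measurable borel"
        by (rule measurable_limit_gap) (use r in auto)
      show "series_gap r \<in> borel_measurable borel" by (rule measurable_series_gap)
      show "\<bar>limit_gap r z - series_gap r z\<bar> \<le> 3 * (phi_bound * r) / 2 ^ m" for z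
        by (rule Suc.IH[OF r])
      fix z
      show "\<bar>limit_gap r z\<bar> \<le> 2 * phi_bound * r" by (rule g)
      show "\<bar>series_gap r z\<bar> \<le> 2 * phi_bound * r" by (rule abs_series_gap_le[OF r])
      show "- (1 / 2) \<le> limit_gap r z" "limit_gap r z < 1"
        using limit_gap_nonneg[OF r(1), of z] limit_gap_less_1[OF r(1), of z] by linarith+
      show "- (1 / 2) \<le> series_gap r z" "series_gap r z < 1"
        using abs_series_gap_le[OF r, of z] radius_small(1)[OF r] by linarith+
    qed
    also have "\<dots> = rate_bound * (18 * (6 / 2 ^ m * (phi_bound * r)\<^sup>2) * off_bound)"
      by (simp add: power2_eq_square)
    also have "\<dots> = ?M * exp (- 2 * lam * s)"
      unfolding r_def discount_square by (simp add: power2_eq_square)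
    finally show ?thesis using s by (simp add: r_def)
  qed
  have D: "discounted ?M (\<lambda>s y. ?l s y - ?k s y)"
    unfolding discounted_def using discountedD(1)[OF discounted_diff(1)[OF l(1) k(1)]] bd by blast
  have "\<bar>limit_gap \<theta> x - series_gap \<theta> x\<bar> = \<bar>time_mean ?l x - time_mean ?k x\<bar>"
    unfolding l(2)[symmetric] k(2)[symmetric] by (simp add: abs_minus_commute)
  also have "\<dots> = \<bar>time_mean (\<lambda>s y. ?l s y - ?k s y) x\<bar>"
    unfolding discounted_diff(2)[OF l(1) k(1)] ..
  also have "\<dots> \<le> ?M * mean_const / lam" by (rule time_mean_bound[OF D])
  also have "\<dots> = (4 * nonlinearity * (phi_bound * \<theta>)) * (3 * (phi_bound * \<theta>) / 2 ^ Suc m)"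
    by (simp add: nonlinearity_def ac_simps)
  also have "\<dots> \<le> 1 * (3 * (phi_bound * \<theta>) / 2 ^ Suc m)"
    using radius_small(2)[OF th] phi_bound_pos th by (intro mult_right_mono) auto
  finally show ?case by simp
qed

theorem laplace_limit_series:
  assumes th: "0 \<le> \<theta>" "\<theta> \<le> radius"
  shows "(\<lambda>k. limit_coeff k x * (- \<theta>) ^ k) sums (\<integral>\<omega>. exp (- (\<theta> * mart_limit \<omega>)) \<partial>\<PP> {#x#})"
proof -
  have "(\<lambda>m. 3 * (phi_bound * \<theta>) * (1 / 2) ^ m) \<longlonglongrightarrow> 0"
    by (intro tendsto_mult_right_zero LIMSEQ_power_zero) simp
  then have "(\<lambda>m. 3 * (phi_bound * \<theta>) / 2 ^ m) \<longlonglongrightarrow> 0" by (simp add: power_divide)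
  then have "\<bar>limit_gap \<theta> x - series_gap \<theta> x\<bar> \<le> 0"
    by (rule LIMSEQ_le_const) (use gap_contraction[OF th] in blast)
  then have eq: "limit_gap \<theta> x = series_gap \<theta> x" by simp
  have "(\<lambda>k. (- \<theta>) ^ Suc k * limit_coeff (Suc k) x) sums - series_gap \<theta> x"
    unfolding series_gap_def minus_minus
    by (rule summable_sums[OF summable_rabs_cancel[OF limit_coeff_summable(2)[OF th]]])
  then have "(\<lambda>k. (- \<theta>) ^ k * limit_coeff k x) sums (- series_gap \<theta> x + (- \<theta>) ^ 0 * limit_coeff 0 x)"
    by (rule sums_Suc)
  then show ?thesis by (simp add: limit_coeff_def[of 0] eq[symmetric] limit_gap_def mult.commute)
qed

lemma limit_coeff_summable_radius: "summable (\<lambda>k. limit_coeff k x * radius ^ k)"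
  using limit_coeff_summable(1)[of radius x] radius_pos
  by (subst summable_Suc_iff[symmetric]) (simp add: mult.commute)

end

section \<open>Moments from Laplace transforms, and laws determined by their moments\<close>

text \<open>The remainder of the exponential series, with the sign that makes it non-negative.\<close>

definition exp_remainder :: "nat \<Rightarrow> real \<Rightarrow> real" where
  "exp_remainder k y = (- 1) ^ k * (exp (- y) - (\<Sum>j<k. (- y) ^ j / fact j))"

lemma exp_remainder_nonneg:
  assumes "0 \<le> y"
  shows "0 \<le> exp_remainder k y"
proof -
  obtain t where "exp (- y) = (\<Sum>m<k. (- y) ^ m / fact m) + exp t / fact k * (- y) ^ k"
    using Maclaurin_exp_le[of "- y" k] by blast
  then have "exp_remainder k y = (- 1) ^ k * (exp t / fact k * (- y) ^ k)"
    by (simp add: exp_remainder_def)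
  also have "\<dots> = exp t / fact k * y ^ k"
  proof -
    have "(- 1) ^ k * (- y) ^ k = y ^ k" by (simp flip: power_mult_distrib)
    then show ?thesis by (metis (no_types, lifting) mult.left_commute)
  qed
  finally show ?thesis using assms by simp
qed

lemma exp_remainder_Suc: "exp_remainder (Suc k) y = y ^ k / fact k - exp_remainder k y"
proof -
  have "(- 1) ^ k * ((- y) ^ k / fact k) = y ^ k / fact k"
    by (simp add: power_mult_distrib[symmetric])
  then show ?thesis by (simp add: exp_remainder_def algebra_simps)
qed

lemma exp_remainder_le:
  assumes "0 \<le> y"
  shows "exp_remainder k y \<le> y ^ k / fact k"
  using exp_remainder_nonneg[OF assms, of "Suc k"] by (simp add: exp_remainder_Suc)

lemma exp_remainder_tendsto:
  assumes y: "0 \<le> y" and c: "\<And>n. 0 < c n" and c0: "c \<longlonglongrightarrow> (0::real)"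
  shows "(\<lambda>n. exp_remainder k (c n * y) / c n ^ k) \<longlonglongrightarrow> y ^ k / fact k"
proof (rule tendsto_sandwich[OF always_eventually always_eventually _ tendsto_const])
  show "\<forall>n. exp_remainder k (c n * y) / c n ^ k \<le> y ^ k / fact k"
  proof
    fix n
    have "exp_remainder k (c n * y) \<le> (c n * y) ^ k / fact k"
      using y c[of n] by (intro exp_remainder_le) simp
    then show "exp_remainder k (c n * y) / c n ^ k \<le> y ^ k / fact k"
      using c[of n] by (simp add: divide_simps power_mult_distrib mult_ac)
  qed
  show "\<forall>n. y ^ k / fact k - c n * (y ^ Suc k / fact (Suc k)) \<le> exp_remainder k (c n * y) / c n ^ k"
  proof
    fix n
    have "(c n * y) ^ k / fact k - (c n * y) ^ Suc k / fact (Suc k) \<le> exp_remainder k (c n * y)"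
      using exp_remainder_le[of "c n * y" "Suc k"] y c[of n] by (simp add: exp_remainder_Suc)
    then have "((c n * y) ^ k / fact k - (c n * y) ^ Suc k / fact (Suc k)) / c n ^ k \<le> exp_remainder k (c n * y) / c n ^ k"
      using c[of n] by (intro divide_right_mono) auto
    moreover have "((c n * y) ^ k / fact k - (c n * y) ^ Suc k / fact (Suc k)) / c n ^ k
        = y ^ k / fact k - c n * (y ^ Suc k / fact (Suc k))"
      using c[of n] by (simp add: diff_divide_distrib power_mult_distrib)
    ultimately show "y ^ k / fact k - c n * (y ^ Suc k / fact (Suc k)) \<le> exp_remainder k (c n * y) / c n ^ k"
      by simp
  qed
  have "(\<lambda>n. y ^ k / fact k - c n * (y ^ Suc k / fact (Suc k))) \<longlonglongrightarrow> y ^ k / fact k - 0 * (y ^ Suc k / fact (Suc k))"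
    by (intro tendsto_intros c0)
  then show "(\<lambda>n. y ^ k / fact k - c n * (y ^ Suc k / fact (Suc k))) \<longlonglongrightarrow> y ^ k / fact k" by simp
qed

text \<open>
  The series is known for non-negative arguments only, so moments are not obtained by
  differentiation. Instead, given the moments of order below \<open>k\<close>, the remainder of order \<open>k\<close> of
  the exponential series has an expectation which is known from the series; divided by \<open>\<theta> ^ k\<close>
  it tends to \<open>h k\<close>. Fatou's lemma gives integrability, and dominated convergence the value.
\<close>

theorem moments_from_laplace:
  fixes V :: "'b \<Rightarrow> real"
  assumes M: "prob_space M" and V [measurable]: "V \<in> borel_measurable M" and V0: "\<And>x. 0 \<le> V x"
    and \<rho>: "0 < \<rho>"
    and L: "\<And>\<theta>. 0 \<le> \<theta> \<Longrightarrow> \<theta> \<le> \<rho> \<Longrightarrow> (\<lambda>k. h k * (- \<theta>) ^ k) sums (\<integral>x. exp (- (\<theta> * V x)) \<partial>M)"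
  shows "integrable M (\<lambda>x. V x ^ k) \<and> (\<integral>x. V x ^ k \<partial>M) = fact k * h k"
proof (induction k rule: less_induct)
  case (less k)
  interpret prob_space M by fact
  define c where "c n = \<rho> / real (Suc n)" for n
  have c: "0 < c n" "c n \<le> \<rho>" for n using \<rho> by (auto simp: c_def field_simps)
  have c0: "c \<longlonglongrightarrow> 0" unfolding c_def using LIMSEQ_inverse_real_of_nat[THEN tendsto_mult_left, of \<rho>] by (simp add: divide_inverse)
  let ?R = "\<lambda>n x. exp_remainder k (c n * V x) / c n ^ k"
  have R0: "0 \<le> ?R n x" for n x
    using c[of n] V0[of x] by (intro divide_nonneg_nonneg exp_remainder_nonneg) auto
  have R_le: "?R n x \<le> V x ^ k / fact k" for n x
  proof -
    have "exp_remainder k (c n * V x) \<le> (c n * V x) ^ k / fact k"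
      using V0[of x] c(1)[of n] by (intro exp_remainder_le) simp
    then show ?thesis using c(1)[of n] by (simp add: divide_simps power_mult_distrib mult_ac)
  qed
  have Rm [measurable]: "?R n \<in> borel_measurable M" for n
    unfolding exp_remainder_def by measurable
  have R_lim: "(\<lambda>n. ?R n x) \<longlonglongrightarrow> V x ^ k / fact k" for x
    by (rule exp_remainder_tendsto[OF V0 c(1) c0])
  have int_R: "integrable M (?R n)" and eq_R: "(\<lambda>i. h (i + k) * (- c n) ^ i) sums (\<integral>x. ?R n x \<partial>M)" for n
  proof -
    have ie: "integrable M (\<lambda>x. exp (- (c n * V x)))"
    proof (rule integrable_const_bound[where B = 1])
      show "AE x in M. norm (exp (- (c n * V x))) \<le> 1" using c(1)[of n] V0 by (intro AE_I2) simp
    qed measurable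
    have iterms: "integrable M (\<lambda>x. (- (c n * V x)) ^ j / fact j)" if "j < k" for j
    proof -
      have "(\<lambda>x. (- (c n * V x)) ^ j / fact j) = (\<lambda>x. (- c n) ^ j / fact j * V x ^ j)"
        by (simp add: fun_eq_iff power_mult_distrib[symmetric])
      then show ?thesis using less[OF that] by simp
    qed
    have js: "(\<integral>x. (- (c n * V x)) ^ j / fact j \<partial>M) = h j * (- c n) ^ j" if "j < k" for j
    proof -
      have "(\<lambda>x. (- (c n * V x)) ^ j / fact j) = (\<lambda>x. (- c n) ^ j / fact j * V x ^ j)"
        by (simp add: fun_eq_iff power_mult_distrib[symmetric])
      then show ?thesis using less[OF that] by simp
    qed
    have id: "integrable M (\<lambda>x. exp (- (c n * V x)) - (\<Sum>j<k. (- (c n * V x)) ^ j / fact j))"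
      by (intro Bochner_Integration.integrable_diff Bochner_Integration.integrable_sum ie iterms) simp
    show "integrable M (?R n)"
      unfolding exp_remainder_def by (intro integrable_divide integrable_mult_right id)
    have I: "(\<integral>x. ?R n x \<partial>M) = (- 1) ^ k * ((\<integral>x. exp (- (c n * V x)) \<partial>M) - (\<Sum>j<k. h j * (- c n) ^ j)) / c n ^ k"
    proof -
      have "(\<integral>x. exp (- (c n * V x)) - (\<Sum>j<k. (- (c n * V x)) ^ j / fact j) \<partial>M)
          = (\<integral>x. exp (- (c n * V x)) \<partial>M) - (\<Sum>j<k. h j * (- c n) ^ j)"
      proof (subst Bochner_Integration.integral_diff[OF ie])
        show "integrable M (\<lambda>x. \<Sum>j<k. (- (c n * V x)) ^ j / fact j)"
          by (intro Bochner_Integration.integrable_sum iterms) simp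
        have "(\<integral>x. (\<Sum>j<k. (- (c n * V x)) ^ j / fact j) \<partial>M) = (\<Sum>j<k. \<integral>x. (- (c n * V x)) ^ j / fact j \<partial>M)"
          by (intro Bochner_Integration.integral_sum iterms) simp
        also have "\<dots> = (\<Sum>j<k. h j * (- c n) ^ j)" by (intro sum.cong refl js) simp
        finally show "(\<integral>x. exp (- (c n * V x)) \<partial>M) - (\<integral>x. (\<Sum>j<k. (- (c n * V x)) ^ j / fact j) \<partial>M)
            = (\<integral>x. exp (- (c n * V x)) \<partial>M) - (\<Sum>j<k. h j * (- c n) ^ j)" by simp
      qed
      then show ?thesis unfolding exp_remainder_def by simp
    qed
    have "(\<lambda>i. h (i + k) * (- c n) ^ (i + k)) sums ((\<integral>x. exp (- (c n * V x)) \<partial>M) - (\<Sum>j<k. h j * (- c n) ^ j))"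
      using sums_split_initial_segment[OF L[of "c n"], where n = k] c[of n] by simp
    from sums_mult[OF this, of "(- 1) ^ k / c n ^ k"]
    have "(\<lambda>i. (- 1) ^ k / c n ^ k * (h (i + k) * (- c n) ^ (i + k))) sums (\<integral>x. ?R n x \<partial>M)"
      unfolding I by (simp only: times_divide_eq_left)
    moreover have "(- 1) ^ k / c n ^ k * (h (i + k) * (- c n) ^ (i + k)) = h (i + k) * (- c n) ^ i" for i
    proof -
      have "(- 1) ^ k * (- c n) ^ k = c n ^ k" by (simp add: power_mult_distrib[symmetric])
      then show ?thesis using c(1)[of n] by (simp add: power_add field_simps)
    qed
    ultimately show "(\<lambda>i. h (i + k) * (- c n) ^ i) sums (\<integral>x. ?R n x \<partial>M)" by simp
  qed
  have lim_int: "(\<lambda>n. \<integral>x. ?R n x \<partial>M) \<longlonglongrightarrow> h k"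
  proof -
    have "summable (\<lambda>i. h (i + k) * (- \<rho>) ^ i)"
      using eq_R[of 0] by (simp add: c_def sums_iff)
    then have "summable (\<lambda>i. h (i + k) * z ^ i)" if "norm z < \<rho>" for z :: real
      by (rule powser_inside) (use \<rho> that in simp)
    then have "((\<lambda>z. \<Sum>i. h (i + k) * z ^ i) \<longlongrightarrow> h (0 + k)) (at 0)"
      by (intro powser_limit_0[OF \<rho>]) (auto intro: summable_sums)
    moreover have "filterlim (\<lambda>n. - c n) (at 0) sequentially"
      unfolding filterlim_at using tendsto_minus[OF c0] c(1) by (auto simp: less_imp_neq[symmetric])
    ultimately have "(\<lambda>n. \<Sum>i. h (i + k) * (- c n) ^ i) \<longlonglongrightarrow> h (0 + k)" by (rule filterlim_compose)
    then show ?thesis using sums_unique[OF eq_R] by simp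
  qed
  have "(\<integral>\<^sup>+x. ennreal (V x ^ k / fact k) \<partial>M) = (\<integral>\<^sup>+x. liminf (\<lambda>n. ennreal (?R n x)) \<partial>M)"
    by (intro nn_integral_cong lim_imp_Liminf[symmetric] tendsto_ennrealI R_lim) simp
  also have "\<dots> \<le> liminf (\<lambda>n. \<integral>\<^sup>+x. ennreal (?R n x) \<partial>M)" by (rule nn_integral_liminf) measurable
  also have "\<dots> = liminf (\<lambda>n. ennreal (\<integral>x. ?R n x \<partial>M))"
    by (simp only: nn_integral_eq_integral[OF int_R AE_I2[OF R0]])
  also have "\<dots> = ennreal (h k)" by (intro lim_imp_Liminf tendsto_ennrealI lim_int) simp
  finally have "(\<integral>\<^sup>+x. ennreal (V x ^ k / fact k) \<partial>M) < \<infinity>" by (rule le_less_trans) simp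
  then have int: "integrable M (\<lambda>x. V x ^ k / fact k)"
    using V0 by (intro integrableI_nonneg) auto
  have "(\<lambda>n. \<integral>x. ?R n x \<partial>M) \<longlonglongrightarrow> (\<integral>x. V x ^ k / fact k \<partial>M)"
  proof (rule integral_dominated_convergence[OF _ _ int])
    show "AE x in M. norm (?R n x) \<le> V x ^ k / fact k" for n
      unfolding real_norm_def abs_of_nonneg[OF R0] by (intro AE_I2 R_le)
    show "AE x in M. (\<lambda>n. ?R n x) \<longlonglongrightarrow> V x ^ k / fact k" by (rule AE_I2) (rule R_lim)
  qed measurable
  then have eq: "(\<integral>x. V x ^ k / fact k \<partial>M) = h k" using lim_int by (rule LIMSEQ_unique)
  have "(\<lambda>x. V x ^ k) = (\<lambda>x. fact k * (V x ^ k / fact k))" by (simp add: fun_eq_iff)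
  then show ?case using int eq by (metis integrable_mult_right integral_mult_right_zero)
qed

text \<open>The derivatives of the characteristic function, up to powers of the imaginary unit.\<close>

definition char_deriv :: "real measure \<Rightarrow> nat \<Rightarrow> real \<Rightarrow> complex" where
  "char_deriv \<mu> m y = (\<integral>w. complex_of_real (w ^ m) * iexp (y * w) \<partial>\<mu>)"

text \<open>
  The moments are the absolute ones, the law being supported on \<open>{0..}\<close>. Their growth makes the
  Taylor series at any point \<open>y\<close> converge within a distance that does not depend on \<open>y\<close>; the
  factor \<open>fact (n + m) / fact n\<close> for the derivative of order \<open>m\<close> is at most
  \<open>fact m * 2 ^ (n + m)\<close>, whence the factor \<open>1/2\<close> in the bound on \<open>t\<close>.
\<close>

lemma char_deriv_Taylor:
  assumes \<mu>: "real_distribution \<mu>" "AE w in \<mu>. 0 \<le> w"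
    and int: "\<And>k. integrable \<mu> (\<lambda>w. w ^ k)" and mom: "\<And>k. (\<integral>w. w ^ k \<partial>\<mu>) = fact k * h k"
    and sm: "summable (\<lambda>k. h k * \<rho> ^ k)" and \<rho>: "0 < \<rho>" and t: "\<bar>t\<bar> \<le> \<rho> / 2"
  shows "(\<lambda>n. (\<i> * complex_of_real t) ^ n / fact n * char_deriv \<mu> (n + m) y) sums char_deriv \<mu> m (y + t)"
proof -
  interpret real_distribution \<mu> by fact
  let ?f = "\<lambda>n w. (\<i> * complex_of_real t) ^ n / fact n * (complex_of_real (w ^ (n + m)) * iexp (y * w))"
  have h0: "0 \<le> h k" for k
  proof -
    have "0 \<le> (\<integral>w. w ^ k \<partial>\<mu>)" using \<mu>(2) by (intro integral_nonneg_AE) (auto elim: eventually_mono)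
    then show ?thesis unfolding mom using zero_le_mult_iff[of "fact k :: real" "h k"] fact_gt_zero[of k, where 'a = real] by linarith
  qed
  have nf: "norm (?f n w) = \<bar>t\<bar> ^ n / fact n * \<bar>w\<bar> ^ (n + m)" for n w
    by (simp add: norm_mult norm_divide norm_power)
  have intc: "integrable \<mu> (\<lambda>w. complex_of_real (w ^ k) * iexp (y * w))" for k
  proof (rule Bochner_Integration.integrable_bound[OF int[of k]])
    show "AE w in \<mu>. norm (complex_of_real (w ^ k) * iexp (y * w)) \<le> norm (w ^ k)"
      by (rule AE_I2) (simp add: norm_mult norm_power power_abs)
  qed measurable
  have intf: "integrable \<mu> (?f n)" for n using intc by (rule integrable_mult_right)
  have norm_int: "(\<integral>w. norm (?f n w) \<partial>\<mu>) = \<bar>t\<bar> ^ n / fact n * (fact (n + m) * h (n + m))" for n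
  proof -
    have "(\<integral>w. norm (?f n w) \<partial>\<mu>) = (\<integral>w. \<bar>t\<bar> ^ n / fact n * w ^ (n + m) \<partial>\<mu>)"
      unfolding nf
    proof (rule integral_cong_AE)
      show "AE w in \<mu>. \<bar>t\<bar> ^ n / fact n * \<bar>w\<bar> ^ (n + m) = \<bar>t\<bar> ^ n / fact n * w ^ (n + m)"
        using \<mu>(2) by eventually_elim simp
    qed measurable
    then show ?thesis by (simp add: mom)
  qed
  have summ: "summable (\<lambda>n. \<integral>w. norm (?f n w) \<partial>\<mu>)"
    unfolding norm_int
  proof (rule summable_comparison_test'[where N = 0])
    have "summable (\<lambda>n. h (n + m) * \<rho> ^ (n + m))" using sm by (rule summable_ignore_initial_segment)
    then show "summable (\<lambda>n. fact m * 2 ^ m / \<rho> ^ m * (h (n + m) * \<rho> ^ (n + m)))" by (rule summable_mult)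
    fix n
    have "fact (n + m) / fact n = fact m * real ((n + m) choose m)"
      using binomial_fact[of m "n + m", where 'a = real] by simp
    also have "\<dots> \<le> fact m * 2 ^ (n + m)"
      using binomial_le_pow2[of "n + m" m] by (intro mult_left_mono) (metis of_nat_le_iff of_nat_numeral of_nat_power, simp)
    finally have b: "fact (n + m) / fact n \<le> (fact m * 2 ^ (n + m) :: real)" .
    have "\<bar>t\<bar> ^ n / fact n * (fact (n + m) * h (n + m)) = fact (n + m) / fact n * (\<bar>t\<bar> ^ n * h (n + m))" by simp
    also have "\<dots> \<le> fact m * 2 ^ (n + m) * ((\<rho> / 2) ^ n * h (n + m))"
      using b t h0 \<rho> by (intro mult_mono power_mono) auto
    also have "\<dots> = fact m * 2 ^ m * ((2 * (\<rho> / 2)) ^ n * h (n + m))"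
      by (simp only: power_add power_mult_distrib ac_simps)
    also have "\<dots> = fact m * 2 ^ m / \<rho> ^ m * (h (n + m) * \<rho> ^ (n + m))"
      using \<rho> by (simp add: power_add)
    finally show "norm (\<bar>t\<bar> ^ n / fact n * (fact (n + m) * h (n + m))) \<le> fact m * 2 ^ m / \<rho> ^ m * (h (n + m) * \<rho> ^ (n + m))"
      using h0 by simp
  qed
  have series: "(\<lambda>n. ?f n w) sums (complex_of_real (w ^ m) * iexp ((y + t) * w))" for w
  proof -
    have "(\<lambda>n. (\<i> * complex_of_real t * complex_of_real w) ^ n / fact n) sums exp (\<i> * complex_of_real t * complex_of_real w)"
      using exp_converges[of "\<i> * complex_of_real t * complex_of_real w"] by (simp add: scaleR_conv_of_real divide_inverse mult.commute)
    from sums_mult[OF this, of "complex_of_real (w ^ m) * iexp (y * w)"]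
    show ?thesis by (simp add: power_add power_mult_distrib exp_add[symmetric] algebra_simps)
  qed
  have AEs: "AE w in \<mu>. summable (\<lambda>n. norm (?f n w))"
  proof (rule AE_I2)
    fix w
    have "summable (\<lambda>n. \<bar>w\<bar> ^ m * ((\<bar>t\<bar> * \<bar>w\<bar>) ^ n / fact n))"
      using summable_exp[of "\<bar>t\<bar> * \<bar>w\<bar>"] by (intro summable_mult) (simp add: divide_inverse mult.commute)
    then show "summable (\<lambda>n. norm (?f n w))" unfolding nf by (simp add: power_add power_mult_distrib mult_ac)
  qed
  have "(\<lambda>n. \<integral>w. ?f n w \<partial>\<mu>) sums (\<integral>w. (\<Sum>n. ?f n w) \<partial>\<mu>)"
    by (rule sums_integral[OF intf AEs summ])
  moreover have "(\<integral>w. ?f n w \<partial>\<mu>) = (\<i> * complex_of_real t) ^ n / fact n * char_deriv \<mu> (n + m) y" for n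
    unfolding char_deriv_def by (rule integral_mult_right_zero)
  moreover have "(\<Sum>n. ?f n w) = complex_of_real (w ^ m) * iexp ((y + t) * w)" for w
    using series by (rule sums_unique[symmetric])
  ultimately show ?thesis by (simp add: char_deriv_def)
qed

text \<open>
  At zero all derivatives of the two characteristic functions are given by the moments. Steps of
  length \<open>\<rho> / 2\<close> carry this equality to the whole line.
\<close>

theorem determined_by_moments:
  assumes \<mu>: "real_distribution \<mu>" "AE w in \<mu>. 0 \<le> w" "\<And>k. integrable \<mu> (\<lambda>w. w ^ k)" "\<And>k. (\<integral>w. w ^ k \<partial>\<mu>) = fact k * h k"
    and \<nu>: "real_distribution \<nu>" "AE w in \<nu>. 0 \<le> w" "\<And>k. integrable \<nu> (\<lambda>w. w ^ k)" "\<And>k. (\<integral>w. w ^ k \<partial>\<nu>) = fact k * h k"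
    and sm: "summable (\<lambda>k. h k * \<rho> ^ k)" and \<rho>: "0 < \<rho>"
  shows "\<mu> = \<nu>"
proof -
  have step: "char_deriv \<mu> m y = char_deriv \<nu> m y" if "\<bar>y\<bar> \<le> real n * (\<rho> / 2)" for n m y
    using that
  proof (induction n arbitrary: m y)
    case 0
    have "char_deriv \<kappa> m 0 = complex_of_real (\<integral>w. w ^ m \<partial>\<kappa>)" for \<kappa> :: "real measure"
      unfolding char_deriv_def by (simp del: of_real_power add: integral_complex_of_real)
    then show ?case using 0 \<mu>(4) \<nu>(4) by simp
  next
    case (Suc n)
    obtain z where z: "\<bar>z\<bar> \<le> real n * (\<rho> / 2)" "\<bar>y - z\<bar> \<le> \<rho> / 2"
    proof
      \<comment> \<open>the projection of \<open>y\<close> to the interval already covered\<close>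
      let ?z = "max (- (real n * (\<rho> / 2))) (min (real n * (\<rho> / 2)) y)"
      have "0 \<le> real n * (\<rho> / 2)" using \<rho> by simp
      then show "\<bar>?z\<bar> \<le> real n * (\<rho> / 2)" "\<bar>y - ?z\<bar> \<le> \<rho> / 2"
        using Suc.prems \<rho> by (auto simp: abs_le_iff max_def min_def algebra_simps)
    qed
    have "(\<lambda>j. (\<i> * complex_of_real (y - z)) ^ j / fact j * char_deriv \<mu> (j + m) z) sums char_deriv \<mu> m (z + (y - z))"
      by (rule char_deriv_Taylor[OF \<mu> sm \<rho> z(2)])
    moreover have "(\<lambda>j. (\<i> * complex_of_real (y - z)) ^ j / fact j * char_deriv \<nu> (j + m) z) sums char_deriv \<nu> m (z + (y - z))"
      by (rule char_deriv_Taylor[OF \<nu> sm \<rho> z(2)])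
    ultimately show ?case using Suc.IH[OF z(1)] by (simp add: sums_unique2)
  qed
  have "char \<mu> y = char \<nu> y" for y
  proof -
    obtain n :: nat where "\<bar>y\<bar> / (\<rho> / 2) \<le> real n" using real_arch_simple by blast
    then have "\<bar>y\<bar> \<le> real n * (\<rho> / 2)" using \<rho> by (simp add: field_simps)
    from step[OF this, of 0] show ?thesis by (simp add: char_deriv_def char_def)
  qed
  then show ?thesis by (intro Levy_uniqueness \<mu>(1) \<nu>(1)) auto
qed

section \<open>The limit theorem\<close>

context supercritical_branching
begin

lemma limit_moments:
  "integrable (\<PP> {#x#}) (\<lambda>\<omega>. mart_limit \<omega> ^ k)"
  "(\<integral>\<omega>. mart_limit \<omega> ^ k \<partial>\<PP> {#x#}) = fact k * limit_coeff k x"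
  using moments_from_laplace[OF prob measurable_mart_limit mart_limit_nonneg radius_pos laplace_limit_series, of x k]
  by auto

lemma limit_determined_by_moments:
  assumes \<nu>: "real_distribution \<nu>" "AE w in \<nu>. 0 \<le> w"
    and mom: "\<And>k. integrable \<nu> (\<lambda>w. w ^ k)" "\<And>k. (\<integral>w. w ^ k \<partial>\<nu>) = (\<integral>\<omega>. mart_limit \<omega> ^ k \<partial>\<PP> {#x#})"
  shows "\<nu> = distr (\<PP> {#x#}) borel mart_limit"
proof (rule determined_by_moments[OF \<nu> mom(1) _ _ _ _ _ limit_coeff_summable_radius radius_pos])
  note [measurable] = measurable_mart_limit
  interpret prob_space "\<PP> {#x#}" by (rule prob)
  show "(\<integral>w. w ^ k \<partial>\<nu>) = fact k * limit_coeff k x" for k unfolding mom(2) limit_moments(2) ..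
  show "real_distribution (distr (\<PP> {#x#}) borel mart_limit)" by (rule real_distribution_distr) measurable
  show "AE w in distr (\<PP> {#x#}) borel mart_limit. 0 \<le> w"
    by (subst AE_distr_iff) (auto simp: mart_limit_nonneg)
  show "integrable (distr (\<PP> {#x#}) borel mart_limit) (\<lambda>w. w ^ k)" for k
    by (subst integrable_distr_eq) (auto simp: limit_moments(1))
  show "(\<integral>w. w ^ k \<partial>distr (\<PP> {#x#}) borel mart_limit) = fact k * limit_coeff k x" for k
    by (subst integral_distr) (auto simp: limit_moments(2))
qed

end
theorem theorem1p1:
  fixes P :: "real \<Rightarrow> 'a::polish_space \<Rightarrow> 'a measure"
    and \<gamma> :: "'a \<Rightarrow> real"
    and Off :: "'a \<Rightarrow> 'a multiset measure"
    and F :: "'w measure"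
    and \<PP> :: "'a multiset \<Rightarrow> 'w measure"
    and X :: "real \<Rightarrow> 'w \<Rightarrow> 'a multiset"
    and lam :: real
    and \<phi> :: "'a \<Rightarrow> real"
    and \<phi>t :: "'a measure"
  assumes bmp: "branching_markov_process P \<gamma> Off F \<PP> X"
    and lam_pos: "0 < lam"
    and phi: "\<phi> \<in> bfun_nonneg" "\<And>x. 0 < \<phi> x"
    and phit: "prob_space \<phi>t" "sets \<phi>t = sets borel"
    and normalised: "(\<integral>x. \<phi> x \<partial>\<phi>t) = 1"
    and right_eigen: "\<And>t x. 0 \<le> t \<Longrightarrow> mean_semigroup \<PP> X t \<phi> x = exp (lam * t) * \<phi> x"
    and left_eigen: "\<And>t f. 0 \<le> t \<Longrightarrow> f \<in> bfun \<Longrightarrow>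
      (\<integral>x. mean_semigroup \<PP> X t f x \<partial>\<phi>t) = exp (lam * t) * (\<integral>x. f x \<partial>\<phi>t)"
    and ergodic: "((\<lambda>t. SUP (x, f) \<in> UNIV \<times> bfun_unit.
        ennreal \<bar>exp (- lam * t) * inverse (\<phi> x) * mean_semigroup \<PP> X t f x - (\<integral>y. f y \<partial>\<phi>t)\<bar>)
      \<longlongrightarrow> 0) at_top"
    and offspring_moment: "(SUP y. \<integral>\<^sup>+Z. 2 ^ size Z \<partial>Off y) < \<infinity>"
  shows "\<forall>x. \<exists>W \<in> borel_measurable (\<PP> {#x#}).
    \<comment> \<open>\<open>W\<close> is the almost sure limit: along every countable set of times,
      and along all real times as soon as the paths are right-continuous\<close>
    (\<forall>D. countable D \<longrightarrow>
      (AE \<omega> in \<PP> {#x#}.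
        ((\<lambda>t. exp (- lam * t) * (\<Sum>y\<in>#X t \<omega>. \<phi> y)) \<longlongrightarrow> W \<omega>) (inf at_top (principal D)))) \<and>
    ((AE \<omega> in \<PP> {#x#}. \<forall>t\<ge>0. continuous (at_right t) (\<lambda>t. \<Sum>y\<in>#X t \<omega>. \<phi> y)) \<longrightarrow>
      (AE \<omega> in \<PP> {#x#}.
        ((\<lambda>t. exp (- lam * t) * (\<Sum>y\<in>#X t \<omega>. \<phi> y)) \<longlongrightarrow> W \<omega>) at_top)) \<and>
    \<comment> \<open>convergence in distribution as \<open>t\<close> tends to infinity\<close>
    (\<forall>f \<in> bfun_nonneg. \<forall>\<tau>. filterlim \<tau> at_top sequentially \<longrightarrow>
      weak_conv_m
        (\<lambda>n. distr (\<PP> {#x#}) borel (\<lambda>\<omega>. exp (- lam * \<tau> n) * (\<Sum>y\<in>#X (\<tau> n) \<omega>. f y)))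
        (distr (\<PP> {#x#}) borel (\<lambda>\<omega>. W \<omega> * (\<integral>y. f y \<partial>\<phi>t)))) \<and>
    \<comment> \<open>the law of \<open>W\<close> is determined by its moments\<close>
    (\<forall>k. integrable (\<PP> {#x#}) (\<lambda>\<omega>. W \<omega> ^ k)) \<and>
    (\<forall>\<nu>. real_distribution \<nu> \<longrightarrow> (AE w in \<nu>. 0 \<le> w) \<longrightarrow>
      (\<forall>k. integrable \<nu> (\<lambda>w. w ^ k) \<and> (\<integral>w. w ^ k \<partial>\<nu>) = (\<integral>\<omega>. W \<omega> ^ k \<partial>\<PP> {#x#})) \<longrightarrow>
      \<nu> = distr (\<PP> {#x#}) borel W) \<and>
    (\<forall>k\<ge>2. (\<integral>\<omega>. W \<omega> ^ k \<partial>\<PP> {#x#}) =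
      fact k * \<phi> x * limit_moment lam \<phi> \<gamma> Off \<PP> X k x)"
proof
  fix x
  have "exponential_offspring P \<gamma> Off F \<PP> X"
    by (intro exponential_offspring.intro exponential_offspring_axioms.intro bmp offspring_moment)
  then interpret supercritical_branching P \<gamma> Off F \<PP> X lam \<phi> \<phi>t
    by (rule supercritical_branching.intro, intro supercritical_branching_axioms.intro)
      (rule lam_pos phi phit right_eigen ergodic; assumption?)+
  let ?M = "\<PP> {#x#}"
  show "\<exists>W \<in> borel_measurable ?M.
    (\<forall>D. countable D \<longrightarrow>
      (AE \<omega> in ?M.
        ((\<lambda>t. exp (- lam * t) * (\<Sum>y\<in>#X t \<omega>. \<phi> y)) \<longlongrightarrow> W \<omega>) (inf at_top (principal D)))) \<and>
    ((AE \<omega> in ?M. \<forall>t\<ge>0. continuous (at_right t) (\<lambda>t. \<Sum>y\<in>#X t \<omega>. \<phi> y)) \<longrightarrow>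
      (AE \<omega> in ?M.
        ((\<lambda>t. exp (- lam * t) * (\<Sum>y\<in>#X t \<omega>. \<phi> y)) \<longlongrightarrow> W \<omega>) at_top)) \<and>
    (\<forall>f \<in> bfun_nonneg. \<forall>\<tau>. filterlim \<tau> at_top sequentially \<longrightarrow>
      weak_conv_m
        (\<lambda>n. distr ?M borel (\<lambda>\<omega>. exp (- lam * \<tau> n) * (\<Sum>y\<in>#X (\<tau> n) \<omega>. f y)))
        (distr ?M borel (\<lambda>\<omega>. W \<omega> * (\<integral>y. f y \<partial>\<phi>t)))) \<and>
    (\<forall>k. integrable ?M (\<lambda>\<omega>. W \<omega> ^ k)) \<and>
    (\<forall>\<nu>. real_distribution \<nu> \<longrightarrow> (AE w in \<nu>. 0 \<le> w) \<longrightarrow>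
      (\<forall>k. integrable \<nu> (\<lambda>w. w ^ k) \<and> (\<integral>w. w ^ k \<partial>\<nu>) = (\<integral>\<omega>. W \<omega> ^ k \<partial>?M)) \<longrightarrow>
      \<nu> = distr ?M borel W) \<and>
    (\<forall>k\<ge>2. (\<integral>\<omega>. W \<omega> ^ k \<partial>?M) = fact k * \<phi> x * limit_moment lam \<phi> \<gamma> Off \<PP> X k x)"
  proof (intro bexI[of _ mart_limit] conjI allI ballI impI)
    show "mart_limit \<in> borel_measurable ?M" by (rule measurable_mart_limit)
  next
    fix D :: "real set" assume "countable D"
    then show "AE \<omega> in ?M. ((\<lambda>t. exp (- lam * t) * (\<Sum>y\<in>#X t \<omega>. \<phi> y)) \<longlongrightarrow> mart_limit \<omega>) (inf at_top (principal D))"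
      by (rule AE_mart_limit[unfolded mart_def])
  next
    assume "AE \<omega> in ?M. \<forall>t\<ge>0. continuous (at_right t) (\<lambda>t. \<Sum>y\<in>#X t \<omega>. \<phi> y)"
    then show "AE \<omega> in ?M. ((\<lambda>t. exp (- lam * t) * (\<Sum>y\<in>#X t \<omega>. \<phi> y)) \<longlongrightarrow> mart_limit \<omega>) at_top"
      by (rule AE_mart_limit_right_continuous[unfolded mart_def])
  next
    fix f :: "'a \<Rightarrow> real" and \<tau> :: "nat \<Rightarrow> real" assume "f \<in> bfun_nonneg" "filterlim \<tau> at_top sequentially"
    then show "weak_conv_m
        (\<lambda>n. distr ?M borel (\<lambda>\<omega>. exp (- lam * \<tau> n) * (\<Sum>y\<in>#X (\<tau> n) \<omega>. f y)))
        (distr ?M borel (\<lambda>\<omega>. mart_limit \<omega> * (\<integral>y. f y \<partial>\<phi>t)))"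
      by (rule population_weak_conv)
  next
    show "integrable ?M (\<lambda>\<omega>. mart_limit \<omega> ^ k)" for k by (rule limit_moments(1))
  next
    fix \<nu> :: "real measure" assume "real_distribution \<nu>" "AE w in \<nu>. 0 \<le> w"
      and "\<forall>k. integrable \<nu> (\<lambda>w. w ^ k) \<and> (\<integral>w. w ^ k \<partial>\<nu>) = (\<integral>\<omega>. mart_limit \<omega> ^ k \<partial>?M)"
    then show "\<nu> = distr ?M borel mart_limit" by (intro limit_determined_by_moments) auto
  next
    fix k :: nat assume "2 \<le> k"
    then show "(\<integral>\<omega>. mart_limit \<omega> ^ k \<partial>?M) = fact k * \<phi> x * limit_moment lam \<phi> \<gamma> Off \<PP> X k x"
      by (simp add: limit_moments(2) limit_coeff_def)
  qed
qed

end
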